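(* Let $\mathbf c\in\mathbb R$ and let $\mathrm{Diff}^{\mathrm{an}}_+(S^1)$ be the group of real-analytic orientation-preserving diffeomorphisms of $S^1$. For all $\phi,\psi\in\mathrm{Diff}^{\mathrm{an}}_+(S^1)$, $$\log\Gamma_{\mathbf c}(\phi,\psi)=\mathsf N(\phi\circ\psi)-\mathsf N(\phi)-\mathsf N(\psi),\qquad \mathsf N(\phi):=\frac1{96\pi}\int_0^{2\pi}\log F_\phi(z)\,\partial_x\log F_\phi(z)\,d\theta,$$ where $z=\theta+ix$, the integrand is evaluated on $S^1=\{x=0\}$, and $F_\phi(z)=|(\phi^{-1})'(z)|^2$ with $\phi^{-1}$ extended holomorphically to a neighbourhood of $S^1$. In particular $\log\Gamma_{\mathbf c}$ restricted to $\mathrm{Diff}^{\mathrm{an}}_+(S^1)$ is a coboundary, i.e. trivial in $H^2(\mathrm{Diff}^{\mathrm{an}}_+(S^1),\mathbb R)$.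
   Context: **Cylinders.** $S^1=\mathbb R/2\pi\mathbb Z$; $S^1\times\mathbb R$ has complex coordinate $z=\theta+ix$ and flat metric $dz\,d\bar z:=d\theta^2+dx^2$. A cylinder with analytically parametrized boundary is a triple $(A,\zeta_1,\zeta_2)$: $A$ a compact genus-zero Riemann surface with two boundary components $\partial_1A,\partial_2A$, and $\zeta_i:S^1\to\partial_iA$ parametrizations such that $\zeta_1$ (resp. $\zeta_2$) extends biholomorphically from $S^1\times[0,\varepsilon)$ (resp. $S^1\times(-\varepsilon,0]$) onto a neighbourhood of $\partial_1A$ (resp. $\partial_2A$). Isomorphisms are biholomorphisms intertwining parametrizations. Every cylinder is isomorphic to a unique uniformized representative $(S^1\times[0,\tau],\xi_1,\xi_2)$ with $\xi_2(0)=(0,\tau)$. $\mathbb A_r=(S^1\times[0,r],\theta,\theta+ir)$, $\mathbb A=\mathbb A_1$. For $\phi\in\mathrm{Diff}^{\mathrm{an}}_+(S^1)$, $A*_1\phi:=(A,\zeta_1\circ\phi,\zeta_2)$. **Determinant lines.** A conformal metric $g$ on $A$ is admissible ($g\in\mathrm{Adm}(A)$) if $\zeta_1^*g=dz\,d\bar z$ on some $S^1\times[0,\varepsilon)$ and $\zeta_2^*g=dz\,d\bar z$ on some $S^1\times(-\varepsilon,0]$. For conformal metrics, locally $g_i=e^{f_i}dz\,d\bar z$, put $[\![g_1,g_2]\!]=\frac1{48\pi i}\iint_A(f_1-f_2)\partial\bar\partial(f_1+f_2)$. $\mathrm{Det}^{\mathbf c}_{\mathbb R}(A)$ is the one-dimensional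 real vector space of formal multiples $\lambda[g]$, $g\in\mathrm{Adm}(A)$, with $\lambda_1[g_1]=\lambda_2[g_2]$ iff $\lambda_1=e^{\mathbf c[\![g_1,g_2]\!]}\lambda_2$. $v^\vee$ denotes the dual element with $v^\vee(v)=1$. $\mu^{\mathbf c}(A)\in\mathrm{Det}^{\mathbf c}_{\mathbb R}(A)$ is the pullback, under the isomorphism from $A$ to its uniformized representative $\mathcal UA$, of $e^{-\mathbf c[\![dz\,d\bar z,g]\!]}[g]$, $g\in\mathrm{Adm}(\mathcal UA)$ arbitrary (independent of $g$). **Lines over diffeomorphisms.** $\mathrm{Det}^{\mathbf c}_{\mathbb R}(\phi,A)=\mathrm{Det}^{\mathbf c}_{\mathbb R}(A*_1\phi)\otimes(\mathrm{Det}^{\mathbf c}_{\mathbb R}(A))^\vee$. For cylinders $A,B$ with first parametrizations $\zeta_1,\xi_1$ and small $r>0$, let $U=\zeta_1(\mathbb A_r)$, $U^c=\overline{A\setminus U}$, $V=\xi_1(\mathbb A_r)$, $V^c=\overline{B\setminus V}$, seams parametrized by $\zeta_1(\theta+ir)$, $\xi_1(\theta+ir)$. The canonical isomorphism $\mathrm{Det}^{\mathbf c}_{\mathbb R}(\phi,A)\to\mathrm{Det}^{\mathbf c}_{\mathbb R}(\phi,B)$ sends $[h_\phi\cup k]\otimes[h\cup k]^\vee$ to $[\kappa_*h_\phi\cup k']\otimes[\kappa_*h\cup k']^\vee$ for $h_\phi\in\mathrm{Adm}(U*_1\phi)$, $h\in\mathrm{Adm}(U)$, $k\in\mathrm{Adm}(U^c)$,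 $k'\in\mathrm{Adm}(V^c)$, $\kappa=\xi_1\circ\zeta_1^{-1}$ (independent of choices). $\mathrm{Det}^{\mathbf c}_{\mathbb R}(\phi)$ is the line obtained by identifying all $\mathrm{Det}^{\mathbf c}_{\mathbb R}(\phi,A)$. Multiplication $m_{\phi,\psi}:\mathrm{Det}^{\mathbf c}_{\mathbb R}(\phi)\otimes\mathrm{Det}^{\mathbf c}_{\mathbb R}(\psi)\to\mathrm{Det}^{\mathbf c}_{\mathbb R}(\phi\circ\psi)$: represent the factors in $\mathrm{Det}^{\mathbf c}_{\mathbb R}(\phi,A)$ and $\mathrm{Det}^{\mathbf c}_{\mathbb R}(\psi,A*_1\phi)$ and contract $\mathrm{Det}^{\mathbf c}_{\mathbb R}(A*_1\phi)$ with its dual (independent of $A$). Section: $\hat\mu^{\mathbf c}(\phi)=\mu^{\mathbf c}(\mathbb A*_1\phi)\otimes(\mu^{\mathbf c}(\mathbb A))^\vee$. The cocycle $\Gamma_{\mathbf c}(\phi,\psi)>0$ is defined by $m_{\phi,\psi}(\hat\mu^{\mathbf c}(\phi)\otimes\hat\mu^{\mathbf c}(\psi))=\Gamma_{\mathbf c}(\phi,\psi)\hat\mu^{\mathbf c}(\phi\circ\psi)$. *)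

theory Defs
  imports "HOL-Complex_Analysis.Complex_Analysis" "HOL-Algebra.Coset"
begin

section \<open>The circle and its analytic diffeomorphisms\<close>

definition circle_rel :: "real \<Rightarrow> real \<Rightarrow> bool" where
  "circle_rel s t \<longleftrightarrow> (\<exists>k::int. t = s + 2 * pi * of_int k)"

quotient_type circle = real / circle_rel
proof (rule equivpI)
  show "reflp circle_rel"
    unfolding reflp_def circle_rel_def by (auto intro: exI[of _ 0])
  show "symp circle_rel"
    unfolding symp_def circle_rel_def
  proof clarify
    fix s :: real and k :: int
    show "\<exists>k'::int. s = s + 2 * pi * of_int k + 2 * pi * of_int k'"
      by (intro exI[of _ "- k"]) simp
  qed
  show "transp circle_rel"
    unfolding transp_def circle_rel_def
  proof clarify
    fix s :: real and k l :: int
    show "\<exists>m::int. s + 2 * pi * of_int k + 2 * pi * of_int l = s + 2 * pi * of_int m"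
      by (intro exI[of _ "k + l"]) (simp add: algebra_simps)
  qed
qed

abbreviation circ :: "real \<Rightarrow> circle" where
  "circ \<equiv> abs_circle"

definition circle_lift :: "(circle \<Rightarrow> circle) \<Rightarrow> (real \<Rightarrow> real) \<Rightarrow> bool" where
  "circle_lift \<phi> f \<longleftrightarrow> (\<forall>\<theta>. circ (f \<theta>) = \<phi> (circ \<theta>))"

definition real_analytic :: "(real \<Rightarrow> real) \<Rightarrow> bool" where
  "real_analytic f \<longleftrightarrow>
     (\<forall>x. \<exists>r>0. \<exists>a :: nat \<Rightarrow> real. \<forall>y. \<bar>y - x\<bar> < r \<longrightarrow> (\<lambda>n. a n * (y - x) ^ n) sums f y)"

definition diff_an :: "(circle \<Rightarrow> circle) set" where
  "diff_an = {\<phi>. bij \<phi>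
     \<and> (\<exists>f. circle_lift \<phi> f \<and> real_analytic f \<and> strict_mono f)
     \<and> (\<exists>f. circle_lift (inv_into UNIV \<phi>) f \<and> real_analytic f)}"

definition Diff_an :: "(circle \<Rightarrow> circle) monoid" where
  "Diff_an = \<lparr>carrier = diff_an, mult = (\<circ>), one = id\<rparr>"

section \<open>Riemann surfaces with boundary\<close>

text \<open>
  The atlas consists of inverse charts (local parametrizations) \<open>(D, s)\<close>, with \<open>D\<close> relatively open
  in the closed upper half-plane and \<open>s\<close> defined on \<open>D\<close>; the local coordinate of the point \<open>s w\<close>
  is \<open>w\<close>.
\<close>

type_synonym 'a ichart = "complex set \<times> (complex \<Rightarrow> 'a)"

record 'a surface =
  topo :: "'a topology"
  atlas :: "'a ichart set"

definition upper_half :: "complex set" where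
  "upper_half = {w. 0 \<le> Im w}"

text \<open>Holomorphic maps are required to extend holomorphically across the boundary in charts.\<close>

definition holo_map :: "'a surface \<Rightarrow> 'b surface \<Rightarrow> ('a \<Rightarrow> 'b) \<Rightarrow> bool" where
  "holo_map S S' F \<longleftrightarrow> continuous_map (topo S) (topo S') F \<and>
     (\<forall>(D, s) \<in> atlas S. \<forall>(D', s') \<in> atlas S'. \<forall>w\<in>D. F (s w) \<in> s' ` D' \<longrightarrow>
        (\<exists>N h. open N \<and> w \<in> N \<and> h holomorphic_on N \<and>
           (\<forall>u \<in> N \<inter> D. h u \<in> D' \<and> s' (h u) = F (s u))))"

definition biholo :: "'a surface \<Rightarrow> 'b surface \<Rightarrow> ('a \<Rightarrow> 'b) \<Rightarrow> bool" where
  "biholo S S' F \<longleftrightarrow>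
     (\<exists>G. homeomorphic_maps (topo S) (topo S') F G \<and> holo_map S S' F \<and> holo_map S' S G)"

definition riemann_surface :: "'a surface \<Rightarrow> bool" where
  "riemann_surface S \<longleftrightarrow> Hausdorff_space (topo S) \<and>
     (\<forall>(D, s) \<in> atlas S. openin (top_of_set upper_half) D \<and>
        embedding_map (top_of_set D) (topo S) s \<and> openin (topo S) (s ` D)) \<and>
     topspace (topo S) = (\<Union>(D, s) \<in> atlas S. s ` D) \<and>
     holo_map S S id"

definition surface_boundary :: "'a surface \<Rightarrow> 'a set" where
  "surface_boundary S = {s w | D s w. (D, s) \<in> atlas S \<and> w \<in> D \<and> Im w = 0}"

definition open_sub :: "'a surface \<Rightarrow> 'a set \<Rightarrow> 'a surface" where
  "open_sub S V = \<lparr>topo = subtopology (topo S) V,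
     atlas = {({w \<in> D. s w \<in> V}, s) | D s. (D, s) \<in> atlas S}\<rparr>"

section \<open>The flat cylinders\<close>

definition cyl_pt :: "complex \<Rightarrow> circle \<times> real" where
  "cyl_pt z = (circ (Re z), Im z)"

definition cyl_topology :: "(circle \<times> real) topology" where
  "cyl_topology = topology (\<lambda>V. open (cyl_pt -` V))"

text \<open>
  \<open>flat_cyl I\<close> is \<open>S\<^sup>1 \<times> I\<close> for a bounded interval \<open>I\<close> with end points \<open>a < b\<close>. The first family of
  parametrizations misses the level \<open>x = b\<close>, the second one misses \<open>x = a\<close> and is turned by a
  half-turn, which is holomorphic, so as to start from the upper half-plane. All of them are
  local isometries for the flat metric.
\<close>

definition flat_cyl :: "real set \<Rightarrow> (circle \<times> real) surface" where
  "flat_cyl I = (let a = Inf I; b = Sup I in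
     \<lparr>topo = subtopology cyl_topology (UNIV \<times> I),
      atlas =
        range (\<lambda>\<theta>. ({w. \<bar>Re w\<bar> < pi \<and> 0 \<le> Im w \<and> Im w < b - a \<and> a + Im w \<in> I},
                    \<lambda>w. cyl_pt (Complex \<theta> a + w))) \<union>
        range (\<lambda>\<theta>. ({w. \<bar>Re w\<bar> < pi \<and> 0 \<le> Im w \<and> Im w < b - a \<and> b - Im w \<in> I},
                    \<lambda>w. cyl_pt (Complex \<theta> b - w)))\<rparr>)"

section \<open>Cylinders with analytically parametrized boundary\<close>

record 'a cylinder =
  surf :: "'a surface"
  bd1 :: "circle \<Rightarrow> 'a"
  bd2 :: "circle \<Rightarrow> 'a"

definition collar :: "real set \<Rightarrow> 'a surface \<Rightarrow> (circle \<Rightarrow> 'a) \<Rightarrow> (circle \<times> real \<Rightarrow> 'a) \<Rightarrow> bool" where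
  "collar I S \<zeta> Z \<longleftrightarrow> (\<forall>p. Z (p, 0) = \<zeta> p) \<and>
     (\<exists>V. openin (topo S) V \<and> range \<zeta> \<subseteq> V \<and> biholo (flat_cyl I) (open_sub S V) Z)"

text \<open>
  A compact surface of genus zero with two boundary components is topologically \<open>S\<^sup>1 \<times> [0,1]\<close>;
  the two boundary components are the ranges of the two parametrizations.
\<close>

definition cylinder :: "'a cylinder \<Rightarrow> bool" where
  "cylinder A \<longleftrightarrow> riemann_surface (surf A) \<and>
     topo (surf A) homeomorphic_space topo (flat_cyl {0..1}) \<and>
     surface_boundary (surf A) = range (bd1 A) \<union> range (bd2 A) \<and>
     range (bd1 A) \<inter> range (bd2 A) = {} \<and>
     (\<exists>\<epsilon>>0. \<exists>Z. collar {0..<\<epsilon>} (surf A) (bd1 A) Z) \<and>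
     (\<exists>\<epsilon>>0. \<exists>Z. collar {-\<epsilon><..0} (surf A) (bd2 A) Z)"

definition cyl_iso :: "'a cylinder \<Rightarrow> 'b cylinder \<Rightarrow> ('a \<Rightarrow> 'b) \<Rightarrow> bool" where
  "cyl_iso A B u \<longleftrightarrow> biholo (surf A) (surf B) u \<and> u \<circ> bd1 A = bd1 B \<and> u \<circ> bd2 A = bd2 B"

definition uniformized :: "(circle \<times> real) cylinder \<Rightarrow> bool" where
  "uniformized B \<longleftrightarrow> cylinder B \<and>
     (\<exists>\<tau>>0. surf B = flat_cyl {0..\<tau>} \<and> bd2 B (circ 0) = (circ 0, \<tau>))"

definition std_cyl :: "(circle \<times> real) cylinder" where
  "std_cyl = \<lparr>surf = flat_cyl {0..1}, bd1 = (\<lambda>p. (p, 0)), bd2 = (\<lambda>p. (p, 1))\<rparr>"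

definition reparam :: "'a cylinder \<Rightarrow> (circle \<Rightarrow> circle) \<Rightarrow> 'a cylinder" where
  "reparam A \<phi> = A\<lparr>bd1 := bd1 A \<circ> \<phi>\<rparr>"

section \<open>Conformal metrics\<close>

primrec Ck_on :: "nat \<Rightarrow> complex set \<Rightarrow> (complex \<Rightarrow> real) \<Rightarrow> bool" where
  "Ck_on 0 N f \<longleftrightarrow> continuous_on N f"
| "Ck_on (Suc k) N f \<longleftrightarrow> (\<forall>w\<in>N. f differentiable (at w)) \<and>
     Ck_on k N (\<lambda>w. frechet_derivative f (at w) 1) \<and>
     Ck_on k N (\<lambda>w. frechet_derivative f (at w) \<i>)"

definition smooth_on :: "complex set \<Rightarrow> (complex \<Rightarrow> real) \<Rightarrow> bool" where
  "smooth_on D f \<longleftrightarrow>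
     (\<forall>w\<in>D. \<exists>N F. open N \<and> w \<in> N \<and> (\<forall>k. Ck_on k N F) \<and> (\<forall>u \<in> N \<inter> D. F u = f u))"

text \<open>
  \<open>coord_deriv (D, s) (D', s') F w\<close> is the complex derivative at \<open>w\<close> of \<open>F\<close> in coordinates.
\<close>

definition coord_deriv :: "'a ichart \<Rightarrow> 'b ichart \<Rightarrow> ('a \<Rightarrow> 'b) \<Rightarrow> complex \<Rightarrow> complex" where
  "coord_deriv c c' F w =
     (THE d. ((inv_into (fst c') (snd c') \<circ> F \<circ> snd c) has_field_derivative d) (at w within fst c))"

text \<open>
  A conformal metric is given by its log-densities: \<open>g (D, s) w = f\<close> means that the metric is
  \<open>e\<^sup>f dw d\<bar>w\<close> in the coordinate \<open>w\<close> of \<open>(D, s)\<close>. Values outside the atlas are irrelevant.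
\<close>

type_synonym 'a metric = "'a ichart \<Rightarrow> complex \<Rightarrow> real"

definition conf_metric :: "'a surface \<Rightarrow> 'a metric \<Rightarrow> bool" where
  "conf_metric S g \<longleftrightarrow> (\<forall>(D, s) \<in> atlas S. smooth_on D (g (D, s))) \<and>
     (\<forall>(D, s) \<in> atlas S. \<forall>(D', s') \<in> atlas S. \<forall>w\<in>D. \<forall>w'\<in>D'. s w = s' w' \<longrightarrow>
        g (D, s) w = g (D', s') w' + 2 * ln (cmod (coord_deriv (D, s) (D', s') id w)))"

definition flat_metric :: "(circle \<times> real) metric" where
  "flat_metric = (\<lambda>_ _. 0)"

text \<open>Pull-back under \<open>F\<close> of a metric \<open>g\<close> on \<open>S'\<close>.\<close>

definition pull_metric :: "'b surface \<Rightarrow> ('a \<Rightarrow> 'b) \<Rightarrow> 'b metric \<Rightarrow> 'a metric" where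
  "pull_metric S' F g c w =
     (let (c', w') = (SOME (c', w'). c' \<in> atlas S' \<and> w' \<in> fst c' \<and> snd c' w' = F (snd c w))
      in g c' w' + 2 * ln (cmod (coord_deriv c c' F w)))"

definition metric_eq_on :: "'a surface \<Rightarrow> 'a set \<Rightarrow> 'a metric \<Rightarrow> 'a metric \<Rightarrow> bool" where
  "metric_eq_on S E g g' \<longleftrightarrow> (\<forall>(D, s) \<in> atlas S. \<forall>w\<in>D. s w \<in> E \<longrightarrow> g (D, s) w = g' (D, s) w)"

definition Adm :: "'a cylinder \<Rightarrow> 'a metric set" where
  "Adm A = {g. conf_metric (surf A) g \<and>
     (\<exists>\<epsilon>>0. \<exists>Z. collar {0..<\<epsilon>} (surf A) (bd1 A) Z \<and>
        metric_eq_on (flat_cyl {0..<\<epsilon>}) UNIV (pull_metric (surf A) Z g) flat_metric) \<and>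
     (\<exists>\<epsilon>>0. \<exists>Z. collar {-\<epsilon><..0} (surf A) (bd2 A) Z \<and>
        metric_eq_on (flat_cyl {-\<epsilon><..0}) UNIV (pull_metric (surf A) Z g) flat_metric)}"

section \<open>Integration of 2-forms and the conformal anomaly\<close>

definition chart_partition :: "'a surface \<Rightarrow> ('a ichart \<times> complex set) set \<Rightarrow> bool" where
  "chart_partition S P \<longleftrightarrow> finite P \<and>
     (\<forall>((D, s), E) \<in> P. (D, s) \<in> atlas S \<and> E \<subseteq> D \<and> E \<in> sets lebesgue) \<and>
     disjoint_family_on (\<lambda>((D, s), E). s ` E) P \<and>
     (\<Union>((D, s), E) \<in> P. s ` E) = topspace (topo S)"

text \<open>
  Integral over a compact surface of the 2-form given by \<open>\<rho> (D, s) w dRe(w) \<and> dIm(w)\<close> in the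
  chart \<open>(D, s)\<close>: the common value obtained from all finite measurable partitions subordinate to
  the atlas.
\<close>

definition surf_integral :: "'a surface \<Rightarrow> 'a metric \<Rightarrow> real" where
  "surf_integral S \<rho> = (THE J. \<forall>P. chart_partition S P \<longrightarrow>
     J = (\<Sum>(c, E) \<in> P. integral E (\<rho> c)))"

definition laplacian :: "(complex \<Rightarrow> real) \<Rightarrow> complex \<Rightarrow> real" where
  "laplacian f w = (deriv ^^ 2) (\<lambda>t. f (w + of_real t)) 0
                 + (deriv ^^ 2) (\<lambda>t. f (w + \<i> * of_real t)) 0"

text \<open>
  The functional \<open>1 / (48 \<pi> i) \<integral>\<integral> (f\<^sub>1 - f\<^sub>2) \<partial>\<bar>\<partial> (f\<^sub>1 + f\<^sub>2)\<close>. For \<open>w = \<theta> + i x\<close> one has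
  \<open>\<partial>\<bar>\<partial> F = (1/4) (\<Delta> F) dw \<and> d\<bar>w\<close> and \<open>dw \<and> d\<bar>w = - 2 i d\<theta> \<and> dx\<close>, so the constant in front of
  \<open>(f\<^sub>1 - f\<^sub>2) \<Delta> (f\<^sub>1 + f\<^sub>2) d\<theta> \<and> dx\<close> is \<open>- 1 / (96 \<pi>)\<close>. Boundary points of the charts, where the
  second derivatives need not make sense, form a null set.
\<close>

definition anomaly :: "'a surface \<Rightarrow> 'a metric \<Rightarrow> 'a metric \<Rightarrow> real" where
  "anomaly S g1 g2 = - 1 / (96 * pi) *
     surf_integral S (\<lambda>c w. (g1 c w - g2 c w) * laplacian (\<lambda>v. g1 c v + g2 c v) w)"

section \<open>Determinant lines\<close>

text \<open>
  The formal multiple \<open>a[g]\<close> is the class of all pairs \<open>(a', g')\<close> with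
  \<open>a' = e\<^bsup>c \<lbrakk>g', g\<rbrakk>\<^esup> a\<close>.
\<close>

type_synonym 'a det_elem = "(real \<times> 'a metric) set"

definition fmult :: "real \<Rightarrow> 'a cylinder \<Rightarrow> real \<Rightarrow> 'a metric \<Rightarrow> 'a det_elem" where
  "fmult c A a g = {(a', g'). g' \<in> Adm A \<and> a' = exp (c * anomaly (surf A) g' g) * a}"

definition Det :: "real \<Rightarrow> 'a cylinder \<Rightarrow> 'a det_elem set" where
  "Det c A = {fmult c A a g | a g. g \<in> Adm A}"

definition scale :: "real \<Rightarrow> 'a det_elem \<Rightarrow> 'a det_elem" where
  "scale t v = (\<lambda>(a, g). (t * a, g)) ` v"

text \<open>The dual element of \<open>v \<noteq> 0\<close>: the linear functional on the line taking the value 1 at \<open>v\<close>.\<close>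

definition dual_elem :: "real \<Rightarrow> 'a cylinder \<Rightarrow> 'a det_elem \<Rightarrow> 'a det_elem \<Rightarrow> real" where
  "dual_elem c A v = (\<lambda>w \<in> Det c A. THE t. w = scale t v)"

text \<open>
  The tensor product of a line with the dual of the line \<open>Det c A\<close> is realised as usual by linear
  maps on \<open>Det c A\<close>, the elementary tensor \<open>l \<otimes> \<alpha>\<close> being the rank-one map \<open>w \<mapsto> \<alpha>(w) l\<close>. The
  contraction of \<open>(l \<otimes> \<alpha>)\<close> with \<open>(l' \<otimes> \<alpha>')\<close>, which is \<open>\<alpha>'(l) (l' \<otimes> \<alpha>)\<close>, is then
  the composition of linear maps.
\<close>

type_synonym 'a hom_elem = "'a det_elem \<Rightarrow> 'a det_elem"

definition tensor :: "real \<Rightarrow> 'a cylinder \<Rightarrow> 'a det_elem \<Rightarrow> ('a det_elem \<Rightarrow> real) \<Rightarrow> 'a hom_elem" where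
  "tensor c A l \<alpha> = (\<lambda>w \<in> Det c A. scale (\<alpha> w) l)"

definition tscale :: "real \<Rightarrow> 'a cylinder \<Rightarrow> real \<Rightarrow> 'a hom_elem \<Rightarrow> 'a hom_elem" where
  "tscale c A t X = (\<lambda>w \<in> Det c A. scale t (X w))"

text \<open>
  The element \<open>\<mu>\<^sup>c(A)\<close>, computed from any isomorphism \<open>u\<close> to a uniformized cylinder \<open>B\<close> and any
  admissible metric on \<open>B\<close>.
\<close>

definition mu :: "real \<Rightarrow> 'a cylinder \<Rightarrow> 'a det_elem" where
  "mu c A = (THE v. \<exists>B u g. uniformized B \<and> cyl_iso A B u \<and> g \<in> Adm B \<and>
     v = fmult c A (exp (- c * anomaly (surf B) flat_metric g)) (pull_metric (surf B) u g))"

section \<open>The lines over diffeomorphisms\<close>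

text \<open>
  \<open>seamed A Z r \<delta> g\<close>: with \<open>Z\<close> the holomorphic extension of the first boundary parametrization and
  \<open>U = Z(S\<^sup>1 \<times> [0,r])\<close>, the admissible metric \<open>g\<close> is of the form \<open>h \<union> k\<close> with \<open>h\<close> admissible on
  \<open>U\<close> and \<open>k\<close> admissible on the closure of the complement of \<open>U\<close>. That is, \<open>g\<close> is also flat in the
  coordinate given by \<open>Z\<close> on both sides of the seam.
\<close>

definition seamed ::
  "'a cylinder \<Rightarrow> real \<Rightarrow> (circle \<times> real \<Rightarrow> 'a) \<Rightarrow> real \<Rightarrow> real \<Rightarrow> 'a metric \<Rightarrow> bool" where
  "seamed A \<epsilon> Z r \<delta> g \<longleftrightarrow> g \<in> Adm A \<and>
     metric_eq_on (flat_cyl {0..<\<epsilon>}) (UNIV \<times> {r - \<delta><..<r + \<delta>}) (pull_metric (surf A) Z g) flat_metric"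

text \<open>
  The graph of the canonical isomorphism from \<open>Det(\<phi>, A)\<close> to \<open>Det(\<phi>, B)\<close>. Here \<open>Z\<close>, \<open>Z'\<close> extend
  the unreparametrized boundary maps of \<open>A\<close>, \<open>B\<close>, and the metrics are
  \<open>g\<^sub>\<phi> = h\<^sub>\<phi> \<union> k\<close>, \<open>g = h \<union> k\<close>, \<open>g'\<^sub>\<phi> = \<kappa>\<^sub>* h\<^sub>\<phi> \<union> k'\<close> and \<open>g' = \<kappa>\<^sub>* h \<union> k'\<close> with \<open>\<kappa> = Z' \<circ> Z\<^sup>-\<^sup>1\<close>;
  that \<open>\<kappa>\<close> transports one metric to the other is expressed by equality of the pull-backs under
  \<open>Z\<close> and \<open>Z'\<close>.
\<close>

definition can_rel ::
  "real \<Rightarrow> (circle \<Rightarrow> circle) \<Rightarrow> 'a cylinder \<Rightarrow> 'a cylinder \<Rightarrow> 'a hom_elem \<Rightarrow> 'a hom_elem \<Rightarrow> bool" where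
  "can_rel c \<phi> A B X Y \<longleftrightarrow>
    (\<exists>\<epsilon> r \<delta> t Z Z' g\<phi> g g\<phi>' g'.
       0 < \<delta> \<and> \<delta> < r \<and> r + \<delta> < \<epsilon> \<and>
       collar {0..<\<epsilon>} (surf A) (bd1 A) Z \<and> collar {0..<\<epsilon>} (surf B) (bd1 B) Z' \<and>
       seamed (reparam A \<phi>) \<epsilon> Z r \<delta> g\<phi> \<and> seamed A \<epsilon> Z r \<delta> g \<and>
       seamed (reparam B \<phi>) \<epsilon> Z' r \<delta> g\<phi>' \<and> seamed B \<epsilon> Z' r \<delta> g' \<and>
       metric_eq_on (surf A)
         (topo (surf A) closure_of (topspace (topo (surf A)) - Z ` (UNIV \<times> {0..r}))) g\<phi> g \<and>
       metric_eq_on (surf B)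
         (topo (surf B) closure_of (topspace (topo (surf B)) - Z' ` (UNIV \<times> {0..r}))) g\<phi>' g' \<and>
       metric_eq_on (flat_cyl {0..<\<epsilon>}) (UNIV \<times> {0..r})
         (pull_metric (surf A) Z g\<phi>) (pull_metric (surf B) Z' g\<phi>') \<and>
       metric_eq_on (flat_cyl {0..<\<epsilon>}) (UNIV \<times> {0..r})
         (pull_metric (surf A) Z g) (pull_metric (surf B) Z' g') \<and>
       X = tensor c A (fmult c (reparam A \<phi>) t g\<phi>) (dual_elem c A (fmult c A 1 g)) \<and>
       Y = tensor c B (fmult c (reparam B \<phi>) t g\<phi>') (dual_elem c B (fmult c B 1 g')))"

text \<open>
  Elements of \<open>Det(\<phi>)\<close> are classes of pairs \<open>(A, X)\<close> with \<open>X \<in> Det(\<phi>, A)\<close> under the identifications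
  above; \<open>A\<close> ranges over all cylinders whose set of points lies in the type \<open>circle \<times> real\<close>, which
  up to a bijection are all cylinders.
\<close>

type_synonym line_elem =
  "((circle \<times> real) cylinder \<times> (circle \<times> real) hom_elem) set"

definition line_class ::
  "real \<Rightarrow> (circle \<Rightarrow> circle) \<Rightarrow> (circle \<times> real) cylinder \<Rightarrow> (circle \<times> real) hom_elem \<Rightarrow> line_elem" where
  "line_class c \<phi> A X = {(B, Y). cylinder B \<and> can_rel c \<phi> A B X Y}"

definition line_rep ::
  "line_elem \<Rightarrow> (circle \<times> real) cylinder \<Rightarrow> (circle \<times> real) hom_elem" where
  "line_rep K A = (THE X. (A, X) \<in> K)"

definition line_scale :: "real \<Rightarrow> real \<Rightarrow> line_elem \<Rightarrow> line_elem" where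
  "line_scale c t K = (\<lambda>(B, Y). (B, tscale c B t Y)) ` K"

text \<open>Multiplication from \<open>Det(\<phi>) \<otimes> Det(\<psi>)\<close> to \<open>Det(\<phi> \<circ> \<psi>)\<close>, computed with the cylinder \<open>A\<close>.\<close>

definition line_mult ::
  "real \<Rightarrow> (circle \<times> real) cylinder \<Rightarrow> (circle \<Rightarrow> circle) \<Rightarrow> (circle \<Rightarrow> circle) \<Rightarrow>
     line_elem \<Rightarrow> line_elem \<Rightarrow> line_elem" where
  "line_mult c A \<phi> \<psi> K L =
     line_class c (\<phi> \<circ> \<psi>) A (compose (Det c A) (line_rep L (reparam A \<phi>)) (line_rep K A))"

definition mu_hat :: "real \<Rightarrow> (circle \<Rightarrow> circle) \<Rightarrow> line_elem" where
  "mu_hat c \<phi> = line_class c \<phi> std_cyl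
     (tensor c std_cyl (mu c (reparam std_cyl \<phi>)) (dual_elem c std_cyl (mu c std_cyl)))"

text \<open>The multiplication does not depend on the auxiliary cylinder; the standard one is used.\<close>

definition Gamma_cocycle :: "real \<Rightarrow> (circle \<Rightarrow> circle) \<Rightarrow> (circle \<Rightarrow> circle) \<Rightarrow> real" where
  "Gamma_cocycle c \<phi> \<psi> = (THE \<gamma>. \<gamma> > 0 \<and>
     line_mult c std_cyl \<phi> \<psi> (mu_hat c \<phi>) (mu_hat c \<psi>) = line_scale c \<gamma> (mu_hat c (\<phi> \<circ> \<psi>)))"

section \<open>The cochain N\<close>

text \<open>Holomorphic extension of a circle map, read on the universal covers.\<close>

definition hol_ext :: "(circle \<Rightarrow> circle) \<Rightarrow> (complex \<Rightarrow> complex) \<Rightarrow> bool" where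
  "hol_ext \<phi> G \<longleftrightarrow> G analytic_on \<real> \<and>
     (\<exists>f. circle_lift \<phi> f \<and> (\<forall>\<theta>. G (of_real \<theta>) = of_real (f \<theta>)))"

definition F_fun :: "(circle \<Rightarrow> circle) \<Rightarrow> complex \<Rightarrow> real" where
  "F_fun \<phi> z = (cmod (deriv (SOME G. hol_ext (inv_into UNIV \<phi>) G) z))\<^sup>2"

definition N_fun :: "(circle \<Rightarrow> circle) \<Rightarrow> real" where
  "N_fun \<phi> = 1 / (96 * pi) * integral {0..2 * pi} (\<lambda>\<theta>.
     ln (F_fun \<phi> (of_real \<theta>)) * deriv (\<lambda>x. ln (F_fun \<phi> (Complex \<theta> x))) 0)"

section \<open>Second group cohomology with trivial real coefficients\<close>

definition cocycles2 :: "('g, 'm) monoid_scheme \<Rightarrow> ('g \<times> 'g \<Rightarrow> real) monoid" where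
  "cocycles2 G =
     \<lparr>carrier = {f \<in> extensional (carrier G \<times> carrier G).
        \<forall>g\<in>carrier G. \<forall>h\<in>carrier G. \<forall>k\<in>carrier G.
          f (h, k) - f (g \<otimes>\<^bsub>G\<^esub> h, k) + f (g, h \<otimes>\<^bsub>G\<^esub> k) - f (g, h) = 0},
      mult = (\<lambda>f f'. \<lambda>p \<in> carrier G \<times> carrier G. f p + f' p),
      one = (\<lambda>p \<in> carrier G \<times> carrier G. 0)\<rparr>"

definition coboundary2 :: "('g, 'm) monoid_scheme \<Rightarrow> ('g \<Rightarrow> real) \<Rightarrow> 'g \<times> 'g \<Rightarrow> real" where
  "coboundary2 G n = (\<lambda>(g, h) \<in> carrier G \<times> carrier G. n h - n (g \<otimes>\<^bsub>G\<^esub> h) + n g)"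

definition coboundaries2 :: "('g, 'm) monoid_scheme \<Rightarrow> ('g \<times> 'g \<Rightarrow> real) set" where
  "coboundaries2 G = range (coboundary2 G)"

definition H2 :: "('g, 'm) monoid_scheme \<Rightarrow> ('g \<times> 'g \<Rightarrow> real) set monoid" where
  "H2 G = cocycles2 G Mod coboundaries2 G"

definition H2_class :: "('g, 'm) monoid_scheme \<Rightarrow> ('g \<times> 'g \<Rightarrow> real) \<Rightarrow> ('g \<times> 'g \<Rightarrow> real) set" where
  "H2_class G f = coboundaries2 G #>\<^bsub>cocycles2 G\<^esub> f"

definition log_Gamma :: "real \<Rightarrow> (circle \<Rightarrow> circle) \<times> (circle \<Rightarrow> circle) \<Rightarrow> real" where
  "log_Gamma c = (\<lambda>(\<phi>, \<psi>) \<in> diff_an \<times> diff_an. ln (Gamma_cocycle c \<phi> \<psi>))"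

end

theory Submission imports Defs begin

text \<open>
  On \<open>S\<^sup>1 \<times> [0,1]\<close> a conformal metric has a log-density \<open>v\<close> in the coordinate of the universal cover. An
  analytic boundary parametrization has real derivative along the boundary, so the normal derivative of
  the logarithm of its conformal factor vanishes there, and admissibility forces the normal derivative of
  \<open>v\<close> to vanish on the boundary. By Green's formula the mixed terms of the anomaly of two admissible
  metrics cancel, and the anomaly is \<open>- (E(v\<^sub>1) - E(v\<^sub>2)) / (96 \<pi>)\<close> with \<open>E(v) = \<integral>\<integral> v \<Delta>v\<close>. Thus
  \<open>a[g] \<mapsto> a e\<^bsup>c E(v) / (96 \<pi>)\<^esup>\<close> is a coordinate on the determinant line in which \<open>\<mu>(A)\<close> has the value 1.
  The energy \<open>E\<close> is additive across a flat seam, and conformally invariant because \<open>log |h'|\<close> is harmonic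
  with vanishing normal derivative on the boundary; hence the canonical isomorphisms preserve this
  coordinate and \<open>\<Gamma>\<close> is identically 1. The cochain \<open>N\<close> vanishes as well, by the same boundary remark:
  \<open>(\<phi>\<^sup>-\<^sup>1)'\<close> is real on the circle, so \<open>\<partial>\<^sub>x log |(\<phi>\<^sup>-\<^sup>1)'|\<^sup>2 = - 2 Im ((\<phi>\<^sup>-\<^sup>1)'' / (\<phi>\<^sup>-\<^sup>1)') = 0\<close> there.
\<close>

text \<open>Most objects of the statement are a \<open>THE\<close> or a \<open>SOME\<close>, so each
  has to be shown to exist and to be unique before it can be computed: \<open>surf_integral\<close>
  needs at least one partition, \<open>mu\<close> a uniformized model, \<open>line_rep\<close>
  exactly one transported representative. For \<open>can_rel\<close> existence means four admissible
  metrics, flat along a seam, built from cutoffs of log |h'|^2; uniqueness is the additivity of the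
  energy. The cylinders in play reparametrize the standard one and share its surface; only
  \<open>mu\<close> brings in another modulus. Maps of cylinders are lifted locally, and only the
  derivative of the lifts is made global. The map exp (i z) embeds the cylinder in the plane and
  turns a sum over a partition into one integral. Invariance comes from w = v o H + m with m = log
  |H'|^2: the area integral of (w - m) lap w is that of v lap v, and Green's formula moves the
  Laplacian of the extra term onto the harmonic m. At a seam w vanishes nearby, which replaces the
  Neumann condition there.\<close>

section \<open>Differentiable functions of order k on open sets of the plane\<close>

lemma linear_complex_eq:
  fixes L :: "complex \<Rightarrow> real"
  assumes "linear L" shows "L = (\<lambda>v. Re v * L 1 + Im v * L \<i>)"
proof
  fix v :: complex
  have "v = Re v *\<^sub>R 1 + Im v *\<^sub>R \<i>" by (simp add: complex_eq_iff)
  then have "L v = L (Re v *\<^sub>R 1 + Im v *\<^sub>R \<i>)" by simp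
  also have "\<dots> = Re v * L 1 + Im v * L \<i>"
    by (simp add: linear_add[OF assms] linear_cmul[OF assms])
  finally show "L v = Re v * L 1 + Im v * L \<i>" .
qed

lemma has_derivative_linear_complex:
  fixes f :: "complex \<Rightarrow> real"
  assumes "(f has_derivative L) F"
  shows "(f has_derivative (\<lambda>v. Re v * L 1 + Im v * L \<i>)) F"
proof -
  have "linear L" using assms has_derivative_linear by blast
  then have "L = (\<lambda>v. Re v * L 1 + Im v * L \<i>)" by (rule linear_complex_eq)
  with assms show ?thesis by simp
qed

lemma has_derivative_eq_rhs2:
  "(f has_derivative L) F \<Longrightarrow> (\<And>v. L v = L' v) \<Longrightarrow> (f has_derivative L') F"
  using ext[of L L'] by simp

lemma Ck_on_cong:
  assumes "open N" "\<And>w. w \<in> N \<Longrightarrow> f w = g w"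
  shows "Ck_on k N f \<longleftrightarrow> Ck_on k N g"
  using assms(2)
proof (induction k arbitrary: f g)
  case 0
  then show ?case by (simp cong: continuous_on_cong)
next
  case (Suc k)
  have d: "(f has_derivative L) (at w) \<longleftrightarrow> (g has_derivative L) (at w)" if "w \<in> N" for w L
    using that Suc.prems assms(1)
    by (metis has_derivative_transform_within_open)
  then have dd: "f differentiable (at w) \<longleftrightarrow> g differentiable (at w)"
    "frechet_derivative f (at w) = frechet_derivative g (at w)" if "w \<in> N" for w
    using that by (auto simp: differentiable_def frechet_derivative_def)
  have "Ck_on k N (\<lambda>w. frechet_derivative f (at w) e) \<longleftrightarrow> Ck_on k N (\<lambda>w. frechet_derivative g (at w) e)" for e
    by (rule Suc.IH) (simp add: dd)
  then show ?case using dd(1) by simp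
qed

lemma Ck_on_Suc_has_derivative:
  assumes "Ck_on (Suc k) N f" "w \<in> N"
  shows "(f has_derivative (\<lambda>v. Re v * frechet_derivative f (at w) 1 + Im v * frechet_derivative f (at w) \<i>)) (at w)"
  using assms by (intro has_derivative_linear_complex) (auto simp: frechet_derivative_works)

text \<open>Explicit partials stand in for \<open>frechet_derivative\<close>: at a point the
  differential is unique, so any pair \<open>f1\<close>, \<open>f2\<close> that works is the pair
  demanded by \<open>Ck_on\<close>.\<close>

lemma Ck_on_SucI:
  assumes N: "open N"
    and d: "\<And>w. w \<in> N \<Longrightarrow> (f has_derivative (\<lambda>v. Re v * f1 w + Im v * f2 w)) (at w)"
    and "Ck_on k N f1" "Ck_on k N f2"
  shows "Ck_on (Suc k) N f"
proof -
  have e: "frechet_derivative f (at w) = (\<lambda>v. Re v * f1 w + Im v * f2 w)" if "w \<in> N" for w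
    using d[OF that] frechet_derivative_at by metis
  have "Ck_on k N (\<lambda>w. frechet_derivative f (at w) 1)"
    using assms(3) by (subst Ck_on_cong[OF N, of _ f1]) (auto simp: e)
  moreover have "Ck_on k N (\<lambda>w. frechet_derivative f (at w) \<i>)"
    using assms(4) by (subst Ck_on_cong[OF N, of _ f2]) (auto simp: e)
  ultimately show ?thesis
    using d by (auto simp: differentiable_def)
qed

lemma Ck_on_continuous: "Ck_on k N f \<Longrightarrow> continuous_on N f"
  by (induction k arbitrary: f)
    (auto intro!: differentiable_imp_continuous_on
      simp: differentiable_on_def differentiable_at_withinI)

lemma Ck_on_SucD: "Ck_on (Suc k) N f \<Longrightarrow> Ck_on k N f"
proof (induction k arbitrary: f)
  case 0
  then show ?case using Ck_on_continuous[OF 0] by simp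
next
  case (Suc k)
  have "Ck_on k N (\<lambda>w. frechet_derivative f (at w) 1)" "Ck_on k N (\<lambda>w. frechet_derivative f (at w) \<i>)"
    using Suc.prems by (auto intro!: Suc.IH simp del: Ck_on.simps simp: Ck_on.simps(2)[of "Suc k"])
  then show ?case using Suc.prems by simp
qed

lemma Ck_on_subset: "Ck_on k N f \<Longrightarrow> M \<subseteq> N \<Longrightarrow> Ck_on k M f"
  by (induction k arbitrary: f) (auto intro: continuous_on_subset)

lemma Ck_on_const: "open N \<Longrightarrow> Ck_on k N (\<lambda>w. a)"
proof (induction k arbitrary: a)
  case (Suc k)
  show ?case
    by (rule Ck_on_SucI[where ?f1.0="\<lambda>_. 0" and ?f2.0="\<lambda>_. 0"]) (use Suc in auto)
qed simp

lemma Ck_on_add: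
  assumes "open N" "Ck_on k N f" "Ck_on k N g" shows "Ck_on k N (\<lambda>w. f w + g w)"
  using assms(2,3)
proof (induction k arbitrary: f g)
  case 0
  then show ?case by (simp add: continuous_on_add)
next
  case (Suc k)
  show ?case
  proof (rule Ck_on_SucI[OF assms(1)])
    show "((\<lambda>w. f w + g w) has_derivative
        (\<lambda>v. Re v * (frechet_derivative f (at w) 1 + frechet_derivative g (at w) 1)
           + Im v * (frechet_derivative f (at w) \<i> + frechet_derivative g (at w) \<i>))) (at w)"
      if "w \<in> N" for w
      by (rule has_derivative_eq_rhs2[OF has_derivative_add[OF
            Ck_on_Suc_has_derivative[OF Suc.prems(1) that] Ck_on_Suc_has_derivative[OF Suc.prems(2) that]]])
        (simp add: algebra_simps)
  qed (use Suc in auto)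
qed

lemma Ck_on_mult:
  assumes "open N" "Ck_on k N f" "Ck_on k N g" shows "Ck_on k N (\<lambda>w. f w * g w)"
  using assms(2,3)
proof (induction k arbitrary: f g)
  case 0
  then show ?case by (simp add: continuous_on_mult)
next
  case (Suc k)
  show ?case
  proof (rule Ck_on_SucI[OF assms(1)])
    show "((\<lambda>w. f w * g w) has_derivative
        (\<lambda>v. Re v * (f w * frechet_derivative g (at w) 1 + frechet_derivative f (at w) 1 * g w)
           + Im v * (f w * frechet_derivative g (at w) \<i> + frechet_derivative f (at w) \<i> * g w))) (at w)"
      if "w \<in> N" for w
      by (rule has_derivative_eq_rhs2[OF has_derivative_mult[OF
            Ck_on_Suc_has_derivative[OF Suc.prems(1) that] Ck_on_Suc_has_derivative[OF Suc.prems(2) that]]])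
        (simp add: algebra_simps)
  qed (use Suc in \<open>auto intro!: Ck_on_add[OF assms(1)] Suc.IH Ck_on_SucD[of k N f] Ck_on_SucD[of k N g]\<close>)
qed

lemma Ck_on_minus: "open N \<Longrightarrow> Ck_on k N f \<Longrightarrow> Ck_on k N (\<lambda>w. - f w)"
  using Ck_on_mult[OF _ Ck_on_const[of N k "-1"], of f] by simp

lemma Ck_on_inverse:
  assumes "open N" "Ck_on k N f" "\<And>w. w \<in> N \<Longrightarrow> f w \<noteq> 0"
  shows "Ck_on k N (\<lambda>w. inverse (f w))"
  using assms(2)
proof (induction k)
  case 0
  then show ?case using assms(3) by (simp add: continuous_on_inverse)
next
  case (Suc k)
  show ?case
  proof (rule Ck_on_SucI[OF assms(1)])
    show "((\<lambda>w. inverse (f w)) has_derivative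
        (\<lambda>v. Re v * (- (inverse (f w) * frechet_derivative f (at w) 1 * inverse (f w)))
           + Im v * (- (inverse (f w) * frechet_derivative f (at w) \<i> * inverse (f w))))) (at w)"
      if "w \<in> N" for w
      by (rule has_derivative_eq_rhs2[OF Deriv.has_derivative_inverse[OF assms(3)[OF that]
            Ck_on_Suc_has_derivative[OF Suc.prems(1) that]]])
        (simp add: algebra_simps)
    have i: "Ck_on k N (\<lambda>w. inverse (f w))" by (rule Suc.IH, rule Ck_on_SucD, rule Suc.prems)
    show "Ck_on k N (\<lambda>w. - (inverse (f w) * frechet_derivative f (at w) 1 * inverse (f w)))"
      "Ck_on k N (\<lambda>w. - (inverse (f w) * frechet_derivative f (at w) \<i> * inverse (f w)))"
      using Suc.prems by (auto intro!: Ck_on_minus Ck_on_mult i assms(1))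
  qed
qed

lemma has_derivative_Re_field:
  assumes "(h has_field_derivative d) (at w within S)"
  shows "((\<lambda>u. Re (h u)) has_derivative (\<lambda>v. Re v * Re d + Im v * Re (\<i> * d))) (at w within S)"
proof -
  have "(h has_derivative (*) d) (at w within S)"
    using assms by (simp add: has_field_derivative_def)
  then have "((\<lambda>u. Re (h u)) has_derivative (\<lambda>v. Re (d * v))) (at w within S)"
    by (rule has_derivative_Re)
  then show ?thesis by (rule has_derivative_eq_rhs2) (simp add: algebra_simps)
qed

text \<open>The class is closed under differentiation: the partials of Re h are the real parts of h'
  and i h', again holomorphic.\<close>

lemma Ck_on_Re_holomorphic:
  "open N \<Longrightarrow> h holomorphic_on N \<Longrightarrow> Ck_on k N (\<lambda>w. Re (h w))"
proof (induction k arbitrary: h)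
  case 0
  then show ?case by (auto intro!: continuous_intros holomorphic_on_imp_continuous_on)
next
  case (Suc k)
  show ?case
    by (rule Ck_on_SucI[OF Suc.prems(1) has_derivative_Re_field[OF holomorphic_derivI[OF Suc.prems(2,1)]]];
        (assumption | intro Suc.IH holomorphic_intros Suc.prems)+)
qed

text \<open>log |h| is locally the real part of a branch of log h. The branches differ, but their
  derivative h'/h is global and holomorphic, which reduces smoothness to real parts of holomorphic
  functions.\<close>

lemma Ck_on_ln_holomorphic:
  assumes "open N" "h holomorphic_on N" "\<And>w. w \<in> N \<Longrightarrow> h w \<noteq> 0"
  shows "Ck_on k N (\<lambda>w. 2 * ln (cmod (h w)))"
    and "w \<in> N \<Longrightarrow> ((\<lambda>w. 2 * ln (cmod (h w))) has_derivative
       (\<lambda>v. Re v * Re (2 * (deriv h w / h w)) + Im v * Re (\<i> * (2 * (deriv h w / h w))))) (at w)"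
proof -
  have d: "((\<lambda>w. 2 * ln (cmod (h w))) has_derivative
     (\<lambda>v. Re v * Re (2 * (deriv h w / h w)) + Im v * Re (\<i> * (2 * (deriv h w / h w))))) (at w)"
    if "w \<in> N" for w
  proof -
    have hd: "(h has_field_derivative deriv h w) (at w)"
      using holomorphic_derivI[OF assms(2,1) that] .
    \<comment> \<open>A unimodular factor turns h w onto the positive axis, away from the cut of
      \<open>Ln\<close>, and leaves |h| unchanged.\<close>
    obtain c where c: "cmod c = 1" "c * h w \<notin> \<real>\<^sub>\<le>\<^sub>0"
    proof
      show "cmod (cnj (h w) / cmod (h w)) = 1" using assms(3)[OF \<open>w \<in> N\<close>] by (simp add: norm_divide)
      have "cnj (h w) / cmod (h w) * h w = cmod (h w)"
        using assms(3)[OF \<open>w \<in> N\<close>] complex_norm_square[of "h w"]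
        by (simp add: field_simps power2_eq_square)
      then show "cnj (h w) / cmod (h w) * h w \<notin> \<real>\<^sub>\<le>\<^sub>0"
        using assms(3)[OF \<open>w \<in> N\<close>] by (simp add: complex_nonpos_Reals_iff)
    qed
    have c0: "c \<noteq> 0" using c by auto
    have "((\<lambda>u. 2 * Ln (c * h u)) has_field_derivative (2 * (deriv h w / h w))) (at w)"
      using c0 assms(3)[OF that] c(2)
      by (auto intro!: derivative_eq_intros hd simp: field_simps)
    from has_derivative_Re_field[OF this]
    have "((\<lambda>u. Re (2 * Ln (c * h u))) has_derivative
      (\<lambda>v. Re v * Re (2 * (deriv h w / h w)) + Im v * Re (\<i> * (2 * (deriv h w / h w))))) (at w)" .
    moreover have "Re (2 * Ln (c * h u)) = 2 * ln (cmod (h u))" if "u \<in> N" for u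
      using assms(3)[OF that] c0 c(1) by (simp add: norm_mult)
    ultimately show ?thesis
      by (rule has_derivative_transform_within_open[OF _ assms(1) that])
  qed
  show "w \<in> N \<Longrightarrow> ((\<lambda>w. 2 * ln (cmod (h w))) has_derivative
       (\<lambda>v. Re v * Re (2 * (deriv h w / h w)) + Im v * Re (\<i> * (2 * (deriv h w / h w))))) (at w)"
    by (rule d)
  have hol: "(\<lambda>w. 2 * (deriv h w / h w)) holomorphic_on N"
    "(\<lambda>w. \<i> * (2 * (deriv h w / h w))) holomorphic_on N"
    using assms by (auto intro!: holomorphic_intros)
  show "Ck_on k N (\<lambda>w. 2 * ln (cmod (h w)))"
  \<comment> \<open>One order more than claimed is proved, so that the rule for successors covers k
    = 0 as well.\<close>
  proof (rule Ck_on_SucD, rule Ck_on_SucI[OF assms(1) d])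
  qed (assumption | rule Ck_on_Re_holomorphic assms(1) hol)+
qed

lemma has_derivative_comp_field:
  fixes f :: "complex \<Rightarrow> real"
  assumes "(f has_derivative (\<lambda>v. Re v * a + Im v * b)) (at (h w) within T)"
    and "(h has_field_derivative d) (at w within S)" "h ` S \<subseteq> T"
  shows "((\<lambda>u. f (h u)) has_derivative
     (\<lambda>v. Re v * (Re d * a + Im d * b) + Im v * (Re d * b - Im d * a))) (at w within S)"
proof -
  have "(h has_derivative (*) d) (at w within S)"
    using assms by (simp add: has_field_derivative_def)
  moreover have "(f has_derivative (\<lambda>v. Re v * a + Im v * b)) (at (h w) within h ` S)"
    using assms(1,3) has_derivative_subset by blast
  ultimately have "(f \<circ> h has_derivative (\<lambda>v. Re v * a + Im v * b) \<circ> (*) d) (at w within S)"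
    by (rule diff_chain_within)
  then show ?thesis unfolding o_def by (rule has_derivative_eq_rhs2) (simp add: algebra_simps)
qed

text \<open>By the Cauchy-Riemann equations the partials of the composite are combinations of the
  partials of f along h with Re h' and Im h'; each factor is covered by the induction or by the
  holomorphic case.\<close>

lemma Ck_on_comp_holomorphic:
  assumes "open M" "open N" "h holomorphic_on M" "h ` M \<subseteq> N" "Ck_on k N f"
  shows "Ck_on k M (\<lambda>w. f (h w))"
  using assms(5)
proof (induction k arbitrary: f)
  case 0
  then show ?case
    using continuous_on_compose2[OF _ holomorphic_on_imp_continuous_on[OF assms(3)] assms(4)] by auto
next
  case (Suc k)
  let ?a = "\<lambda>w. frechet_derivative f (at w) 1" and ?b = "\<lambda>w. frechet_derivative f (at w) \<i>"
  have IH: "Ck_on k M (\<lambda>w. ?a (h w))" "Ck_on k M (\<lambda>w. ?b (h w))"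
    using Suc.prems by (auto intro!: Suc.IH)
  \<comment> \<open>Im h' and its negative are the real parts of -i h' and i h'.\<close>
  have R: "Ck_on k M (\<lambda>w. Re (deriv h w))" "Ck_on k M (\<lambda>w. Im (deriv h w))"
    "Ck_on k M (\<lambda>w. - Im (deriv h w))"
    using Ck_on_Re_holomorphic[OF assms(1) holomorphic_deriv[OF assms(3,1)], of k]
      Ck_on_Re_holomorphic[OF assms(1) holomorphic_on_mult[OF holomorphic_on_const[of "-\<i>"] holomorphic_deriv[OF assms(3,1)]], of k]
      Ck_on_Re_holomorphic[OF assms(1) holomorphic_on_mult[OF holomorphic_on_const[of "\<i>"] holomorphic_deriv[OF assms(3,1)]], of k]
    by simp_all
  show ?case
  proof (rule Ck_on_SucI[OF assms(1)])
    show "((\<lambda>w. f (h w)) has_derivative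
      (\<lambda>v. Re v * (Re (deriv h w) * ?a (h w) + Im (deriv h w) * ?b (h w))
         + Im v * (Re (deriv h w) * ?b (h w) + (- Im (deriv h w)) * ?a (h w)))) (at w)" if "w \<in> M" for w
      by (rule has_derivative_eq_rhs2[OF has_derivative_comp_field[where T=UNIV, OF
          Ck_on_Suc_has_derivative[OF Suc.prems] holomorphic_derivI[OF assms(3,1) that]]])
        (use assms(4) that in auto)
  qed (intro Ck_on_add Ck_on_mult assms(1) IH R)+
qed

text \<open>Made for cutoffs: a one-variable function, with all its derivatives listed as the tower
  \<open>d\<close>, is composed with an affine function of the height.\<close>

lemma Ck_on_Im_tower:
  assumes "open N" "\<And>n t. (d n has_real_derivative d (Suc n) t) (at t)"
  shows "Ck_on k N (\<lambda>w. d n (a * Im w + b))"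
proof (induction k arbitrary: n)
  case 0
  have "continuous_on UNIV (d n)"
    by (intro continuous_at_imp_continuous_on) (use assms(2) DERIV_isCont in blast)
  then show ?case
    by (auto intro!: continuous_on_compose2[of UNIV "d n"] continuous_intros)
next
  case (Suc k)
  show ?case
  proof (rule Ck_on_SucI[OF assms(1)])
    show "((\<lambda>w. d n (a * Im w + b)) has_derivative
        (\<lambda>v. Re v * 0 + Im v * (a * d (Suc n) (a * Im w + b)))) (at w)" for w
    proof -
      have "((\<lambda>w. a * Im w + b) has_derivative (\<lambda>v. a * Im v)) (at w)"
        by (auto intro!: derivative_eq_intros)
      from has_derivative_compose[OF this, of "d n"] assms(2)[of n "a * Im w + b"]
      have "((\<lambda>w. d n (a * Im w + b)) has_derivative (\<lambda>v. d (Suc n) (a * Im w + b) * (a * Im v))) (at w)"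
        by (simp add: has_field_derivative_def)
      then show ?thesis by (rule has_derivative_eq_rhs2) simp
    qed
  qed (intro Ck_on_mult Ck_on_const assms(1) Suc)+
qed

section \<open>Smooth functions on strips, up to the boundary\<close>

definition strip :: "real set \<Rightarrow> complex set" where
  "strip I = {z. Im z \<in> I}"

text \<open>The shapes that occur are closed cylinders and the two kinds of collars. Being
  nondegenerate, they determine derivatives at their end points.\<close>

definition cyl_ivl :: "real set \<Rightarrow> real \<Rightarrow> real \<Rightarrow> bool" where
  "cyl_ivl I a b \<longleftrightarrow> a < b \<and> (I = {a..b} \<or> I = {a..<b} \<or> I = {a<..b})"

lemma strip_iff [simp]: "z \<in> strip I \<longleftrightarrow> Im z \<in> I"
  by (simp add: strip_def)

lemma cyl_ivlD:
  assumes "cyl_ivl I a b"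
  shows "a < b" "Inf I = a" "Sup I = b" "I \<subseteq> {a..b}" "{a<..<b} \<subseteq> I"
  using assms by (auto simp: cyl_ivl_def)

text \<open>At an end point only one sign of \<open>d\<close> keeps the point inside, so the sign is
  left open. Uniqueness of derivatives within the strip asks no more of the vertical
  direction.\<close>

lemma cyl_ivl_near:
  assumes "cyl_ivl I a b" "x \<in> I" "e > 0"
  obtains d where "d \<noteq> 0" "\<bar>d\<bar> < e" "x + d \<in> I"
proof (cases "x < b")
  case True
  define d where "d = min (e/2) ((b - x)/2)"
  have "x + d \<in> I" "d > 0" "d < e"
    using assms True by (auto simp: d_def cyl_ivl_def min_def field_simps)
  then show ?thesis using that[of d] by simp
next
  case False
  define d where "d = min (e/2) ((b - a)/2)"
  have "x = b" "a < b" using False assms by (auto simp: cyl_ivl_def)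
  then have "x + (- d) \<in> I" "d > 0" "d < e"
    using assms by (auto simp: d_def cyl_ivl_def min_def field_simps)
  then show ?thesis using that[of "- d"] by simp
qed

lemma strip_derivative_unique:
  fixes f :: "complex \<Rightarrow> 'b::real_normed_vector"
  assumes "cyl_ivl I a b" "w \<in> strip I"
    "(f has_derivative L) (at w within strip I)" "(f has_derivative L') (at w within strip I)"
  shows "L = L'"
proof (rule frechet_derivative_unique_within[OF assms(3,4)])
  fix i :: complex and e :: real assume "i \<in> Basis" "e > 0"
  then consider "i = 1" | "i = \<i>" by (auto simp: Basis_complex_def)
  then show "\<exists>d. 0 < \<bar>d\<bar> \<and> \<bar>d\<bar> < e \<and> w + d *\<^sub>R i \<in> strip I"
  proof cases
    case 1
    then show ?thesis using assms(2) \<open>e > 0\<close> by (auto intro!: exI[of _ "e/2"])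
  next
    case 2
    obtain d where "d \<noteq> 0" "\<bar>d\<bar> < e" "Im w + d \<in> I"
      using cyl_ivl_near[OF assms(1) _ \<open>e > 0\<close>, of "Im w"] assms(2) by auto
    then show ?thesis using 2 by (auto intro!: exI[of _ d])
  qed
qed

lemma strip_field_derivative_unique:
  assumes "cyl_ivl I a b" "w \<in> strip I"
    "(f has_field_derivative d) (at w within strip I)" "(f has_field_derivative d') (at w within strip I)"
  shows "d = d'"
  using strip_derivative_unique[OF assms(1,2), of f "(*) d" "(*) d'"] assms(3,4)
  by (metis has_field_derivative_def mult.right_neutral)

text \<open>Taken within the strip, so that on a boundary line the derivative in direction i is the
  one-sided normal derivative.\<close>

definition pd :: "real set \<Rightarrow> (complex \<Rightarrow> real) \<Rightarrow> complex \<Rightarrow> complex \<Rightarrow> real" where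
  "pd I f v w = frechet_derivative f (at w within strip I) v"

definition lap :: "real set \<Rightarrow> (complex \<Rightarrow> real) \<Rightarrow> complex \<Rightarrow> real" where
  "lap I f w = pd I (pd I f 1) 1 w + pd I (pd I f \<i>) \<i> w"

lemma pd_eqI:
  assumes "cyl_ivl I a b" "w \<in> strip I" "(f has_derivative L) (at w within strip I)"
  shows "pd I f v w = L v"
  using strip_derivative_unique[OF assms(1,2,3)] assms(3) frechet_derivative_works
  unfolding pd_def differentiable_def by metis

lemma has_derivative_within_local:
  assumes "(f has_derivative L) (at w within S)" "open N" "w \<in> N" "w \<in> S"
    "\<And>u. u \<in> N \<inter> S \<Longrightarrow> f u = g u"
  shows "(g has_derivative L) (at w within S)"
proof -
  have "(f has_derivative L) (at w within S \<inter> N)"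
    using assms(1) has_derivative_subset by (metis inf_le1)
  then have "(g has_derivative L) (at w within S \<inter> N)"
    by (rule has_derivative_transform_within[where d=1]) (use assms in auto)
  moreover have "at w within S \<inter> N = at w within S"
    using at_within_nhd[OF assms(3,2), of "S \<inter> N" S] assms(4) by auto
  ultimately show ?thesis by simp
qed

text \<open>Near each point a smooth extension F is at hand. By uniqueness its partials restrict to
  \<open>pd\<close> on the strip and serve as extensions of \<open>pd\<close>, which makes
  \<open>smooth_on\<close> stable under differentiation.\<close>

lemma smooth_on_has_pd:
  assumes I: "cyl_ivl I a b" and f: "smooth_on (strip I) f"
  shows "w \<in> strip I \<Longrightarrow> (f has_derivative (\<lambda>v. Re v * pd I f 1 w + Im v * pd I f \<i> w)) (at w within strip I)"
    and "v = 1 \<or> v = \<i> \<Longrightarrow> smooth_on (strip I) (pd I f v)"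
proof -
  have *: "(f has_derivative frechet_derivative F (at w)) (at w within strip I)"
    if "w \<in> strip I" "open N" "w \<in> N" "\<forall>k. Ck_on k N F" "\<forall>u\<in>N \<inter> strip I. F u = f u" for w N F
  proof -
    have "Ck_on (Suc 0) N F" using that by blast
    with \<open>w \<in> N\<close> have "F differentiable at w" by (simp only: Ck_on.simps)
    then have "(F has_derivative frechet_derivative F (at w)) (at w within strip I)"
      by (simp add: frechet_derivative_works has_derivative_at_withinI)
    then show ?thesis
      by (rule has_derivative_within_local[OF _ that(2,3,1)]) (use that in auto)
  qed
  show "(f has_derivative (\<lambda>v. Re v * pd I f 1 w + Im v * pd I f \<i> w)) (at w within strip I)"
    if w: "w \<in> strip I"
  proof -
    obtain N F where NF: "open N" "w \<in> N" "\<forall>k. Ck_on k N F" "\<forall>u\<in>N \<inter> strip I. F u = f u"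
      using f w unfolding smooth_on_def by blast
    from has_derivative_linear_complex[OF *[OF w NF]] pd_eqI[OF I w *[OF w NF]]
    show ?thesis by simp
  qed
  show "smooth_on (strip I) (pd I f v)" if v: "v = 1 \<or> v = \<i>"
    unfolding smooth_on_def
  proof
    fix w assume w: "w \<in> strip I"
    obtain N F where NF: "open N" "w \<in> N" "\<forall>k. Ck_on k N F" "\<forall>u\<in>N \<inter> strip I. F u = f u"
      using f w unfolding smooth_on_def by blast
    have "Ck_on k N (\<lambda>w. frechet_derivative F (at w) v)" for k
      using NF(3)[THEN spec, of "Suc k"] v by auto
    moreover have "frechet_derivative F (at u) v = pd I f v u" if "u \<in> N \<inter> strip I" for u
      using pd_eqI[OF I _ *[OF _ NF(1) _ NF(3,4)], of u] that by auto
    ultimately show "\<exists>N F. open N \<and> w \<in> N \<and> (\<forall>k. Ck_on k N F) \<and> (\<forall>u\<in>N \<inter> strip I. F u = pd I f v u)"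
      using NF by blast
  qed
qed

lemma smooth_on_comp:
  assumes f: "smooth_on D' f"
    and "\<And>w. w \<in> D \<Longrightarrow> \<exists>N h. open N \<and> w \<in> N \<and> h holomorphic_on N \<and> (\<forall>u\<in>N \<inter> D. h u \<in> D' \<and> g u = f (h u))"
  shows "smooth_on D g"
  unfolding smooth_on_def
proof
  fix w assume w: "w \<in> D"
  obtain N h where Nh: "open N" "w \<in> N" "h holomorphic_on N" "\<And>u. u\<in>N \<inter> D \<Longrightarrow> h u \<in> D' \<and> g u = f (h u)"
    using assms(2)[OF w] by blast
  have hw: "h w \<in> D'" using Nh(2,4) w by simp
  obtain M F where MF: "open M" "h w \<in> M" "\<forall>k. Ck_on k M F" "\<forall>u\<in>M \<inter> D'. F u = f u"
    using f hw unfolding smooth_on_def by blast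
  have o: "open (N \<inter> h -` M)"
    by (rule continuous_open_preimage[OF holomorphic_on_imp_continuous_on[OF Nh(3)] Nh(1) MF(1)])
  have "Ck_on k (N \<inter> h -` M) (\<lambda>w. F (h w))" for k
    by (rule Ck_on_comp_holomorphic[OF o MF(1) holomorphic_on_subset[OF Nh(3)] _ MF(3)[rule_format]]) auto
  then show "\<exists>N F. open N \<and> w \<in> N \<and> (\<forall>k. Ck_on k N F) \<and> (\<forall>u\<in>N \<inter> D. F u = g u)"
    using o Nh MF by (intro exI[of _ "N \<inter> h -` M"] exI[of _ "\<lambda>w. F (h w)"]) auto
qed

lemma smooth_onI:
  assumes "\<And>w. w \<in> D \<Longrightarrow> \<exists>N F. open N \<and> w \<in> N \<and> (\<forall>k. Ck_on k N F) \<and> (\<forall>u\<in>N \<inter> D. F u = f u)"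
  shows "smooth_on D f"
  using assms by (simp add: smooth_on_def)

lemma smooth_on_continuous: "smooth_on D f \<Longrightarrow> continuous_on D f"
proof (unfold continuous_on_eq_continuous_within, rule ballI)
  fix w assume f: "smooth_on D f" and w: "w \<in> D"
  obtain N F where NF: "open N" "w \<in> N" "\<forall>k. Ck_on k N F" "\<forall>u\<in>N \<inter> D. F u = f u"
    using f w unfolding smooth_on_def by blast
  have "continuous_on N F" using NF(3)[THEN spec, of 0] by simp
  then have "continuous (at w within D) F"
    using NF continuous_on_eq_continuous_at continuous_at_imp_continuous_within by blast
  then show "continuous (at w within D) f"
  proof (rule continuous_transform_within_openin[where T=D and S="N \<inter> D"])
    show "openin (top_of_set D) (N \<inter> D)" using NF by (simp add: openin_open_Int inf_commute)
  qed (use NF w in auto)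
qed

lemma smooth_on_binop:
  assumes op: "\<And>k N f g. open N \<Longrightarrow> Ck_on k N f \<Longrightarrow> Ck_on k N g \<Longrightarrow> Ck_on k N (\<lambda>w. h (f w) (g w))"
    and f: "smooth_on D f" and g: "smooth_on D g"
  shows "smooth_on D (\<lambda>w. h (f w) (g w))"
proof (rule smooth_onI)
  fix w assume w: "w \<in> D"
  obtain N F where NF: "open N" "w \<in> N" "\<forall>k. Ck_on k N F" "\<forall>u\<in>N \<inter> D. F u = f u"
    using f w unfolding smooth_on_def by blast
  obtain M G where MG: "open M" "w \<in> M" "\<forall>k. Ck_on k M G" "\<forall>u\<in>M \<inter> D. G u = g u"
    using g w unfolding smooth_on_def by blast
  have "Ck_on k (N \<inter> M) (\<lambda>w. h (F w) (G w))" for k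
    using NF(1) MG(1) by (intro op Ck_on_subset[OF NF(3)[rule_format]] Ck_on_subset[OF MG(3)[rule_format]]) auto
  then show "\<exists>N F. open N \<and> w \<in> N \<and> (\<forall>k. Ck_on k N F) \<and> (\<forall>u\<in>N \<inter> D. F u = h (f u) (g u))"
    using NF MG by (intro exI[of _ "N \<inter> M"] exI[of _ "\<lambda>w. h (F w) (G w)"]) auto
qed

lemma smooth_on_const: "smooth_on D (\<lambda>w. a)"
  by (rule smooth_onI) (auto intro!: exI[of _ UNIV] Ck_on_const)

lemma smooth_on_add: "smooth_on D f \<Longrightarrow> smooth_on D g \<Longrightarrow> smooth_on D (\<lambda>w. f w + g w)"
  by (rule smooth_on_binop[of "(+)"]) (auto intro: Ck_on_add)

lemma smooth_on_mult: "smooth_on D f \<Longrightarrow> smooth_on D g \<Longrightarrow> smooth_on D (\<lambda>w. f w * g w)"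
  by (rule smooth_on_binop[of "(*)"]) (auto intro: Ck_on_mult)

lemma smooth_on_diff: "smooth_on D f \<Longrightarrow> smooth_on D g \<Longrightarrow> smooth_on D (\<lambda>w. f w - g w)"
  using smooth_on_add[of D f "\<lambda>w. -1 * g w"] smooth_on_mult[OF smooth_on_const[of D "-1"], of g] by simp

lemma pd_local:
  assumes I: "cyl_ivl I a b" and f: "smooth_on (strip I) f"
    and "open N" "w \<in> N" "w \<in> strip I" "\<And>u. u \<in> N \<inter> strip I \<Longrightarrow> f u = g u"
  shows "pd I g v w = pd I f v w"
proof -
  note d = smooth_on_has_pd(1)[OF I f assms(5)]
  show ?thesis
    using pd_eqI[OF I assms(5) d, of v] pd_eqI[OF I assms(5) has_derivative_within_local[OF d assms(3,4,5)], of g v] assms(6)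
    by simp
qed

lemma lap_local:
  assumes I: "cyl_ivl I a b" and f: "smooth_on (strip I) f"
    and N: "open N" "w \<in> N" "w \<in> strip I" "\<And>u. u \<in> N \<inter> strip I \<Longrightarrow> f u = g u"
  shows "lap I g w = lap I f w"
proof -
  have e: "pd I f v u = pd I g v u" if "u \<in> N \<inter> strip I" for u v
    using pd_local[OF I f N(1) _ _ N(4)] that by auto
  show ?thesis
    unfolding lap_def
    using pd_local[OF I smooth_on_has_pd(2)[OF I f] N(1-3) e, of 1 1]
      pd_local[OF I smooth_on_has_pd(2)[OF I f] N(1-3) e, of \<i> \<i>] by simp
qed

lemma smooth_on_pd_diff:
  assumes I: "cyl_ivl I a b" and f: "smooth_on (strip I) f" and g: "smooth_on (strip I) g" and w: "w \<in> strip I"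
  shows "pd I (\<lambda>w. f w - g w) v w = pd I f v w - pd I g v w"
    and "lap I (\<lambda>w. f w - g w) w = lap I f w - lap I g w"
proof -
  have p: "pd I (\<lambda>w. f w - g w) v w = pd I f v w - pd I g v w"
    if f: "smooth_on (strip I) f" and g: "smooth_on (strip I) g" and w: "w \<in> strip I" for f g w v
    using pd_eqI[OF I w has_derivative_diff[OF smooth_on_has_pd(1)[OF I f w] smooth_on_has_pd(1)[OF I g w]], of v]
      pd_eqI[OF I w smooth_on_has_pd(1)[OF I f w], of v] pd_eqI[OF I w smooth_on_has_pd(1)[OF I g w], of v]
    by simp
  show "pd I (\<lambda>w. f w - g w) v w = pd I f v w - pd I g v w" by (rule p[OF f g w])
  have "pd I (pd I (\<lambda>w. f w - g w) v) v w = pd I (\<lambda>w. pd I f v w - pd I g v w) v w" if "v = 1 \<or> v = \<i>" for v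
    by (rule pd_local[OF I smooth_on_diff[OF smooth_on_has_pd(2)[OF I f that] smooth_on_has_pd(2)[OF I g that]], of UNIV])
      (use w p[OF f g] in auto)
  then show "lap I (\<lambda>w. f w - g w) w = lap I f w - lap I g w"
    unfolding lap_def using p[OF smooth_on_has_pd(2)[OF I f] smooth_on_has_pd(2)[OF I g] w] by simp
qed

lemma smooth_on_pd_add:
  assumes I: "cyl_ivl I a b" and f: "smooth_on (strip I) f" and g: "smooth_on (strip I) g" and w: "w \<in> strip I"
  shows "pd I (\<lambda>w. f w + g w) v w = pd I f v w + pd I g v w"
    and "lap I (\<lambda>w. f w + g w) w = lap I f w + lap I g w"
  using smooth_on_pd_diff[OF I smooth_on_add[OF f g] g w] by auto

text \<open>Conformal covariance of the Laplacian: in the sum of the pure second derivatives the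
  terms with H'' cancel, and so do the mixed derivatives, each against itself and without appeal to
  their symmetry.\<close>

lemma lap_comp:
  assumes I: "cyl_ivl I a b" and J: "cyl_ivl J c d" and f: "smooth_on (strip J) f"
    and N: "open N" "H holomorphic_on N" "\<And>u. u \<in> N \<inter> strip I \<Longrightarrow> H u \<in> strip J"
      "\<And>u. u \<in> N \<inter> strip I \<Longrightarrow> g u = f (H u)"
    and z: "z \<in> N" "z \<in> strip I"
  shows "pd I g 1 z = Re (deriv H z) * pd J f 1 (H z) + Im (deriv H z) * pd J f \<i> (H z)"
    and "pd I g \<i> z = Re (deriv H z) * pd J f \<i> (H z) - Im (deriv H z) * pd J f 1 (H z)"
    and "lap I g z = (cmod (deriv H z))\<^sup>2 * lap J f (H z)"
proof -
  let ?H' = "deriv H" and ?H'' = "deriv (deriv H)"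
  have dc: "((\<lambda>u. f (H u)) has_derivative
     (\<lambda>v. Re v * (Re (?H' u) * pd J f 1 (H u) + Im (?H' u) * pd J f \<i> (H u))
        + Im v * (Re (?H' u) * pd J f \<i> (H u) - Im (?H' u) * pd J f 1 (H u)))) (at u within N \<inter> strip I)"
    if f: "smooth_on (strip J) f" and u: "u \<in> N" "u \<in> strip I" for f u
    by (rule has_derivative_comp_field[OF smooth_on_has_pd(1)[OF J f]
          has_field_derivative_at_within[OF holomorphic_derivI[OF N(2,1)]]])
      (use N u in auto)
  have wi: "at u within N \<inter> strip I = at u within strip I" if "u \<in> N" "u \<in> strip I" for u
    using at_within_nhd[OF that(1) N(1), of "N \<inter> strip I" "strip I"] by auto
  have g1: "pd I g 1 u = Re (?H' u) * pd J f 1 (H u) + Im (?H' u) * pd J f \<i> (H u)"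
    and g2: "pd I g \<i> u = Re (?H' u) * pd J f \<i> (H u) - Im (?H' u) * pd J f 1 (H u)"
    if u: "u \<in> N" "u \<in> strip I" for u
    using pd_eqI[OF I u(2) has_derivative_within_local[OF dc[OF f u, unfolded wi[OF u]] N(1) u, of g]] N(4)
    by auto
  show "pd I g 1 z = Re (deriv H z) * pd J f 1 (H z) + Im (deriv H z) * pd J f \<i> (H z)"
    "pd I g \<i> z = Re (deriv H z) * pd J f \<i> (H z) - Im (deriv H z) * pd J f 1 (H z)"
    using g1[OF z] g2[OF z] by auto
  have hd: "(?H' has_field_derivative ?H'' z) (at z within strip I)"
    using holomorphic_derivI[OF holomorphic_deriv[OF N(2,1)] N(1) z(1)] has_field_derivative_at_within by blast
  have hd2: "((\<lambda>u. - \<i> * ?H' u) has_field_derivative (- \<i> * ?H'' z)) (at z within strip I)"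
    using hd by (auto intro!: derivative_eq_intros)
  note R = has_derivative_Re_field[OF hd]
  have Im: "((\<lambda>u. Im (?H' u)) has_derivative (\<lambda>v. Re v * Im (?H'' z) + Im v * Re (?H'' z))) (at z within strip I)"
    using has_derivative_Re_field[OF hd2] by simp
  let ?f1 = "pd J f 1" and ?f2 = "pd J f \<i>"
  note s1 = smooth_on_has_pd(2)[OF J f, of 1, simplified] and s2 = smooth_on_has_pd(2)[OF J f, of \<i>, simplified]
  note d1 = dc[OF s1 z, unfolded wi[OF z]] and d2 = dc[OF s2 z, unfolded wi[OF z]]
  note A = has_derivative_add[OF has_derivative_mult[OF R d1] has_derivative_mult[OF Im d2]]
  note B = has_derivative_diff[OF has_derivative_mult[OF R d2] has_derivative_mult[OF Im d1]]
  have 1: "pd I (pd I g 1) 1 z = Re (?H' z) * (Re (?H' z) * pd J ?f1 1 (H z) + Im (?H' z) * pd J ?f1 \<i> (H z))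
     + Re (?H'' z) * ?f1 (H z) + Im (?H' z) * (Re (?H' z) * pd J ?f2 1 (H z) + Im (?H' z) * pd J ?f2 \<i> (H z))
     + Im (?H'' z) * ?f2 (H z)"
    using pd_eqI[OF I z(2) has_derivative_within_local[OF A N(1) z, of "pd I g 1"], of 1] g1
    by (auto simp: )
  have 2: "pd I (pd I g \<i>) \<i> z = Re (?H' z) * (Re (?H' z) * pd J ?f2 \<i> (H z) - Im (?H' z) * pd J ?f2 1 (H z))
     - Im (?H'' z) * ?f2 (H z) - Im (?H' z) * (Re (?H' z) * pd J ?f1 \<i> (H z) - Im (?H' z) * pd J ?f1 1 (H z))
     - Re (?H'' z) * ?f1 (H z)"
    using pd_eqI[OF I z(2) has_derivative_within_local[OF B N(1) z, of "pd I g \<i>"], of \<i>] g2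
    by (auto simp: algebra_simps)
  show "lap I g z = (cmod (deriv H z))\<^sup>2 * lap J f (H z)"
    unfolding lap_def 1 2 cmod_power2 by (simp add: algebra_simps power2_eq_square)
qed

text \<open>The partials of log |q|^2 are Re k and Re (i k) with k = 2 q'/q; differentiating once
  more in the same direction gives Re k' and - Re k'.\<close>

lemma lap_ln_holomorphic:
  assumes I: "cyl_ivl I a b"
    and N: "open N" "q holomorphic_on N" "\<And>u. u \<in> N \<Longrightarrow> q u \<noteq> 0"
      "\<And>u. u \<in> N \<inter> strip I \<Longrightarrow> m u = 2 * ln (cmod (q u))"
    and z: "z \<in> N" "z \<in> strip I"
  shows "pd I m \<i> z = - 2 * Im (deriv q z / q z)" and "lap I m z = 0"
proof -
  define k where "k u = 2 * (deriv q u / q u)" for u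
  have kh: "k holomorphic_on N" unfolding k_def using N by (auto intro!: holomorphic_intros)
  have d: "(m has_derivative (\<lambda>v. Re v * Re (k u) + Im v * Re (\<i> * k u))) (at u within strip I)"
    if "u \<in> N" "u \<in> strip I" for u
    unfolding k_def
    by (rule has_derivative_within_local[OF
        has_derivative_at_withinI[OF Ck_on_ln_holomorphic(2)[OF N(1-3) that(1)]] N(1) that])
      (simp_all add: N(4))
  have m1: "pd I m 1 u = Re (k u)" and m2: "pd I m \<i> u = Re (\<i> * k u)" if "u \<in> N" "u \<in> strip I" for u
    using pd_eqI[OF I that(2) d[OF that]] by auto
  show "pd I m \<i> z = - 2 * Im (deriv q z / q z)"
  proof -
    have *: "Re (\<i> * (2 * x)) = - 2 * Im x" for x :: complex by simp
    show ?thesis unfolding m2[OF z] k_def by (rule *)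
  qed
  have kd: "(k has_field_derivative deriv k z) (at z within strip I)"
    using holomorphic_derivI[OF kh N(1) z(1)] has_field_derivative_at_within by blast
  have kd2: "((\<lambda>u. \<i> * k u) has_field_derivative (\<i> * deriv k z)) (at z within strip I)"
    using kd by (auto intro!: derivative_eq_intros)
  have "pd I (pd I m 1) 1 z = Re (deriv k z)"
    using pd_eqI[OF I z(2) has_derivative_within_local[OF has_derivative_Re_field[OF kd] N(1) z, of "pd I m 1"], of 1] m1
    by auto
  moreover have "pd I (pd I m \<i>) \<i> z = - Re (deriv k z)"
    using pd_eqI[OF I z(2) has_derivative_within_local[OF has_derivative_Re_field[OF kd2] N(1) z, of "pd I m \<i>"], of \<i>] m2
    by auto
  ultimately show "lap I m z = 0" by (simp add: lap_def)
qed

text \<open>Connects the iterated one-variable derivatives of \<open>laplacian\<close> in a chart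
  with \<open>lap\<close> on the cover. In the chart z = \<beta> + \<sigma> w each differentiation
  brings out one sign \<sigma>, and two of them cancel. The point is interior, so short lines
  through it stay in the strip.\<close>

lemma laplacian_eq_lap:
  assumes I: "cyl_ivl I a b" and f: "smooth_on (strip I) f"
    and w: "a < Im (\<beta> + \<sigma> * w)" "Im (\<beta> + \<sigma> * w) < b" and \<sigma>: "\<sigma> = 1 \<or> \<sigma> = -1"
    and N: "open N" "w \<in> N" "\<And>v. v \<in> N \<Longrightarrow> g v = f (\<beta> + \<sigma> * v)"
  shows "laplacian g w = lap I f (\<beta> + \<sigma> * w)"
proof -
  define M where "M = N \<inter> {v. a < Im (\<beta> + \<sigma> * v)} \<inter> {v. Im (\<beta> + \<sigma> * v) < b}"
  have "open M" unfolding M_def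
    by (intro open_Int N open_Collect_less continuous_intros)
  moreover have "w \<in> M" using w N by (auto simp: M_def)
  ultimately obtain e where e: "e > 0" "ball w e \<subseteq> M" using openE by blast
  have mem: "\<beta> + \<sigma> * v \<in> strip I" if "v \<in> M" for v
    using that cyl_ivlD(5)[OF I] by (auto simp: M_def)
  have line: "((\<lambda>t::real. h (\<beta> + \<sigma> * (w + v * t))) has_real_derivative
      (Re (\<sigma> * v) * pd I h 1 (\<beta> + \<sigma> * (w + v * t)) + Im (\<sigma> * v) * pd I h \<i> (\<beta> + \<sigma> * (w + v * t)))) (at t)"
    if h: "smooth_on (strip I) h" and v: "cmod v = 1" and t: "\<bar>t\<bar> < e" for h v and t :: real
  proof -
    let ?p = "\<lambda>t::real. \<beta> + \<sigma> * (w + v * t)"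
    have inM: "w + v * complex_of_real s \<in> M" if "\<bar>s\<bar> < e" for s :: real
      using e(2) that v by (auto simp: dist_norm norm_mult subset_iff)
    have hd: "(h has_derivative (\<lambda>v. Re v * pd I h 1 (?p t) + Im v * pd I h \<i> (?p t))) (at (?p t) within strip I)"
      by (rule smooth_on_has_pd(1)[OF I h mem[OF inM[OF t]]])
    have pdv: "(?p has_derivative (\<lambda>s. \<sigma> * v * of_real s)) (at t within {-e<..<e})"
      by (auto intro!: derivative_eq_intros simp: algebra_simps)
    have "(h \<circ> ?p has_derivative (\<lambda>v. Re v * pd I h 1 (?p t) + Im v * pd I h \<i> (?p t)) \<circ> (\<lambda>s::real. \<sigma> * v * of_real s)) (at t within {-e<..<e})"
      by (rule diff_chain_within[OF pdv has_derivative_subset[OF hd]], intro image_subsetI mem inM)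
        (auto simp: abs_less_iff)
    then have "((\<lambda>t. h (?p t)) has_derivative (\<lambda>v. Re v * pd I h 1 (?p t) + Im v * pd I h \<i> (?p t)) \<circ> (\<lambda>s::real. \<sigma> * v * of_real s)) (at t)"
      using t at_within_open[of t "{-e<..<e}"] by (simp add: abs_less_iff o_def)
    then show ?thesis
      unfolding has_field_derivative_def by (rule has_derivative_eq_rhs2) (simp add: algebra_simps)
  qed
  have second: "(deriv ^^ 2) (\<lambda>t. g (w + v * of_real t)) 0 = pd I (pd I f v) v (\<beta> + \<sigma> * w)"
    if v: "v = 1 \<or> v = \<i>" for v
  proof -
    have cv: "cmod v = 1" using v by auto
    have eqg: "g (w + v * of_real t) = f (\<beta> + \<sigma> * (w + v * of_real t))" if "\<bar>t\<bar> < e" for t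
      by (rule N(3)) (use e(2) that cv in \<open>auto simp: dist_norm norm_mult subset_iff M_def\<close>)
    have simpv: "Re (\<sigma> * v) * x1 + Im (\<sigma> * v) * x2 = Re \<sigma> * (if v = 1 then x1 else x2)" for x1 x2
      using v \<sigma> by auto
    have ev: "eventually (\<lambda>t::real. \<bar>t\<bar> < e) (nhds 0)"
      using eventually_nhds_in_open[of "{-e<..<e}" "0::real"] e(1)
      by (auto elim!: eventually_mono)
    have ev1: "\<forall>\<^sub>F t in nhds t0. g (w + v * of_real t) = f (\<beta> + \<sigma> * (w + v * of_real t))" if "\<bar>t0\<bar> < e" for t0
    proof (rule eventually_mono)
      show "\<forall>\<^sub>F t in nhds t0. t \<in> {-e<..<e}"
        using that by (intro eventually_nhds_in_open) auto
      show "g (w + v * of_real t) = f (\<beta> + \<sigma> * (w + v * of_real t))" if "t \<in> {-e<..<e}" for t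
        using that by (intro eqg) auto
    qed
    have d1: "deriv (\<lambda>t. g (w + v * of_real t)) t = Re \<sigma> * pd I f v (\<beta> + \<sigma> * (w + v * of_real t))" if "\<bar>t\<bar> < e" for t
      using DERIV_imp_deriv[OF line[OF f cv that]] deriv_cong_ev[OF ev1[OF that] refl] v
      by (auto simp: simpv simp del: times_complex.simps)
    have ev2: "\<forall>\<^sub>F t in nhds 0. deriv (\<lambda>t. g (w + v * of_real t)) t = Re \<sigma> * pd I f v (\<beta> + \<sigma> * (w + v * of_real t))"
      using ev by eventually_elim (rule d1)
    have "((\<lambda>t. Re \<sigma> * pd I f v (\<beta> + \<sigma> * (w + v * complex_of_real t))) has_real_derivative
        Re \<sigma> * (Re \<sigma> * pd I (pd I f v) v (\<beta> + \<sigma> * (w + v * of_real 0)))) (at 0)"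
      using DERIV_cmult[OF line[OF smooth_on_has_pd(2)[OF I f v] cv, of 0], of "Re \<sigma>"] e(1) v
      by (auto simp: simpv simp del: times_complex.simps)
    from DERIV_imp_deriv[OF this] deriv_cong_ev[OF ev2 refl] \<sigma>
    show ?thesis by (auto simp: numeral_2_eq_2)
  qed
  show ?thesis
    unfolding laplacian_def lap_def using second[of 1] second[of \<i>] by simp
qed

section \<open>Integration over subsets of the plane\<close>

text \<open>Serves to identify \<open>complex\<close> with \<open>real^2\<close> and with
  \<open>real \<times> real\<close>: maps that preserve boxes, their content and the norm preserve
  gauge integrals. The norm enters through the large balls in the description of the integral over
  an arbitrary set.\<close>

lemma has_integral_box_isometry:
  fixes f :: "'b::euclidean_space \<Rightarrow> real" and g :: "'a::euclidean_space \<Rightarrow> 'b"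
  assumes hg: "\<And>x. h (g x) = x" and gh: "\<And>y. g (h y) = y"
    and nrm: "\<And>x. norm (g x) = norm x" and lin: "linear g"
    and box: "\<And>u v. g ` cbox u v = cbox (g u) (g v)"
    and cont: "\<And>u v. measure lborel (cbox (g u) (g v)) = measure lborel (cbox u v)"
    and f: "(f has_integral i) S"
  shows "((\<lambda>x. f (g x)) has_integral i) (h ` S)"
proof (rule has_integral'[THEN iffD2], intro allI impI)
  fix e :: real assume e: "e > 0"
  obtain B where B: "B > 0"
    "\<forall>a b. ball 0 B \<subseteq> cbox a b \<longrightarrow> (\<exists>z. ((\<lambda>x. if x \<in> S then f x else 0) has_integral z) (cbox a b) \<and> norm (z - i) < e)"
    using has_integral'[THEN iffD1, OF f, rule_format, OF e] by auto
  have "\<exists>z. ((\<lambda>x. if x \<in> h ` S then f (g x) else 0) has_integral z) (cbox a b) \<and> norm (z - i) < e"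
    if ab: "ball 0 B \<subseteq> cbox a b" for a b
  proof -
    have "ball 0 B \<subseteq> cbox (g a) (g b)"
    proof
      fix y :: 'b assume "y \<in> ball 0 B"
      then have "h y \<in> ball 0 B" using nrm[of "h y"] gh by simp
      then have "g (h y) \<in> g ` cbox a b" using ab by blast
      then show "y \<in> cbox (g a) (g b)" using gh box by simp
    qed
    then obtain z where z: "((\<lambda>x. if x \<in> S then f x else 0) has_integral z) (cbox (g a) (g b))" "norm (z - i) < e"
      using B(2) by blast
    have hbox: "h ` cbox u v = cbox (h u) (h v)" for u v
    proof -
      have "cbox u v = g ` cbox (h u) (h v)" using box[of "h u" "h v"] gh by simp
      then show ?thesis by (simp add: image_image hg)
    qed
    have "((\<lambda>x. (if g x \<in> S then f (g x) else 0)) has_integral (1/1) *\<^sub>R z) (h ` cbox (g a) (g b))"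
      by (rule has_integral_twiddle[OF _ hg gh _ _ _ _ z(1)])
        (use box hbox cont linear_continuous_at[OF linear_conv_bounded_linear[THEN iffD1, OF lin]] in auto)
    moreover have "x \<in> h ` S \<longleftrightarrow> g x \<in> S" for x
      using hg gh by (metis imageE image_eqI)
    ultimately show ?thesis using z(2) hbox hg by auto
  qed
  then show "\<exists>B>0. \<forall>a b. ball 0 B \<subseteq> cbox a b \<longrightarrow>
      (\<exists>z. ((\<lambda>x. if x \<in> h ` S then f (g x) else 0) has_integral z) (cbox a b) \<and> norm (z - i) < e)"
    using B(1) by blast
qed

lemma cbox_complex: "cbox u v = {z. Re u \<le> Re z \<and> Re z \<le> Re v \<and> Im u \<le> Im z \<and> Im z \<le> Im v}"
  by (auto simp: cbox_def Basis_complex_def inner_complex_def)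

lemma cbox_complex_empty: "cbox u v = {} \<longleftrightarrow> \<not> (Re u \<le> Re v \<and> Im u \<le> Im v)"
  by (auto simp: box_ne_empty Basis_complex_def inner_complex_def box_eq_empty not_le)

lemma content_cbox_complex:
  "measure lborel (cbox u v) = (if Re u \<le> Re v \<and> Im u \<le> Im v then (Re v - Re u) * (Im v - Im u) else 0)"
  unfolding content_cbox_if cbox_complex_empty
  by (auto simp: Basis_complex_def inner_complex_def complex_eq_iff)

definition c_v2 :: "complex \<Rightarrow> real^2" where "c_v2 z = (\<chi> i. if i = 1 then Re z else Im z)"
definition v2_c :: "real^2 \<Rightarrow> complex" where "v2_c v = Complex (v $ 1) (v $ 2)"

lemma v2_c_simps [simp]: "v2_c (c_v2 z) = z" "c_v2 (v2_c v) = v" "c_v2 z $ 1 = Re z" "c_v2 z $ 2 = Im z"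
  "Re (v2_c v) = v $ 1" "Im (v2_c v) = v $ 2"
  by (auto simp: c_v2_def v2_c_def vec_eq_iff forall_2)

lemma linear_v2: "linear c_v2" "linear v2_c"
  by (auto intro!: linearI simp: vec_eq_iff forall_2 complex_eq_iff)

lemma norm_v2: "norm (c_v2 z) = norm z" "norm (v2_c v) = norm v"
  by (simp_all add: norm_vec_def L2_set_def UNIV_2 cmod_def)

lemma cbox_v2: "c_v2 ` cbox u v = cbox (c_v2 u) (c_v2 v)" "v2_c ` cbox x y = cbox (v2_c x) (v2_c y)"
proof -
  have *: "c_v2 ` cbox u v = cbox (c_v2 u) (c_v2 v)" for u v
  proof (rule equalityI)
    show "cbox (c_v2 u) (c_v2 v) \<subseteq> c_v2 ` cbox u v"
    proof
      fix x assume "x \<in> cbox (c_v2 u) (c_v2 v)"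
      then have "v2_c x \<in> cbox u v" by (auto simp: cbox_complex mem_box_cart forall_2)
      then have "c_v2 (v2_c x) \<in> c_v2 ` cbox u v" by blast
      then show "x \<in> c_v2 ` cbox u v" by simp
    qed
  qed (auto simp: cbox_complex mem_box_cart forall_2)
  then show "c_v2 ` cbox u v = cbox (c_v2 u) (c_v2 v)" .
  have "cbox x y = c_v2 ` cbox (v2_c x) (v2_c y)" using *[of "v2_c x" "v2_c y"] by simp
  then show "v2_c ` cbox x y = cbox (v2_c x) (v2_c y)" by (simp add: image_image)
qed

lemma content_v2: "measure lborel (cbox (c_v2 u) (c_v2 v)) = measure lborel (cbox u v)"
proof -
  have "cbox (c_v2 u) (c_v2 v) = {} \<longleftrightarrow> \<not> (Re u \<le> Re v \<and> Im u \<le> Im v)"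
    by (simp add: cbox_v2(1)[symmetric] cbox_complex_empty)
  then show ?thesis
    unfolding content_cbox_complex content_cbox_if_cart by (auto simp: UNIV_2)
qed

lemma content_v2': "measure lborel (cbox (v2_c x) (v2_c y)) = measure lborel (cbox x y)"
  using content_v2[of "v2_c x" "v2_c y"] by simp

lemma has_integral_v2:
  fixes f :: "complex \<Rightarrow> real"
  shows "((\<lambda>x. f (v2_c x)) has_integral i) (c_v2 ` S) \<longleftrightarrow> (f has_integral i) S"
proof
  assume "((\<lambda>x. f (v2_c x)) has_integral i) (c_v2 ` S)"
  from has_integral_box_isometry[OF _ _ _ _ _ _ this, of v2_c c_v2]
  show "(f has_integral i) S"
    by (simp add: norm_v2 linear_v2 cbox_v2 content_v2 image_image)
next
  assume "(f has_integral i) S"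
  from has_integral_box_isometry[OF _ _ _ _ _ _ this, of c_v2 v2_c]
  show "((\<lambda>x. f (v2_c x)) has_integral i) (c_v2 ` S)"
    by (simp add: norm_v2 linear_v2 cbox_v2 content_v2' image_image)
qed

lemma integrable_v2:
  fixes f :: "complex \<Rightarrow> real"
  shows "(\<lambda>x. f (v2_c x)) integrable_on (c_v2 ` S) \<longleftrightarrow> f integrable_on S"
    "integral (c_v2 ` S) (\<lambda>x. f (v2_c x)) = integral S f"
    "(\<lambda>x. f (v2_c x)) absolutely_integrable_on (c_v2 ` S) \<longleftrightarrow> f absolutely_integrable_on S"
proof -
  show *: "(\<lambda>x. f (v2_c x)) integrable_on (c_v2 ` S) \<longleftrightarrow> f integrable_on S" for f :: "complex \<Rightarrow> real"
    by (auto simp: integrable_on_def has_integral_v2)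
  show "integral (c_v2 ` S) (\<lambda>x. f (v2_c x)) = integral S f"
    using *[of f] has_integral_v2 by (metis integral_unique not_integrable_integral integrable_integral)
  show "(\<lambda>x. f (v2_c x)) absolutely_integrable_on (c_v2 ` S) \<longleftrightarrow> f absolutely_integrable_on S"
    using *[of f] *[of "\<lambda>x. norm (f x)"] by (simp add: absolutely_integrable_on_def)
qed

text \<open>The change-of-variables theorem applied below integrates vector-valued functions; a
  scalar integrand enters it as a vector with one component.\<close>

lemma integrable_vec1:
  fixes f :: "'a::euclidean_space \<Rightarrow> real"
  shows "(\<lambda>x. vec (f x) :: real^1) absolutely_integrable_on S \<longleftrightarrow> f absolutely_integrable_on S"
    and "f absolutely_integrable_on S \<Longrightarrow> integral S (\<lambda>x. vec (f x) :: real^1) = vec (integral S f)"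
proof -
  have bl: "bounded_linear (vec :: real \<Rightarrow> real^1)" "bounded_linear (\<lambda>x::real^1. x $ 1)"
    by (auto intro!: linear_conv_bounded_linear[THEN iffD1] linearI simp: vec_eq_iff)
  have i: "(\<lambda>x. vec (f x) :: real^1) integrable_on S \<longleftrightarrow> f integrable_on S"
  proof
    assume "(\<lambda>x. vec (f x) :: real^1) integrable_on S"
    from integrable_linear[OF this bl(2)] show "f integrable_on S" by (simp add: o_def)
  next
    assume "f integrable_on S"
    from integrable_linear[OF this bl(1)] show "(\<lambda>x. vec (f x) :: real^1) integrable_on S" by (simp add: o_def)
  qed
  have n: "norm (vec x :: real^1) = norm x" for x :: real
    by (simp add: norm_vec_def L2_set_def UNIV_1)
  show "(\<lambda>x. vec (f x) :: real^1) absolutely_integrable_on S \<longleftrightarrow> f absolutely_integrable_on S"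
    unfolding absolutely_integrable_on_def using i by (simp add: n)
  show "integral S (\<lambda>x. vec (f x) :: real^1) = vec (integral S f)" if "f absolutely_integrable_on S"
    using integral_linear[OF _ bl(1), of f S] that by (simp add: o_def absolutely_integrable_on_def)
qed

lemma det_matrix_complex_mult:
  "det (matrix (\<lambda>v. c_v2 (d * v2_c v))) = (cmod d)\<^sup>2"
proof -
  have "(cmod d)\<^sup>2 = Re d * Re d + Im d * Im d" unfolding cmod_power2 by (simp add: power2_eq_square)
  then show ?thesis by (simp add: det_2 matrix_def axis_def)
qed

text \<open>The real Jacobian of multiplication by h' is |h'|^2. Derivatives are taken within S
  only, which admits half-open domains; the equivalence carries integrability and value
  together.\<close>

lemma complex_change_of_variables:
  fixes f :: "complex \<Rightarrow> real"
  assumes S: "S \<in> lmeasurable"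
    and h: "\<And>z. z \<in> S \<Longrightarrow> (h has_field_derivative h' z) (at z within S)"
    and inj: "inj_on h S"
  shows "(\<lambda>z. (cmod (h' z))\<^sup>2 * f (h z)) absolutely_integrable_on S \<and>
     integral S (\<lambda>z. (cmod (h' z))\<^sup>2 * f (h z)) = b
     \<longleftrightarrow> f absolutely_integrable_on (h ` S) \<and> integral (h ` S) f = b"
proof -
  let ?S = "c_v2 ` S" and ?h = "\<lambda>v. c_v2 (h (v2_c v))" and ?f = "\<lambda>v. vec (f (v2_c v)) :: real^1"
  have S': "?S \<in> sets lebesgue"
  proof -
    have "(\<lambda>_::complex. 1::real) integrable_on S" using S by (simp add: lmeasurable_iff_integrable_on)
    then have "?S \<in> lmeasurable"
      using integrable_v2(1)[of "\<lambda>_. 1" S] by (simp add: lmeasurable_iff_integrable_on)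
    then show ?thesis by (simp add: fmeasurable_def)
  qed
  have "?h = c_v2 \<circ> (h \<circ> v2_c)" by (simp add: o_def)
  have der: "(?h has_derivative (\<lambda>v. c_v2 (h' (v2_c x) * v2_c v))) (at x within ?S)" if "x \<in> ?S" for x
  proof -
    have x: "v2_c x \<in> S" using that by auto
    have 1: "(v2_c has_derivative v2_c) (at x within ?S)"
      by (rule linear_imp_has_derivative[OF linear_v2(2)])
    have 2: "(h has_derivative (*) (h' (v2_c x))) (at (v2_c x) within v2_c ` ?S)"
      using h[OF x] by (simp add: has_field_derivative_def image_image)
    have 3: "(c_v2 has_derivative c_v2) (at y within T)" for y T
      by (rule linear_imp_has_derivative[OF linear_v2(1)])
    show ?thesis
      using diff_chain_within[OF diff_chain_within[OF 1 2] 3] by (simp add: o_def)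
  qed
  have injh: "inj_on ?h ?S"
    using inj by (auto simp: inj_on_def) (metis v2_c_simps(1))
  have img: "?h ` ?S = c_v2 ` (h ` S)" by (simp add: image_image)
  have R: "(\<lambda>x. \<bar>det (matrix (\<lambda>v. c_v2 (h' (v2_c x) * v2_c v)))\<bar> *\<^sub>R ?f (?h x))
    = (\<lambda>x. vec ((\<lambda>z. (cmod (h' z))\<^sup>2 * f (h z)) (v2_c x)))"
    by (simp add: det_matrix_complex_mult fun_eq_iff vec_eq_iff)
  let ?g = "\<lambda>z. (cmod (h' z))\<^sup>2 * f (h z)"
  have e: "(vec x :: real^1) = vec y \<longleftrightarrow> x = y" for x y :: real by (simp add: vec_eq_iff)
  have L: "(\<lambda>x. vec (k (v2_c x)) :: real^1) absolutely_integrable_on (c_v2 ` T) \<and>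
      integral (c_v2 ` T) (\<lambda>x. vec (k (v2_c x)) :: real^1) = vec b
      \<longleftrightarrow> k absolutely_integrable_on T \<and> integral T k = b" for k :: "complex \<Rightarrow> real" and T
    using integrable_vec1(2)[where f="\<lambda>x. k (v2_c x)" and S="c_v2 ` T"]
    unfolding integrable_vec1(1) integrable_v2(3)[where f=k and S=T] integrable_v2(2)[where f=k and S=T] by (auto simp: e)
  show ?thesis
    using has_absolute_integral_change_of_variables[OF S' der injh, of ?f "vec b"]
    unfolding img R L unfolding L[of S ?g] .
qed

lemma integral_complex_box:
  fixes f :: "complex \<Rightarrow> real"
  assumes f: "continuous_on (cbox (Complex a c) (Complex b d)) f"
  shows "integral (cbox (Complex a c) (Complex b d)) f = integral {a..b} (\<lambda>x. integral {c..d} (\<lambda>y. f (Complex x y)))"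
    and "integral (cbox (Complex a c) (Complex b d)) f = integral {c..d} (\<lambda>y. integral {a..b} (\<lambda>x. f (Complex x y)))"
proof -
  let ?g = "\<lambda>z. (Re z, Im z)" and ?h = "\<lambda>p. Complex (fst p) (snd p)"
  have img: "?h ` cbox (u::real\<times>real) v = cbox (?h u) (?h v)" for u v
  proof (rule equalityI)
    show "cbox (?h u) (?h v) \<subseteq> ?h ` cbox u v"
    proof
      fix z assume "z \<in> cbox (?h u) (?h v)"
      then have "?g z \<in> cbox u v" by (cases u; cases v) (auto simp: cbox_complex cbox_Pair_eq)
      then have "?h (?g z) \<in> ?h ` cbox u v" by (rule imageI)
      then show "z \<in> ?h ` cbox u v" by simp
    qed
  qed (cases u; cases v; auto simp: cbox_complex cbox_Pair_eq)
  have lin: "linear ?h" by (auto intro!: linearI simp: complex_eq_iff)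
  have cont: "measure lborel (cbox (?h u) (?h v)) = measure lborel (cbox u v)" for u v :: "real \<times> real"
    by (cases u; cases v) (auto simp: content_cbox_complex content_Pair)
  have fi: "f integrable_on cbox (Complex a c) (Complex b d)"
    by (rule integrable_continuous[OF f])
  have "((\<lambda>p. f (?h p)) has_integral integral (cbox (Complex a c) (Complex b d)) f) (?g ` cbox (Complex a c) (Complex b d))"
    by (rule has_integral_box_isometry[OF _ _ _ lin img cont integrable_integral[OF fi]])
      (auto simp: norm_Pair cmod_def)
  moreover have gi: "?g ` cbox (Complex a c) (Complex b d) = cbox (a,c) (b,d)"
  proof -
    have "cbox (Complex a c) (Complex b d) = ?h ` cbox (a,c) (b,d)" by (simp add: img)
    then show ?thesis by (simp add: image_image)
  qed
  ultimately have "integral (cbox (Complex a c) (Complex b d)) f = integral (cbox (a,c) (b,d)) (\<lambda>p. f (?h p))"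
    by (simp add: integral_unique)
  moreover have c: "continuous_on (cbox (a,c) (b,d)) (\<lambda>p. f (?h p))"
  proof (rule continuous_on_compose2[OF f])
    show "continuous_on (cbox (a,c) (b,d)) ?h"
      by (rule linear_continuous_on[OF linear_conv_bounded_linear[THEN iffD1, OF lin]])
    show "?h ` cbox (a,c) (b,d) \<subseteq> cbox (Complex a c) (Complex b d)"
      by (simp add: img)
  qed
  ultimately show "integral (cbox (Complex a c) (Complex b d)) f = integral {a..b} (\<lambda>x. integral {c..d} (\<lambda>y. f (Complex x y)))"
    using integral_prod_continuous[OF c] by simp
  also have "\<dots> = integral {c..d} (\<lambda>y. integral {a..b} (\<lambda>x. f (Complex x y)))"
    using integral_swap_continuous[of a c b d "\<lambda>x y. f (Complex x y)"] c by (simp add: case_prod_unfold)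
  finally show "integral (cbox (Complex a c) (Complex b d)) f = integral {c..d} (\<lambda>y. integral {a..b} (\<lambda>x. f (Complex x y)))" .
qed

lemma smooth_on_line:
  assumes I: "cyl_ivl I a b" and f: "smooth_on (strip I) f"
  shows "y \<in> I \<Longrightarrow> ((\<lambda>x. f (Complex x y)) has_real_derivative pd I f 1 (Complex x y)) (at x within X)"
    and "y \<in> Y \<Longrightarrow> Y \<subseteq> I \<Longrightarrow> ((\<lambda>y. f (Complex x y)) has_real_derivative pd I f \<i> (Complex x y)) (at y within Y)"
proof -
  have gen: "((\<lambda>t. f (p t)) has_real_derivative (Re d * pd I f 1 (p t) + Im d * pd I f \<i> (p t))) (at t within Z)"
    if p: "(p has_derivative (\<lambda>s. of_real s * d)) (at t within Z)" and "p ` Z \<subseteq> strip I" "p t \<in> strip I" for p d t Z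
  proof -
    have "(f \<circ> p has_derivative (\<lambda>v. Re v * pd I f 1 (p t) + Im v * pd I f \<i> (p t)) \<circ> (\<lambda>s. of_real s * d)) (at t within Z)"
      by (rule diff_chain_within[OF p has_derivative_subset[OF smooth_on_has_pd(1)[OF I f that(3)] that(2)]])
    then show ?thesis
      unfolding has_field_derivative_def o_def by (rule has_derivative_eq_rhs2) (simp add: algebra_simps)
  qed
  have C: "Complex x y = of_real x + \<i> * of_real y" for x y by (simp add: complex_eq_iff)
  show "((\<lambda>x. f (Complex x y)) has_real_derivative pd I f 1 (Complex x y)) (at x within X)" if "y \<in> I"
  proof -
    have "((\<lambda>x. Complex x y) has_derivative (\<lambda>s. of_real s * 1)) (at x within X)"
      unfolding C by (auto intro!: derivative_eq_intros)
    moreover have "(\<lambda>x. Complex x y) ` X \<subseteq> strip I" using that by auto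
    ultimately show ?thesis using gen[of "\<lambda>x. Complex x y" 1 x X] that by simp
  qed
  show "((\<lambda>y. f (Complex x y)) has_real_derivative pd I f \<i> (Complex x y)) (at y within Y)" if "y \<in> Y" "Y \<subseteq> I"
  proof -
    have "((\<lambda>y. Complex x y) has_derivative (\<lambda>s. of_real s * \<i>)) (at y within Y)"
      unfolding C by (auto intro!: derivative_eq_intros)
    moreover have "(\<lambda>y. Complex x y) ` Y \<subseteq> strip I" using that by auto
    ultimately show ?thesis using gen[of "\<lambda>y. Complex x y" \<i> y Y] that by auto
  qed
qed

text \<open>u lap v - v lap u is the divergence of u grad v - v grad u. The horizontal part
  integrates to zero over a period, the vertical part by \<open>bd\<close> at the two heights. That
  condition covers Neumann data as well as a function vanishing to first order.\<close>

lemma green_strip: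
  assumes I: "cyl_ivl I a b" and u: "smooth_on (strip I) u" and v: "smooth_on (strip I) v"
    and per: "\<And>z. z \<in> strip I \<Longrightarrow> u (z + of_real (2*pi)) = u z" "\<And>z. z \<in> strip I \<Longrightarrow> v (z + of_real (2*pi)) = v z"
    and r: "p \<le> q" "{p..q} \<subseteq> I"
    and bd: "\<And>x. u (Complex x p) * pd I v \<i> (Complex x p) = v (Complex x p) * pd I u \<i> (Complex x p)"
      "\<And>x. u (Complex x q) * pd I v \<i> (Complex x q) = v (Complex x q) * pd I u \<i> (Complex x q)"
  shows "integral (cbox (Complex 0 p) (Complex (2*pi) q)) (\<lambda>z. u z * lap I v z)
       = integral (cbox (Complex 0 p) (Complex (2*pi) q)) (\<lambda>z. v z * lap I u z)"
proof -
  let ?Q = "cbox (Complex 0 p) (Complex (2*pi) q)"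
  have Qs: "?Q \<subseteq> strip I" using r(2) by (auto simp: cbox_complex)
  let ?k = "\<lambda>e z. u z * pd I (pd I v e) e z - v z * pd I (pd I u e) e z"
  note pu = smooth_on_has_pd(2)[OF I u] and pv = smooth_on_has_pd(2)[OF I v]
  have sk: "smooth_on (strip I) (?k e)" if "e = 1 \<or> e = \<i>" for e
    by (intro smooth_on_diff smooth_on_mult u v smooth_on_has_pd(2)[OF I pu] smooth_on_has_pd(2)[OF I pv] that)
  have ck: "continuous_on ?Q (?k e)" if "e = 1 \<or> e = \<i>" for e
    using smooth_on_continuous[OF sk[OF that]] Qs continuous_on_subset by blast
  have zp: "Complex (2*pi) y = Complex 0 y + of_real (2*pi)" for y by (simp add: complex_eq_iff)
  have pdper: "pd I w e (z + of_real (2*pi)) = pd I w e z"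
    if w: "smooth_on (strip I) w" "\<And>z. z \<in> strip I \<Longrightarrow> w (z + of_real (2*pi)) = w z" "e = 1 \<or> e = \<i>" "z \<in> strip I" for w e z
  proof -
    have "(\<lambda>z. z + complex_of_real (2*pi)) holomorphic_on UNIV" by (intro holomorphic_intros)
    from lap_comp(1,2)[OF I I w(1) open_UNIV this, of w z] w show ?thesis by auto
  qed
  have 1: "integral {0..2*pi} (\<lambda>x. ?k 1 (Complex x y)) = 0" if y: "y \<in> {p..q}" for y
  proof -
    have yI: "y \<in> I" using y r by auto
    let ?W = "\<lambda>x. u (Complex x y) * pd I v 1 (Complex x y) - v (Complex x y) * pd I u 1 (Complex x y)"
    have "((\<lambda>x. ?k 1 (Complex x y)) has_integral (?W (2*pi) - ?W 0)) {0..2*pi}"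
    proof (rule fundamental_theorem_of_calculus)
      show "(?W has_vector_derivative ?k 1 (Complex x y)) (at x within {0..2*pi})" for x
        unfolding has_real_derivative_iff_has_vector_derivative[symmetric]
        by (rule DERIV_cong[OF DERIV_diff[OF
              DERIV_mult[OF smooth_on_line(1)[OF I u yI] smooth_on_line(1)[OF I pv[OF disjI1[OF refl]] yI]]
              DERIV_mult[OF smooth_on_line(1)[OF I v yI] smooth_on_line(1)[OF I pu[OF disjI1[OF refl]] yI]]]])
          (simp add: algebra_simps)
    qed simp
    moreover have "?W (2*pi) = ?W 0"
      unfolding zp using per[of "Complex 0 y"] pdper[OF u per(1), of 1 "Complex 0 y"] pdper[OF v per(2), of 1 "Complex 0 y"] yI
      by simp
    ultimately show ?thesis by (simp add: integral_unique)
  qed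
  have 2: "integral {p..q} (\<lambda>y. ?k \<i> (Complex x y)) = 0" for x
  proof -
    let ?W = "\<lambda>y. u (Complex x y) * pd I v \<i> (Complex x y) - v (Complex x y) * pd I u \<i> (Complex x y)"
    have "((\<lambda>y. ?k \<i> (Complex x y)) has_integral (?W q - ?W p)) {p..q}"
    proof (rule fundamental_theorem_of_calculus[OF r(1)])
      show "(?W has_vector_derivative ?k \<i> (Complex x y)) (at y within {p..q})" if "y \<in> {p..q}" for y
        unfolding has_real_derivative_iff_has_vector_derivative[symmetric]
        by (rule DERIV_cong[OF DERIV_diff[OF
              DERIV_mult[OF smooth_on_line(2)[OF I u that r(2)] smooth_on_line(2)[OF I pv[OF disjI2[OF refl]] that r(2)]]
              DERIV_mult[OF smooth_on_line(2)[OF I v that r(2)] smooth_on_line(2)[OF I pu[OF disjI2[OF refl]] that r(2)]]]])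
          (simp add: algebra_simps)
    qed
    then show ?thesis using bd by (simp add: integral_unique)
  qed
  have "integral ?Q (?k 1) = 0"
    unfolding integral_complex_box(2)[OF ck[of 1, simplified]] using integral_cong[of "{p..q}" _ "\<lambda>_. 0", OF 1] by simp
  moreover have "integral ?Q (?k \<i>) = 0"
    unfolding integral_complex_box(1)[OF ck[of \<i>, simplified]] using 2 by simp
  ultimately have "integral ?Q (\<lambda>z. ?k 1 z + ?k \<i> z) = 0"
    using integral_add[OF integrable_continuous[OF ck[of 1]] integrable_continuous[OF ck[of \<i>]]] by simp
  also have "(\<lambda>z. ?k 1 z + ?k \<i> z) = (\<lambda>z. u z * lap I v z - v z * lap I u z)"
    by (auto simp: lap_def algebra_simps)
  finally have *: "integral ?Q (\<lambda>z. u z * lap I v z - v z * lap I u z) = 0" .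
  have "smooth_on (strip I) (lap I w)" if w: "smooth_on (strip I) w" for w
    unfolding lap_def[abs_def]
    by (intro smooth_on_add smooth_on_has_pd(2)[OF I smooth_on_has_pd(2)[OF I w]]) auto
  then have "continuous_on ?Q (\<lambda>z. u z * lap I v z)" "continuous_on ?Q (\<lambda>z. v z * lap I u z)"
    using u v Qs smooth_on_continuous[OF smooth_on_mult] continuous_on_subset by metis+
  then show ?thesis
    using integral_diff[OF integrable_continuous integrable_continuous, of "Complex 0 p" "Complex (2*pi) q" "\<lambda>z. u z * lap I v z" "\<lambda>z. v z * lap I u z"] *
    by simp
qed

lemma smooth_on_lap:
  assumes I: "cyl_ivl I a b" and w: "smooth_on (strip I) w"
  shows "smooth_on (strip I) (lap I w)"
  unfolding lap_def[abs_def]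
  by (intro smooth_on_add smooth_on_has_pd(2)[OF I smooth_on_has_pd(2)[OF I w]]) auto

section \<open>The covering of the cylinder by the plane\<close>

lemma circ_eq_iff: "circ s = circ t \<longleftrightarrow> (\<exists>k::int. t = s + 2 * pi * of_int k)"
  by (simp add: circle.abs_eq_iff circle_rel_def)

lemma circ_surj: obtains s where "p = circ s"
proof -
  have "\<exists>s. p = circ s" by (induct p rule: circle.abs_induct) auto
  with that show ?thesis by blast
qed

lemma cyl_pt_eq_iff: "cyl_pt z = cyl_pt w \<longleftrightarrow> (\<exists>k::int. w = z + of_real (2 * pi * of_int k))"
  by (auto simp: cyl_pt_def circ_eq_iff complex_eq_iff)

lemma cyl_pt_add_period [simp]: "cyl_pt (z + of_real (2 * pi * of_int k)) = cyl_pt z"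
  using cyl_pt_eq_iff by metis

lemma cyl_pt_add_period1: "cyl_pt (z + of_real (2 * pi)) = cyl_pt z"
  using cyl_pt_add_period[of z 1] by simp

lemma snd_cyl_pt [simp]: "snd (cyl_pt z) = Im z"
  by (simp add: cyl_pt_def)

lemma cyl_pt_surj: obtains z where "p = cyl_pt z"
proof -
  obtain s where "fst p = circ s" by (rule circ_surj)
  then have "p = cyl_pt (Complex s (snd p))" by (simp add: cyl_pt_def prod_eq_iff)
  then show ?thesis by (rule that)
qed

lemma cyl_pt_in [simp]: "cyl_pt z \<in> UNIV \<times> I \<longleftrightarrow> Im z \<in> I"
  by (simp add: cyl_pt_def)

lemma openin_cyl: "openin cyl_topology V \<longleftrightarrow> open (cyl_pt -` V)"
proof -
  have "istopology (\<lambda>V. open (cyl_pt -` V))"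
    by (auto simp: istopology_def vimage_Union)
  then show ?thesis by (simp add: cyl_topology_def topology_inverse')
qed

lemma topspace_cyl [simp]: "topspace cyl_topology = UNIV"
  using openin_subset[of cyl_topology UNIV] by (auto simp: openin_cyl)

lemma topo_flat_cyl: "topo (flat_cyl I) = subtopology cyl_topology (UNIV \<times> I)"
  by (simp add: flat_cyl_def Let_def)

lemma topspace_flat [simp]: "topspace (topo (flat_cyl I)) = UNIV \<times> I"
  by (simp add: topo_flat_cyl)

text \<open>The saturation of an open set is the union of its translates, which is open.\<close>

lemma openin_flat:
  "openin (topo (flat_cyl I)) X \<longleftrightarrow> X \<subseteq> UNIV \<times> I \<and> openin (top_of_set (strip I)) (cyl_pt -` X)"
proof
  assume "openin (topo (flat_cyl I)) X"
  then obtain T where T: "open (cyl_pt -` T)" "X = T \<inter> (UNIV \<times> I)"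
    by (auto simp: topo_flat_cyl openin_subtopology openin_cyl)
  then have "cyl_pt -` X = strip I \<inter> cyl_pt -` T" by (auto simp: cyl_pt_def)
  then show "X \<subseteq> UNIV \<times> I \<and> openin (top_of_set (strip I)) (cyl_pt -` X)"
    using T by (auto simp: openin_open)
next
  assume X: "X \<subseteq> UNIV \<times> I \<and> openin (top_of_set (strip I)) (cyl_pt -` X)"
  then obtain U where U: "open U" "cyl_pt -` X = strip I \<inter> U" by (auto simp: openin_open)
  have "cyl_pt -` (cyl_pt ` U) = (\<Union>k::int. (\<lambda>z. z + of_real (2 * pi * of_int k)) ` U)"
  proof (intro equalityI subsetI)
    fix w assume "w \<in> cyl_pt -` (cyl_pt ` U)"
    then obtain z where "z \<in> U" "cyl_pt z = cyl_pt w" by auto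
    then show "w \<in> (\<Union>k::int. (\<lambda>z. z + of_real (2 * pi * of_int k)) ` U)"
      unfolding cyl_pt_eq_iff by blast
  next
    fix w assume "w \<in> (\<Union>k::int. (\<lambda>z. z + of_real (2 * pi * of_int k)) ` U)"
    then obtain k :: int and z where "z \<in> U" "w = z + of_real (2 * pi * of_int k)" by blast
    then show "w \<in> cyl_pt -` (cyl_pt ` U)" using cyl_pt_add_period by simp
  qed
  moreover have "open ((\<lambda>z. z + of_real (2 * pi * of_int k)) ` U)" for k :: int
    using open_translation[OF U(1), of "of_real (2 * pi * of_int k)"] by (simp add: add.commute)
  ultimately have o: "open (cyl_pt -` (cyl_pt ` U))" by auto
  have "X = cyl_pt ` U \<inter> (UNIV \<times> I)"
  proof (intro equalityI subsetI)
    fix p assume p: "p \<in> X"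
    obtain z where z: "p = cyl_pt z" by (rule cyl_pt_surj)
    then have "z \<in> strip I \<inter> U" using U(2) p by auto
    then show "p \<in> cyl_pt ` U \<inter> (UNIV \<times> I)" using z by auto
  next
    fix p assume p: "p \<in> cyl_pt ` U \<inter> (UNIV \<times> I)"
    then obtain z where z: "p = cyl_pt z" "z \<in> U" by (elim IntE imageE)
    moreover have "Im z \<in> I" using p unfolding z(1) by (simp only: cyl_pt_in Int_iff)
    ultimately have z: "p = cyl_pt z" "z \<in> U" "Im z \<in> I" by auto
    then have "z \<in> cyl_pt -` X" using U(2) by simp
    then show "p \<in> X" using z by simp
  qed
  then show "openin (topo (flat_cyl I)) X"
    using o by (auto simp: topo_flat_cyl openin_subtopology openin_cyl)
qed

lemma openin_flatI:
  assumes "X \<subseteq> UNIV \<times> I"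
    and "\<And>z. cyl_pt z \<in> X \<Longrightarrow> \<exists>N. open N \<and> z \<in> N \<and> (\<forall>u\<in>N. Im u \<in> I \<longrightarrow> cyl_pt u \<in> X)"
  shows "openin (topo (flat_cyl I)) X"
proof -
  have "openin (top_of_set (strip I)) (cyl_pt -` X)"
  proof (subst openin_subopen, rule ballI)
    fix z assume "z \<in> cyl_pt -` X"
    then obtain N where N: "open N" "z \<in> N" "\<forall>u\<in>N. Im u \<in> I \<longrightarrow> cyl_pt u \<in> X" using assms(2) by auto
    have "cyl_pt z \<in> UNIV \<times> I" using assms(1) \<open>z \<in> cyl_pt -` X\<close> by blast
    then have "Im z \<in> I" by (simp only: cyl_pt_in)
    then show "\<exists>T. openin (top_of_set (strip I)) T \<and> z \<in> T \<and> T \<subseteq> cyl_pt -` X"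
      using N by (intro exI[of _ "strip I \<inter> N"]) auto
  qed
  then show ?thesis using assms(1) by (simp add: openin_flat)
qed

lemma openin_flatD:
  assumes "openin (topo (flat_cyl I)) X" "cyl_pt z \<in> X"
  shows "\<exists>N. open N \<and> z \<in> N \<and> (\<forall>u\<in>N. Im u \<in> I \<longrightarrow> cyl_pt u \<in> X)"
proof -
  obtain U where U: "open U" "cyl_pt -` X = strip I \<inter> U"
    using assms(1) by (auto simp: openin_flat openin_open)
  then have "u \<in> U \<Longrightarrow> Im u \<in> I \<Longrightarrow> cyl_pt u \<in> X" for u
    by (metis IntI strip_iff vimage_eq)
  moreover have "z \<in> U" using U(2) assms(2) by blast
  ultimately show ?thesis using U(1) by blast
qed

lemma open_sub_UNIV [simp]: "open_sub S UNIV = S"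
  by (cases S) (auto simp: open_sub_def)

section \<open>Charts and local lifts\<close>

text \<open>Symmetric in Im w, which makes it an open set of the plane around the boundary points Im
  w = 0; a chart domain is the part of it lying over I.\<close>

definition chart_box :: "real \<Rightarrow> real \<Rightarrow> complex set" where
  "chart_box a b = {w. \<bar>Re w\<bar> < pi \<and> \<bar>Im w\<bar> < b - a}"

text \<open>Treats the two families of parametrizations as one affine map: \<sigma> = 1 starts at
  the lower end, \<sigma> = -1 is the half-turn starting at the upper end. As \<sigma> is its own
  inverse, the inverse chart is equally simple.\<close>

definition flat_chart :: "real set \<Rightarrow> real \<Rightarrow> real \<Rightarrow> complex set \<Rightarrow> (complex \<Rightarrow> circle \<times> real) \<Rightarrow> complex \<Rightarrow> complex \<Rightarrow> bool" where
  "flat_chart I a b D s \<beta> \<sigma> \<longleftrightarrow> s = (\<lambda>w. cyl_pt (\<beta> + \<sigma> * w)) \<and>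
     D = {w \<in> chart_box a b. Im (\<beta> + \<sigma> * w) \<in> I} \<and> (\<sigma> = 1 \<and> Im \<beta> = a \<or> \<sigma> = -1 \<and> Im \<beta> = b)"

lemma open_chart_box [simp]: "open (chart_box a b)"
  unfolding chart_box_def by (intro open_Collect_conj open_Collect_less continuous_intros)

lemma flat_cyl_atlasD:
  assumes I: "cyl_ivl I a b" and c: "(D, s) \<in> atlas (flat_cyl I)"
  obtains \<beta> \<sigma> where "flat_chart I a b D s \<beta> \<sigma>"
proof -
  note ab = cyl_ivlD[OF I]
  from c consider \<theta> where "D = {w. \<bar>Re w\<bar> < pi \<and> 0 \<le> Im w \<and> Im w < b - a \<and> a + Im w \<in> I}" "s = (\<lambda>w. cyl_pt (Complex \<theta> a + w))"
    | \<theta> where "D = {w. \<bar>Re w\<bar> < pi \<and> 0 \<le> Im w \<and> Im w < b - a \<and> b - Im w \<in> I}" "s = (\<lambda>w. cyl_pt (Complex \<theta> b - w))"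
    by (auto simp: flat_cyl_def Let_def ab)
  then show ?thesis
  proof cases
    case 1
    have "flat_chart I a b D s (Complex \<theta> a) 1"
      using 1 ab(4) by (auto simp: flat_chart_def chart_box_def subset_iff)
    then show ?thesis by (rule that)
  next
    case 2
    have "flat_chart I a b D s (Complex \<theta> b) (-1)"
      using 2 ab(4) by (auto simp: flat_chart_def chart_box_def subset_iff)
    then show ?thesis by (rule that)
  qed
qed

lemma flat_cyl_atlas_cover:
  assumes I: "cyl_ivl I a b" and z: "Im z \<in> I"
  obtains D s \<beta> \<sigma> where "(D, s) \<in> atlas (flat_cyl I)" "flat_chart I a b D s \<beta> \<sigma>" "\<sigma> * (z - \<beta>) \<in> D"
proof (cases "Im z < b")
  note ab = cyl_ivlD[OF I]
  case True
  let ?D = "{w. \<bar>Re w\<bar> < pi \<and> 0 \<le> Im w \<and> Im w < b - a \<and> a + Im w \<in> I}" and ?s = "\<lambda>w. cyl_pt (Complex (Re z) a + w)"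
  have "(?D, ?s) \<in> atlas (flat_cyl I)" by (simp add: flat_cyl_def Let_def ab)
  moreover have "flat_chart I a b ?D ?s (Complex (Re z) a) 1"
    using ab(4) by (auto simp: flat_chart_def chart_box_def subset_iff)
  moreover have "1 * (z - Complex (Re z) a) \<in> ?D" using True z ab(4) by auto
  ultimately show ?thesis by (rule that)
next
  note ab = cyl_ivlD[OF I]
  case False
  then have zb: "Im z = b" using z ab(4) by force
  let ?D = "{w. \<bar>Re w\<bar> < pi \<and> 0 \<le> Im w \<and> Im w < b - a \<and> b - Im w \<in> I}" and ?s = "\<lambda>w. cyl_pt (Complex (Re z) b - w)"
  have "(?D, ?s) \<in> atlas (flat_cyl I)" by (simp add: flat_cyl_def Let_def ab)
  moreover have "flat_chart I a b ?D ?s (Complex (Re z) b) (-1)"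
    using ab(4) by (auto simp: flat_chart_def chart_box_def subset_iff)
  moreover have "-1 * (z - Complex (Re z) b) \<in> ?D" using zb z ab(1) by auto
  ultimately show ?thesis by (rule that)
qed

lemma flat_chartD:
  assumes "flat_chart I a b D s \<beta> \<sigma>"
  shows "s w = cyl_pt (\<beta> + \<sigma> * w)" "w \<in> D \<longleftrightarrow> w \<in> chart_box a b \<and> Im (\<beta> + \<sigma> * w) \<in> I"
    "\<sigma> = 1 \<or> \<sigma> = -1" "\<sigma> * \<sigma> = 1" "\<beta> + \<sigma> * (\<sigma> * (z - \<beta>)) = z" "\<sigma> * (\<beta> + \<sigma> * w - \<beta>) = w"
  using assms by (auto simp: flat_chart_def)

text \<open>Two points of the chart differ horizontally by less than 2 pi, so the period separating
  their lifts is zero.\<close>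

lemma flat_chart_inj: "flat_chart I a b D s \<beta> \<sigma> \<Longrightarrow> inj_on s D"
proof (rule inj_onI)
  fix w w' assume c: "flat_chart I a b D s \<beta> \<sigma>" and w: "w \<in> D" "w' \<in> D" "s w = s w'"
  note d = flat_chartD[OF c]
  obtain k :: int where k: "\<beta> + \<sigma> * w' = \<beta> + \<sigma> * w + of_real (2 * pi * of_int k)"
    using w(3) unfolding d(1) cyl_pt_eq_iff by blast
  have "Re w' - Re w = 2 * pi * k \<or> Re w' - Re w = - (2 * pi * k)"
    using d(3) k by (auto simp: complex_eq_iff)
  then have e: "\<bar>Re w' - Re w\<bar> = 2 * pi * \<bar>k\<bar>" by (auto simp: abs_mult)
  have "\<bar>Re w' - Re w\<bar> < 2 * pi" using w(1,2) unfolding d(2) chart_box_def by auto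
  then have "2 * pi * \<bar>k\<bar> < 2 * pi * 1" unfolding e by simp
  then have "real_of_int \<bar>k\<bar> < 1" by (rule mult_left_less_imp_less) simp
  then have "k = 0" by linarith
  then show "w = w'" using k d(3) by auto
qed

text \<open>Holomorphy read on the cover. The lift H lives on a full neighbourhood in the plane,
  which encodes the extension across the boundary, while compatibility with F is asked only over I
  and V.\<close>

definition loc_lift :: "real set \<Rightarrow> (circle \<times> real) set \<Rightarrow> real set \<Rightarrow> (circle \<times> real) set \<Rightarrow> (circle \<times> real \<Rightarrow> circle \<times> real) \<Rightarrow> bool" where
  "loc_lift I V J V' F \<longleftrightarrow> (\<forall>z. Im z \<in> I \<and> cyl_pt z \<in> V \<longrightarrow> (\<exists>N H. open N \<and> z \<in> N \<and> H holomorphic_on N \<and>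
     (\<forall>u\<in>N. Im u \<in> I \<and> cyl_pt u \<in> V \<longrightarrow> Im (H u) \<in> J \<and> cyl_pt (H u) \<in> V' \<and> cyl_pt (H u) = F (cyl_pt u))))"

lemma open_sub_sel: "topo (open_sub S V) = subtopology (topo S) V"
  "atlas (open_sub S V) = {({w \<in> D. s w \<in> V}, s) | D s. (D, s) \<in> atlas S}"
  by (auto simp: open_sub_def)

lemma holo_map_imp_loc_lift:
  assumes I: "cyl_ivl I a b" and J: "cyl_ivl J c d"
    and F: "holo_map (open_sub (flat_cyl I) V) (open_sub (flat_cyl J) V') F"
  shows "loc_lift I V J V' F"
  unfolding loc_lift_def
proof (intro allI impI)
  fix z assume z: "Im z \<in> I \<and> cyl_pt z \<in> V"
  obtain D s \<beta> \<sigma> where c: "(D, s) \<in> atlas (flat_cyl I)" "flat_chart I a b D s \<beta> \<sigma>" "\<sigma> * (z - \<beta>) \<in> D"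
    using flat_cyl_atlas_cover[OF I] z by metis
  note cd = flat_chartD[OF c(2)]
  have cont: "continuous_map (topo (open_sub (flat_cyl I) V)) (topo (open_sub (flat_cyl J) V')) F"
    using F by (simp add: holo_map_def)
  have "cyl_pt z \<in> topspace (topo (open_sub (flat_cyl I) V))" using z by (simp add: open_sub_sel)
  then have "F (cyl_pt z) \<in> topspace (topo (open_sub (flat_cyl J) V'))"
    using continuous_map_image_subset_topspace[OF cont] by blast
  then have Fz: "F (cyl_pt z) \<in> UNIV \<times> J" "F (cyl_pt z) \<in> V'" by (auto simp: open_sub_sel)
  obtain z' where z': "F (cyl_pt z) = cyl_pt z'" by (rule cyl_pt_surj)
  obtain D' s' \<beta>' \<sigma>' where c': "(D', s') \<in> atlas (flat_cyl J)" "flat_chart J c d D' s' \<beta>' \<sigma>'" "\<sigma>' * (z' - \<beta>') \<in> D'"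
    using flat_cyl_atlas_cover[OF J] Fz z' by (metis cyl_pt_in)
  note cd' = flat_chartD[OF c'(2)]
  let ?w = "\<sigma> * (z - \<beta>)" and ?w' = "\<sigma>' * (z' - \<beta>')"
  let ?D = "{w \<in> D. s w \<in> V}" and ?D' = "{w \<in> D'. s' w \<in> V'}"
  have at: "(?D, s) \<in> atlas (open_sub (flat_cyl I) V)" "(?D', s') \<in> atlas (open_sub (flat_cyl J) V')"
    using c c' by (auto simp: open_sub_sel)
  have wD: "?w \<in> ?D" using c(3) z by (simp only: mem_Collect_eq cd(1,5))
  have FwD: "F (s ?w) \<in> s' ` ?D'"
  proof
    show "F (s ?w) = s' ?w'" using z' by (simp add: cd cd')
    show "?w' \<in> ?D'" using c'(3) Fz(2) unfolding z' by (simp only: mem_Collect_eq cd'(1,5))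
  qed
  have "\<exists>N h. open N \<and> ?w \<in> N \<and> h holomorphic_on N \<and> (\<forall>u\<in>N \<inter> ?D. h u \<in> ?D' \<and> s' (h u) = F (s u))"
    by (rule F[unfolded holo_map_def, THEN conjunct2, THEN bspec, OF at(1), unfolded split,
          THEN bspec, OF at(2), unfolded split, THEN bspec, OF wD, THEN mp, OF FwD])
  then obtain N h where Nh: "open N" "?w \<in> N" "h holomorphic_on N"
    "\<forall>u \<in> N \<inter> ?D. h u \<in> ?D' \<and> s' (h u) = F (s u)"
    by auto
  \<comment> \<open>The chart expression h, conjugated back by the two affine charts.\<close>
  define H where "H v = \<beta>' + \<sigma>' * h (\<sigma> * (v - \<beta>))" for v
  define M where "M = (\<lambda>v. \<sigma> * (v - \<beta>)) -` (N \<inter> chart_box a b)"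
  have "open M" unfolding M_def
    by (rule open_vimage) (auto intro!: open_Int Nh continuous_intros)
  moreover have "z \<in> M" using Nh(2) c(3) by (auto simp: M_def cd(2))
  moreover have "H holomorphic_on M"
    unfolding H_def by (intro holomorphic_intros holomorphic_on_compose_gen[OF _ Nh(3), unfolded o_def])
      (auto simp: M_def)
  moreover have "Im (H u) \<in> J \<and> cyl_pt (H u) \<in> V' \<and> cyl_pt (H u) = F (cyl_pt u)"
    if "u \<in> M" "Im u \<in> I \<and> cyl_pt u \<in> V" for u
  proof -
    have "\<sigma> * (u - \<beta>) \<in> N \<inter> ?D" using that by (simp only: M_def cd(1,2,5) Int_iff mem_Collect_eq vimage_eq)
    from bspec[OF Nh(4) this] have "h (\<sigma> * (u - \<beta>)) \<in> ?D'" "s' (h (\<sigma> * (u - \<beta>))) = F (s (\<sigma> * (u - \<beta>)))" by auto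
    then show ?thesis by (simp only: mem_Collect_eq cd(1,2,5) cd'(1,2) H_def)
  qed
  ultimately show "\<exists>N H. open N \<and> z \<in> N \<and> H holomorphic_on N \<and>
     (\<forall>u\<in>N. Im u \<in> I \<and> cyl_pt u \<in> V \<longrightarrow> Im (H u) \<in> J \<and> cyl_pt (H u) \<in> V' \<and> cyl_pt (H u) = F (cyl_pt u))"
    by blast
qed

text \<open>The values of H may lie in another sheet than the target chart. A period k moves the
  base point to \<open>w'\<close>, and on the preimage of the open \<open>chart_box\<close> the
  moved lift stays in the chart domain.\<close>

lemma chart_lift:
  assumes c: "flat_chart I a b D s \<beta> \<sigma>" and c': "flat_chart J c d D' s' \<beta>' \<sigma>'"
    and N: "open N" "\<beta> + \<sigma> * w \<in> N" "H holomorphic_on N"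
    and w: "w' \<in> D'" "cyl_pt (H (\<beta> + \<sigma> * w)) = s' w'"
  obtains M h where "open M" "w \<in> M" "h holomorphic_on M" "h w = w'"
    "(h has_field_derivative \<sigma>' * \<sigma> * deriv H (\<beta> + \<sigma> * w)) (at w)"
    "\<forall>u\<in>M. \<beta> + \<sigma> * u \<in> N \<and> s' (h u) = cyl_pt (H (\<beta> + \<sigma> * u)) \<and> (Im (H (\<beta> + \<sigma> * u)) \<in> J \<longrightarrow> h u \<in> D')"
proof -
  note cd = flat_chartD[OF c] and cd' = flat_chartD[OF c']
  obtain k :: int where k: "\<beta>' + \<sigma>' * w' = H (\<beta> + \<sigma> * w) + of_real (2 * pi * of_int k)"
    using w(2) unfolding cd' cyl_pt_eq_iff by blast
  define h where "h u = \<sigma>' * (H (\<beta> + \<sigma> * u) + of_real (2 * pi * of_int k) - \<beta>')" for u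
  define M0 where "M0 = (\<lambda>u. \<beta> + \<sigma> * u) -` N"
  have M0: "open M0" unfolding M0_def by (rule open_vimage) (auto intro!: N continuous_intros)
  have hM0: "h holomorphic_on M0"
    unfolding h_def by (intro holomorphic_intros holomorphic_on_compose_gen[OF _ N(3), unfolded o_def])
      (auto simp: M0_def)
  define M where "M = M0 \<inter> h -` chart_box c d"
  have M: "open M" unfolding M_def
    by (rule continuous_open_preimage[OF holomorphic_on_imp_continuous_on[OF hM0] M0]) simp
  have hw: "h w = w'" unfolding h_def k[symmetric] by (rule cd'(6))
  have e: "\<beta>' + \<sigma>' * h u = H (\<beta> + \<sigma> * u) + of_real (2 * pi * of_int k)" for u
    unfolding h_def by (rule cd'(5))
  show thesis
  proof (rule that[OF M])
    show "w \<in> M" using N(2) w(1) hw by (auto simp: M_def M0_def cd'(2))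
    show "h holomorphic_on M" using hM0 by (rule holomorphic_on_subset) (auto simp: M_def)
    show "h w = w'" by (rule hw)
    show "(h has_field_derivative \<sigma>' * \<sigma> * deriv H (\<beta> + \<sigma> * w)) (at w)"
    proof -
      have "((\<lambda>u. H (\<beta> + \<sigma> * u)) has_field_derivative deriv H (\<beta> + \<sigma> * w) * \<sigma>) (at w)"
        by (rule DERIV_chain2[where f=H and g="\<lambda>u. \<beta> + \<sigma> * u", OF holomorphic_derivI[OF N(3,1,2)]]) (auto intro!: derivative_eq_intros)
      then show ?thesis unfolding h_def by (auto intro!: derivative_eq_intros)
    qed
    show "\<forall>u\<in>M. \<beta> + \<sigma> * u \<in> N \<and> s' (h u) = cyl_pt (H (\<beta> + \<sigma> * u)) \<and> (Im (H (\<beta> + \<sigma> * u)) \<in> J \<longrightarrow> h u \<in> D')"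
      unfolding cd'(1,2) e cyl_pt_add_period by (auto simp: M_def M0_def)
  qed
qed

lemma loc_lift_imp_holo_map:
  assumes I: "cyl_ivl I a b" and J: "cyl_ivl J c d"
    and V: "openin (topo (flat_cyl I)) (V \<inter> UNIV \<times> I)"
    and F: "loc_lift I V J V' F"
  shows "holo_map (open_sub (flat_cyl I) V) (open_sub (flat_cyl J) V') F"
  unfolding holo_map_def
proof (intro conjI)
  have Fin: "F (cyl_pt z) \<in> V'" "F (cyl_pt z) \<in> UNIV \<times> J" if z: "Im z \<in> I" "cyl_pt z \<in> V" for z
  proof -
    obtain N H where "z \<in> N" "\<forall>u\<in>N. Im u \<in> I \<and> cyl_pt u \<in> V \<longrightarrow> Im (H u) \<in> J \<and> cyl_pt (H u) \<in> V' \<and> cyl_pt (H u) = F (cyl_pt u)"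
      using F z unfolding loc_lift_def by blast
    then have "Im (H z) \<in> J" "cyl_pt (H z) \<in> V'" "F (cyl_pt z) = cyl_pt (H z)" using z by auto
    then show "F (cyl_pt z) \<in> V'" "F (cyl_pt z) \<in> UNIV \<times> J" by simp_all
  qed
  show "continuous_map (topo (open_sub (flat_cyl I) V)) (topo (open_sub (flat_cyl J) V')) F"
    unfolding continuous_map_def open_sub_sel
  proof (intro conjI allI impI)
    show "F \<in> topspace (subtopology (topo (flat_cyl I)) V) \<rightarrow> topspace (subtopology (topo (flat_cyl J)) V')"
    proof
      fix p assume p: "p \<in> topspace (subtopology (topo (flat_cyl I)) V)"
      obtain z where "p = cyl_pt z" by (rule cyl_pt_surj)
      then show "F p \<in> topspace (subtopology (topo (flat_cyl J)) V')" using p Fin[of z] by auto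
    qed
    fix U assume "openin (subtopology (topo (flat_cyl J)) V') U"
    then obtain U' where U': "openin (topo (flat_cyl J)) U'" "U = U' \<inter> V'"
      by (auto simp: openin_subtopology)
    let ?X = "{x \<in> topspace (subtopology (topo (flat_cyl I)) V). F x \<in> U}"
    have "openin (topo (flat_cyl I)) ?X"
    proof (rule openin_flatI)
      fix z assume z: "cyl_pt z \<in> ?X"
      then have z': "Im z \<in> I" "cyl_pt z \<in> V" "F (cyl_pt z) \<in> U'" using U' by auto
      obtain N H where N: "open N" "z \<in> N" "H holomorphic_on N"
        "\<forall>u\<in>N. Im u \<in> I \<and> cyl_pt u \<in> V \<longrightarrow> Im (H u) \<in> J \<and> cyl_pt (H u) \<in> V' \<and> cyl_pt (H u) = F (cyl_pt u)"
        using F z' unfolding loc_lift_def by blast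
      have "cyl_pt (H z) \<in> U'" using N z' by auto
      then obtain K where K: "open K" "H z \<in> K" "\<forall>u\<in>K. Im u \<in> J \<longrightarrow> cyl_pt u \<in> U'"
        using openin_flatD[OF U'(1)] by blast
      obtain L where L: "open L" "z \<in> L" "\<forall>u\<in>L. Im u \<in> I \<longrightarrow> cyl_pt u \<in> V \<inter> UNIV \<times> I"
        using openin_flatD[OF V, of z] z' by auto
      have "open (N \<inter> H -` K)"
        by (rule continuous_open_preimage[OF holomorphic_on_imp_continuous_on[OF N(3)] N(1) K(1)])
      moreover have "cyl_pt u \<in> ?X" if "u \<in> (N \<inter> H -` K) \<inter> L" "Im u \<in> I" for u
      proof -
        have u: "cyl_pt u \<in> V" using that L by auto
        then have "Im (H u) \<in> J" "cyl_pt (H u) \<in> V'" "F (cyl_pt u) = cyl_pt (H u)" using N(4) that by auto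
        then show ?thesis using u that K U' by auto
      qed
      ultimately show "\<exists>N. open N \<and> z \<in> N \<and> (\<forall>u\<in>N. Im u \<in> I \<longrightarrow> cyl_pt u \<in> ?X)"
        using L N(2) K(2) by (intro exI[of _ "(N \<inter> H -` K) \<inter> L"]) auto
    qed auto
    then show "openin (subtopology (topo (flat_cyl I)) V) ?X"
      by (auto intro: subset_openin_subtopology)
  qed
  show "\<forall>(D, s)\<in>atlas (open_sub (flat_cyl I) V). \<forall>(D', s')\<in>atlas (open_sub (flat_cyl J) V'). \<forall>w\<in>D. F (s w) \<in> s' ` D' \<longrightarrow>
     (\<exists>N h. open N \<and> w \<in> N \<and> h holomorphic_on N \<and> (\<forall>u\<in>N \<inter> D. h u \<in> D' \<and> s' (h u) = F (s u)))"
  proof (clarsimp simp: open_sub_sel)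
    fix D s D' s' w w'
    assume c: "(D, s) \<in> atlas (flat_cyl I)" and c': "(D', s') \<in> atlas (flat_cyl J)"
      and w: "w \<in> D" "s w \<in> V" "F (s w) = s' w'" "w' \<in> D'" "s' w' \<in> V'"
    obtain \<beta> \<sigma> where ch: "flat_chart I a b D s \<beta> \<sigma>" by (rule flat_cyl_atlasD[OF I c])
    obtain \<beta>' \<sigma>' where ch': "flat_chart J c d D' s' \<beta>' \<sigma>'" by (rule flat_cyl_atlasD[OF J c'])
    note cd = flat_chartD[OF ch]
    have z: "Im (\<beta> + \<sigma> * w) \<in> I" "cyl_pt (\<beta> + \<sigma> * w) \<in> V" using w cd(1,2) by auto
    obtain N H where N: "open N" "\<beta> + \<sigma> * w \<in> N" "H holomorphic_on N"
      "\<forall>u\<in>N. Im u \<in> I \<and> cyl_pt u \<in> V \<longrightarrow> Im (H u) \<in> J \<and> cyl_pt (H u) \<in> V' \<and> cyl_pt (H u) = F (cyl_pt u)"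
      using F z unfolding loc_lift_def by blast
    have e: "cyl_pt (H (\<beta> + \<sigma> * w)) = s' w'" using N z w cd(1) by auto
    obtain M h where M: "open M" "w \<in> M" "h holomorphic_on M" "h w = w'"
      "(h has_field_derivative \<sigma>' * \<sigma> * deriv H (\<beta> + \<sigma> * w)) (at w)"
      "\<forall>u\<in>M. \<beta> + \<sigma> * u \<in> N \<and> s' (h u) = cyl_pt (H (\<beta> + \<sigma> * u)) \<and> (Im (H (\<beta> + \<sigma> * u)) \<in> J \<longrightarrow> h u \<in> D')"
      by (rule chart_lift[OF ch ch' N(1-3) w(4) e]) (rule that; assumption)
    have "h u \<in> D' \<and> s' (h u) \<in> V' \<and> s' (h u) = F (s u)" if "u \<in> M" "u \<in> D" "s u \<in> V" for u
      using bspec[OF M(6) that(1)] N(4) that(2,3) cd(1,2) by auto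
    then show "\<exists>N. open N \<and> w \<in> N \<and> (\<exists>h. h holomorphic_on N \<and> (\<forall>u\<in>N \<inter> {w \<in> D. s w \<in> V}. h u \<in> D' \<and> s' (h u) \<in> V' \<and> s' (h u) = F (s u)))"
      using M(1-3) by blast
  qed
qed

text \<open>\<open>coord_deriv\<close> is a definite description over derivatives within the chart
  domain, so their uniqueness is part of the argument. Only the modulus is stated: the signs of the
  affine charts drop out of it, and metrics see nothing else.\<close>

lemma coord_deriv_lift:
  assumes I: "cyl_ivl I a b" and c: "flat_chart I a b D s \<beta> \<sigma>" and c': "flat_chart J c d D' s' \<beta>' \<sigma>'"
    and N: "open N" "\<beta> + \<sigma> * w \<in> N" "H holomorphic_on N"
      "\<And>u. u \<in> N \<Longrightarrow> Im u \<in> I \<Longrightarrow> Im (H u) \<in> J \<and> cyl_pt (H u) = F (cyl_pt u)"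
    and w: "w \<in> D" "F (s w) \<in> s' ` D'"
  shows "cmod (coord_deriv (D, s) (D', s') F w) = cmod (deriv H (\<beta> + \<sigma> * w))"
proof -
  note cd = flat_chartD[OF c] and cd' = flat_chartD[OF c']
  obtain w' where w': "w' \<in> D'" "F (s w) = s' w'" using w(2) by auto
  have e: "cyl_pt (H (\<beta> + \<sigma> * w)) = s' w'" using N(2,4) w(1) w'(2) cd(1,2) by auto
  let ?d = "\<sigma>' * \<sigma> * deriv H (\<beta> + \<sigma> * w)"
  obtain M h where M: "open M" "w \<in> M" "h holomorphic_on M" "h w = w'" "(h has_field_derivative ?d) (at w)"
    "\<forall>u\<in>M. \<beta> + \<sigma> * u \<in> N \<and> s' (h u) = cyl_pt (H (\<beta> + \<sigma> * u)) \<and> (Im (H (\<beta> + \<sigma> * u)) \<in> J \<longrightarrow> h u \<in> D')"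
    by (rule chart_lift[OF c c' N(1-3) w'(1) e]) (rule that; assumption)
  let ?f = "inv_into D' s' \<circ> F \<circ> s"
  have fh: "?f u = h u" if "u \<in> M" "u \<in> D" for u
  proof -
    have "h u \<in> D'" "s' (h u) = F (s u)" using bspec[OF M(6) that(1)] N(4) that(2) cd(1,2) by auto
    then show ?thesis using inv_into_f_f[OF flat_chart_inj[OF c'], of "h u"] by simp
  qed
  obtain e where e: "e > 0" "ball w e \<subseteq> M" using M openE by blast
  have fd: "(?f has_field_derivative ?d) (at w within D)"
  proof (rule has_field_derivative_transform_within[OF has_field_derivative_at_within[OF M(5)] e(1) w(1)])
    fix x assume "x \<in> D" "dist x w < e"
    then show "h x = ?f x" using e(2) fh[of x] by (simp only: subset_iff mem_ball dist_commute)
  qed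
  \<comment> \<open>I in the height coordinate of the chart, reflected when \<sigma> = -1, which
    exchanges the two half-open shapes. Near w the chart domain agrees with the strip over it, where
    derivatives are unique.\<close>
  define I' where "I' = {y. Im \<beta> + Re \<sigma> * y \<in> I}"
  have I': "cyl_ivl I' 0 (b - a)"
  proof -
    have I3: "a < b" "I = {a..b} \<or> I = {a..<b} \<or> I = {a<..b}" using I by (auto simp: cyl_ivl_def)
    consider "\<sigma> = 1" "Im \<beta> = a" | "\<sigma> = -1" "Im \<beta> = b" using c by (auto simp: flat_chart_def)
    then have "I' = {0..b - a} \<or> I' = {0..<b - a} \<or> I' = {0<..b - a}"
    proof cases
      case 1
      then have "I = {a..b} \<Longrightarrow> I' = {0..b - a}" "I = {a..<b} \<Longrightarrow> I' = {0..<b - a}" "I = {a<..b} \<Longrightarrow> I' = {0<..b - a}"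
        by (auto simp: I'_def)
      then show ?thesis using I3(2) by argo
    next
      case 2
      then have "I = {a..b} \<Longrightarrow> I' = {0..b - a}" "I = {a..<b} \<Longrightarrow> I' = {0<..b - a}" "I = {a<..b} \<Longrightarrow> I' = {0..<b - a}"
        by (auto simp: I'_def)
      then show ?thesis using I3(2) by argo
    qed
    then show ?thesis using I3(1) by (simp add: cyl_ivl_def)
  qed
  have Im0: "Im \<sigma> = 0" using cd(3) by (elim disjE; simp)
  have Ds: "D \<inter> chart_box a b = strip I' \<inter> chart_box a b"
    unfolding set_eq_iff by (simp add: cd(2) I'_def Im0 conj_ac)
  have wat: "at w within D = at w within strip I'"
    by (rule at_within_nhd[of _ "chart_box a b"]) (use w(1)[unfolded cd(2)] Ds in \<open>simp_all add: Int_Diff[symmetric]\<close>)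
  have wI': "w \<in> strip I'" using w(1)[unfolded cd(2)] by (simp add: I'_def Im0)
  have "coord_deriv (D, s) (D', s') F w = ?d"
    unfolding coord_deriv_def fst_conv snd_conv
  proof (rule the_equality)
    show "(?f has_field_derivative ?d) (at w within D)" by (rule fd)
    fix d' assume "(?f has_field_derivative d') (at w within D)"
    then show "d' = ?d" by (rule strip_field_derivative_unique[OF I' wI' _ fd[unfolded wat], unfolded wat[symmetric]])
  qed
  moreover have "cmod \<sigma> = 1" "cmod \<sigma>' = 1" using cd(3) cd'(3) by (elim disjE; simp)+
  ultimately show ?thesis by (simp add: norm_mult)
qed

text \<open>The log-density as a function of points. The chart is picked arbitrarily; for conformal
  metrics \<open>gam_chart\<close> shows the choice to be immaterial.\<close>

definition gam :: "(circle \<times> real) surface \<Rightarrow> (circle \<times> real) metric \<Rightarrow> circle \<times> real \<Rightarrow> real" where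
  "gam S g p = (let (c, w) = (SOME (c, w). c \<in> atlas S \<and> w \<in> fst c \<and> snd c w = p) in g c w)"

lemma some_chart:
  assumes I: "cyl_ivl I a b" and p: "p \<in> UNIV \<times> I"
  obtains D s w where "(SOME (c, w). c \<in> atlas (flat_cyl I) \<and> w \<in> fst c \<and> snd c w = p) = ((D, s), w)"
    "(D, s) \<in> atlas (flat_cyl I)" "w \<in> D" "s w = p"
proof -
  obtain z where z: "p = cyl_pt z" by (rule cyl_pt_surj)
  then have "Im z \<in> I" using p by simp
  then obtain D s \<beta> \<sigma> where c: "(D, s) \<in> atlas (flat_cyl I)" "flat_chart I a b D s \<beta> \<sigma>" "\<sigma> * (z - \<beta>) \<in> D"
    using flat_cyl_atlas_cover[OF I] by metis
  have sp: "s (\<sigma> * (z - \<beta>)) = p" unfolding flat_chartD(1,5)[OF c(2)] z ..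
  define Q where "Q = (\<lambda>x. (case x of (c, w) \<Rightarrow> c \<in> atlas (flat_cyl I) \<and> w \<in> fst c \<and> snd c w = p))"
  have "Q ((D, s), \<sigma> * (z - \<beta>))" using c(1,3) sp by (simp only: Q_def split fst_conv snd_conv simp_thms)
  then have Q: "Q (SOME x. Q x)" by (rule someI)
  obtain D' s' w' where e: "(SOME x. Q x) = ((D', s'), w')"
  proof -
    have "(SOME x. Q x) = ((fst (fst (SOME x. Q x)), snd (fst (SOME x. Q x))), snd (SOME x. Q x))"
      by (simp only: prod.collapse)
    then show thesis by (rule that)
  qed
  show ?thesis
    by (rule that[OF e[unfolded Q_def]]) (use Q[unfolded e] in \<open>simp_all add: Q_def\<close>)
qed

text \<open>Transitions of the flat atlas lift to the identity, so the transformation law only adds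
  ln 1.\<close>

lemma gam_chart:
  assumes I: "cyl_ivl I a b" and g: "conf_metric (flat_cyl I) g" and c: "(D, s) \<in> atlas (flat_cyl I)" and w: "w \<in> D"
  shows "g (D, s) w = gam (flat_cyl I) g (s w)"
proof -
  obtain \<beta> \<sigma> where ch: "flat_chart I a b D s \<beta> \<sigma>" by (rule flat_cyl_atlasD[OF I c])
  have p: "s w \<in> UNIV \<times> I" using w flat_chartD(1,2)[OF ch] by simp
  obtain D' s' w' where e: "(SOME (c, w'). c \<in> atlas (flat_cyl I) \<and> w' \<in> fst c \<and> snd c w' = s w) = ((D', s'), w')"
    and c': "(D', s') \<in> atlas (flat_cyl I)" "w' \<in> D'" "s' w' = s w"
    by (rule some_chart[OF I p]) (rule that; assumption)
  obtain \<beta>' \<sigma>' where ch': "flat_chart I a b D' s' \<beta>' \<sigma>'" by (rule flat_cyl_atlasD[OF I c'(1)])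
  have "g (D, s) w = g (D', s') w' + 2 * ln (cmod (coord_deriv (D, s) (D', s') id w))"
  proof -
    have "\<forall>w\<in>D. \<forall>w'\<in>D'. s w = s' w' \<longrightarrow> g (D, s) w = g (D', s') w' + 2 * ln (cmod (coord_deriv (D, s) (D', s') id w))"
      by (rule g[unfolded conf_metric_def, THEN conjunct2, THEN bspec, OF c, unfolded split, THEN bspec, OF c'(1), unfolded split])
    then show ?thesis using w c'(2) c'(3)[symmetric] by (elim ballE) auto
  qed
  also have "cmod (coord_deriv (D, s) (D', s') id w) = cmod (deriv (\<lambda>z. z) (\<beta> + \<sigma> * w))"
    by (rule coord_deriv_lift[OF I ch ch', of UNIV]) (use w c' in \<open>auto intro: image_eqI[of _ s' w']\<close>)
  finally show ?thesis by (simp add: gam_def e)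
qed

text \<open>\<open>pull_metric\<close> and \<open>gam\<close> select their chart by the same
  \<open>SOME\<close>, so the two selections coincide and only the derivative of the lift remains to
  be computed.\<close>

lemma pull_metric_lift:
  assumes I: "cyl_ivl I a b" and J: "cyl_ivl J c d" and c: "(D, s) \<in> atlas (flat_cyl I)" "flat_chart I a b D s \<beta> \<sigma>"
    and N: "open N" "\<beta> + \<sigma> * w \<in> N" "H holomorphic_on N"
      "\<And>u. u \<in> N \<Longrightarrow> Im u \<in> I \<Longrightarrow> Im (H u) \<in> J \<and> cyl_pt (H u) = F (cyl_pt u)"
    and w: "w \<in> D"
  shows "pull_metric (flat_cyl J) F g (D, s) w = gam (flat_cyl J) g (F (cyl_pt (\<beta> + \<sigma> * w))) + 2 * ln (cmod (deriv H (\<beta> + \<sigma> * w)))"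
proof -
  note cd = flat_chartD[OF c(2)]
  have z: "Im (\<beta> + \<sigma> * w) \<in> I" using w cd(2) by blast
  have "F (s w) = cyl_pt (H (\<beta> + \<sigma> * w))" "Im (H (\<beta> + \<sigma> * w)) \<in> J" using N(4)[OF N(2) z] by (simp_all add: cd(1))
  then have p: "F (s w) \<in> UNIV \<times> J" by simp
  obtain D' s' w' where e: "(SOME (c, w'). c \<in> atlas (flat_cyl J) \<and> w' \<in> fst c \<and> snd c w' = F (s w)) = ((D', s'), w')"
    and c': "(D', s') \<in> atlas (flat_cyl J)" "w' \<in> D'" "s' w' = F (s w)"
    by (rule some_chart[OF J p]) (rule that; assumption)
  obtain \<beta>' \<sigma>' where ch': "flat_chart J c d D' s' \<beta>' \<sigma>'" by (rule flat_cyl_atlasD[OF J c'(1)])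
  have "cmod (coord_deriv (D, s) (D', s') F w) = cmod (deriv H (\<beta> + \<sigma> * w))"
    by (rule coord_deriv_lift[OF I c(2) ch' N(1-3) N(4) w]) (use c' in \<open>auto intro: image_eqI[of _ s' w']\<close>)
  then show ?thesis by (simp add: pull_metric_def gam_def e cd(1)[symmetric])
qed

lemma smooth_on_comp_local:
  assumes "\<And>w. w \<in> D \<Longrightarrow> \<exists>D' f N h. smooth_on D' f \<and> open N \<and> w \<in> N \<and> h holomorphic_on N \<and> (\<forall>u\<in>N \<inter> D. h u \<in> D' \<and> g u = f (h u))"
  shows "smooth_on D g"
proof (rule smooth_onI)
  fix w assume w: "w \<in> D"
  from assms[OF w] obtain D' f N h where s: "smooth_on D' f" and N: "open N" "w \<in> N" "h holomorphic_on N"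
    "\<forall>u\<in>N \<inter> D. h u \<in> D' \<and> g u = f (h u)" by blast
  have "smooth_on (N \<inter> D) g"
    by (rule smooth_on_comp[OF s]) (use N in blast)
  then obtain M F where M: "open M" "w \<in> M" "\<forall>k. Ck_on k M F" "\<forall>u\<in>M \<inter> (N \<inter> D). F u = g u"
    using w N(2) unfolding smooth_on_def by blast
  then have "open (M \<inter> N) \<and> w \<in> M \<inter> N \<and> (\<forall>k. Ck_on k (M \<inter> N) F) \<and> (\<forall>u\<in>M \<inter> N \<inter> D. F u = g u)"
    using N by (auto intro: Ck_on_subset)
  then show "\<exists>N F. open N \<and> w \<in> N \<and> (\<forall>k. Ck_on k N F) \<and> (\<forall>u\<in>N \<inter> D. F u = g u)" by blast
qed

text \<open>\<open>v\<close> is the log-density of the metric \<open>g\<close> in the coordinate of the universal cover.\<close>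

definition density :: "real set \<Rightarrow> (circle \<times> real) metric \<Rightarrow> (complex \<Rightarrow> real) \<Rightarrow> bool" where
  "density I g v \<longleftrightarrow> smooth_on (strip I) v \<and> (\<forall>z\<in>strip I. v (z + of_real (2 * pi)) = v z) \<and>
     (\<forall>(D, s)\<in>atlas (flat_cyl I). \<forall>w\<in>D. \<forall>z. s w = cyl_pt z \<longrightarrow> Im z \<in> I \<longrightarrow> g (D, s) w = v z)"

lemma densityD:
  assumes "density I g v"
  shows "smooth_on (strip I) v" "Im z \<in> I \<Longrightarrow> v (z + of_real (2 * pi)) = v z"
    "(D, s) \<in> atlas (flat_cyl I) \<Longrightarrow> w \<in> D \<Longrightarrow> s w = cyl_pt z \<Longrightarrow> Im z \<in> I \<Longrightarrow> g (D, s) w = v z"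
  using assms unfolding density_def by (auto simp del: cyl_pt_add_period)

lemma density_gam:
  assumes I: "cyl_ivl I a b" and g: "conf_metric (flat_cyl I) g"
  shows "density I g (\<lambda>z. gam (flat_cyl I) g (cyl_pt z))"
  unfolding density_def
proof (intro conjI)
  show "smooth_on (strip I) (\<lambda>z. gam (flat_cyl I) g (cyl_pt z))"
  proof (rule smooth_on_comp_local)
    fix z assume "z \<in> strip I"
    then obtain D s \<beta> \<sigma> where c: "(D, s) \<in> atlas (flat_cyl I)" "flat_chart I a b D s \<beta> \<sigma>" "\<sigma> * (z - \<beta>) \<in> D"
      using flat_cyl_atlas_cover[OF I, of z] by (metis strip_iff)
    note cd = flat_chartD[OF c(2)]
    let ?N = "(\<lambda>u. \<sigma> * (u - \<beta>)) -` chart_box a b"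
    have "smooth_on D (g (D, s))" using g c(1) unfolding conf_metric_def by fast
    moreover have "open ?N" by (rule open_vimage) (auto intro!: continuous_intros)
    moreover have "z \<in> ?N" using c(3) unfolding cd(2) by simp
    moreover have "(\<lambda>u. \<sigma> * (u - \<beta>)) holomorphic_on ?N" by (intro holomorphic_intros)
    moreover have "\<sigma> * (u - \<beta>) \<in> D \<and> gam (flat_cyl I) g (cyl_pt u) = g (D, s) (\<sigma> * (u - \<beta>))"
      if u: "u \<in> ?N \<inter> strip I" for u
    proof -
      have D: "\<sigma> * (u - \<beta>) \<in> D" using u unfolding cd(2) cd(5) by simp
      show ?thesis using gam_chart[OF I g c(1) D] D unfolding cd(1) cd(5) by simp
    qed
    ultimately show "\<exists>D' f N h. smooth_on D' f \<and> open N \<and> z \<in> N \<and> h holomorphic_on N \<and>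
      (\<forall>u\<in>N \<inter> strip I. h u \<in> D' \<and> gam (flat_cyl I) g (cyl_pt u) = f (h u))" by blast
  qed
  show "\<forall>z\<in>strip I. gam (flat_cyl I) g (cyl_pt (z + complex_of_real (2 * pi))) = gam (flat_cyl I) g (cyl_pt z)"
    by (intro ballI) (simp only: cyl_pt_add_period1)
  show "\<forall>(D, s)\<in>atlas (flat_cyl I). \<forall>w\<in>D. \<forall>z. s w = cyl_pt z \<longrightarrow> Im z \<in> I \<longrightarrow> g (D, s) w = gam (flat_cyl I) g (cyl_pt z)"
    using gam_chart[OF I g] by auto
qed

text \<open>Inverse to \<open>gam\<close>: because the charts are isometric, a smooth function of
  points gives a conformal metric by the same formula in each chart.\<close>

definition metric_of :: "(circle \<times> real \<Rightarrow> real) \<Rightarrow> (circle \<times> real) metric" where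
  "metric_of \<gamma> = (\<lambda>(D, s) w. \<gamma> (s w))"

lemma metric_of:
  assumes I: "cyl_ivl I a b" and s: "smooth_on (strip I) (\<lambda>z. \<gamma> (cyl_pt z))"
  shows "conf_metric (flat_cyl I) (metric_of \<gamma>)"
    and "p \<in> UNIV \<times> I \<Longrightarrow> gam (flat_cyl I) (metric_of \<gamma>) p = \<gamma> p"
proof -
  show "conf_metric (flat_cyl I) (metric_of \<gamma>)"
    unfolding conf_metric_def
  proof (intro conjI; clarify)
    fix D s assume c: "(D, s) \<in> atlas (flat_cyl I)"
    obtain \<beta> \<sigma> where ch: "flat_chart I a b D s \<beta> \<sigma>" by (rule flat_cyl_atlasD[OF I c])
    note cd = flat_chartD[OF ch]
    show "smooth_on D (metric_of \<gamma> (D, s))"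
    proof (rule smooth_on_comp[OF assms(2)])
      fix w assume "w \<in> D"
      have "(\<lambda>w. \<beta> + \<sigma> * w) holomorphic_on UNIV" by (intro holomorphic_intros)
      then show "\<exists>N h. open N \<and> w \<in> N \<and> h holomorphic_on N \<and> (\<forall>u\<in>N \<inter> D. h u \<in> strip I \<and> metric_of \<gamma> (D, s) u = \<gamma> (cyl_pt (h u)))"
        using cd(1,2) by (intro exI[of _ UNIV] exI[of _ "\<lambda>w. \<beta> + \<sigma> * w"]) (simp add: metric_of_def)
    qed
    fix D' s' w w' assume c': "(D', s') \<in> atlas (flat_cyl I)" and w: "w \<in> D" "w' \<in> D'" "s w = s' w'"
    obtain \<beta>' \<sigma>' where ch': "flat_chart I a b D' s' \<beta>' \<sigma>'" by (rule flat_cyl_atlasD[OF I c'])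
    have "cmod (coord_deriv (D, s) (D', s') id w) = cmod (deriv (\<lambda>z. z) (\<beta> + \<sigma> * w))"
      by (rule coord_deriv_lift[OF I ch ch', of UNIV]) (use w c' in \<open>auto intro: image_eqI[of _ s' w']\<close>)
    then show "metric_of \<gamma> (D, s) w = metric_of \<gamma> (D', s') w' + 2 * ln (cmod (coord_deriv (D, s) (D', s') id w))"
      using w by (simp add: metric_of_def)
  qed
  assume p: "p \<in> UNIV \<times> I"
  obtain D s w where e: "(SOME (c, w). c \<in> atlas (flat_cyl I) \<and> w \<in> fst c \<and> snd c w = p) = ((D, s), w)" "(D, s) \<in> atlas (flat_cyl I)" "w \<in> D" "s w = p"
    by (rule some_chart[OF I p]) (rule that; assumption)
  show "gam (flat_cyl I) (metric_of \<gamma>) p = \<gamma> p" by (simp add: gam_def e metric_of_def)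
qed

section \<open>Integration over the cylinder\<close>

text \<open>Embeds the cylinder in the punctured plane. Pieces that come from different charts
  thereby become subsets of one plane, over which integrals simply add.\<close>

definition Ecyl :: "circle \<times> real \<Rightarrow> complex" where
  "Ecyl p = exp (\<i> * (SOME z. cyl_pt z = p))"

lemma Ecyl_cyl_pt: "Ecyl (cyl_pt z) = exp (\<i> * z)"
proof -
  have "cyl_pt (SOME z'. cyl_pt z' = cyl_pt z) = cyl_pt z" by (rule someI) simp
  then obtain k :: int where k: "z = (SOME z'. cyl_pt z' = cyl_pt z) + of_real (2 * pi * of_int k)"
    unfolding cyl_pt_eq_iff by blast
  have "exp (\<i> * z) = exp (\<i> * (SOME z'. cyl_pt z' = cyl_pt z) + of_int (2 * k) * pi * \<i>)"
    by (subst k) (simp add: algebra_simps)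
  also have "\<dots> = exp (\<i> * (SOME z'. cyl_pt z' = cyl_pt z))"
    unfolding exp_eq by (intro exI[of _ k]) (simp add: algebra_simps)
  finally show ?thesis by (simp add: Ecyl_def)
qed

lemma inj_Ecyl: "inj Ecyl"
proof (rule injI)
  fix p q assume e: "Ecyl p = Ecyl q"
  obtain z w where zw: "p = cyl_pt z" "q = cyl_pt w" by (metis cyl_pt_surj)
  with e have "exp (\<i> * w) = exp (\<i> * z)" by (simp add: Ecyl_cyl_pt)
  then obtain n :: int where "\<i> * w = \<i> * z + of_int (2 * n) * pi * \<i>" unfolding exp_eq by blast
  then have "\<i> * w = \<i> * (z + of_real (2 * pi * of_int n))" by (simp add: algebra_simps)
  then have "w = z + of_real (2 * pi * of_int n)" by (simp only: mult_left_cancel[OF complex_i_not_zero])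
  then show "p = q" using zw cyl_pt_eq_iff by blast
qed

text \<open>The weight is the inverse Jacobian: exp (i z) has a derivative of modulus |\<zeta>| at
  the point with image \<zeta>, so cylinder area is plane area divided by |\<zeta>|^2.\<close>

definition area_density :: "(circle \<times> real \<Rightarrow> real) \<Rightarrow> complex \<Rightarrow> real" where
  "area_density \<rho> \<zeta> = \<rho> (inv_into UNIV Ecyl \<zeta>) / (cmod \<zeta>)\<^sup>2"

definition area_integral :: "(circle \<times> real) set \<Rightarrow> (circle \<times> real \<Rightarrow> real) \<Rightarrow> real" where
  "area_integral X \<rho> = integral (Ecyl ` X) (area_density \<rho>)"

definition area_integrable :: "(circle \<times> real) set \<Rightarrow> (circle \<times> real \<Rightarrow> real) \<Rightarrow> bool" where
  "area_integrable X \<rho> \<longleftrightarrow> area_density \<rho> absolutely_integrable_on (Ecyl ` X)"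

text \<open>The derivative is written as i d times the value, so that d is the derivative of a lift
  of F. The square of the modulus of the value cancels the weight in
  \<open>area_density\<close>.\<close>

lemma area_param:
  assumes S: "S \<in> lmeasurable" and inj: "inj_on F S"
    and d: "\<And>z. z \<in> S \<Longrightarrow> ((\<lambda>u. Ecyl (F u)) has_field_derivative \<i> * d z * Ecyl (F z)) (at z within S)"
  shows "area_integrable (F ` S) \<rho> \<and> area_integral (F ` S) \<rho> = b \<longleftrightarrow>
     (\<lambda>z. (cmod (d z))\<^sup>2 * \<rho> (F z)) absolutely_integrable_on S \<and> integral S (\<lambda>z. (cmod (d z))\<^sup>2 * \<rho> (F z)) = b"
proof -
  have E0: "Ecyl p \<noteq> 0" for p by (simp add: Ecyl_def)
  have "(cmod (\<i> * d z * Ecyl (F z)))\<^sup>2 * area_density \<rho> (Ecyl (F z)) = (cmod (d z))\<^sup>2 * \<rho> (F z)" for z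
    using E0[of "F z"] by (simp add: area_density_def inv_f_f[OF inj_Ecyl] norm_mult power_mult_distrib)
  moreover have "inj_on (\<lambda>u. Ecyl (F u)) S"
    using comp_inj_on[OF inj inj_on_subset[OF inj_Ecyl subset_UNIV]] by (simp add: o_def)
  ultimately show ?thesis
    using complex_change_of_variables[OF S d, of "area_density \<rho>" b]
    by (simp add: area_integrable_def area_integral_def image_image)
qed

lemma Ecyl_lift_derivative:
  assumes "(H has_field_derivative d) (at z within S)" "\<And>u. u \<in> N \<inter> S \<Longrightarrow> F u = cyl_pt (H u)" "open N" "z \<in> N" "z \<in> S"
  shows "((\<lambda>u. Ecyl (F u)) has_field_derivative \<i> * d * Ecyl (F z)) (at z within S)"
proof -
  obtain e where e: "e > 0" "ball z e \<subseteq> N" using assms(3,4) openE by blast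
  have "((\<lambda>u. exp (\<i> * H u)) has_field_derivative \<i> * d * exp (\<i> * H z)) (at z within S)"
    by (auto intro!: derivative_eq_intros assms(1))
  then have "((\<lambda>u. exp (\<i> * H u)) has_field_derivative \<i> * d * Ecyl (F z)) (at z within S)"
    using assms(2,4,5) by (simp add: Ecyl_cyl_pt)
  then show ?thesis
  proof (rule has_field_derivative_transform_within[OF _ e(1) assms(5)])
    fix x assume "x \<in> S" "dist x z < e"
    then have "x \<in> N \<inter> S" using e(2) by (auto simp: dist_commute subset_iff)
    then show "exp (\<i> * H x) = Ecyl (F x)" using assms(2) by (simp add: Ecyl_cyl_pt)
  qed
qed

lemma affine_derivative: "((\<lambda>u. \<beta> + \<sigma> * u) has_field_derivative \<sigma>) (at w within S)" for \<beta> \<sigma> :: complex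
  by (auto intro!: derivative_eq_intros)

definition period_box :: "real \<Rightarrow> real \<Rightarrow> complex set" where
  "period_box p q = cbox (Complex 0 p) (Complex (2 * pi) q)"

text \<open>Half-open in the real direction so as to be a fundamental domain; it differs from
  \<open>period_box\<close> by a null set.\<close>

definition half_box :: "real \<Rightarrow> real \<Rightarrow> complex set" where
  "half_box p q = {z. 0 \<le> Re z \<and> Re z < 2 * pi \<and> p \<le> Im z \<and> Im z \<le> q}"

lemma half_box: "half_box p q \<in> lmeasurable" "half_box p q \<subseteq> period_box p q"
  "negligible (period_box p q - half_box p q)" "cyl_pt ` half_box p q = UNIV \<times> {p..q}" "inj_on cyl_pt (half_box p q)"
proof -
  show sub: "half_box p q \<subseteq> period_box p q" by (auto simp: half_box_def period_box_def cbox_complex)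
  have e: "half_box p q = period_box p q \<inter> {z. Re z < 2 * pi}"
    by (auto simp: half_box_def period_box_def cbox_complex)
  have "open {z. Re z < 2 * pi}" by (intro open_Collect_less continuous_intros)
  then show "half_box p q \<in> lmeasurable"
    unfolding e period_box_def by (intro fmeasurable_Int_fmeasurable) auto
  have "period_box p q - half_box p q \<subseteq> {z. 1 \<bullet> z = 2 * pi}"
    by (auto simp: e period_box_def cbox_complex inner_complex_def)
  then show "negligible (period_box p q - half_box p q)"
    by (rule negligible_subset[OF negligible_hyperplane, rotated]) simp
  show "cyl_pt ` half_box p q = UNIV \<times> {p..q}"
  proof (intro equalityI subsetI)
    fix x :: "circle \<times> real" assume x: "x \<in> UNIV \<times> {p..q}"
    obtain z where z: "x = cyl_pt z" by (rule cyl_pt_surj)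
    define k where "k = \<lfloor>Re z / (2 * pi)\<rfloor>"
    let ?w = "z + of_real (2 * pi * of_int (- k))"
    have "of_int k \<le> Re z / (2 * pi)" "Re z / (2 * pi) < of_int k + 1" unfolding k_def by linarith+
    then have "of_int k * (2 * pi) \<le> Re z" "Re z < (of_int k + 1) * (2 * pi)"
      by (simp_all add: field_simps)
    moreover have "Im z \<in> {p..q}" using x z by simp
    ultimately have "?w \<in> half_box p q" by (auto simp: half_box_def algebra_simps)
    moreover have "cyl_pt ?w = x" unfolding z by (rule cyl_pt_add_period)
    ultimately show "x \<in> cyl_pt ` half_box p q" by (metis image_eqI)
  qed (auto simp: half_box_def cyl_pt_def)
  show "inj_on cyl_pt (half_box p q)"
  proof (rule inj_onI)
    fix z w assume zw: "z \<in> half_box p q" "w \<in> half_box p q" "cyl_pt z = cyl_pt w"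
    obtain k :: int where k: "w = z + of_real (2 * pi * of_int k)" using zw(3) unfolding cyl_pt_eq_iff by blast
    have "Re w = Re z + 2 * pi * k" using k by simp
    moreover have "0 \<le> Re w" "Re w < 2 * pi" "0 \<le> Re z" "Re z < 2 * pi" using zw(1,2) by (auto simp: half_box_def)
    ultimately have k1: "2 * pi * k < 2 * pi * 1" and k2: "2 * pi * (-1) < 2 * pi * k" by linarith+
    have "real_of_int k < 1" by (rule mult_left_less_imp_less[OF k1]) simp
    moreover have "-1 < real_of_int k" by (rule mult_left_less_imp_less[OF k2]) simp
    ultimately have "k < 1" "-1 < k" by linarith+
    then have "k = 0" by linarith
    then show "z = w" using k by simp
  qed
qed

lemma half_box_integral:
  fixes f :: "complex \<Rightarrow> real"
  assumes "continuous_on (period_box p q) f"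
  shows "f absolutely_integrable_on half_box p q" "integral (half_box p q) f = integral (period_box p q) f"
proof -
  have "f absolutely_integrable_on period_box p q"
    using assms unfolding period_box_def by (rule absolutely_integrable_continuous)
  then show "f absolutely_integrable_on half_box p q"
    by (rule set_integrable_subset) (use half_box(1,2)[of p q] in \<open>auto simp: fmeasurable_def\<close>)
  show "integral (half_box p q) f = integral (period_box p q) f"
    by (rule integral_subset_negligible[OF half_box(2,3)])
qed

lemma area_integral_box:
  assumes c: "continuous_on (period_box p q) (\<lambda>z. \<rho> (cyl_pt z))"
  shows "area_integrable (UNIV \<times> {p..q}) \<rho>"
    and "area_integral (UNIV \<times> {p..q}) \<rho> = integral (period_box p q) (\<lambda>z. \<rho> (cyl_pt z))"
proof -
  have "((\<lambda>u. Ecyl (cyl_pt u)) has_field_derivative \<i> * 1 * Ecyl (cyl_pt z)) (at z within half_box p q)" if "z \<in> half_box p q" for z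
    by (rule Ecyl_lift_derivative[of "\<lambda>u. u" _ _ _ UNIV]) (use that in auto)
  from area_param[OF half_box(1,5) this, where \<rho>=\<rho> and b="integral (period_box p q) (\<lambda>z. \<rho> (cyl_pt z))"]
  have "area_integrable (UNIV \<times> {p..q}) \<rho> \<and> area_integral (UNIV \<times> {p..q}) \<rho> = integral (period_box p q) (\<lambda>z. \<rho> (cyl_pt z))"
    using half_box_integral[OF c] by (simp add: half_box(4))
  then show "area_integrable (UNIV \<times> {p..q}) \<rho>"
    and "area_integral (UNIV \<times> {p..q}) \<rho> = integral (period_box p q) (\<lambda>z. \<rho> (cyl_pt z))" by auto
qed

lemma area_integral_chart:
  assumes t: "0 < \<tau>" and c: "(D, s) \<in> atlas (flat_cyl {0..\<tau>})" and E: "E \<subseteq> D" "E \<in> sets lebesgue"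
    and \<rho>: "continuous_on (strip {0..\<tau>}) (\<lambda>z. \<rho> (cyl_pt z))"
    and r: "\<And>w. w \<in> D \<Longrightarrow> Im w \<noteq> 0 \<Longrightarrow> r w = \<rho> (s w)"
  shows "area_integrable (s ` E) \<rho>" "area_integral (s ` E) \<rho> = integral E r"
proof -
  have I: "cyl_ivl {0..\<tau>} 0 \<tau>" using t by (simp add: cyl_ivl_def)
  obtain \<beta> \<sigma> where ch: "flat_chart {0..\<tau>} 0 \<tau> D s \<beta> \<sigma>" by (rule flat_cyl_atlasD[OF I c])
  note cd = flat_chartD[OF ch]
  let ?K = "cbox (Complex (- pi) 0) (Complex pi \<tau>)"
  have \<beta>\<sigma>: "\<sigma> = 1 \<and> Im \<beta> = 0 \<or> \<sigma> = -1 \<and> Im \<beta> = \<tau>" using ch by (simp add: flat_chart_def)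
  have DK: "D \<subseteq> ?K"
  proof
    fix w assume "w \<in> D"
    then show "w \<in> ?K" unfolding cd(2) using \<beta>\<sigma> by (auto simp: chart_box_def cbox_complex)
  qed
  have img: "(\<lambda>w. \<beta> + \<sigma> * w) ` ?K \<subseteq> strip {0..\<tau>}"
    using \<beta>\<sigma> by (auto simp: cbox_complex)
  have cont: "continuous_on ?K (\<lambda>w. \<rho> (cyl_pt (\<beta> + \<sigma> * w)))"
    by (rule continuous_on_compose2[OF \<rho> _ img]) (intro continuous_intros)
  have El: "E \<in> lmeasurable"
    by (rule bounded_set_imp_lmeasurable) (use E DK bounded_cbox bounded_subset in \<open>blast+\<close>)
  have ai: "(\<lambda>w. \<rho> (s w)) absolutely_integrable_on E"
    unfolding cd(1)
    by (rule set_integrable_subset[OF absolutely_integrable_continuous[OF cont]]) (use E DK in auto)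
  have "((\<lambda>u. Ecyl (s u)) has_field_derivative \<i> * \<sigma> * Ecyl (s w)) (at w within E)" if "w \<in> E" for w
    by (rule Ecyl_lift_derivative[OF affine_derivative[of \<beta> \<sigma>], of UNIV]) (use that cd(1) in auto)
  from area_param[OF El inj_on_subset[OF flat_chart_inj[OF ch] E(1)] this, where \<rho>=\<rho> and b="integral E (\<lambda>w. \<rho> (s w))"]
  have "area_integrable (s ` E) \<rho> \<and> area_integral (s ` E) \<rho> = integral E (\<lambda>w. \<rho> (s w))"
    using ai cd(3) by auto
  \<comment> \<open>The integrands may disagree on the line Im w = 0, where the two-sided
    derivatives of \<open>laplacian\<close> need not make sense; the line is a null set.\<close>
  moreover have "integral E (\<lambda>w. \<rho> (s w)) = integral E r"
  proof (rule integral_spike)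
    have "{w. Im w = 0} = {z. \<i> \<bullet> z = 0}" by (auto simp: inner_complex_def)
    then show "negligible {w. Im w = 0}" using negligible_hyperplane[of "\<i>" 0] by simp
  qed (use r E(1) in auto)
  ultimately show "area_integrable (s ` E) \<rho>" "area_integral (s ` E) \<rho> = integral E r" by auto
qed

text \<open>\<open>surf_integral\<close> quantifies over all partitions and would pick out no number
  if there were none. The lower chart at angle 0 misses the vertical line at angle pi and the top
  circle. The line comes from the lower chart at pi, the top circle from two upper charts, the
  second of which contributes a single point.\<close>

lemma chart_partition_exists:
  assumes t: "0 < \<tau>"
  shows "\<exists>P. chart_partition (flat_cyl {0..\<tau>}) P"
proof -
  define D where "D = {w. \<bar>Re w\<bar> < pi \<and> 0 \<le> Im w \<and> Im w < \<tau> - 0 \<and> 0 + Im w \<in> {0..\<tau>}}"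
  define D' where "D' = {w. \<bar>Re w\<bar> < pi \<and> 0 \<le> Im w \<and> Im w < \<tau> - 0 \<and> \<tau> - Im w \<in> {0..\<tau>}}"
  define s where "s \<theta> w = cyl_pt (Complex \<theta> 0 + w)" for \<theta> w
  define s' where "s' \<theta> w = cyl_pt (Complex \<theta> \<tau> - w)" for \<theta> w
  have at: "(D, s \<theta>) \<in> atlas (flat_cyl {0..\<tau>})" "(D', s' \<theta>) \<in> atlas (flat_cyl {0..\<tau>})" for \<theta>
    using t by (auto simp: flat_cyl_def Let_def D_def D'_def s_def[abs_def] s'_def[abs_def])
  define E1 where "E1 = D \<inter> {w. Re w = 0}"
  define E2 where "E2 = D' \<inter> {w. Im w = 0}"
  define E3 where "E3 = {0::complex}"
  let ?P = "{((D, s 0), D), ((D, s pi), E1), ((D', s' 0), E2), ((D', s' pi), E3)}"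
  \<comment> \<open>An odd multiple of pi has modulus at least pi.\<close>
  have nopi: "x \<noteq> pi + 2 * pi * of_int k" if "\<bar>x\<bar> < pi" for x :: real and k :: int
  proof
    assume "x = pi + 2 * pi * of_int k"
    then have "x = pi * of_int (1 + 2 * k)" by (simp add: algebra_simps)
    then have "\<bar>x\<bar> = pi * \<bar>of_int (1 + 2 * k)\<bar>" by (simp add: abs_mult)
    moreover have "\<bar>of_int (1 + 2 * k)\<bar> \<ge> (1::real)"
    proof -
      have "1 \<le> \<bar>1 + 2 * k\<bar>" by presburger
      then have "real_of_int 1 \<le> of_int \<bar>1 + 2 * k\<bar>" by (rule of_int_le_iff[THEN iffD2])
      then show ?thesis by linarith
    qed
    then have "pi * \<bar>of_int (1 + 2 * k)\<bar> \<ge> pi * 1" by (intro mult_left_mono) auto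
    ultimately show False using that by simp
  qed
  have i0: "p \<in> s 0 ` D \<longleftrightarrow> (\<exists>z. p = cyl_pt z \<and> \<bar>Re z\<bar> < pi \<and> 0 \<le> Im z \<and> Im z < \<tau>)" for p
  proof -
    have "Complex 0 0 = 0" by (simp add: complex_eq_iff)
    then have "s 0 = cyl_pt" by (simp add: s_def fun_eq_iff)
    then show ?thesis by (auto simp: D_def)
  qed
  have i1: "p \<in> s pi ` E1 \<longleftrightarrow> (\<exists>z. p = cyl_pt z \<and> Re z = pi \<and> 0 \<le> Im z \<and> Im z < \<tau>)" for p
  proof
    assume "\<exists>z. p = cyl_pt z \<and> Re z = pi \<and> 0 \<le> Im z \<and> Im z < \<tau>"
    then obtain z where "p = cyl_pt z" "Re z = pi" "0 \<le> Im z" "Im z < \<tau>" by auto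
    then have "p = s pi (z - of_real pi)" "z - of_real pi \<in> E1"
      by (auto simp: s_def E1_def D_def complex_eq_iff intro!: arg_cong[of _ _ cyl_pt])
    then show "p \<in> s pi ` E1" by blast
  next
    assume "p \<in> s pi ` E1"
    then obtain w where "w \<in> E1" "p = s pi w" by auto
    then show "\<exists>z. p = cyl_pt z \<and> Re z = pi \<and> 0 \<le> Im z \<and> Im z < \<tau>"
      by (intro exI[of _ "Complex pi 0 + w"]) (auto simp: s_def E1_def D_def)
  qed
  have i2: "p \<in> s' 0 ` E2 \<longleftrightarrow> (\<exists>z. p = cyl_pt z \<and> \<bar>Re z\<bar> < pi \<and> Im z = \<tau>)" for p
  proof
    assume "\<exists>z. p = cyl_pt z \<and> \<bar>Re z\<bar> < pi \<and> Im z = \<tau>"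
    then obtain z where "p = cyl_pt z" "\<bar>Re z\<bar> < pi" "Im z = \<tau>" by auto
    then have "p = s' 0 (- of_real (Re z))" "- of_real (Re z) \<in> E2"
      using t by (auto simp: s'_def E2_def D'_def complex_eq_iff intro!: arg_cong[of _ _ cyl_pt])
    then show "p \<in> s' 0 ` E2" by blast
  next
    assume "p \<in> s' 0 ` E2"
    then obtain w where "w \<in> E2" "p = s' 0 w" by auto
    then show "\<exists>z. p = cyl_pt z \<and> \<bar>Re z\<bar> < pi \<and> Im z = \<tau>"
      by (intro exI[of _ "Complex 0 \<tau> - w"]) (auto simp: s'_def E2_def D'_def)
  qed
  have i3: "p \<in> s' pi ` E3 \<longleftrightarrow> p = cyl_pt (Complex pi \<tau>)" for p
    by (auto simp: s'_def E3_def)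
  have dis: "s 0 ` D \<inter> s pi ` E1 = {}" "s' 0 ` E2 \<inter> s' pi ` E3 = {}"
    "s 0 ` D \<inter> s' 0 ` E2 = {}" "s 0 ` D \<inter> s' pi ` E3 = {}" "s pi ` E1 \<inter> s' 0 ` E2 = {}" "s pi ` E1 \<inter> s' pi ` E3 = {}"
  proof -
    have lev: "cyl_pt z \<noteq> cyl_pt w" if "Im z < \<tau>" "Im w = \<tau>" for z w
      using that by (metis snd_cyl_pt less_irrefl)
    have npi: "cyl_pt z \<noteq> cyl_pt w" if "\<bar>Re z\<bar> < pi" "Re w = pi" for z w
    proof
      assume "cyl_pt z = cyl_pt w"
      then have "cyl_pt w = cyl_pt z" ..
      then obtain k :: int where "z = w + of_real (2 * pi * of_int k)" unfolding cyl_pt_eq_iff by blast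
      then have "Re z = pi + 2 * pi * of_int k" using that by simp
      then show False using nopi[OF that(1)] by blast
    qed
    show "s 0 ` D \<inter> s pi ` E1 = {}" unfolding disjoint_iff i0 i1
      by (intro allI impI notI, elim exE conjE) (metis npi)
    show "s' 0 ` E2 \<inter> s' pi ` E3 = {}" unfolding disjoint_iff i2 i3
      by (intro allI impI notI, elim exE conjE) (metis npi complex.sel(1))
    show "s 0 ` D \<inter> s' 0 ` E2 = {}" unfolding disjoint_iff i0 i2
      by (intro allI impI notI, elim exE conjE) (metis lev)
    show "s 0 ` D \<inter> s' pi ` E3 = {}" unfolding disjoint_iff i0 i3
      by (intro allI impI notI, elim exE conjE) (metis lev complex.sel(2))
    show "s pi ` E1 \<inter> s' 0 ` E2 = {}" unfolding disjoint_iff i1 i2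
      by (intro allI impI notI, elim exE conjE) (metis lev)
    show "s pi ` E1 \<inter> s' pi ` E3 = {}" unfolding disjoint_iff i1 i3
      by (intro allI impI notI, elim exE conjE) (metis lev complex.sel(2))
  qed
  have cover: "s 0 ` D \<union> s pi ` E1 \<union> s' 0 ` E2 \<union> s' pi ` E3 = UNIV \<times> {0..\<tau>}"
  proof (intro equalityI subsetI)
    fix p assume "p \<in> s 0 ` D \<union> s pi ` E1 \<union> s' 0 ` E2 \<union> s' pi ` E3"
    then obtain z where "p = cyl_pt z" "0 \<le> Im z" "Im z \<le> \<tau>"
      unfolding Un_iff i0 i1 i2 i3 using t by force
    then show "p \<in> UNIV \<times> {0..\<tau>}" by simp
  next
    fix p :: "circle \<times> real" assume p: "p \<in> UNIV \<times> {0..\<tau>}"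
    then have "p \<in> cyl_pt ` half_box 0 \<tau>" by (simp add: half_box(4))
    then obtain z where z: "z \<in> half_box 0 \<tau>" "p = cyl_pt z" by auto
    define w where "w = (if Re z \<le> pi then z else z + of_real (2 * pi * of_int (-1)))"
    have w: "p = cyl_pt w" using z(2) cyl_pt_add_period[of z "-1"] by (auto simp: w_def)
    have wb: "- pi < Re w" "Re w \<le> pi" "0 \<le> Im w" "Im w \<le> \<tau>"
      using z(1) by (auto simp: w_def half_box_def)
    then consider "\<bar>Re w\<bar> < pi" "Im w < \<tau>" | "Re w = pi" "Im w < \<tau>" | "\<bar>Re w\<bar> < pi" "Im w = \<tau>" | "w = Complex pi \<tau>"
      by (force simp: complex_eq_iff)
    then show "p \<in> s 0 ` D \<union> s pi ` E1 \<union> s' 0 ` E2 \<union> s' pi ` E3"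
      unfolding Un_iff i0 i1 i2 i3 using w wb by cases blast+
  qed
  have cl: "closed {w. Re w = 0}" "closed {w. Im w = 0}"
    by (intro closed_Collect_eq continuous_intros)+
  have "D = {w. \<bar>Re w\<bar> < pi} \<inter> {w. Im w < \<tau>} \<inter> {w. 0 \<le> Im w}" "D' = D" by (auto simp: D_def D'_def)
  moreover have "open {w. \<bar>Re w\<bar> < pi}" "open {w. Im w < \<tau>}" "closed {w. 0 \<le> Im w}"
    by (intro open_Collect_less closed_Collect_le continuous_intros)+
  ultimately have DL: "D \<in> sets lebesgue" "D' \<in> sets lebesgue" by auto
  have "chart_partition (flat_cyl {0..\<tau>}) ?P"
    unfolding chart_partition_def
  proof (intro conjI)
    show "\<forall>((D, s), E)\<in>?P. (D, s) \<in> atlas (flat_cyl {0..\<tau>}) \<and> E \<subseteq> D \<and> E \<in> sets lebesgue"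
      using at DL cl t by (auto simp: E1_def E2_def E3_def D'_def)
    show "disjoint_family_on (\<lambda>((D, s), E). s ` E) ?P"
      unfolding disjoint_family_on_def using dis by (auto simp: Int_commute)
    show "(\<Union>((D, s), E)\<in>?P. s ` E) = topspace (topo (flat_cyl {0..\<tau>}))"
      using cover by (simp add: Un_assoc)
  qed simp
  then show ?thesis by blast
qed

text \<open>Under \<open>Ecyl\<close> the pieces of any partition become disjoint planar sets with
  the same union, so every partition gives the same sum.\<close>

lemma surf_integral_flat:
  assumes t: "0 < \<tau>" and \<rho>: "continuous_on (strip {0..\<tau>}) (\<lambda>z. \<rho> (cyl_pt z))"
    and r: "\<And>D s w. (D, s) \<in> atlas (flat_cyl {0..\<tau>}) \<Longrightarrow> w \<in> D \<Longrightarrow> Im w \<noteq> 0 \<Longrightarrow> r (D, s) w = \<rho> (s w)"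
  shows "surf_integral (flat_cyl {0..\<tau>}) r = area_integral (UNIV \<times> {0..\<tau>}) \<rho>"
proof -
  have *: "(\<Sum>(c, E) \<in> P. integral E (r c)) = area_integral (UNIV \<times> {0..\<tau>}) \<rho>"
    if P: "chart_partition (flat_cyl {0..\<tau>}) P" for P
  proof -
    define T where "T = (\<lambda>((D :: complex set, s :: complex \<Rightarrow> circle \<times> real), E :: complex set). Ecyl ` (s ` E))"
    have fin: "finite P" and disj: "disjoint_family_on (\<lambda>((D, s), E). s ` E) P"
      and un: "(\<Union>((D, s), E) \<in> P. s ` E) = UNIV \<times> {0..\<tau>}"
      using P by (auto simp: chart_partition_def)
    have piece: "(area_density \<rho> has_integral (case x of (c, E) \<Rightarrow> integral E (r c))) (T x)" if x: "x \<in> P" for x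
    proof -
      obtain D s E where xe: "x = ((D, s), E)" by (metis surj_pair)
      have "(D, s) \<in> atlas (flat_cyl {0..\<tau>})" "E \<subseteq> D" "E \<in> sets lebesgue"
        using P x unfolding chart_partition_def xe by fast+
      from area_integral_chart[OF t this \<rho> r[OF this(1)]]
      show ?thesis
        unfolding xe T_def area_integrable_def area_integral_def split absolutely_integrable_on_def
        by (metis integrable_integral)
    qed
    have "(area_density \<rho> has_integral (\<Sum>x\<in>P. case x of (c, E) \<Rightarrow> integral E (r c))) (\<Union>x\<in>P. T x)"
    proof (rule has_integral_UN[OF fin piece])
      show "pairwise (\<lambda>i i'. negligible (T i \<inter> T i')) P"
      proof (rule pairwiseI)
        fix x y assume xy: "x \<in> P" "y \<in> P" "x \<noteq> y"
        obtain D s E D' s' E' where e: "x = ((D, s), E)" "y = ((D', s'), E')" by (metis surj_pair)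
        have "s ` E \<inter> s' ` E' = {}"
          using disjoint_family_onD[OF disj xy] by (simp add: e)
        then have "T x \<inter> T y = {}"
          using inj_image_mem_iff[OF inj_Ecyl] image_Int[OF inj_Ecyl, of "s ` E" "s' ` E'"] by (simp add: T_def e)
        then show "negligible (T x \<inter> T y)" by simp
      qed
    qed
    moreover have "(\<Union>x\<in>P. T x) = Ecyl ` (UNIV \<times> {0..\<tau>})"
      unfolding un[symmetric] T_def by (auto simp: image_Union)
    ultimately show ?thesis by (simp add: area_integral_def integral_unique)
  qed
  obtain P where P: "chart_partition (flat_cyl {0..\<tau>}) P" using chart_partition_exists[OF t] by blast
  show ?thesis unfolding surf_integral_def
    by (rule the_equality) (use * P in auto)
qed

section \<open>Energy of log-densities and the anomaly\<close>

definition neumann :: "real \<Rightarrow> (complex \<Rightarrow> real) \<Rightarrow> bool" where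
  "neumann \<tau> v \<longleftrightarrow> (\<forall>x. pd {0..\<tau>} v \<i> (Complex x 0) = 0 \<and> pd {0..\<tau>} v \<i> (Complex x \<tau>) = 0)"

definition energy :: "real \<Rightarrow> (complex \<Rightarrow> real) \<Rightarrow> real" where
  "energy \<tau> v = integral (period_box 0 \<tau>) (\<lambda>z. v z * lap {0..\<tau>} v z)"

lemma periodic_int:
  assumes "\<And>z. Im z \<in> I \<Longrightarrow> v (z + of_real (2 * pi)) = v z" "Im z \<in> I"
  shows "v (z + of_real (2 * pi * of_int k)) = v z"
proof (induction k rule: int_induct[of _ 0])
  case base
  then show ?case by simp
next
  case (step1 i)
  have "z + of_real (2 * pi * of_int (i + 1)) = (z + of_real (2 * pi * of_int i)) + of_real (2 * pi)"
    by (simp add: algebra_simps)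
  moreover have "Im (z + of_real (2 * pi * of_int i)) \<in> I" using assms(2) by simp
  ultimately show ?case using assms(1) step1(2) by metis
next
  case (step2 i)
  have "z + of_real (2 * pi * of_int i) = (z + of_real (2 * pi * of_int (i - 1))) + of_real (2 * pi)"
    by (simp add: algebra_simps)
  moreover have "Im (z + of_real (2 * pi * of_int (i - 1))) \<in> I" using assms(2) by simp
  ultimately show ?case using assms(1) step2(2) by metis
qed

lemma periodic_cyl_pt:
  assumes "\<And>z. Im z \<in> I \<Longrightarrow> v (z + of_real (2 * pi)) = v z" "Im z \<in> I"
  shows "v (SOME z'. cyl_pt z' = cyl_pt z) = v z"
proof -
  have "cyl_pt (SOME z'. cyl_pt z' = cyl_pt z) = cyl_pt z" by (rule someI) simp
  then have "cyl_pt z = cyl_pt (SOME z'. cyl_pt z' = cyl_pt z)" ..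
  then obtain k :: int where k: "(SOME z'. cyl_pt z' = cyl_pt z) = z + of_real (2 * pi * of_int k)"
    unfolding cyl_pt_eq_iff by blast
  show ?thesis unfolding k by (rule periodic_int[where v=v and I=I, OF assms])
qed

text \<open>Meant for periodic functions, for which the chosen preimage is immaterial.\<close>

definition descend :: "(complex \<Rightarrow> real) \<Rightarrow> circle \<times> real \<Rightarrow> real" where
  "descend v p = v (SOME z. cyl_pt z = p)"

lemma descend:
  assumes "\<And>z. Im z \<in> I \<Longrightarrow> v (z + of_real (2 * pi)) = v z" "Im z \<in> I"
  shows "descend v (cyl_pt z) = v z"
  unfolding descend_def by (rule periodic_cyl_pt[where v=v and I=I, OF assms])

lemma lap_periodic:
  assumes I: "cyl_ivl I a b" and v: "smooth_on (strip I) v"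
    and per: "\<And>z. Im z \<in> I \<Longrightarrow> v (z + of_real (2 * pi)) = v z" and z: "Im z \<in> I"
  shows "lap I v (z + of_real (2 * pi)) = lap I v z"
proof -
  have "(\<lambda>z. z + complex_of_real (2 * pi)) holomorphic_on UNIV" by (intro holomorphic_intros)
  from lap_comp(3)[OF I I v open_UNIV this, of v z] per z show ?thesis by auto
qed

lemma period_box_strip: "{p..q} \<subseteq> I \<Longrightarrow> period_box p q \<subseteq> strip I"
  by (auto simp: period_box_def cbox_complex)

text \<open>With vanishing normal derivatives the mixed terms of the anomaly cancel by Green's formula.\<close>

lemma anomaly_density:
  assumes t: "0 < \<tau>" and g1: "density {0..\<tau>} g1 v1" and g2: "density {0..\<tau>} g2 v2"
    and n: "neumann \<tau> v1" "neumann \<tau> v2"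
  shows "anomaly (flat_cyl {0..\<tau>}) g1 g2 = - 1 / (96 * pi) * (energy \<tau> v1 - energy \<tau> v2)"
proof -
  let ?I = "{0..\<tau>}"
  have I: "cyl_ivl ?I 0 \<tau>" using t by (simp add: cyl_ivl_def)
  note d1 = densityD[OF g1] and d2 = densityD[OF g2]
  define R where "R z = (v1 z - v2 z) * lap ?I (\<lambda>w. v1 w + v2 w) z" for z
  have s12: "smooth_on (strip ?I) (\<lambda>w. v1 w + v2 w)" by (intro smooth_on_add d1(1) d2(1))
  have Rper: "R (z + of_real (2 * pi)) = R z" if "Im z \<in> ?I" for z
    unfolding R_def
    using d1(2)[OF that] d2(2)[OF that] lap_periodic[OF I s12, of z] d1(2) d2(2) that by simp
  have Rs: "smooth_on (strip ?I) R"
    unfolding R_def by (intro smooth_on_mult smooth_on_diff d1(1) d2(1) smooth_on_lap[OF I s12])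
  have Rc: "continuous_on (strip ?I) (\<lambda>z. descend R (cyl_pt z))"
    using smooth_on_continuous[OF Rs] by (rule continuous_on_eq) (use descend[of ?I R, OF Rper] in simp)
  have box: "period_box 0 \<tau> \<subseteq> strip ?I" by (rule period_box_strip) simp
  have "surf_integral (flat_cyl ?I) (\<lambda>c w. (g1 c w - g2 c w) * laplacian (\<lambda>v. g1 c v + g2 c v) w)
    = area_integral (UNIV \<times> ?I) (descend R)"
  proof (rule surf_integral_flat[OF t Rc])
    fix D s w assume c: "(D, s) \<in> atlas (flat_cyl ?I)" and w: "w \<in> D" "Im w \<noteq> 0"
    obtain \<beta> \<sigma> where ch: "flat_chart ?I 0 \<tau> D s \<beta> \<sigma>" by (rule flat_cyl_atlasD[OF I c])
    note cd = flat_chartD[OF ch]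
    have \<beta>\<sigma>: "\<sigma> = 1 \<and> Im \<beta> = 0 \<or> \<sigma> = -1 \<and> Im \<beta> = \<tau>" using ch by (simp add: flat_chart_def)
    \<comment> \<open>The interior of the chart: an open set on which the log-densities are
      expressed by v1 and v2, as the two-sided derivatives of \<open>laplacian\<close>
      require.\<close>
    define N where "N = chart_box 0 \<tau> \<inter> {w. 0 < Im w}"
    have N: "open N" unfolding N_def by (intro open_Int open_chart_box open_Collect_less continuous_intros)
    have "0 \<le> Im w" using w(1) \<beta>\<sigma> unfolding cd(2) by auto
    then have wN: "w \<in> N" using w unfolding cd(2) by (simp add: N_def)
    have ND: "u \<in> D" "Im (\<beta> + \<sigma> * u) \<in> ?I" "0 < Im (\<beta> + \<sigma> * u)" "Im (\<beta> + \<sigma> * u) < \<tau>" if "u \<in> N" for u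
      using that \<beta>\<sigma> unfolding cd(2) by (auto simp: N_def chart_box_def)
    have e: "g1 (D, s) u = v1 (\<beta> + \<sigma> * u)" "g2 (D, s) u = v2 (\<beta> + \<sigma> * u)" if "u \<in> N" for u
      using d1(3)[OF c ND(1)[OF that] cd(1) ND(2)[OF that]] d2(3)[OF c ND(1)[OF that] cd(1) ND(2)[OF that]] by auto
    have "laplacian (\<lambda>v. g1 (D, s) v + g2 (D, s) v) w = lap ?I (\<lambda>w. v1 w + v2 w) (\<beta> + \<sigma> * w)"
      by (rule laplacian_eq_lap[OF I s12 ND(3)[OF wN] ND(4)[OF wN] cd(3) N wN]) (simp add: e)
    then show "(g1 (D, s) w - g2 (D, s) w) * laplacian (\<lambda>v. g1 (D, s) v + g2 (D, s) v) w = descend R (s w)"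
      using descend[of ?I R, OF Rper ND(2)[OF wN]] by (simp add: R_def e[OF wN] cd(1))
  qed
  also have "\<dots> = integral (period_box 0 \<tau>) (\<lambda>z. descend R (cyl_pt z))"
    by (rule area_integral_box(2)) (rule continuous_on_subset[OF Rc box])
  also have "\<dots> = integral (period_box 0 \<tau>) R"
    by (rule integral_cong) (use descend[of ?I R, OF Rper] box in \<open>auto simp: subset_iff\<close>)
  also have "\<dots> = energy \<tau> v1 - energy \<tau> v2"
  proof -
    have c: "continuous_on (period_box 0 \<tau>) (\<lambda>z. u z * lap ?I v z)"
      if "smooth_on (strip ?I) u" "smooth_on (strip ?I) v" for u v
      by (rule continuous_on_subset[OF smooth_on_continuous box]) (intro smooth_on_mult smooth_on_lap[OF I] that)
    have i: "(\<lambda>z. u z * lap ?I v z) integrable_on (period_box 0 \<tau>)"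
      if "smooth_on (strip ?I) u" "smooth_on (strip ?I) v" for u v
      using c[OF that] unfolding period_box_def by (rule integrable_continuous)
    have "integral (period_box 0 \<tau>) R = integral (period_box 0 \<tau>)
       (\<lambda>z. ((v1 z * lap ?I v1 z - v2 z * lap ?I v2 z) + v1 z * lap ?I v2 z) - v2 z * lap ?I v1 z)"
      by (rule integral_cong)
        (use smooth_on_pd_add(2)[OF I d1(1) d2(1)] box in \<open>auto simp: R_def algebra_simps subset_iff\<close>)
    also have "\<dots> = energy \<tau> v1 - energy \<tau> v2 + integral (period_box 0 \<tau>) (\<lambda>z. v1 z * lap ?I v2 z)
       - integral (period_box 0 \<tau>) (\<lambda>z. v2 z * lap ?I v1 z)"
      unfolding energy_def
      by (simp add: integral_diff integral_add integrable_diff integrable_add i[OF d1(1) d1(1)] i[OF d1(1) d2(1)] i[OF d2(1) d1(1)] i[OF d2(1) d2(1)])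
    also have "integral (period_box 0 \<tau>) (\<lambda>z. v1 z * lap ?I v2 z) = integral (period_box 0 \<tau>) (\<lambda>z. v2 z * lap ?I v1 z)"
      unfolding period_box_def
      by (rule green_strip[OF I d1(1) d2(1)]) (use d1(2) d2(2) n t in \<open>simp_all add: neumann_def\<close>)
    finally show ?thesis by simp
  qed
  finally show ?thesis by (simp add: anomaly_def)
qed

section \<open>Conformal embeddings\<close>

definition lift_on :: "real set \<Rightarrow> real set \<Rightarrow> (circle \<times> real \<Rightarrow> circle \<times> real) \<Rightarrow> complex set \<Rightarrow> (complex \<Rightarrow> complex) \<Rightarrow> bool" where
  "lift_on I J F N H \<longleftrightarrow> open N \<and> H holomorphic_on N \<and> (\<forall>u\<in>N. deriv H u \<noteq> 0) \<and>
     (\<forall>u\<in>N. Im u \<in> I \<longrightarrow> Im (H u) \<in> J \<and> cyl_pt (H u) = F (cyl_pt u))"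

definition conf_embedding :: "real set \<Rightarrow> real set \<Rightarrow> (circle \<times> real \<Rightarrow> circle \<times> real) \<Rightarrow> bool" where
  "conf_embedding I J F \<longleftrightarrow> (\<forall>z. Im z \<in> I \<longrightarrow> (\<exists>N H. z \<in> N \<and> lift_on I J F N H)) \<and> inj_on F (UNIV \<times> I)"

lemma lift_onD:
  assumes "lift_on I J F N H"
  shows "open N" "H holomorphic_on N" "u \<in> N \<Longrightarrow> deriv H u \<noteq> 0"
    "u \<in> N \<Longrightarrow> Im u \<in> I \<Longrightarrow> Im (H u) \<in> J" "u \<in> N \<Longrightarrow> Im u \<in> I \<Longrightarrow> cyl_pt (H u) = F (cyl_pt u)"
  using assms by (auto simp: lift_on_def)

text \<open>The difference of two lifts is continuous and, over I, takes values in the multiples of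
  2 pi; on a neighbourhood where it varies by less than 1 it is constant there.\<close>

lemma lifts_differ_by_period:
  assumes N: "open N" "z \<in> N" "Im z \<in> I" and c: "continuous_on N K1" "continuous_on N K2"
    and e: "\<And>u. u \<in> N \<Longrightarrow> Im u \<in> I \<Longrightarrow> cyl_pt (K1 u) = cyl_pt (K2 u)"
  obtains M and k :: int where "open M" "z \<in> M" "M \<subseteq> N" "\<forall>u\<in>M. Im u \<in> I \<longrightarrow> K2 u = K1 u + of_real (2 * pi * of_int k)"
proof -
  let ?d = "\<lambda>u. K2 u - K1 u"
  have cd: "continuous_on N ?d" by (intro continuous_intros c)
  obtain k :: int where k: "K2 z = K1 z + of_real (2 * pi * of_int k)"
    using e[OF N(2,3)] unfolding cyl_pt_eq_iff by blast
  define M where "M = N \<inter> ?d -` ball (?d z) 1"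
  have "open M" unfolding M_def by (rule continuous_open_preimage[OF cd N(1)]) simp
  moreover have "z \<in> M" "M \<subseteq> N" using N(2) by (auto simp: M_def)
  moreover have "K2 u = K1 u + of_real (2 * pi * of_int k)" if u: "u \<in> M" "Im u \<in> I" for u
  proof -
    obtain l :: int where l: "K2 u = K1 u + of_real (2 * pi * of_int l)"
      using e[of u] u unfolding cyl_pt_eq_iff by (auto simp: M_def)
    have "dist (?d z) (?d u) < 1" using u by (simp add: M_def)
    then have "cmod (of_real (2 * pi * of_int k) - of_real (2 * pi * of_int l)) < 1" by (simp add: k l dist_norm)
    then have "\<bar>2 * pi * of_int (k - l)\<bar> < 1"
      by (simp only: of_real_diff[symmetric] norm_of_real right_diff_distrib of_int_diff real_norm_def)
    then have "2 * pi * \<bar>of_int (k - l)\<bar> < 1" by (simp add: abs_mult)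
    moreover have "\<bar>of_int (k - l)\<bar> \<le> 2 * pi * \<bar>of_int (k - l) :: real\<bar>"
      using pi_gt3 by (intro mult_le_cancel_right1[THEN iffD2]) auto
    ultimately have "\<bar>of_int (k - l) :: real\<bar> < 1" by linarith
    then have "k = l" by linarith
    then show ?thesis using l by simp
  qed
  ultimately show ?thesis by (intro that) auto
qed

text \<open>The lifts are only known to agree, up to a period, over I. At a boundary point their
  derivatives are therefore compared within the strip, where they are still unique.\<close>

lemma lifts_deriv_eq:
  assumes I: "cyl_ivl I a b" and N: "open N" "z \<in> N" "Im z \<in> I" and h: "K1 holomorphic_on N" "K2 holomorphic_on N"
    and e: "\<And>u. u \<in> N \<Longrightarrow> Im u \<in> I \<Longrightarrow> cyl_pt (K1 u) = cyl_pt (K2 u)"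
  shows "deriv K1 z = deriv K2 z"
proof -
  obtain M and k :: int where M: "open M" "z \<in> M" "M \<subseteq> N" "\<forall>u\<in>M. Im u \<in> I \<longrightarrow> K2 u = K1 u + of_real (2 * pi * of_int k)"
    by (rule lifts_differ_by_period[OF N h[THEN holomorphic_on_imp_continuous_on] e]) (assumption | rule that)+
  have d: "(K1 has_field_derivative deriv K1 z) (at z within strip I)" "(K2 has_field_derivative deriv K2 z) (at z within strip I)"
    using holomorphic_derivI[OF h(1) N(1,2)] holomorphic_derivI[OF h(2) N(1,2)] has_field_derivative_at_within by blast+
  obtain r where r: "r > 0" "ball z r \<subseteq> M" using M openE by blast
  have "((\<lambda>u. K1 u + of_real (2 * pi * of_int k)) has_field_derivative deriv K1 z) (at z within strip I)"
    using d(1) by (auto intro!: derivative_eq_intros)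
  then have "(K2 has_field_derivative deriv K1 z) (at z within strip I)"
  proof (rule has_field_derivative_transform_within[OF _ r(1)])
    fix x assume "x \<in> strip I" "dist x z < r"
    then have "x \<in> M" "Im x \<in> I" using r(2) by (auto simp: dist_commute subset_iff)
    then show "K1 x + of_real (2 * pi * of_int k) = K2 x" using M(4) by simp
  qed (use N in simp)
  then show ?thesis using strip_field_derivative_unique[OF I _ _ d(2)] N(3) by simp
qed

text \<open>Lifts are local and determined up to periods, but their derivative is a function on the
  whole strip, which any local lift evaluates.\<close>

definition lift_deriv :: "real set \<Rightarrow> real set \<Rightarrow> (circle \<times> real \<Rightarrow> circle \<times> real) \<Rightarrow> complex \<Rightarrow> complex" where
  "lift_deriv I J F z = (SOME d. \<exists>N H. z \<in> N \<and> lift_on I J F N H \<and> d = deriv H z)"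

lemma lift_deriv_eq:
  assumes I: "cyl_ivl I a b" and N: "lift_on I J F N H" "z \<in> N" "Im z \<in> I"
  shows "lift_deriv I J F z = deriv H z"
proof -
  have "\<exists>N H. z \<in> N \<and> lift_on I J F N H \<and> lift_deriv I J F z = deriv H z"
    unfolding lift_deriv_def by (rule someI_ex) (use N in blast)
  then obtain N' H' where N': "z \<in> N'" "lift_on I J F N' H'" "lift_deriv I J F z = deriv H' z" by blast
  have "deriv H' z = deriv H z"
  proof (rule lifts_deriv_eq[OF I, of "N \<inter> N'"])
    show "open (N \<inter> N')" "z \<in> N \<inter> N'" "Im z \<in> I" "H' holomorphic_on N \<inter> N'" "H holomorphic_on N \<inter> N'"
      using lift_onD(1,2)[OF N(1)] lift_onD(1,2)[OF N'(2)] N N' by (auto intro: holomorphic_on_subset)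
    show "cyl_pt (H' u) = cyl_pt (H u)" if "u \<in> N \<inter> N'" "Im u \<in> I" for u
      using lift_onD(5)[OF N(1)] lift_onD(5)[OF N'(2)] that by simp
  qed
  then show ?thesis using N' by simp
qed

text \<open>A lift H of F followed by a lift K of the inverse is a lift of the identity, so K' H' =
  1 and H' does not vanish.\<close>

lemma conf_embedding_of_biholo:
  assumes I: "cyl_ivl I a b" and J: "cyl_ivl J c d"
    and F: "biholo (flat_cyl I) (open_sub (flat_cyl J) V) F"
  shows "conf_embedding I J F"
proof -
  obtain G where G: "homeomorphic_maps (topo (flat_cyl I)) (topo (open_sub (flat_cyl J) V)) F G"
    "holo_map (flat_cyl I) (open_sub (flat_cyl J) V) F" "holo_map (open_sub (flat_cyl J) V) (flat_cyl I) G"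
    using F by (auto simp: biholo_def)
  have GF: "G (F p) = p" if "p \<in> UNIV \<times> I" for p
    using G(1) that by (auto simp: homeomorphic_maps_def)
  have lF: "loc_lift I UNIV J V F"
    by (rule holo_map_imp_loc_lift[OF I J]) (use G in simp)
  have lG: "loc_lift J V I UNIV G"
    by (rule holo_map_imp_loc_lift[OF J I]) (use G in simp)
  have "\<exists>N H. z \<in> N \<and> lift_on I J F N H" if z: "Im z \<in> I" for z
  proof -
    obtain N H where N: "open N" "z \<in> N" "H holomorphic_on N"
      "\<forall>u\<in>N. Im u \<in> I \<longrightarrow> Im (H u) \<in> J \<and> cyl_pt (H u) \<in> V \<and> cyl_pt (H u) = F (cyl_pt u)"
      using lF[unfolded loc_lift_def, rule_format, of z] z by auto
    have "Im (H z) \<in> J \<and> cyl_pt (H z) \<in> V" using N z by blast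
    then obtain M K where M: "open M" "H z \<in> M" "K holomorphic_on M"
      "\<forall>u\<in>M. Im u \<in> J \<and> cyl_pt u \<in> V \<longrightarrow> Im (K u) \<in> I \<and> cyl_pt (K u) = G (cyl_pt u)"
      using lG[unfolded loc_lift_def, rule_format, of "H z"] by auto
    define L where "L = N \<inter> H -` M"
    have L: "open L" unfolding L_def
      by (rule continuous_open_preimage[OF holomorphic_on_imp_continuous_on[OF N(3)] N(1) M(1)])
    have zL: "z \<in> L" using N(2) M(2) by (simp add: L_def)
    have KH: "(\<lambda>u. K (H u)) holomorphic_on L"
      by (rule holomorphic_on_compose_gen[OF _ M(3), unfolded o_def])
        (use N(3) in \<open>auto simp: L_def intro: holomorphic_on_subset\<close>)
    have "deriv (\<lambda>u. K (H u)) z = deriv (\<lambda>u. u) z"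
    proof (rule lifts_deriv_eq[OF I L zL z KH])
      fix u assume u: "u \<in> L" "Im u \<in> I"
      have h: "Im (H u) \<in> J" "cyl_pt (H u) \<in> V" "cyl_pt (H u) = F (cyl_pt u)" using N(4) u by (auto simp: L_def)
      then have "cyl_pt (K (H u)) = G (cyl_pt (H u))" using M(4) u by (auto simp: L_def)
      then show "cyl_pt (K (H u)) = cyl_pt u" using h(3) GF[of "cyl_pt u"] u(2) by simp
    qed simp
    moreover have "deriv (K \<circ> H) z = deriv K (H z) * deriv H z"
      by (rule deriv_chain)
        (use N M in \<open>auto simp: holomorphic_on_imp_differentiable_at\<close>)
    ultimately have nz: "deriv H z \<noteq> 0" by (auto simp: o_def)
    define N' where "N' = N \<inter> deriv H -` (- {0})"
    have "open N'" unfolding N'_def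
      by (rule continuous_open_preimage[OF holomorphic_on_imp_continuous_on[OF holomorphic_deriv[OF N(3,1)]] N(1)]) auto
    then have "lift_on I J F N' H"
      using N holomorphic_on_subset[OF N(3), of N'] by (auto simp: lift_on_def N'_def)
    moreover have "z \<in> N'" using nz N(2) by (simp add: N'_def)
    ultimately show ?thesis by blast
  qed
  moreover have "inj_on F (UNIV \<times> I)" using GF by (metis inj_on_inverseI)
  ultimately show ?thesis by (simp add: conf_embedding_def)
qed

definition pull_density :: "real set \<Rightarrow> real set \<Rightarrow> (circle \<times> real \<Rightarrow> circle \<times> real) \<Rightarrow> (complex \<Rightarrow> real) \<Rightarrow> complex \<Rightarrow> real" where
  "pull_density I J F v z = descend v (F (cyl_pt z)) + 2 * ln (cmod (lift_deriv I J F z))"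

text \<open>The level might a priori change from point to point; continuity of a lift excludes this
  locally, and which of the two circles is hit is immaterial.\<close>

definition boundary_level :: "real \<Rightarrow> (circle \<times> real \<Rightarrow> circle \<times> real) \<Rightarrow> real \<Rightarrow> bool" where
  "boundary_level \<tau> F c \<longleftrightarrow> (\<forall>x. snd (F (circ x, c)) = 0 \<or> snd (F (circ x, c)) = \<tau>)"

lemma deriv_along_real_line:
  assumes "(h has_field_derivative d) (at z)" and e: "e > 0" "\<And>t::real. \<bar>t\<bar> < e \<Longrightarrow> Im (h (z + of_real t)) = c"
  shows "Im d = 0"
proof -
  have "((\<lambda>t::real. z + of_real t) has_derivative of_real) (at 0)"
    by (auto intro!: derivative_eq_intros)
  moreover have "(h has_derivative (*) d) (at (z + of_real 0))"
    using assms(1) by (simp add: has_field_derivative_def)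
  ultimately have "(h \<circ> (\<lambda>t::real. z + of_real t) has_derivative (*) d \<circ> of_real) (at 0)"
    by (rule diff_chain_at)
  then have "((\<lambda>t::real. Im (h (z + of_real t))) has_derivative (\<lambda>t. Im (d * of_real t))) (at 0)"
    unfolding o_def by (rule has_derivative_Im)
  then have "((\<lambda>t. Im (h (z + of_real t))) has_real_derivative Im d) (at 0)"
    unfolding has_field_derivative_def by (rule has_derivative_eq_rhs2) simp
  moreover have "((\<lambda>t. Im (h (z + of_real t))) has_real_derivative 0) (at 0)"
  proof (rule has_field_derivative_transform_within_open[of "\<lambda>_. c" _ _ "{-e<..<e}"])
    show "c = Im (h (z + of_real t))" if "t \<in> {-e<..<e}" for t using e(2)[of t] that by auto
  qed (use e(1) in auto)
  ultimately show ?thesis by (rule DERIV_unique)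
qed

context
  fixes I :: "real set" and a b \<tau> :: real and F :: "circle \<times> real \<Rightarrow> circle \<times> real" and v :: "complex \<Rightarrow> real"
  assumes I: "cyl_ivl I a b" and t: "0 < \<tau>" and F: "conf_embedding I {0..\<tau>} F"
    and vs: "smooth_on (strip {0..\<tau>}) v" and vp: "\<And>z. Im z \<in> {0..\<tau>} \<Longrightarrow> v (z + of_real (2 * pi)) = v z"
begin

private lemma J: "cyl_ivl {0..\<tau>} 0 \<tau>" using t by (simp add: cyl_ivl_def)

private abbreviation "w \<equiv> pull_density I {0..\<tau>} F v"
private abbreviation "m \<equiv> \<lambda>z. 2 * ln (cmod (lift_deriv I {0..\<tau>} F z))"

private lemma lift_ex: "Im z \<in> I \<Longrightarrow> \<exists>N H. z \<in> N \<and> lift_on I {0..\<tau>} F N H"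
  using F by (simp add: conf_embedding_def)

lemma pull_density_lift:
  assumes "lift_on I {0..\<tau>} F N H" "u \<in> N" "Im u \<in> I"
  shows "lift_deriv I {0..\<tau>} F u = deriv H u" "w u = v (H u) + 2 * ln (cmod (deriv H u))"
proof -
  show e: "lift_deriv I {0..\<tau>} F u = deriv H u" by (rule lift_deriv_eq[OF I assms])
  have "descend v (F (cyl_pt u)) = v (H u)"
    using descend[of "{0..\<tau>}" v "H u", OF vp] lift_onD(4,5)[OF assms(1-3)] by simp
  then show "w u = v (H u) + 2 * ln (cmod (deriv H u))" by (simp add: pull_density_def e)
qed

lemma smooth_lift_factor: "smooth_on (strip I) m"
proof (rule smooth_onI)
  fix z assume "z \<in> strip I"
  then obtain N H where N: "z \<in> N" "lift_on I {0..\<tau>} F N H" using lift_ex[of z] by auto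
  note l = lift_onD[OF N(2)]
  have "Ck_on k N (\<lambda>w. 2 * ln (cmod (deriv H w)))" for k
    by (rule Ck_on_ln_holomorphic(1)[OF l(1) holomorphic_deriv[OF l(2,1)] l(3)])
  then show "\<exists>N F'. open N \<and> z \<in> N \<and> (\<forall>k. Ck_on k N F') \<and> (\<forall>u\<in>N \<inter> strip I. F' u = m u)"
    using l(1) N pull_density_lift(1)[OF N(2)] by (intro exI[of _ N] exI[of _ "\<lambda>w. 2 * ln (cmod (deriv H w))"]) auto
qed

lemma smooth_pull_part: "smooth_on (strip I) (\<lambda>z. descend v (F (cyl_pt z)))"
proof (rule smooth_on_comp[OF vs])
  fix z assume "z \<in> strip I"
  then obtain N H where N: "z \<in> N" "lift_on I {0..\<tau>} F N H" using lift_ex[of z] by auto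
  note l = lift_onD[OF N(2)]
  have "H u \<in> strip {0..\<tau>} \<and> descend v (F (cyl_pt u)) = v (H u)" if "u \<in> N \<inter> strip I" for u
    using descend[of "{0..\<tau>}" v "H u", OF vp] l(4,5)[of u] that by simp
  then show "\<exists>N h. open N \<and> z \<in> N \<and> h holomorphic_on N \<and> (\<forall>u\<in>N \<inter> strip I. h u \<in> strip {0..\<tau>} \<and> descend v (F (cyl_pt u)) = v (h u))"
    using N l(1,2) by blast
qed

lemma smooth_pull_density: "smooth_on (strip I) w"
  unfolding pull_density_def by (intro smooth_on_add smooth_pull_part smooth_lift_factor)

lemma lift_deriv_periodic: "Im z \<in> I \<Longrightarrow> lift_deriv I {0..\<tau>} F (z + of_real (2 * pi)) = lift_deriv I {0..\<tau>} F z"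
proof -
  assume z: "Im z \<in> I"
  then obtain N H where N: "z \<in> N" "lift_on I {0..\<tau>} F N H" using lift_ex[of z] by auto
  note l = lift_onD[OF N(2)]
  \<comment> \<open>A lift translated by a period is a lift near the translated point.\<close>
  define N' where "N' = (\<lambda>u. u - of_real (2 * pi)) -` N"
  define H' where "H' u = H (u - of_real (2 * pi))" for u
  have d: "(H' has_field_derivative deriv H (u - of_real (2 * pi))) (at u)" if "u \<in> N'" for u
  proof -
    have u: "u - of_real (2 * pi) \<in> N" using that by (simp add: N'_def)
    have "((\<lambda>u. H (u - of_real (2 * pi))) has_field_derivative deriv H (u - of_real (2 * pi)) * 1) (at u)"
      by (rule DERIV_chain2[where f=H and g="\<lambda>u. u - of_real (2 * pi)", OF holomorphic_derivI[OF l(2,1) u]])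
        (auto intro!: derivative_eq_intros)
    then show ?thesis by (simp add: H'_def[abs_def])
  qed
  have "lift_on I {0..\<tau>} F N' H'"
    unfolding lift_on_def
  proof (intro conjI ballI impI)
    show o: "open N'" unfolding N'_def by (rule open_vimage[OF l(1)]) (intro continuous_intros)
    show "H' holomorphic_on N'" using d o by (auto simp: holomorphic_on_open)
    fix u assume u: "u \<in> N'"
    then have u': "u - of_real (2 * pi) \<in> N" by (simp add: N'_def)
    show "deriv H' u \<noteq> 0" using DERIV_imp_deriv[OF d[OF u]] l(3)[OF u'] by simp
    assume "Im u \<in> I"
    then show "Im (H' u) \<in> {0..\<tau>}" "cyl_pt (H' u) = F (cyl_pt u)"
      using l(4,5)[OF u'] cyl_pt_add_period1[of "u - of_real (2 * pi)"] by (simp_all add: H'_def)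
  qed
  moreover have "z + of_real (2 * pi) \<in> N'" using N by (simp add: N'_def)
  ultimately have "lift_deriv I {0..\<tau>} F (z + of_real (2 * pi)) = deriv H' (z + of_real (2 * pi))"
    using lift_deriv_eq[OF I] z by simp
  also have "\<dots> = deriv H z" using DERIV_imp_deriv[OF d[of "z + of_real (2 * pi)"]] N by (simp add: N'_def)
  also have "\<dots> = lift_deriv I {0..\<tau>} F z" using lift_deriv_eq[OF I N(2,1) z] by simp
  finally show ?thesis .
qed

lemma pull_density_periodic: "Im z \<in> I \<Longrightarrow> w (z + of_real (2 * pi)) = w z"
  unfolding pull_density_def by (simp only: cyl_pt_add_period1 lift_deriv_periodic)

lemma lift_factor_harmonic: "Im z \<in> I \<Longrightarrow> lap I m z = 0"
proof -
  assume z: "Im z \<in> I"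
  then obtain N H where N: "z \<in> N" "lift_on I {0..\<tau>} F N H" using lift_ex[of z] by auto
  note l = lift_onD[OF N(2)]
  show ?thesis
    by (rule lap_ln_holomorphic(2)[OF I l(1) holomorphic_deriv[OF l(2,1)] l(3) _ N(1)])
      (use pull_density_lift(1)[OF N(2)] z in auto)
qed

text \<open>Only the composed part has a Laplacian, the factor m being harmonic. It is scaled by
  |H'|^2, exactly the Jacobian of the area integral.\<close>

lemma lap_pull_density:
  "Im z \<in> I \<Longrightarrow> lap I w z = (cmod (lift_deriv I {0..\<tau>} F z))\<^sup>2 * descend (lap {0..\<tau>} v) (F (cyl_pt z))"
proof -
  assume z: "Im z \<in> I"
  then obtain N H where N: "z \<in> N" "lift_on I {0..\<tau>} F N H" using lift_ex[of z] by auto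
  note l = lift_onD[OF N(2)]
  have dv: "descend v (F (cyl_pt u)) = v (H u)" if "u \<in> N" "Im u \<in> I" for u
    using descend[of "{0..\<tau>}" v "H u", OF vp] l(4,5)[of u] that by simp
  have "lap I w z = lap I (\<lambda>z. descend v (F (cyl_pt z))) z + lap I m z"
    unfolding pull_density_def by (rule smooth_on_pd_add(2)[OF I smooth_pull_part smooth_lift_factor]) (use z in simp)
  also have "lap I (\<lambda>z. descend v (F (cyl_pt z))) z = (cmod (deriv H z))\<^sup>2 * lap {0..\<tau>} v (H z)"
    by (rule lap_comp(3)[OF I J vs l(1,2) _ _ N(1)]) (use l(4) dv z in auto)
  also have "lap {0..\<tau>} v (H z) = descend (lap {0..\<tau>} v) (F (cyl_pt z))"
    using descend[of "{0..\<tau>}" "lap {0..\<tau>} v" "H z", OF lap_periodic[OF J vs vp]] l(4,5)[OF N(1) z] by simp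
  finally show ?thesis
    using lift_factor_harmonic[OF z] pull_density_lift(1)[OF N(2,1) z] by simp
qed

text \<open>On a boundary circle the derivative of a local lift is real, and so is its logarithmic derivative.\<close>

lemma pull_density_boundary:
  assumes c: "c \<in> I" and bl: "boundary_level \<tau> F c" and z: "Im z = c"
  shows "pd I m \<i> z = 0"
    and "\<exists>N H. z \<in> N \<and> lift_on I {0..\<tau>} F N H \<and> (Im (H z) = 0 \<or> Im (H z) = \<tau>) \<and> Re (deriv H z) \<noteq> 0 \<and>
      pd I w \<i> z = Re (deriv H z) * pd {0..\<tau>} v \<i> (H z)"
proof -
  have zI: "Im z \<in> I" using c z by simp
  obtain N H where N: "z \<in> N" "lift_on I {0..\<tau>} F N H" using lift_ex[OF zI] by auto
  note l = lift_onD[OF N(2)]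
  have lev: "Im (H u) = 0 \<or> Im (H u) = \<tau>" if u: "u \<in> N" "Im u = c" for u
  proof -
    have "Im (H u) = snd (F (cyl_pt u))" using l(5)[of u] u c by (metis snd_cyl_pt)
    then show ?thesis using bl u by (simp add: boundary_level_def cyl_pt_def)
  qed
  have real: "Im (deriv H u) = 0" if u: "u \<in> N" "Im u = c" for u
  proof -
    have co: "continuous_on N H" by (rule holomorphic_on_imp_continuous_on[OF l(2)])
    \<comment> \<open>Within distance \<tau> of H u the other level is out of reach, so H keeps its
      level along the boundary line.\<close>
    define M where "M = N \<inter> H -` ball (H u) \<tau>"
    have "open M" unfolding M_def by (rule continuous_open_preimage[OF co l(1)]) simp
    moreover have "u \<in> M" using u t by (simp add: M_def)
    ultimately obtain e where e: "e > 0" "ball u e \<subseteq> M" using openE by blast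
    show ?thesis
    proof (rule deriv_along_real_line[OF holomorphic_derivI[OF l(2,1) u(1)] e(1)])
      fix s :: real assume "\<bar>s\<bar> < e"
      then have "u + of_real s \<in> M" using e(2) by (auto simp: subset_iff dist_norm)
      then have "u + of_real s \<in> N" "cmod (H u - H (u + of_real s)) < \<tau>" by (auto simp: M_def dist_norm)
      moreover have "\<bar>Im (H u) - Im (H (u + of_real s))\<bar> \<le> cmod (H u - H (u + of_real s))"
        using abs_Im_le_cmod[of "H u - H (u + of_real s)"] by simp
      ultimately show "Im (H (u + of_real s)) = Im (H u)" using lev[of u] lev[of "u + of_real s"] u by auto
    qed
  qed
  \<comment> \<open>H' is itself real along the boundary line, so the same argument applies to
    it.\<close>
  have real2: "Im (deriv (deriv H) z) = 0"
  proof -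
    obtain e where e: "e > 0" "ball z e \<subseteq> N" using l(1) N(1) openE by blast
    show ?thesis
    proof (rule deriv_along_real_line[OF holomorphic_derivI[OF holomorphic_deriv[OF l(2,1)] l(1) N(1)] e(1)])
      fix s :: real assume "\<bar>s\<bar> < e"
      then have "z + of_real s \<in> N" using e(2) by (auto simp: subset_iff dist_norm)
      then show "Im (deriv H (z + of_real s)) = 0" using real z by simp
    qed
  qed
  have Im0: "Im (deriv H z) = 0" using real[OF N(1) z] .
  then have Re0: "Re (deriv H z) \<noteq> 0" using l(3)[OF N(1)] by (auto simp: complex_eq_iff)
  have q: "Im (deriv (deriv H) z / deriv H z) = 0"
    using Im0 real2 by (simp add: Im_divide)
  show m0: "pd I m \<i> z = 0"
    using lap_ln_holomorphic(1)[OF I l(1) holomorphic_deriv[OF l(2,1)] l(3), of m z] pull_density_lift(1)[OF N(2)] N(1) zI q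
    by auto
  have dv: "descend v (F (cyl_pt u)) = v (H u)" if "u \<in> N" "Im u \<in> I" for u
    using descend[of "{0..\<tau>}" v "H u", OF vp] l(4,5)[of u] that by simp
  have "pd I w \<i> z = pd I (\<lambda>z. descend v (F (cyl_pt z))) \<i> z + pd I m \<i> z"
    unfolding pull_density_def by (rule smooth_on_pd_add(1)[OF I smooth_pull_part smooth_lift_factor]) (use zI in simp)
  also have "pd I (\<lambda>z. descend v (F (cyl_pt z))) \<i> z = Re (deriv H z) * pd {0..\<tau>} v \<i> (H z) - Im (deriv H z) * pd {0..\<tau>} v 1 (H z)"
    by (rule lap_comp(2)[OF I J vs l(1,2) _ _ N(1)]) (use l(4) dv zI in auto)
  finally have "pd I w \<i> z = Re (deriv H z) * pd {0..\<tau>} v \<i> (H z)" using m0 Im0 by simp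
  then show "\<exists>N H. z \<in> N \<and> lift_on I {0..\<tau>} F N H \<and> (Im (H z) = 0 \<or> Im (H z) = \<tau>) \<and> Re (deriv H z) \<noteq> 0 \<and>
      pd I w \<i> z = Re (deriv H z) * pd {0..\<tau>} v \<i> (H z)"
    using N Re0 lev[OF N(1) z] by blast
qed

text \<open>Conformal invariance of the energy, up to a boundary term that vanishes by hypothesis.\<close>

lemma area_integral_pull:
  assumes pq: "p \<le> q" "{p..q} \<subseteq> I"
    and bd: "\<And>z. Im z = p \<or> Im z = q \<Longrightarrow> m z * pd I w \<i> z = w z * pd I m \<i> z"
  shows "area_integrable (F ` (UNIV \<times> {p..q})) (\<lambda>x. descend v x * descend (lap {0..\<tau>} v) x)"
    and "area_integral (F ` (UNIV \<times> {p..q})) (\<lambda>x. descend v x * descend (lap {0..\<tau>} v) x)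
      = integral (period_box p q) (\<lambda>z. w z * lap I w z)"
proof -
  let ?\<rho> = "\<lambda>x. descend v x * descend (lap {0..\<tau>} v) x" and ?d = "lift_deriv I {0..\<tau>} F"
  have hI: "half_box p q \<subseteq> strip I" using half_box(2) period_box_strip[OF pq(2)] by blast
  have inj: "inj_on (\<lambda>z. F (cyl_pt z)) (half_box p q)"
  proof -
    have "inj_on F (cyl_pt ` half_box p q)"
      using F pq(2) unfolding half_box(4) conf_embedding_def by (auto elim: inj_on_subset)
    from comp_inj_on[OF half_box(5) this] show ?thesis by (simp add: o_def)
  qed
  have der: "((\<lambda>u. Ecyl (F (cyl_pt u))) has_field_derivative \<i> * ?d z * Ecyl (F (cyl_pt z))) (at z within half_box p q)"
    if z: "z \<in> half_box p q" for z
  proof -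
    have zI: "Im z \<in> I" using z hI by auto
    then obtain N H where N: "z \<in> N" "lift_on I {0..\<tau>} F N H" using lift_ex[of z] by auto
    note l = lift_onD[OF N(2)]
    show ?thesis
      unfolding pull_density_lift(1)[OF N(2,1) zI]
      by (rule Ecyl_lift_derivative[OF has_field_derivative_at_within[OF holomorphic_derivI[OF l(2,1) N(1)]] _ l(1) N(1) z])
        (use l(5) hI in auto)
  qed
  \<comment> \<open>v lap v, pulled back together with its Jacobian, is (w - m) lap w, because w - m
    is the composed density.\<close>
  define R where "R z = w z * lap I w z - m z * lap I w z" for z
  have R: "(cmod (?d z))\<^sup>2 * ?\<rho> (F (cyl_pt z)) = R z" if "Im z \<in> I" for z
    using lap_pull_density[OF that] by (simp add: R_def pull_density_def algebra_simps)
  note ws = smooth_pull_density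
  have cont: "continuous_on (period_box p q) (\<lambda>z. u z * lap I w z)" if "smooth_on (strip I) u" for u
    by (rule continuous_on_subset[OF smooth_on_continuous period_box_strip[OF pq(2)]])
      (intro smooth_on_mult that smooth_on_lap[OF I ws])
  have Rc: "continuous_on (period_box p q) R"
    unfolding R_def by (intro continuous_on_diff cont ws smooth_lift_factor)
  have "integral (period_box p q) R = integral (period_box p q) (\<lambda>z. w z * lap I w z) - integral (period_box p q) (\<lambda>z. m z * lap I w z)"
    unfolding R_def using cont[OF ws] cont[OF smooth_lift_factor]
    unfolding period_box_def by (intro integral_diff integrable_continuous)
  \<comment> \<open>Green's formula moves the Laplacian onto m, which is harmonic; its boundary
    condition is \<open>bd\<close>.\<close>
  also have "integral (period_box p q) (\<lambda>z. m z * lap I w z) = integral (period_box p q) (\<lambda>z. w z * lap I m z)"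
    unfolding period_box_def
    by (rule green_strip[OF I smooth_lift_factor ws _ _ pq])
      (use lift_deriv_periodic pull_density_periodic bd in auto)
  also have "\<dots> = integral (period_box p q) (\<lambda>z. 0)"
    by (rule integral_cong) (use lift_factor_harmonic period_box_strip[OF pq(2)] in auto)
  finally have iR: "integral (period_box p q) R = integral (period_box p q) (\<lambda>z. w z * lap I w z)" by simp
  have "(\<lambda>z. (cmod (?d z))\<^sup>2 * ?\<rho> (F (cyl_pt z))) absolutely_integrable_on half_box p q"
    using half_box_integral(1)[OF Rc] hI
    by (subst absolutely_integrable_spike_eq[OF negligible_empty, of _ R]) (auto simp: R)
  moreover have "integral (half_box p q) (\<lambda>z. (cmod (?d z))\<^sup>2 * ?\<rho> (F (cyl_pt z))) = integral (period_box p q) (\<lambda>z. w z * lap I w z)"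
  proof -
    have hI': "Im x \<in> I" if "x \<in> half_box p q" for x using hI that by auto
    show ?thesis using half_box_integral(2)[OF Rc] iR integral_cong[of "half_box p q" _ R, OF R[OF hI']] by simp
  qed
  ultimately have "area_integrable ((\<lambda>z. F (cyl_pt z)) ` half_box p q) ?\<rho> \<and>
     area_integral ((\<lambda>z. F (cyl_pt z)) ` half_box p q) ?\<rho> = integral (period_box p q) (\<lambda>z. w z * lap I w z)"
    using area_param[OF half_box(1) inj der, where \<rho>="?\<rho>"] by blast
  moreover have "(\<lambda>z. F (cyl_pt z)) ` half_box p q = F ` (UNIV \<times> {p..q})"
    using half_box(4)[of p q] by (metis image_image)
  ultimately show "area_integrable (F ` (UNIV \<times> {p..q})) ?\<rho>"
    and "area_integral (F ` (UNIV \<times> {p..q})) ?\<rho> = integral (period_box p q) (\<lambda>z. w z * lap I w z)" by auto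
qed

end

section \<open>Boundary behaviour of admissible metrics\<close>

abbreviation dens :: "real \<Rightarrow> (circle \<times> real) metric \<Rightarrow> complex \<Rightarrow> real" where
  "dens \<tau> g \<equiv> \<lambda>z. gam (flat_cyl {0..\<tau>}) g (cyl_pt z)"

lemma cyl_ivl_closed: "0 < \<tau> \<Longrightarrow> cyl_ivl {0..\<tau>} 0 \<tau>"
  by (simp add: cyl_ivl_def)

lemma density_dens: "0 < \<tau> \<Longrightarrow> conf_metric (flat_cyl {0..\<tau>}) g \<Longrightarrow> density {0..\<tau>} g (dens \<tau> g)"
  by (rule density_gam[OF cyl_ivl_closed])

text \<open>Passes from the chart-wise \<open>pull_metric\<close> to a function on the cover. The
  point given by the chart and the given z differ by a period, which periodicity absorbs.\<close>

lemma pull_metric_density: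
  assumes I: "cyl_ivl I a b" and t: "0 < \<tau>" and F: "conf_embedding I {0..\<tau>} F" and g: "conf_metric (flat_cyl {0..\<tau>}) g"
  shows "density I (pull_metric (flat_cyl {0..\<tau>}) F g) (pull_density I {0..\<tau>} F (dens \<tau> g))"
proof -
  note d = densityD[OF density_dens[OF t g]]
  let ?w = "pull_density I {0..\<tau>} F (dens \<tau> g)"
  have per: "?w (z + of_real (2 * pi)) = ?w z" if "Im z \<in> I" for z
    by (rule pull_density_periodic[OF I t F d(1,2) that])
  have "pull_metric (flat_cyl {0..\<tau>}) F g (D, s) w = ?w z"
    if c: "(D, s) \<in> atlas (flat_cyl I)" "w \<in> D" "s w = cyl_pt z" "Im z \<in> I" for D s w z
  proof -
    obtain \<beta> \<sigma> where ch: "flat_chart I a b D s \<beta> \<sigma>" by (rule flat_cyl_atlasD[OF I c(1)])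
    note cd = flat_chartD[OF ch]
    let ?z = "\<beta> + \<sigma> * w"
    have zI: "Im ?z \<in> I" using c(2) cd(2) by blast
    then obtain N H where N: "?z \<in> N" "lift_on I {0..\<tau>} F N H" using F unfolding conf_embedding_def by blast
    note l = lift_onD[OF N(2)]
    have "pull_metric (flat_cyl {0..\<tau>}) F g (D, s) w = gam (flat_cyl {0..\<tau>}) g (F (cyl_pt ?z)) + 2 * ln (cmod (deriv H ?z))"
      by (rule pull_metric_lift[OF I cyl_ivl_closed[OF t] c(1) ch l(1) N(1) l(2) _ c(2)]) (use l(4,5) in blast)
    also have "F (cyl_pt ?z) = cyl_pt (H ?z)" using l(5)[OF N(1) zI] ..
    also have "gam (flat_cyl {0..\<tau>}) g (cyl_pt (H ?z)) + 2 * ln (cmod (deriv H ?z)) = ?w ?z"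
      using pull_density_lift(2)[OF I t F d(1,2) N(2,1) zI] by simp
    also have "?w ?z = ?w z"
    proof -
      have "cyl_pt z = cyl_pt ?z" using c(3) cd(1) by simp
      then obtain k :: int where k: "?z = z + of_real (2 * pi * of_int k)" unfolding cyl_pt_eq_iff by blast
      show ?thesis unfolding k by (rule periodic_int[where v="?w" and I=I, OF per c(4)])
    qed
    finally show ?thesis .
  qed
  then show ?thesis
    using smooth_pull_density[OF I t F d(1,2)] per unfolding density_def by auto
qed

lemma surface_boundary_flat:
  assumes t: "0 < \<tau>" shows "surface_boundary (flat_cyl {0..\<tau>}) = UNIV \<times> {0, \<tau>}"
proof (intro equalityI subsetI)
  note I = cyl_ivl_closed[OF t]
  fix p assume "p \<in> surface_boundary (flat_cyl {0..\<tau>})"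
  then obtain D s w where p: "p = s w" "(D, s) \<in> atlas (flat_cyl {0..\<tau>})" "w \<in> D" "Im w = 0"
    by (auto simp: surface_boundary_def)
  obtain \<beta> \<sigma> where ch: "flat_chart {0..\<tau>} 0 \<tau> D s \<beta> \<sigma>" by (rule flat_cyl_atlasD[OF I p(2)])
  have "\<sigma> = 1 \<and> Im \<beta> = 0 \<or> \<sigma> = -1 \<and> Im \<beta> = \<tau>" using ch by (simp add: flat_chart_def)
  then have "Im (\<beta> + \<sigma> * w) \<in> {0, \<tau>}" using p(4) by auto
  then show "p \<in> UNIV \<times> {0, \<tau>}" unfolding p(1) flat_chartD(1)[OF ch] by (simp only: cyl_pt_in)
next
  fix p :: "circle \<times> real" assume p: "p \<in> UNIV \<times> {0, \<tau>}"
  obtain z where z: "p = cyl_pt z" by (rule cyl_pt_surj)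
  have zl: "Im z = 0 \<or> Im z = \<tau>" using p z by simp
  let ?a = "(if Im z = 0 then (\<lambda>w. cyl_pt (Complex (Re z) 0 + w)) else (\<lambda>w. cyl_pt (Complex (Re z) \<tau> - w)))"
  let ?D = "(if Im z = 0 then {w. \<bar>Re w\<bar> < pi \<and> 0 \<le> Im w \<and> Im w < \<tau> - 0 \<and> 0 + Im w \<in> {0..\<tau>}}
     else {w. \<bar>Re w\<bar> < pi \<and> 0 \<le> Im w \<and> Im w < \<tau> - 0 \<and> \<tau> - Im w \<in> {0..\<tau>}})"
  have "(?D, ?a) \<in> atlas (flat_cyl {0..\<tau>})" using t by (simp add: flat_cyl_def Let_def)
  moreover have "0 \<in> ?D" using t by simp
  moreover have "?a 0 = p"
  proof -
    have "Complex (Re z) 0 = z" if "Im z = 0" using that by (simp add: complex_eq_iff)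
    moreover have "Complex (Re z) \<tau> = z" if "Im z \<noteq> 0" using that zl by (simp add: complex_eq_iff)
    ultimately show ?thesis using z by simp
  qed
  ultimately show "p \<in> surface_boundary (flat_cyl {0..\<tau>})"
    unfolding surface_boundary_def by (intro CollectI exI[of _ ?D] exI[of _ ?a] exI[of _ 0]) simp
qed

lemma collar_conf_embedding:
  assumes I: "cyl_ivl I a b" and t: "0 < \<tau>" and Z: "collar I (flat_cyl {0..\<tau>}) \<zeta> Z"
  shows "conf_embedding I {0..\<tau>} Z" "Z (p, 0) = \<zeta> p"
  using Z conf_embedding_of_biholo[OF I cyl_ivl_closed[OF t]] by (auto simp: collar_def)

lemma lower_strip_point: "p = circ x \<Longrightarrow> cyl_pt (of_real x) = (p, 0)"
  by (simp add: cyl_pt_def)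

text \<open>An admissible metric is flat in a boundary parametrization; transporting this back gives
  a vanishing normal derivative in the flat coordinate, because the normal derivative of the
  conformal factor of the parametrization vanishes on the boundary.\<close>

lemma collar_flat_neumann:
  assumes I: "cyl_ivl I a b" "0 \<in> I" and t: "0 < \<tau>" and Z: "collar I (flat_cyl {0..\<tau>}) \<zeta> Z"
    and \<zeta>: "range \<zeta> \<subseteq> UNIV \<times> {0, \<tau>}" and g: "conf_metric (flat_cyl {0..\<tau>}) g"
    and fl: "metric_eq_on (flat_cyl I) UNIV (pull_metric (flat_cyl {0..\<tau>}) Z g) flat_metric"
    and z: "cyl_pt z \<in> range \<zeta>"
  shows "pd {0..\<tau>} (dens \<tau> g) \<i> z = 0"
proof -
  note d = densityD[OF density_dens[OF t g]]
  note ce = collar_conf_embedding(1)[OF I(1) t Z] and Z0 = collar_conf_embedding(2)[OF I(1) t Z]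
  let ?w = "pull_density I {0..\<tau>} Z (dens \<tau> g)"
  have w0: "?w u = 0" if u: "Im u \<in> I" for u
  proof -
    obtain D s \<beta> \<sigma> where c: "(D, s) \<in> atlas (flat_cyl I)" "flat_chart I a b D s \<beta> \<sigma>" "\<sigma> * (u - \<beta>) \<in> D"
      by (rule flat_cyl_atlas_cover[OF I(1) u])
    have "pull_metric (flat_cyl {0..\<tau>}) Z g (D, s) (\<sigma> * (u - \<beta>)) = 0"
      using fl c(1,3) unfolding metric_eq_on_def flat_metric_def by fastforce
    moreover have "s (\<sigma> * (u - \<beta>)) = cyl_pt u" unfolding flat_chartD(1,5)[OF c(2)] ..
    ultimately show ?thesis
      using densityD(3)[OF pull_metric_density[OF I(1) t ce g] c(1,3) _ u] by simp
  qed
  have bl: "boundary_level \<tau> Z 0"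
    unfolding boundary_level_def Z0
  proof
    fix x
    have "\<zeta> (circ x) \<in> UNIV \<times> {0, \<tau>}" using \<zeta> by blast
    then show "snd (\<zeta> (circ x)) = 0 \<or> snd (\<zeta> (circ x)) = \<tau>" by (simp add: mem_Times_iff)
  qed
  obtain q where q: "cyl_pt z = \<zeta> q" using z by auto
  obtain x where x: "q = circ x" by (rule circ_surj)
  let ?y = "of_real x :: complex"
  from pull_density_boundary(2)[OF I(1) t ce d(1,2) I(2) bl, of ?y]
  obtain N H where N: "?y \<in> N" "lift_on I {0..\<tau>} Z N H" "Re (deriv H ?y) \<noteq> 0"
    "pd I ?w \<i> ?y = Re (deriv H ?y) * pd {0..\<tau>} (dens \<tau> g) \<i> (H ?y)" by auto
  have yI: "Im ?y \<in> I" using I(2) by simp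
  have "pd I ?w \<i> ?y = pd I (\<lambda>_. 0) \<i> ?y"
    by (rule pd_local[OF I(1) smooth_on_const open_UNIV]) (use yI w0 in auto)
  also have "\<dots> = 0" using pd_eqI[OF I(1) _ has_derivative_const] yI by simp
  finally have 0: "pd {0..\<tau>} (dens \<tau> g) \<i> (H ?y) = 0" using N(3,4) by simp
  have HJ: "Im (H ?y) \<in> {0..\<tau>}" and "cyl_pt (H ?y) = Z (cyl_pt ?y)" using lift_onD(4,5)[OF N(2,1) yI] by auto
  then have "cyl_pt (H ?y) = cyl_pt z" using q x Z0 by (simp add: lower_strip_point)
  then obtain k :: int where k: "z = H ?y + of_real (2 * pi * of_int k)" unfolding cyl_pt_eq_iff by blast
  have "(\<lambda>u. u + complex_of_real (2 * pi)) holomorphic_on UNIV" by (intro holomorphic_intros)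
  note lc = lap_comp(2)[OF cyl_ivl_closed[OF t] cyl_ivl_closed[OF t] d(1) open_UNIV this]
  have per: "pd {0..\<tau>} (dens \<tau> g) \<i> (u + of_real (2 * pi)) = pd {0..\<tau>} (dens \<tau> g) \<i> u" if "Im u \<in> {0..\<tau>}" for u
  proof -
    have sh: "w \<in> UNIV \<inter> strip {0..\<tau>} \<Longrightarrow> w + complex_of_real (2 * pi) \<in> strip {0..\<tau>}"
      "w \<in> UNIV \<inter> strip {0..\<tau>} \<Longrightarrow> dens \<tau> g w = dens \<tau> g (w + complex_of_real (2 * pi))" for w
      using d(2)[of w] by simp_all
    show ?thesis using lc[OF sh, of u] that by simp
  qed
  show ?thesis
    unfolding k using periodic_int[where v="pd {0..\<tau>} (dens \<tau> g) \<i>" and I="{0..\<tau>}", OF per HJ] 0 by simp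
qed

text \<open>Fixes the boundary circles only as a whole, leaving free which circle each
  parametrization covers and how it runs; this is enough to locate the Neumann condition.\<close>

definition flat_model :: "real \<Rightarrow> (circle \<times> real) cylinder \<Rightarrow> bool" where
  "flat_model \<tau> A \<longleftrightarrow> 0 < \<tau> \<and> surf A = flat_cyl {0..\<tau>} \<and> range (bd1 A) \<union> range (bd2 A) = UNIV \<times> {0, \<tau>}"

text \<open>Every boundary point lies on one of the two parametrizations, whose collar supplies the
  vanishing normal derivative there.\<close>

lemma Adm_neumann:
  assumes A: "flat_model \<tau> A" and g: "g \<in> Adm A"
  shows "conf_metric (flat_cyl {0..\<tau>}) g" "density {0..\<tau>} g (dens \<tau> g)" "neumann \<tau> (dens \<tau> g)"
proof -
  have t: "0 < \<tau>" and S: "surf A = flat_cyl {0..\<tau>}" and r: "range (bd1 A) \<union> range (bd2 A) = UNIV \<times> {0, \<tau>}"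
    using A by (auto simp: flat_model_def)
  show c: "conf_metric (flat_cyl {0..\<tau>}) g" using g by (simp add: Adm_def S)
  show "density {0..\<tau>} g (dens \<tau> g)" by (rule density_dens[OF t c])
  obtain \<epsilon>1 Z1 where 1: "\<epsilon>1 > 0" "collar {0..<\<epsilon>1} (surf A) (bd1 A) Z1"
    "metric_eq_on (flat_cyl {0..<\<epsilon>1}) UNIV (pull_metric (surf A) Z1 g) flat_metric"
    using g unfolding Adm_def by blast
  obtain \<epsilon>2 Z2 where 2: "\<epsilon>2 > 0" "collar {-\<epsilon>2<..0} (surf A) (bd2 A) Z2"
    "metric_eq_on (flat_cyl {-\<epsilon>2<..0}) UNIV (pull_metric (surf A) Z2 g) flat_metric"
    using g unfolding Adm_def by blast
  have "pd {0..\<tau>} (dens \<tau> g) \<i> z = 0" if z: "Im z = 0 \<or> Im z = \<tau>" for z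
  proof -
    have "cyl_pt z \<in> range (bd1 A) \<union> range (bd2 A)" unfolding r using z by simp
    then consider "cyl_pt z \<in> range (bd1 A)" | "cyl_pt z \<in> range (bd2 A)" by blast
    then show ?thesis
    proof cases
      case 1
      then show ?thesis
        by (intro collar_flat_neumann[of "{0..<\<epsilon>1}" 0 \<epsilon>1 \<tau> "bd1 A" Z1])
          (use \<open>\<epsilon>1 > 0\<close> 1(1) t r c S \<open>collar {0..<\<epsilon>1} (surf A) (bd1 A) Z1\<close>
            \<open>metric_eq_on (flat_cyl {0..<\<epsilon>1}) UNIV (pull_metric (surf A) Z1 g) flat_metric\<close> in \<open>auto simp: cyl_ivl_def\<close>)
    next
      case 2
      then show ?thesis
        by (intro collar_flat_neumann[of "{-\<epsilon>2<..0}" "-\<epsilon>2" 0 \<tau> "bd2 A" Z2])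
          (use \<open>\<epsilon>2 > 0\<close> t r c S \<open>collar {-\<epsilon>2<..0} (surf A) (bd2 A) Z2\<close>
            \<open>metric_eq_on (flat_cyl {-\<epsilon>2<..0}) UNIV (pull_metric (surf A) Z2 g) flat_metric\<close> in \<open>auto simp: cyl_ivl_def\<close>)
    qed
  qed
  then show "neumann \<tau> (dens \<tau> g)" by (simp add: neumann_def)
qed

section \<open>The determinant line in coordinates\<close>

text \<open>By the anomaly formula two pairs represent the same vector exactly when they have the
  same coordinate, so a vector is a level set of the coordinate.\<close>

definition line_vec :: "real \<Rightarrow> (circle \<times> real) cylinder \<Rightarrow> real \<Rightarrow> (circle \<times> real) det_elem" where
  "line_vec c A s = {(a, g). g \<in> Adm A \<and> a * exp (c * energy 1 (dens 1 g) / (96 * pi)) = s}"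

text \<open>Asks of g only a density with vanishing normal derivatives, so that it also applies to
  the pulled-back metrics in \<open>mu\<close>.\<close>

lemma fmult_line_vec:
  assumes A: "flat_model 1 A" and g: "density {0..1} g v" "neumann 1 v"
  shows "fmult c A a g = line_vec c A (a * exp (c * energy 1 v / (96 * pi)))"
proof -
  have S: "surf A = flat_cyl {0..1}" using A by (simp add: flat_model_def)
  have "a' = exp (c * anomaly (surf A) g' g) * a \<longleftrightarrow>
      a' * exp (c * energy 1 (dens 1 g') / (96 * pi)) = a * exp (c * energy 1 v / (96 * pi))"
    if "g' \<in> Adm A" for a' g'
  proof -
    have an: "anomaly (surf A) g' g = - 1 / (96 * pi) * (energy 1 (dens 1 g') - energy 1 v)"
      unfolding S by (rule anomaly_density[OF _ Adm_neumann(2)[OF A that] g(1) Adm_neumann(3)[OF A that] g(2)]) simp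
    have "c * anomaly (surf A) g' g = c * energy 1 v / (96 * pi) - c * energy 1 (dens 1 g') / (96 * pi)"
      unfolding an by (simp add: field_simps)
    then have "exp (c * energy 1 v / (96 * pi)) = exp (c * anomaly (surf A) g' g) * exp (c * energy 1 (dens 1 g') / (96 * pi))"
      by (simp flip: exp_add)
    then have "a * exp (c * energy 1 v / (96 * pi)) = (exp (c * anomaly (surf A) g' g) * a) * exp (c * energy 1 (dens 1 g') / (96 * pi))"
      by (simp only: mult.assoc mult.left_commute)
    then show ?thesis by (simp only: mult_right_cancel[OF exp_not_eq_zero])
  qed
  then show ?thesis unfolding fmult_def line_vec_def by auto
qed

lemma fmult_Adm:
  assumes A: "flat_model 1 A" and g: "g \<in> Adm A"
  shows "fmult c A a g = line_vec c A (a * exp (c * energy 1 (dens 1 g) / (96 * pi)))"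
  using fmult_line_vec[OF A Adm_neumann(2,3)[OF A g]] .

lemma scale_line_vec: "scale t (line_vec c A s) = line_vec c A (t * s)"
proof (intro equalityI subsetI)
  fix x assume "x \<in> line_vec c A (t * s)"
  then obtain b g where x: "x = (b, g)" "g \<in> Adm A" "b * exp (c * energy 1 (dens 1 g) / (96 * pi)) = t * s"
    by (auto simp: line_vec_def)
  let ?W = "exp (c * energy 1 (dens 1 g) / (96 * pi))"
  have "(s / ?W, g) \<in> line_vec c A s" using x by (simp add: line_vec_def)
  moreover have "x = (t * (s / ?W), g)" using x by (simp add: field_simps)
  ultimately show "x \<in> scale t (line_vec c A s)" unfolding scale_def by force
qed (auto simp: scale_def line_vec_def)

text \<open>An admissible metric makes the level sets nonempty; without one all of them would
  coincide.\<close>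

lemma line_vec_inj:
  assumes "g \<in> Adm A" "line_vec c A s = line_vec c A s'" shows "s = s'"
proof -
  have "(s / exp (c * energy 1 (dens 1 g) / (96 * pi)), g) \<in> line_vec c A s" using assms(1) by (simp add: line_vec_def)
  then show ?thesis unfolding assms(2) by (simp add: line_vec_def)
qed

text \<open>Multiplication by k in the coordinates of the two lines. The homomorphisms of the
  construction are brought to this form, in which composition is multiplication of reals.\<close>

definition line_map :: "real \<Rightarrow> (circle \<times> real) cylinder \<Rightarrow> (circle \<times> real) cylinder \<Rightarrow> real \<Rightarrow> (circle \<times> real) hom_elem" where
  "line_map c A B k = (\<lambda>w \<in> Det c A. line_vec c B (k * (THE s. w = line_vec c A s)))"

lemma Det_line_vec:
  assumes A: "flat_model 1 A" and g: "g \<in> Adm A"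
  shows "Det c A = range (line_vec c A)"
proof (intro equalityI subsetI)
  fix x assume "x \<in> range (line_vec c A)"
  then obtain s where "x = line_vec c A s" by auto
  then have "x = fmult c A (s / exp (c * energy 1 (dens 1 g) / (96 * pi))) g"
    by (simp add: fmult_Adm[OF A g])
  then show "x \<in> Det c A" using g by (auto simp: Det_def)
qed (auto simp: Det_def fmult_Adm[OF A])

lemma line_coord:
  assumes g: "g \<in> Adm A" shows "(THE s. line_vec c A x = line_vec c A s) = x"
  by (rule the_equality) (auto dest: line_vec_inj[OF g])

lemma line_map_apply:
  assumes A: "flat_model 1 A" and g: "g \<in> Adm A"
  shows "line_map c A B k (line_vec c A x) = line_vec c B (k * x)"
  by (simp add: line_map_def Det_line_vec[OF A g] line_coord[OF g])

lemma tensor_line_map: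
  assumes A: "flat_model 1 A" and g: "g \<in> Adm A" and s: "s \<noteq> 0"
  shows "tensor c A (line_vec c B t) (dual_elem c A (line_vec c A s)) = line_map c A B (t / s)"
proof
  fix w
  show "tensor c A (line_vec c B t) (dual_elem c A (line_vec c A s)) w = line_map c A B (t / s) w"
  proof (cases "w \<in> Det c A")
    case True
    then obtain x where x: "w = line_vec c A x" unfolding Det_line_vec[OF A g] by auto
    have "(THE y. line_vec c A x = scale y (line_vec c A s)) = x / s"
      unfolding scale_line_vec
      by (rule the_equality) (use s in \<open>auto dest!: line_vec_inj[OF g]\<close>)
    then have "dual_elem c A (line_vec c A s) w = x / s" using True x by (simp add: dual_elem_def)
    then show ?thesis using True x
      by (simp add: tensor_def scale_line_vec line_map_def line_coord[OF g] field_simps)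
  next
    case False
    then show ?thesis by (simp add: tensor_def line_map_def)
  qed
qed

lemma compose_line_map:
  assumes A: "flat_model 1 A" "g \<in> Adm A" and B: "flat_model 1 B" "g' \<in> Adm B"
  shows "compose (Det c A) (line_map c B C k) (line_map c A B l) = line_map c A C (k * l)"
proof
  fix w
  show "compose (Det c A) (line_map c B C k) (line_map c A B l) w = line_map c A C (k * l) w"
  proof (cases "w \<in> Det c A")
    case True
    then obtain x where x: "w = line_vec c A x" unfolding Det_line_vec[OF A] by auto
    then show ?thesis using True line_map_apply[OF A] line_map_apply[OF B] by (simp add: compose_def mult.assoc)
  next
    case False
    then show ?thesis by (simp add: compose_def line_map_def)
  qed
qed

lemma tscale_line_map: "tscale c A t (line_map c A B k) = line_map c A B (t * k)"
  by (auto simp: tscale_def line_map_def scale_line_vec mult.assoc fun_eq_iff)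

lemma line_map_inj:
  assumes A: "flat_model 1 A" "g \<in> Adm A" and B: "g' \<in> Adm B" and e: "line_map c A B k = line_map c A B k'"
  shows "k = k'"
  using line_map_apply[OF A, of c B k 1] line_map_apply[OF A, of c B k' 1] line_vec_inj[OF B, of c k k'] e by simp

section \<open>The distinguished element\<close>

text \<open>With Neumann data on both circles the boundary terms in
  \<open>area_integral_pull\<close> vanish, and u is onto, so the area integral over its image is
  the whole energy. The moduli are independent because \<open>mu\<close> quantifies over all
  uniformized cylinders.\<close>

lemma energy_biholo:
  assumes t: "0 < \<tau>" "0 < \<tau>'" and u: "biholo (flat_cyl {0..\<tau>}) (flat_cyl {0..\<tau>'}) u"
    and b: "boundary_level \<tau>' u 0" "boundary_level \<tau>' u \<tau>"
    and g: "conf_metric (flat_cyl {0..\<tau>'}) g" "neumann \<tau>' (dens \<tau>' g)"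
  shows "\<exists>w. density {0..\<tau>} (pull_metric (flat_cyl {0..\<tau>'}) u g) w \<and> neumann \<tau> w \<and> energy \<tau> w = energy \<tau>' (dens \<tau>' g)"
proof -
  note I = cyl_ivl_closed[OF t(1)] and J = cyl_ivl_closed[OF t(2)]
  have ce: "conf_embedding {0..\<tau>} {0..\<tau>'} u"
    by (rule conf_embedding_of_biholo[OF I J, of UNIV]) (use u in simp)
  note d = densityD[OF density_dens[OF t(2) g(1)]]
  let ?v = "dens \<tau>' g"
  let ?w = "pull_density {0..\<tau>} {0..\<tau>'} u ?v"
  let ?m = "\<lambda>z. 2 * ln (cmod (lift_deriv {0..\<tau>} {0..\<tau>'} u z))"
  have wn: "pd {0..\<tau>} ?w \<i> z = 0" "pd {0..\<tau>} ?m \<i> z = 0" if z: "Im z = 0 \<or> Im z = \<tau>" for z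
  proof -
    obtain c where c: "Im z = c" "c \<in> {0..\<tau>}" "boundary_level \<tau>' u c" using z b t by auto
    from pull_density_boundary[OF I t(2) ce d(1,2) c(2,3,1)]
    obtain N H where 1: "pd {0..\<tau>} ?m \<i> z = 0" and N: "z \<in> N" "Im (H z) = 0 \<or> Im (H z) = \<tau>'"
      "pd {0..\<tau>} ?w \<i> z = Re (deriv H z) * pd {0..\<tau>'} ?v \<i> (H z)" by auto
    have "pd {0..\<tau>'} ?v \<i> (H z) = 0"
      using N(2) g(2) complex_surj[of "H z"] unfolding neumann_def by metis
    then show "pd {0..\<tau>} ?w \<i> z = 0" "pd {0..\<tau>} ?m \<i> z = 0" using N 1 by auto
  qed
  have img: "u ` (UNIV \<times> {0..\<tau>}) = UNIV \<times> {0..\<tau>'}"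
  proof -
    obtain G where "homeomorphic_maps (topo (flat_cyl {0..\<tau>})) (topo (flat_cyl {0..\<tau>'})) u G"
      using u by (auto simp: biholo_def)
    then have "homeomorphic_map (topo (flat_cyl {0..\<tau>})) (topo (flat_cyl {0..\<tau>'})) u"
      using homeomorphic_maps_map by blast
    from homeomorphic_imp_surjective_map[OF this] show ?thesis by simp
  qed
  have "energy \<tau> ?w = area_integral (UNIV \<times> {0..\<tau>'}) (\<lambda>x. descend ?v x * descend (lap {0..\<tau>'} ?v) x)"
    unfolding energy_def img[symmetric]
    by (rule area_integral_pull(2)[OF I t(2) ce d(1,2), symmetric]) (use t wn in auto)
  also have "\<dots> = integral (period_box 0 \<tau>') (\<lambda>z. descend ?v (cyl_pt z) * descend (lap {0..\<tau>'} ?v) (cyl_pt z))"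
  proof (rule area_integral_box(2))
    have "continuous_on (period_box 0 \<tau>') (\<lambda>z. ?v z * lap {0..\<tau>'} ?v z)"
      by (rule continuous_on_subset[OF smooth_on_continuous period_box_strip])
        (auto intro!: smooth_on_mult d(1) smooth_on_lap[OF J d(1)])
    then show "continuous_on (period_box 0 \<tau>') (\<lambda>z. descend ?v (cyl_pt z) * descend (lap {0..\<tau>'} ?v) (cyl_pt z))"
      by (rule continuous_on_eq)
        (use period_box_strip[of 0 \<tau>' "{0..\<tau>'}"] descend[of "{0..\<tau>'}" ?v, OF d(2)]
          descend[of "{0..\<tau>'}" "lap {0..\<tau>'} ?v", OF lap_periodic[OF J d(1,2)]] in \<open>auto simp: subset_iff\<close>)
  qed
  also have "\<dots> = energy \<tau>' ?v"
    unfolding energy_def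
    by (rule integral_cong)
      (use period_box_strip[of 0 \<tau>' "{0..\<tau>'}"] descend[of "{0..\<tau>'}" ?v, OF d(2)]
        descend[of "{0..\<tau>'}" "lap {0..\<tau>'} ?v", OF lap_periodic[OF J d(1,2)]] in \<open>auto simp: subset_iff\<close>)
  finally have "energy \<tau> ?w = energy \<tau>' ?v" .
  moreover have "neumann \<tau> ?w" using wn(1) by (simp add: neumann_def)
  ultimately show ?thesis using pull_metric_density[OF I t(2) ce g(1)] by blast
qed

lemma density_flat_metric: "density I flat_metric (\<lambda>_. 0)" "0 < \<tau> \<Longrightarrow> neumann \<tau> (\<lambda>_. 0)" "energy \<tau> (\<lambda>_. 0) = 0"
proof -
  show "density I flat_metric (\<lambda>_. 0)" by (auto simp: density_def flat_metric_def smooth_on_const)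
  show "neumann \<tau> (\<lambda>_. 0)" if "0 < \<tau>"
    unfolding neumann_def using pd_eqI[OF cyl_ivl_closed[OF that] _ has_derivative_const] that by simp
  show "energy \<tau> (\<lambda>_. 0) = 0" by (simp add: energy_def)
qed

text \<open>Every candidate in the description of \<open>mu\<close> is evaluated: its scalar exp (-
  c E / (96 pi)) cancels the weight of the pulled-back metric, whose energy is again E. This gives
  uniqueness; A itself with the identity gives existence.\<close>

lemma mu_line_vec:
  assumes A: "flat_model 1 A" "cylinder A" and g0: "g0 \<in> Adm A"
    and b2: "bd2 A (circ 0) = (circ 0, 1)"
  shows "mu c A = line_vec c A 1"
  unfolding mu_def
proof (rule the_equality)
  have S: "surf A = flat_cyl {0..1}" and rA: "range (bd1 A) \<union> range (bd2 A) = UNIV \<times> {0, 1}"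
    using A by (auto simp: flat_model_def)
  have *: "v = line_vec c A 1"
    if B: "uniformized B" "cyl_iso A B u" "g \<in> Adm B"
      and v: "v = fmult c A (exp (- c * anomaly (surf B) flat_metric g)) (pull_metric (surf B) u g)" for B u g v
  proof -
    obtain \<tau> where t: "\<tau> > 0" and SB: "surf B = flat_cyl {0..\<tau>}" and cB: "cylinder B"
      using B(1) by (auto simp: uniformized_def)
    have rB: "range (bd1 B) \<union> range (bd2 B) = UNIV \<times> {0, \<tau>}"
      using cB surface_boundary_flat[OF t] by (simp add: cylinder_def SB)
    then have mB: "flat_model \<tau> B" using t SB by (simp add: flat_model_def)
    note gB = Adm_neumann[OF mB B(3)]
    have iso: "biholo (flat_cyl {0..1}) (flat_cyl {0..\<tau>}) u" "u \<circ> bd1 A = bd1 B" "u \<circ> bd2 A = bd2 B"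
      using B(2) S SB by (auto simp: cyl_iso_def)
    have bl: "boundary_level \<tau> u c'" if c': "c' = 0 \<or> c' = 1" for c'
      unfolding boundary_level_def
    proof
      fix x
      have "(circ x, c') \<in> range (bd1 A) \<union> range (bd2 A)" unfolding rA using c' by auto
      then obtain q where "(circ x, c') = bd1 A q \<or> (circ x, c') = bd2 A q" by blast
      then have "u (circ x, c') = bd1 B q \<or> u (circ x, c') = bd2 B q" using iso(2,3) by (metis comp_apply)
      then have "u (circ x, c') \<in> UNIV \<times> {0, \<tau>}" unfolding rB[symmetric] by auto
      then show "snd (u (circ x, c')) = 0 \<or> snd (u (circ x, c')) = \<tau>" by (metis insertE mem_Times_iff singletonD)
    qed
    obtain w where w: "density {0..1} (pull_metric (flat_cyl {0..\<tau>}) u g) w" "neumann 1 w" "energy 1 w = energy \<tau> (dens \<tau> g)"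
      using energy_biholo[OF _ t iso(1) bl bl gB(1,3)] by auto
    have "anomaly (flat_cyl {0..\<tau>}) flat_metric g = energy \<tau> (dens \<tau> g) / (96 * pi)"
      using anomaly_density[OF t density_flat_metric(1) gB(2) density_flat_metric(2)[OF t] gB(3)]
      by (simp add: density_flat_metric(3))
    then show ?thesis
      unfolding v SB fmult_line_vec[OF A(1) w(1,2)] w(3) by (simp add: exp_minus)
  qed
  show "\<exists>B u g. uniformized B \<and> cyl_iso A B u \<and> g \<in> Adm B \<and>
     line_vec c A 1 = fmult c A (exp (- c * anomaly (surf B) flat_metric g)) (pull_metric (surf B) u g)"
  proof -
    have "uniformized A" using A(2) S b2 by (auto simp: uniformized_def intro!: exI[of _ 1])
    moreover have "cyl_iso A A id"
      using A(2) by (auto simp: cyl_iso_def biholo_def cylinder_def riemann_surface_def homeomorphic_maps_def intro!: exI[of _ id])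
    ultimately show ?thesis using *[of A id g0] g0 by blast
  qed
  show "v = line_vec c A 1" if "\<exists>B u g. uniformized B \<and> cyl_iso A B u \<and> g \<in> Adm B \<and>
     v = fmult c A (exp (- c * anomaly (surf B) flat_metric g)) (pull_metric (surf B) u g)" for v
    using that * by blast
qed

section \<open>The canonical isomorphisms in coordinates\<close>

text \<open>Locality of the energy. The cylinder is cut along the image of the circle at height r:
  beyond it the two metrics agree and contribute equally, while the collar integral is read in the
  coordinate given by F.\<close>

lemma energy_difference:
  assumes I: "cyl_ivl I a b" "0 \<in> I" and F: "conf_embedding I {0..1} F" and bl: "boundary_level 1 F 0"
    and r: "0 < r" "{0..r} \<subseteq> I" and g: "conf_metric (flat_cyl {0..1}) g" "neumann 1 (dens 1 g)"
    and h: "conf_metric (flat_cyl {0..1}) h" "neumann 1 (dens 1 h)"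
    and N: "open N" "\<And>x. Complex x r \<in> N"
    and wg: "\<And>z. z \<in> N \<Longrightarrow> Im z \<in> I \<Longrightarrow> pull_density I {0..1} F (dens 1 g) z = 0"
    and wh: "\<And>z. z \<in> N \<Longrightarrow> Im z \<in> I \<Longrightarrow> pull_density I {0..1} F (dens 1 h) z = 0"
    and gh: "\<And>z. Im z \<in> {0..1} \<Longrightarrow> cyl_pt z \<notin> F ` (UNIV \<times> {0..r}) \<Longrightarrow> dens 1 g z = dens 1 h z"
  shows "energy 1 (dens 1 g) - energy 1 (dens 1 h)
    = integral (period_box 0 r) (\<lambda>z. pull_density I {0..1} F (dens 1 g) z * lap I (pull_density I {0..1} F (dens 1 g)) z)
    - integral (period_box 0 r) (\<lambda>z. pull_density I {0..1} F (dens 1 h) z * lap I (pull_density I {0..1} F (dens 1 h)) z)"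
proof -
  have J: "cyl_ivl {0..1} 0 1" by (simp add: cyl_ivl_def)
  let ?U = "UNIV \<times> {0..r} :: (circle \<times> real) set"
  define \<rho> where "\<rho> g x = descend (dens 1 g) x * descend (lap {0..1} (dens 1 g)) x" for g x
  have one: "area_integrable (F ` ?U) (\<rho> g)"
    "area_integral (F ` ?U) (\<rho> g) = integral (period_box 0 r) (\<lambda>z. pull_density I {0..1} F (dens 1 g) z * lap I (pull_density I {0..1} F (dens 1 g)) z)"
    "area_integrable (UNIV \<times> {0..1}) (\<rho> g)" "area_integral (UNIV \<times> {0..1}) (\<rho> g) = energy 1 (dens 1 g)"
    if g: "conf_metric (flat_cyl {0..1}) g" "neumann 1 (dens 1 g)"
      and wg: "\<And>z. z \<in> N \<Longrightarrow> Im z \<in> I \<Longrightarrow> pull_density I {0..1} F (dens 1 g) z = 0" for g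
  proof -
    note d = densityD[OF density_dens[OF zero_less_one g(1)]]
    let ?v = "dens 1 g" let ?w = "pull_density I {0..1} F ?v"
    let ?m = "\<lambda>z. 2 * ln (cmod (lift_deriv I {0..1} F z))"
    have b0: "pd I ?w \<i> z = 0 \<and> pd I ?m \<i> z = 0" if z: "Im z = 0" for z
    proof -
      from pull_density_boundary[OF I(1) zero_less_one F d(1,2) I(2) bl z]
      obtain M H where 1: "pd I ?m \<i> z = 0" and M: "z \<in> M" "Im (H z) = 0 \<or> Im (H z) = 1"
        "pd I ?w \<i> z = Re (deriv H z) * pd {0..1} ?v \<i> (H z)" by auto
      have "pd {0..1} ?v \<i> (H z) = 0" using M(2) g(2) complex_surj[of "H z"] unfolding neumann_def by metis
      then show ?thesis using M 1 by auto
    qed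
    \<comment> \<open>Vanishing on a neighbourhood gives the normal derivative as well, so both
      sides of the Green condition are zero at height r.\<close>
    have br: "?w z = 0 \<and> pd I ?w \<i> z = 0" if z: "Im z = r" for z
    proof -
      have zN: "z \<in> N" using N(2)[of "Re z"] z complex_surj[of z] by simp
      have zI: "Im z \<in> I" using z r by auto
      have "pd I ?w \<i> z = pd I (\<lambda>_. 0) \<i> z"
        by (rule pd_local[OF I(1) smooth_on_const N(1) zN]) (use zI wg in auto)
      also have "\<dots> = 0" using pd_eqI[OF I(1) _ has_derivative_const] zI by simp
      finally show ?thesis using wg[OF zN zI] by simp
    qed
    have bd: "?m z * pd I ?w \<i> z = ?w z * pd I ?m \<i> z" if "Im z = 0 \<or> Im z = r" for z
      using that b0[of z] br[of z] by auto
    show "area_integrable (F ` ?U) (\<rho> g)"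
      "area_integral (F ` ?U) (\<rho> g) = integral (period_box 0 r) (\<lambda>z. ?w z * lap I ?w z)"
      unfolding \<rho>_def
      using area_integral_pull[OF I(1) zero_less_one F d(1,2) less_imp_le[OF r(1)] r(2) bd] by auto
    have box: "period_box 0 1 \<subseteq> strip {0..1}" by (rule period_box_strip) simp
    have \<rho>v: "\<rho> g (cyl_pt z) = ?v z * lap {0..1} ?v z" if "Im z \<in> {0..1}" for z
      unfolding \<rho>_def using descend[of "{0..1}" ?v, OF d(2) that]
        descend[of "{0..1}" "lap {0..1} ?v", OF lap_periodic[OF J d(1,2)] that] by simp
    have "continuous_on (period_box 0 1) (\<lambda>z. ?v z * lap {0..1} ?v z)"
      by (rule continuous_on_subset[OF smooth_on_continuous box])
        (intro smooth_on_mult d(1) smooth_on_lap[OF J d(1)])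
    then have cont: "continuous_on (period_box 0 1) (\<lambda>z. \<rho> g (cyl_pt z))"
      by (rule continuous_on_eq) (use \<rho>v box in \<open>auto simp: subset_iff\<close>)
    show "area_integrable (UNIV \<times> {0..1}) (\<rho> g)" by (rule area_integral_box(1)[OF cont])
    have "area_integral (UNIV \<times> {0..1}) (\<rho> g) = integral (period_box 0 1) (\<lambda>z. \<rho> g (cyl_pt z))"
      by (rule area_integral_box(2)[OF cont])
    also have "\<dots> = energy 1 ?v" unfolding energy_def
      by (rule integral_cong) (use \<rho>v box in \<open>auto simp: subset_iff\<close>)
    finally show "area_integral (UNIV \<times> {0..1}) (\<rho> g) = energy 1 ?v" .
  qed
  let ?R = "Ecyl ` (UNIV \<times> {0..1})" and ?P = "Ecyl ` F ` ?U"
  have FU: "F ` ?U \<subseteq> UNIV \<times> {0..1}"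
  proof
    fix x assume "x \<in> F ` ?U"
    then obtain p where p: "p \<in> ?U" "x = F p" by blast
    obtain z where z: "p = cyl_pt z" by (rule cyl_pt_surj)
    then have "Im z \<in> {0..r}" using p(1) by (simp only: cyl_pt_in)
    then have zI: "Im z \<in> I" using r(2) by blast
    then obtain M H where "z \<in> M" "lift_on I {0..1} F M H" using F unfolding conf_embedding_def by blast
    from lift_onD(4,5)[OF this(2,1) zI] have H: "Im (H z) \<in> {0..1}" "x = cyl_pt (H z)" using p z by auto
    then show "x \<in> UNIV \<times> {0..1}" by (simp only: cyl_pt_in)
  qed
  have PR: "?P \<subseteq> ?R" using FU by blast
  have diff: "integral (?R - ?P) (area_density (\<rho> g)) = energy 1 (dens 1 g)
      - integral (period_box 0 r) (\<lambda>z. pull_density I {0..1} F (dens 1 g) z * lap I (pull_density I {0..1} F (dens 1 g)) z)"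
    if "conf_metric (flat_cyl {0..1}) g" "neumann 1 (dens 1 g)"
      "\<And>z. z \<in> N \<Longrightarrow> Im z \<in> I \<Longrightarrow> pull_density I {0..1} F (dens 1 g) z = 0" for g
  proof -
    note o = one[OF that]
    have "integral (?R - ?P) (area_density (\<rho> g)) = integral ?R (area_density (\<rho> g)) - integral ?P (area_density (\<rho> g))"
    proof (rule integral_setdiff)
      show "area_density (\<rho> g) integrable_on ?R" "area_density (\<rho> g) integrable_on ?P"
        using o(1,3) by (auto simp: area_integrable_def absolutely_integrable_on_def)
      show "negligible (?P - ?R)" using PR by (simp add: Diff_eq_empty_iff[THEN iffD2])
    qed
    then show ?thesis using o(2,4) by (simp add: area_integral_def)
  qed
  have "integral (?R - ?P) (area_density (\<rho> g)) = integral (?R - ?P) (area_density (\<rho> h))"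
  proof (rule integral_cong)
    fix \<zeta> assume \<zeta>: "\<zeta> \<in> ?R - ?P"
    then obtain p where p: "p \<in> UNIV \<times> {0..1}" "\<zeta> = Ecyl p" by blast
    obtain z where z: "p = cyl_pt z" by (rule cyl_pt_surj)
    have zJ: "Im z \<in> {0..1}" using p z by simp
    have "Ecyl p \<notin> ?P" using \<zeta>[unfolded p(2)] by (elim DiffE)
    then have "p \<notin> F ` ?U" by (meson imageI)
    then have zP: "cyl_pt z \<notin> F ` ?U" unfolding z .
    let ?f = "\<lambda>z. Ecyl (F (cyl_pt z))"
    have Pf: "?P = ?f ` period_box 0 r"
    proof -
      have "half_box 0 r \<subseteq> period_box 0 r" by (rule half_box(2))
      moreover have "cyl_pt ` period_box 0 r \<subseteq> ?U" by (auto simp: period_box_def cbox_complex cyl_pt_def)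
      ultimately have "cyl_pt ` period_box 0 r = ?U"
        using half_box(4)[of 0 r] image_mono[of "half_box 0 r" "period_box 0 r" cyl_pt] by (intro equalityI) simp_all
      then show ?thesis by (metis image_image)
    qed
    have "continuous_on (period_box 0 r) ?f"
      unfolding continuous_on_eq_continuous_within
    proof
      fix u assume u: "u \<in> period_box 0 r"
      then have uI: "Im u \<in> I" using period_box_strip[OF r(2)] by auto
      then obtain M H where M: "u \<in> M" "lift_on I {0..1} F M H" using F unfolding conf_embedding_def by blast
      note l = lift_onD[OF M(2)]
      have "(?f has_field_derivative \<i> * deriv H u * ?f u) (at u within period_box 0 r)"
        by (rule Ecyl_lift_derivative[OF has_field_derivative_at_within[OF holomorphic_derivI[OF l(2,1) M(1)]] _ l(1) M(1) u])
          (use l(5) period_box_strip[OF r(2)] in auto)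
      then show "continuous (at u within period_box 0 r) ?f" by (rule DERIV_continuous)
    qed
    \<comment> \<open>The image of the collar is compact, so its complement is open and equality of
      the densities there passes to their Laplacians.\<close>
    then have "compact ?P" unfolding Pf by (rule compact_continuous_image) (simp add: period_box_def)
    then have "closed ?P" by (rule compact_imp_closed)
    define M where "M = (\<lambda>u. exp (\<i> * u)) -` (- ?P)"
    have M: "open M" unfolding M_def by (rule open_vimage) (use \<open>closed ?P\<close> in \<open>auto intro!: continuous_intros\<close>)
    have zM: "z \<in> M" using \<zeta> p z by (simp add: M_def Ecyl_cyl_pt)
    have eq: "dens 1 h u = dens 1 g u" if "u \<in> M \<inter> strip {0..1}" for u
    proof -
      have "Ecyl (cyl_pt u) \<notin> ?P" using that by (simp add: M_def Ecyl_cyl_pt)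
      then have "cyl_pt u \<notin> F ` ?U" by blast
      then show ?thesis using gh[of u] that by simp
    qed
    note dg = densityD[OF density_dens[OF zero_less_one g(1)]] and dh = densityD[OF density_dens[OF zero_less_one h(1)]]
    have "lap {0..1} (dens 1 g) z = lap {0..1} (dens 1 h) z"
      by (rule lap_local[OF J dh(1) M zM]) (use zJ eq in auto)
    moreover have "dens 1 g z = dens 1 h z" using gh[OF zJ zP] .
    ultimately have "\<rho> g p = \<rho> h p"
      unfolding \<rho>_def z
      using descend[of "{0..1}" "dens 1 g", OF dg(2) zJ] descend[of "{0..1}" "dens 1 h", OF dh(2) zJ]
        descend[of "{0..1}" "lap {0..1} (dens 1 g)", OF lap_periodic[OF J dg(1,2)] zJ]
        descend[of "{0..1}" "lap {0..1} (dens 1 h)", OF lap_periodic[OF J dh(1,2)] zJ] by simp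
    then show "area_density (\<rho> g) \<zeta> = area_density (\<rho> h) \<zeta>"
      unfolding area_density_def p(2) inv_f_f[OF inj_Ecyl] by simp
  qed
  then show ?thesis using diff[OF g wg] diff[OF h wh] by simp
qed

section \<open>Real-analytic functions and their extensions\<close>

text \<open>A real power series converges in the complex disc of the same radius. Conversely, the
  Taylor series of a holomorphic function that is real on the axis yields real coefficients by
  taking real parts.\<close>

lemma real_analytic_iff:
  "real_analytic f \<longleftrightarrow> (\<forall>x. \<exists>r>0. \<exists>h. h holomorphic_on ball (of_real x) r \<and> (\<forall>y. \<bar>y - x\<bar> < r \<longrightarrow> h (of_real y) = of_real (f y)))"
proof
  assume f: "real_analytic f"
  show "\<forall>x. \<exists>r>0. \<exists>h. h holomorphic_on ball (of_real x) r \<and> (\<forall>y. \<bar>y - x\<bar> < r \<longrightarrow> h (of_real y) = of_real (f y))"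
  proof
    fix x
    obtain r a where r: "r > 0" and a: "\<And>y. \<bar>y - x\<bar> < r \<Longrightarrow> (\<lambda>n. a n * (y - x) ^ n) sums f y"
      using f unfolding real_analytic_def by metis
    define h where "h z = (\<Sum>n. of_real (a n) * (z - of_real x) ^ n)" for z :: complex
    have sums: "(\<lambda>n. of_real (a n) * (z - of_real x) ^ n) sums h z" if "z \<in> ball (of_real x) r" for z
    proof -
      have d: "cmod (z - of_real x) < r" using that by (simp add: dist_norm norm_minus_commute)
      \<comment> \<open>An intermediate radius: the series converges at the real point x + s by
        hypothesis, hence at every complex point closer to x.\<close>
      then obtain s where s: "cmod (z - of_real x) < s" "s < r" using dense by blast
      have "0 \<le> s" using s(1) norm_ge_zero[of "z - of_real x"] by linarith
      then have "summable (\<lambda>n. a n * s ^ n)" using a[of "x + s"] s(2) by (simp add: sums_iff)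
      then have "summable (\<lambda>n. complex_of_real (a n * s ^ n))" by (simp only: summable_of_real_iff)
      then have "summable (\<lambda>n. of_real (a n) * (of_real s :: complex) ^ n)" by simp
      then have "summable (\<lambda>n. of_real (a n) * (z - of_real x) ^ n)"
        by (rule powser_inside) (use s \<open>0 \<le> s\<close> in simp)
      then show ?thesis unfolding h_def by (rule summable_sums)
    qed
    have "h holomorphic_on ball (of_real x) r"
      by (rule power_series_holomorphic[OF sums])
    moreover have "h (of_real y) = of_real (f y)" if "\<bar>y - x\<bar> < r" for y
    proof -
      have 1: "(\<lambda>n. complex_of_real (a n * (y - x) ^ n)) sums of_real (f y)"
        using a[OF that] by (simp only: sums_of_real_iff)
      have "of_real y \<in> ball (complex_of_real x) r" using that
        by (simp add: dist_norm norm_minus_commute flip: of_real_diff)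
      from sums[OF this] have "(\<lambda>n. complex_of_real (a n * (y - x) ^ n)) sums h (of_real y)" by simp
      with 1 show ?thesis using sums_unique2 by blast
    qed
    ultimately show "\<exists>r>0. \<exists>h. h holomorphic_on ball (of_real x) r \<and> (\<forall>y. \<bar>y - x\<bar> < r \<longrightarrow> h (of_real y) = of_real (f y))"
      using r by blast
  qed
next
  assume *: "\<forall>x. \<exists>r>0. \<exists>h. h holomorphic_on ball (of_real x) r \<and> (\<forall>y. \<bar>y - x\<bar> < r \<longrightarrow> h (of_real y) = of_real (f y))"
  show "real_analytic f"
    unfolding real_analytic_def
  proof
    fix x
    obtain r h where r: "r > 0" and h: "h holomorphic_on ball (of_real x) r" "\<And>y. \<bar>y - x\<bar> < r \<Longrightarrow> h (of_real y) = of_real (f y)"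
      using * by metis
    define a where "a n = Re ((deriv ^^ n) h (of_real x) / fact n)" for n
    have "(\<lambda>n. a n * (y - x) ^ n) sums f y" if y: "\<bar>y - x\<bar> < r" for y
    proof -
      have "of_real y \<in> ball (complex_of_real x) r" using y
        by (simp add: dist_norm norm_minus_commute flip: of_real_diff)
      from sums_Re[OF holomorphic_power_series[OF h(1) this]]
      have s: "(\<lambda>n. Re ((deriv ^^ n) h (of_real x) / fact n * (of_real y - of_real x) ^ n)) sums f y"
        using h(2)[OF y] by simp
      have "Re (c * (of_real y - of_real x) ^ n) = Re c * (y - x) ^ n" for c n
        by (simp flip: of_real_diff of_real_power)
      then show ?thesis using s unfolding a_def by (simp only:)
    qed
    then show "\<exists>r>0. \<exists>a. \<forall>y. \<bar>y - x\<bar> < r \<longrightarrow> (\<lambda>n. a n * (y - x) ^ n) sums f y" using r by blast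
  qed
qed

lemma real_analytic_continuous: "real_analytic f \<Longrightarrow> continuous_on UNIV f"
proof (rule continuous_at_imp_continuous_on, rule ballI)
  fix x assume f: "real_analytic f"
  obtain r h where r: "r > 0" and h: "h holomorphic_on ball (of_real x) r" "\<And>y. \<bar>y - x\<bar> < r \<Longrightarrow> h (of_real y) = of_real (f y)"
    using f[unfolded real_analytic_iff] by metis
  have ch: "isCont h (of_real x)"
    using holomorphic_on_imp_continuous_on[OF h(1)] r by (simp add: continuous_on_eq_continuous_at)
  have "isCont (\<lambda>y. h (of_real y)) x"
    by (rule isCont_o2[where f=of_real and g=h, OF _ ch]) (intro continuous_intros)
  then have "isCont (\<lambda>y. Re (h (of_real y))) x" by (rule continuous_Re)
  moreover have "\<forall>\<^sub>F y in nhds x. Re (h (of_real y)) = f y"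
    using eventually_nhds_in_open[of "{x - r<..<x + r}" x] r by (auto elim!: eventually_mono simp: h(2) abs_less_iff)
  ultimately show "isCont f x" by (simp only: isCont_cong)
qed

lemma real_analytic_compose:
  assumes f: "real_analytic f" and g: "real_analytic g" shows "real_analytic (\<lambda>x. f (g x))"
  unfolding real_analytic_iff
proof
  fix x
  obtain r h where r: "r > 0" and h: "h holomorphic_on ball (of_real x) r" "\<And>y. \<bar>y - x\<bar> < r \<Longrightarrow> h (of_real y) = of_real (g y)"
    using g[unfolded real_analytic_iff] by metis
  obtain s k where s: "s > 0" and k: "k holomorphic_on ball (of_real (g x)) s" "\<And>y. \<bar>y - g x\<bar> < s \<Longrightarrow> k (of_real y) = of_real (f y)"
    using f[unfolded real_analytic_iff] by metis
  let ?M = "ball (complex_of_real x) r \<inter> h -` ball (of_real (g x)) s"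
  have "open ?M"
    by (rule continuous_open_preimage[OF holomorphic_on_imp_continuous_on[OF h(1)]]) auto
  moreover have "of_real x \<in> ?M" using r s h(2)[of x] by simp
  ultimately obtain e where e: "e > 0" "ball (of_real x) e \<subseteq> ?M" using openE by blast
  have "(\<lambda>z. k (h z)) holomorphic_on ball (of_real x) e"
    by (rule holomorphic_on_compose_gen[OF holomorphic_on_subset[OF h(1)] k(1), unfolded o_def]) (use e in auto)
  moreover have "k (h (of_real y)) = of_real (f (g y))" if y: "\<bar>y - x\<bar> < e" for y
  proof -
    have "complex_of_real y \<in> ball (of_real x) e" using y by (simp add: dist_norm norm_minus_commute flip: of_real_diff)
    then have yM: "complex_of_real y \<in> ball (of_real x) r" "h (of_real y) \<in> ball (of_real (g x)) s" using e(2) by blast+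
    have "\<bar>y - x\<bar> < r" using yM(1) by (simp add: dist_norm norm_minus_commute flip: of_real_diff)
    note hs = yM(2)
    have hy: "h (of_real y) = of_real (g y)" using h(2) \<open>\<bar>y - x\<bar> < r\<close> by blast
    have "\<bar>g y - g x\<bar> < s" using hs unfolding hy by (simp add: dist_norm norm_minus_commute flip: of_real_diff)
    then show ?thesis using k(2) hy by simp
  qed
  ultimately show "\<exists>r>0. \<exists>h. h holomorphic_on ball (of_real x) r \<and> (\<forall>y. \<bar>y - x\<bar> < r \<longrightarrow> h (of_real y) = of_real (f (g y)))"
    using e(1) by blast
qed

abbreviation band :: "real \<Rightarrow> complex set" where
  "band \<rho> \<equiv> {z. \<bar>Im z\<bar> < \<rho>}"

lemma open_band: "open (band \<rho>)" and convex_band: "convex (band \<rho>)"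
proof -
  show "open (band \<rho>)" by (intro open_Collect_less continuous_intros)
  have "band \<rho> = {z. Im z < \<rho>} \<inter> {z. - \<rho> < Im z}" by auto
  moreover have "convex {z. Im z < \<rho>}" "convex {z. - \<rho> < Im z}"
    by (simp_all add: convex_halfspace_Im_lt convex_halfspace_Im_gt)
  ultimately show "convex (band \<rho>)" by (simp add: convex_Int)
qed

lemma ball_subset_band: "ball (of_real 0) \<sigma> \<subseteq> band \<sigma>"
proof
  fix z :: complex assume "z \<in> ball (of_real 0) \<sigma>"
  then show "z \<in> band \<sigma>" using abs_Im_le_cmod[of z] by simp
qed

lemma analytic_continuation_real:
  assumes "open S" "connected S" and h: "f holomorphic_on S" "g holomorphic_on S"
    and e: "e > 0" "ball (of_real x) e \<subseteq> S" "\<And>y. \<bar>y - x\<bar> < e \<Longrightarrow> f (of_real y) = g (of_real y)" and z: "z \<in> S"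
  shows "f z = g z"
proof -
  let ?U = "of_real ` {y. \<bar>y - x\<bar> < e} :: complex set"
  have "of_real x islimpt ?U"
    unfolding islimpt_approachable
  proof (intro allI impI)
    fix d :: real assume d: "0 < d"
    define y where "y = x + min d e / 2"
    have "\<bar>y - x\<bar> < e" "\<bar>y - x\<bar> < d" "y \<noteq> x" using d e(1) by (auto simp: y_def min_def)
    then show "\<exists>x'\<in>?U. x' \<noteq> complex_of_real x \<and> dist x' (complex_of_real x) < d"
      by (intro bexI[of _ "of_real y"]) (auto simp: dist_norm simp flip: of_real_diff)
  qed
  moreover have "?U \<subseteq> S" using e(2) by (auto simp: subset_iff dist_norm norm_minus_commute simp flip: of_real_diff)
  moreover have "(\<lambda>z. f z - g z) holomorphic_on S" by (intro holomorphic_intros h)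
  moreover have "of_real x \<in> S" using e(1,2) by auto
  moreover have "f u - g u = 0" if "u \<in> ?U" for u using e(3) that by auto
  ultimately have "f z - g z = 0"
    using analytic_continuation[where f="\<lambda>z. f z - g z" and S=S and U="?U" and \<xi>="of_real x"] assms(1,2) z by blast
  then show ?thesis by simp
qed

lemma lebesgue_number:
  assumes "compact S" "S \<subseteq> \<Union>G" "\<forall>g\<in>G. open g"
  shows "\<exists>e>0. \<forall>x\<in>S. \<exists>g\<in>G. ball x e \<subseteq> g"
  by (rule Heine_Borel_lemma[OF assms(1,2)]) (use assms(3) in auto)

text \<open>One period of the real axis is compact, so a uniform radius exists there; periodicity
  carries it along the whole axis.\<close>

lemma periodic_open_contains_band:
  assumes U: "open U" "\<And>x::real. of_real x \<in> U" and per: "\<And>z. z \<in> U \<Longrightarrow> z + of_real (2 * pi) \<in> U" "\<And>z. z + of_real (2 * pi) \<in> U \<Longrightarrow> z \<in> U"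
  shows "\<exists>\<sigma>>0. band \<sigma> \<subseteq> U"
proof -
  have P: "z + of_real (2 * pi * of_int k) \<in> U \<longleftrightarrow> z \<in> U" for z and k :: int
  proof (rule periodic_int[where v="\<lambda>z. z \<in> U" and I=UNIV])
    show "(z + of_real (2 * pi) \<in> U) = (z \<in> U)" for z using per by blast
  qed simp
  have "compact (complex_of_real ` {0..2 * pi})" by (intro compact_continuous_image continuous_intros) auto
  moreover have "complex_of_real ` {0..2 * pi} \<subseteq> \<Union>{U}" using U(2) by auto
  ultimately have "\<exists>e>0. \<forall>x\<in>complex_of_real ` {0..2 * pi}. \<exists>g\<in>{U}. ball x e \<subseteq> g"
    by (rule lebesgue_number) (use U(1) in simp)
  then obtain e where e: "e > 0" "\<forall>x \<in> complex_of_real ` {0..2 * pi}. ball x e \<subseteq> U" by blast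
  have "z \<in> U" if z: "\<bar>Im z\<bar> < e" for z
  proof -
    have "cyl_pt z \<in> UNIV \<times> {Im z..Im z}" by simp
    then obtain w where w: "w \<in> half_box (Im z) (Im z)" "cyl_pt w = cyl_pt z" using half_box(4) by (metis imageE)
    obtain k :: int where k: "z = w + of_real (2 * pi * of_int k)" using w(2) unfolding cyl_pt_eq_iff by blast
    have "of_real (Re w) \<in> complex_of_real ` {0..2 * pi}" using w(1) by (auto simp: half_box_def)
    moreover have "w \<in> ball (of_real (Re w)) e"
    proof -
      have "of_real (Re w) - w = - (\<i> * of_real (Im w))" by (simp add: complex_eq_iff)
      then have "dist (of_real (Re w)) w = \<bar>Im w\<bar>" by (simp add: dist_norm norm_mult)
      moreover have "Im w = Im z" using w(1) by (simp add: half_box_def)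
      ultimately show ?thesis using z by simp
    qed
    ultimately have "w \<in> U" using e(2) by blast
    then show ?thesis using P k by simp
  qed
  then show ?thesis using e(1) by blast
qed

lemma real_periodic_int:
  assumes "\<And>x::real. f (x + 2 * pi) = f x + 2 * pi" shows "f (x + 2 * pi * of_int k) = f x + 2 * pi * of_int k"
  using periodic_int[where v="\<lambda>z. f (Re z) - Re z" and I=UNIV and z="of_real x" and k=k] assms by simp

text \<open>Compactness of a period makes the radius e of the local extensions uniform. Where two
  discs overlap the extensions agree, because they agree on a real interval.\<close>

lemma holomorphic_extension_band:
  assumes f: "real_analytic f" and per: "\<And>x. f (x + 2 * pi) = f x + 2 * pi"
  shows "\<exists>\<rho>>0. \<exists>\<Phi>. \<Phi> holomorphic_on band \<rho> \<and> (\<forall>x. \<Phi> (of_real x) = of_real (f x)) \<and>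
     (\<forall>z\<in>band \<rho>. \<Phi> (z + of_real (2 * pi)) = \<Phi> z + of_real (2 * pi))"
proof -
  define good where "good x r h \<longleftrightarrow> h holomorphic_on ball (complex_of_real x) r \<and> (\<forall>y. \<bar>y - x\<bar> < r \<longrightarrow> h (of_real y) = of_real (f y))" for x r h
  define G where "G = {ball (complex_of_real x) r | x r. \<exists>h. good x r h}"
  have ex: "\<exists>r>0. \<exists>h. good x r h" for x using f unfolding real_analytic_iff good_def by blast
  have "compact (complex_of_real ` {0..2 * pi})" by (intro compact_continuous_image continuous_intros) auto
  moreover have "complex_of_real ` {0..2 * pi} \<subseteq> \<Union>G"
  proof clarify
    fix x :: real
    obtain r h where "r > 0" "good x r h" using ex by blast
    then show "complex_of_real x \<in> \<Union>G" unfolding G_def by (intro UnionI[of "ball (of_real x) r"]) auto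
  qed
  ultimately have "\<exists>e>0. \<forall>x\<in>complex_of_real ` {0..2 * pi}. \<exists>g\<in>G. ball x e \<subseteq> g"
    by (rule lebesgue_number) (auto simp: G_def)
  then obtain e where e: "e > 0" "\<forall>x\<in>complex_of_real ` {0..2 * pi}. \<exists>g\<in>G. ball x e \<subseteq> g" by blast
  have loc0: "\<exists>h. good x e h" if x: "x \<in> {0..2 * pi}" for x
  proof -
    obtain g where "g \<in> G" "ball (of_real x) e \<subseteq> g" using e(2)[rule_format, OF imageI[OF x]] by blast
    then obtain c r h where c: "ball (of_real x) e \<subseteq> ball (complex_of_real c) r" "good c r h" by (auto simp: G_def)
    have "\<bar>y - c\<bar> < r" if "\<bar>y - x\<bar> < e" for y
    proof -
      have "complex_of_real y \<in> ball (of_real x) e" using that by (simp add: dist_norm norm_minus_commute flip: of_real_diff)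
      then have "complex_of_real y \<in> ball (of_real c) r" using c(1) by blast
      then show ?thesis by (simp add: dist_norm norm_minus_commute flip: of_real_diff)
    qed
    moreover have "h holomorphic_on ball (of_real x) e" using c unfolding good_def by (blast intro: holomorphic_on_subset)
    ultimately have "good x e h" using c(2) unfolding good_def by blast
    then show ?thesis by blast
  qed
  have loc: "\<exists>h. good x e h" for x
  proof -
    define k where "k = \<lfloor>x / (2 * pi)\<rfloor>"
    have "of_int k \<le> x / (2 * pi)" "x / (2 * pi) < of_int k + 1" unfolding k_def by linarith+
    then have "x - 2 * pi * of_int k \<in> {0..2 * pi}" by (simp add: field_simps)
    then obtain h where h: "good (x - 2 * pi * of_int k) e h" using loc0 by blast
    let ?p = "complex_of_real (2 * pi * of_int k)"
    have "good x e (\<lambda>z. h (z - ?p) + ?p)"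
      unfolding good_def
    proof (intro conjI allI impI)
      have "(\<lambda>z. h (z - ?p)) holomorphic_on ball (of_real x) e"
      proof (rule holomorphic_on_compose_gen[where g=h and f="\<lambda>z. z - ?p", unfolded o_def])
        show "h holomorphic_on ball (of_real (x - 2 * pi * of_int k)) e" using h by (simp add: good_def)
      qed (auto intro!: holomorphic_intros simp: dist_norm algebra_simps)
      then show "(\<lambda>z. h (z - ?p) + ?p) holomorphic_on ball (of_real x) e" by (intro holomorphic_intros)
      fix y assume "\<bar>y - x\<bar> < e"
      then have "\<bar>(y - 2 * pi * of_int k) - (x - 2 * pi * of_int k)\<bar> < e" by simp
      then have "h (of_real (y - 2 * pi * of_int k)) = of_real (f (y - 2 * pi * of_int k))" using h unfolding good_def by blast
      moreover have "f y = f (y - 2 * pi * of_int k) + 2 * pi * of_int k"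
        using real_periodic_int[of f "y - 2 * pi * of_int k" k, OF per] by simp
      ultimately show "h (of_real y - ?p) + ?p = of_real (f y)" by simp
    qed
    then show ?thesis by blast
  qed
  then obtain h where h: "\<And>x. good x e (h x)" by metis
  \<comment> \<open>Each z is evaluated in the disc centred at its foot on the real axis.\<close>
  define \<Phi> where "\<Phi> z = h (Re z) z" for z
  have near: "\<Phi> z = h x z" if z: "z \<in> ball (complex_of_real x) e" "\<bar>Im z\<bar> < e" for z x
  proof -
    let ?x = "Re z"
    have "complex_of_real x - z = of_real (x - ?x) - \<i> * of_real (Im z)" by (simp add: complex_eq_iff)
    have xx: "\<bar>?x - x\<bar> < e" using z(1) abs_Re_le_cmod[of "z - of_real x"] by (simp add: dist_norm norm_minus_commute)
    have zx: "z \<in> ball (of_real ?x) e"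
    proof -
      have "of_real ?x - z = - (\<i> * of_real (Im z))" by (simp add: complex_eq_iff)
      then have "dist (of_real ?x) z = \<bar>Im z\<bar>" by (simp add: dist_norm norm_mult)
      then show ?thesis using z(2) by simp
    qed
    let ?S = "ball (complex_of_real ?x) e \<inter> ball (of_real x) e"
    have "of_real ?x \<in> ?S" using xx e(1) by (simp add: dist_norm norm_minus_commute flip: of_real_diff)
    then obtain d where d: "d > 0" "ball (of_real ?x) d \<subseteq> ?S" using openE[of ?S] by (metis open_Int open_ball)
    have "h ?x z = h x z"
    proof (rule analytic_continuation_real[where S="?S" and e=d and x="?x" and f="h ?x" and g="h x"])
      show "connected ?S" by (intro convex_connected convex_Int convex_ball)
      show "h ?x holomorphic_on ?S" "h x holomorphic_on ?S" using h unfolding good_def by (auto intro: holomorphic_on_subset)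
      fix y assume "\<bar>y - ?x\<bar> < d"
      then have "complex_of_real y \<in> ball (of_real ?x) d" by (simp add: dist_norm norm_minus_commute flip: of_real_diff)
      then have "complex_of_real y \<in> ?S" using d(2) by blast
      then have "\<bar>y - ?x\<bar> < e" "\<bar>y - x\<bar> < e" by (auto simp: dist_norm norm_minus_commute simp flip: of_real_diff)
      then show "h ?x (of_real y) = h x (of_real y)" using h unfolding good_def by auto
    qed (use d zx z in auto)
    then show ?thesis by (simp add: \<Phi>_def)
  qed
  have reals: "\<Phi> (of_real x) = of_real (f x)" for x using h[of x] e(1) unfolding \<Phi>_def good_def by simp
  have hol: "\<Phi> holomorphic_on band e"
    unfolding holomorphic_on_open[OF open_band]
  proof
    fix z assume z: "z \<in> band e"
    let ?B = "ball (complex_of_real (Re z)) e \<inter> band e"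
    have zB: "z \<in> ?B"
    proof -
      have "of_real (Re z) - z = - (\<i> * of_real (Im z))" by (simp add: complex_eq_iff)
      then have "dist (of_real (Re z)) z = \<bar>Im z\<bar>" by (simp add: dist_norm norm_mult)
      then show ?thesis using z by simp
    qed
    have "h (Re z) holomorphic_on ball (complex_of_real (Re z)) e" using h[of "Re z"] unfolding good_def by blast
    then have "(h (Re z) has_field_derivative deriv (h (Re z)) z) (at z)" using zB by (intro holomorphic_derivI[OF _ open_ball]) auto
    then have "(\<Phi> has_field_derivative deriv (h (Re z)) z) (at z)"
      by (rule has_field_derivative_transform_within_open[OF _ _ zB]) (auto simp: near open_band)
    then show "\<exists>f'. (\<Phi> has_field_derivative f') (at z)" ..
  qed
  have "\<Phi> (z + of_real (2 * pi)) = \<Phi> z + of_real (2 * pi)" if z: "z \<in> band e" for z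
  proof (rule analytic_continuation_real[OF open_band convex_connected[OF convex_band], where e=e and x=0 and
      f="\<lambda>z. \<Phi> (z + of_real (2 * pi))" and g="\<lambda>z. \<Phi> z + of_real (2 * pi)"])
    show "(\<lambda>z. \<Phi> (z + of_real (2 * pi))) holomorphic_on band e"
      by (rule holomorphic_on_compose_gen[OF _ hol, unfolded o_def]) (auto intro!: holomorphic_intros)
    show "(\<lambda>z. \<Phi> z + of_real (2 * pi)) holomorphic_on band e" by (intro holomorphic_intros hol)
    show "ball (of_real 0) e \<subseteq> band e" by (rule ball_subset_band)
    show "\<Phi> (of_real y + of_real (2 * pi)) = \<Phi> (of_real y) + of_real (2 * pi)" for y
      using reals[of "y + 2 * pi"] reals[of y] per by simp
  qed (use e z in auto)
  then show ?thesis using e(1) hol reals by blast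
qed

section \<open>Extensions of analytic circle diffeomorphisms\<close>

text \<open>Extensions of mutually inverse lifts to a common band. Images may leave the band, so the
  inverse relations are conditional; preservation of Im z \<ge> 0 is what lets the maps act on
  collars.\<close>

definition ext_pair :: "(circle \<Rightarrow> circle) \<Rightarrow> (complex \<Rightarrow> complex) \<Rightarrow> (complex \<Rightarrow> complex) \<Rightarrow> real \<Rightarrow> bool" where
  "ext_pair \<phi> \<Phi> \<Psi> \<rho> \<longleftrightarrow> 0 < \<rho> \<and> \<Phi> holomorphic_on band \<rho> \<and> \<Psi> holomorphic_on band \<rho> \<and>
     (\<forall>z\<in>band \<rho>. \<Phi> (z + of_real (2 * pi)) = \<Phi> z + of_real (2 * pi)) \<and>
     (\<forall>z\<in>band \<rho>. \<Psi> (z + of_real (2 * pi)) = \<Psi> z + of_real (2 * pi)) \<and>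
     (\<forall>x::real. Im (\<Phi> (of_real x)) = 0) \<and> (\<forall>x::real. Im (\<Psi> (of_real x)) = 0) \<and>
     (\<forall>z\<in>band \<rho>. 0 \<le> Im z \<longrightarrow> 0 \<le> Im (\<Phi> z)) \<and> (\<forall>z\<in>band \<rho>. 0 \<le> Im z \<longrightarrow> 0 \<le> Im (\<Psi> z)) \<and>
     (\<forall>z\<in>band \<rho>. \<Phi> z \<in> band \<rho> \<longrightarrow> \<Psi> (\<Phi> z) = z) \<and> (\<forall>z\<in>band \<rho>. \<Psi> z \<in> band \<rho> \<longrightarrow> \<Phi> (\<Psi> z) = z) \<and>
     (\<forall>x. \<phi> (circ x) = circ (Re (\<Phi> (of_real x))))"

lemma small_image_band:
  assumes r: "0 < \<rho>" and h: "\<Phi> holomorphic_on band \<rho>" and per: "\<And>z. z \<in> band \<rho> \<Longrightarrow> \<Phi> (z + of_real (2 * pi)) = \<Phi> z + of_real (2 * pi)"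
    and re: "\<And>x::real. Im (\<Phi> (of_real x)) = 0" and e: "0 < \<eta>"
  shows "\<exists>\<sigma>>0. \<sigma> \<le> \<rho> \<and> \<Phi> ` band \<sigma> \<subseteq> band \<eta>"
proof -
  have o: "open (band \<rho> \<inter> \<Phi> -` band \<eta>)"
    by (rule continuous_open_preimage[OF holomorphic_on_imp_continuous_on[OF h] open_band open_band])
  have "\<exists>\<sigma>>0. band \<sigma> \<subseteq> band \<rho> \<inter> \<Phi> -` band \<eta>"
  proof (rule periodic_open_contains_band[OF o])
    fix z assume "z + of_real (2 * pi) \<in> band \<rho> \<inter> \<Phi> -` band \<eta>"
    then show "z \<in> band \<rho> \<inter> \<Phi> -` band \<eta>" using per[of z] by simp
  next
    fix z assume "z \<in> band \<rho> \<inter> \<Phi> -` band \<eta>"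
    then show "z + of_real (2 * pi) \<in> band \<rho> \<inter> \<Phi> -` band \<eta>" using per[of z] by simp
  qed (use r e re in auto)
  then obtain \<sigma> where "\<sigma> > 0" "band \<sigma> \<subseteq> band \<rho> \<inter> \<Phi> -` band \<eta>" by blast
  then show ?thesis by (intro exI[of _ "min \<sigma> \<rho>"]) (use r in auto)
qed

lemma real_line_derivative:
  assumes "(h has_field_derivative d) (at (of_real x))"
  shows "((\<lambda>t::real. Re (h (of_real t))) has_real_derivative Re d) (at x)"
proof -
  have "(complex_of_real has_derivative of_real) (at x)" by (auto intro!: derivative_eq_intros)
  moreover have "(h has_derivative (*) d) (at (of_real x))" using assms by (simp add: has_field_derivative_def)
  ultimately have "(h \<circ> of_real has_derivative (*) d \<circ> of_real) (at x)" by (rule diff_chain_at)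
  then have "((\<lambda>t::real. Re (h (of_real t))) has_derivative (\<lambda>t. Re (d * of_real t))) (at x)"
    unfolding o_def by (rule has_derivative_Re)
  then show ?thesis unfolding has_field_derivative_def by (rule has_derivative_eq_rhs2) simp
qed

text \<open>Re \<Phi>' is positive on the axis, hence on a band by periodicity, and it is the
  vertical derivative of Im \<Phi>; so Im \<Phi> grows from 0 along upward lines.\<close>

lemma upper_preserving:
  assumes r: "0 < \<rho>" and h: "\<Phi> holomorphic_on band \<rho>" and per: "\<And>z. z \<in> band \<rho> \<Longrightarrow> \<Phi> (z + of_real (2 * pi)) = \<Phi> z + of_real (2 * pi)"
    and re: "\<And>x::real. Im (\<Phi> (of_real x)) = 0" and pos: "\<And>x::real. 0 < Re (deriv \<Phi> (of_real x))"
  shows "\<exists>\<sigma>>0. \<sigma> \<le> \<rho> \<and> (\<forall>z\<in>band \<sigma>. 0 \<le> Im z \<longrightarrow> 0 \<le> Im (\<Phi> z))"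
proof -
  have h': "deriv \<Phi> holomorphic_on band \<rho>" by (rule holomorphic_deriv[OF h open_band])
  let ?U = "band \<rho> \<inter> deriv \<Phi> -` {z. 0 < Re z}"
  have o: "open ?U"
    by (rule continuous_open_preimage[OF holomorphic_on_imp_continuous_on[OF h'] open_band])
      (intro open_Collect_less continuous_intros)
  have dper: "deriv \<Phi> (z + of_real (2 * pi)) = deriv \<Phi> z" if z: "z \<in> band \<rho>" for z
  proof -
    let ?p = "complex_of_real (2 * pi)"
    have "z + ?p \<in> band \<rho>" using z by simp
    from holomorphic_derivI[OF h open_band this]
    have "((\<lambda>w. \<Phi> (w + ?p)) has_field_derivative deriv \<Phi> (z + ?p) * 1) (at z)"
      by (rule DERIV_chain2[where f=\<Phi> and g="\<lambda>w. w + ?p"]) (auto intro!: derivative_eq_intros)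
    then have "((\<lambda>w. \<Phi> (w + ?p) - ?p) has_field_derivative deriv \<Phi> (z + ?p)) (at z)"
      by (auto intro!: derivative_eq_intros)
    then have "(\<Phi> has_field_derivative deriv \<Phi> (z + ?p)) (at z)"
      by (rule has_field_derivative_transform_within_open[OF _ open_band z]) (use per in auto)
    then show ?thesis by (simp add: DERIV_imp_deriv)
  qed
  have "\<exists>\<sigma>>0. band \<sigma> \<subseteq> ?U"
  proof (rule periodic_open_contains_band[OF o])
    fix z assume "z + of_real (2 * pi) \<in> ?U"
    then show "z \<in> ?U" using dper[of z] by simp
  next
    fix z assume "z \<in> ?U"
    then show "z + of_real (2 * pi) \<in> ?U" using dper[of z] by simp
  qed (use r pos in auto)
  then obtain \<sigma> where s: "\<sigma> > 0" "band \<sigma> \<subseteq> ?U" by blast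
  have "0 \<le> Im (\<Phi> z)" if z: "z \<in> band \<sigma>" "0 \<le> Im z" for z
  proof -
    have line: "((\<lambda>y. Im (\<Phi> (Complex (Re z) y))) has_real_derivative Re (deriv \<Phi> (Complex (Re z) y))) (at y)"
      if y: "0 \<le> y" "y \<le> Im z" for y
    proof -
      have "Complex (Re z) y \<in> band \<sigma>" using y z(1) by simp
      then have b: "Complex (Re z) y \<in> band \<rho>" using s(2) by blast
      have C: "Complex (Re z) y = of_real (Re z) + \<i> * of_real y" for y by (simp add: complex_eq_iff)
      have "(\<Phi> has_derivative (*) (deriv \<Phi> (Complex (Re z) y))) (at (Complex (Re z) y))"
        using holomorphic_derivI[OF h open_band b] by (simp add: has_field_derivative_def)
      moreover have "((\<lambda>y. Complex (Re z) y) has_derivative (\<lambda>s. \<i> * of_real s)) (at y)"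
        unfolding C by (auto intro!: derivative_eq_intros)
      ultimately have "(\<Phi> \<circ> (\<lambda>y. Complex (Re z) y) has_derivative (*) (deriv \<Phi> (Complex (Re z) y)) \<circ> (\<lambda>s. \<i> * of_real s)) (at y)"
        by (intro diff_chain_at)
      then have "((\<lambda>y. Im (\<Phi> (Complex (Re z) y))) has_derivative (\<lambda>s. Im (deriv \<Phi> (Complex (Re z) y) * (\<i> * of_real s)))) (at y)"
        unfolding o_def by (rule has_derivative_Im)
      then show ?thesis unfolding has_field_derivative_def by (rule has_derivative_eq_rhs2) simp
    qed
    have "Im (\<Phi> (Complex (Re z) 0)) \<le> Im (\<Phi> (Complex (Re z) (Im z)))"
    proof (rule DERIV_nonneg_imp_nondecreasing[OF z(2)])
      fix y assume y: "0 \<le> y" "y \<le> Im z"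
      have "Complex (Re z) y \<in> band \<sigma>" using y z(1) by simp
      then have "Complex (Re z) y \<in> ?U" using s(2) by blast
      then show "\<exists>d. ((\<lambda>y. Im (\<Phi> (Complex (Re z) y))) has_real_derivative d) (at y) \<and> 0 \<le> d"
        using line[OF y] by (intro exI[of _ "Re (deriv \<Phi> (Complex (Re z) y))"]) auto
    qed
    moreover have "Complex (Re z) 0 = of_real (Re z)" by (simp add: complex_eq_iff)
    ultimately show ?thesis using re[of "Re z"] by simp
  qed
  then show ?thesis by (intro exI[of _ "min \<sigma> \<rho>"]) (use s r in auto)
qed

lemma multiple_2pi_constant:
  fixes g :: "real \<Rightarrow> real"
  assumes c: "continuous_on UNIV g" and g: "\<And>x. \<exists>k::int. g x = 2 * pi * of_int k"
  shows "\<exists>k::int. \<forall>x. g x = 2 * pi * of_int k"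
proof -
  have "g constant_on UNIV"
  proof (rule continuous_discrete_range_constant[OF connected_UNIV c])
    fix x
    have "1 \<le> norm (g y - g x)" if ne: "g y \<noteq> g x" for y
    proof -
      obtain k l :: int where k: "g x = 2 * pi * of_int k" "g y = 2 * pi * of_int l" using g by metis
      then have "k \<noteq> l" using ne by auto
      then have "1 \<le> \<bar>l - k\<bar>" by linarith
      then have "real_of_int 1 \<le> of_int \<bar>l - k\<bar>" by (rule of_int_le_iff[THEN iffD2])
      then have "1 * 1 \<le> (2 * pi) * \<bar>of_int (l - k) :: real\<bar>" using pi_gt3 by (intro mult_mono) auto
      also have "\<dots> = norm (g y - g x)" unfolding k by (simp add: abs_mult flip: right_diff_distrib)
      finally show ?thesis by simp
    qed
    then show "\<exists>e>0. \<forall>y. y \<in> UNIV \<and> g y \<noteq> g x \<longrightarrow> e \<le> norm (g y - g x)" by (intro exI[of _ 1]) auto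
  qed
  then obtain a where a: "\<And>x. g x = a" by (auto simp: constant_on_def)
  obtain k :: int where "g 0 = 2 * pi * of_int k" using g by blast
  then show ?thesis using a by metis
qed

text \<open>\<open>diff_an\<close> provides lifts of the map and of its inverse that are unrelated
  to each other. Their composite differs from the identity by a constant multiple of 2 pi, which is
  subtracted from the second one.\<close>

lemma diff_an_lifts:
  assumes "\<phi> \<in> diff_an"
  obtains f f' where "circle_lift \<phi> f" "real_analytic f" "strict_mono f" "\<forall>x. f (x + 2 * pi) = f x + 2 * pi"
    "circle_lift (inv_into UNIV \<phi>) f'" "real_analytic f'" "\<forall>x. f' (f x) = x" "\<forall>x. f (f' x) = x"
    "\<forall>x. f' (x + 2 * pi) = f' x + 2 * pi" "strict_mono f'"
proof -
  obtain f f0 where b: "bij \<phi>" and f: "circle_lift \<phi> f" "real_analytic f" "strict_mono f"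
    and f0: "circle_lift (inv_into UNIV \<phi>) f0" "real_analytic f0"
    using assms by (auto simp: diff_an_def)
  note cf = real_analytic_continuous[OF f(2)] and cf0 = real_analytic_continuous[OF f0(2)]
  have lf: "circ (f x) = \<phi> (circ x)" for x using f(1) by (simp add: circle_lift_def)
  have lf0: "circ (f0 x) = inv_into UNIV \<phi> (circ x)" for x using f0(1) by (simp add: circle_lift_def)
  have "\<exists>k::int. f (x + 2 * pi) - f x = 2 * pi * of_int k" for x
  proof -
    have "circ x = circ (x + 2 * pi)" unfolding circ_eq_iff by (intro exI[of _ 1]) simp
    then have "circ (f x) = circ (f (x + 2 * pi))" unfolding lf by simp
    then show ?thesis unfolding circ_eq_iff by (auto simp: algebra_simps)
  qed
  moreover have "continuous_on UNIV (\<lambda>x. f (x + 2 * pi) - f x)"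
    by (intro continuous_intros cf continuous_on_compose2[OF cf]) auto
  ultimately have "\<exists>n::int. \<forall>x. f (x + 2 * pi) - f x = 2 * pi * of_int n"
    by (intro multiple_2pi_constant) blast+
  then obtain n :: int where n': "\<forall>x. f (x + 2 * pi) - f x = 2 * pi * of_int n" ..
  note n = n'[rule_format]
  have "f 0 < f (0 + 2 * pi)" using f(3) by (simp add: strict_mono_less)
  then have "0 < 2 * pi * real_of_int n" using n[of 0] by linarith
  then have "0 < n" by (simp add: zero_less_mult_iff)
  \<comment> \<open>For n > 1 the increasing lift takes the value f 0 + 2 pi strictly inside a
    period, against injectivity on the circle.\<close>
  have "n = 1"
  proof (rule ccontr)
    assume "n \<noteq> 1"
    then have n2: "1 < n" using \<open>0 < n\<close> by linarith
    then have "2 * pi * 1 < 2 * pi * real_of_int n" by (intro mult_strict_left_mono) auto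
    moreover have "f (2 * pi) - f 0 = 2 * pi * real_of_int n" using n[of 0] by simp
    ultimately have lt: "f 0 + 2 * pi < f (2 * pi)" by linarith
    obtain y where y: "0 \<le> y" "y \<le> 2 * pi" "f y = f 0 + 2 * pi"
      using IVT'[of f 0 "f 0 + 2 * pi" "2 * pi"] lt continuous_on_subset[OF cf] by auto
    have "y \<noteq> 0" "y \<noteq> 2 * pi" using y(3) lt by auto
    have "circ (f 0) = circ (f y)" unfolding y(3) circ_eq_iff by (intro exI[of _ 1]) simp
    then have "circ 0 = circ y" unfolding lf using b by (metis bij_def injD)
    then obtain k :: int where k: "y = 2 * pi * of_int k" unfolding circ_eq_iff by auto
    have "0 < y" "y < 2 * pi" using y(1,2) \<open>y \<noteq> 0\<close> \<open>y \<noteq> 2 * pi\<close> by linarith+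
    then have "0 < 2 * pi * of_int k" "2 * pi * of_int k < 2 * pi * 1" unfolding k by simp_all
    then have "0 < real_of_int k" "real_of_int k < 1" by (simp_all add: zero_less_mult_iff)
    then have "0 < k" "k < 1" by (simp_all only: of_int_0_less_iff of_int_less_1_iff)
    then show False by linarith
  qed
  then have per: "f (x + 2 * pi) = f x + 2 * pi" for x using n[of x] by simp
  have "\<exists>k::int. f0 (f x) - x = 2 * pi * of_int k" for x
  proof -
    have "circ x = circ (f0 (f x))" unfolding lf0 lf using b by (simp add: bij_def)
    then show ?thesis unfolding circ_eq_iff by (auto simp: algebra_simps)
  qed
  moreover have "continuous_on UNIV (\<lambda>x. f0 (f x) - x)"
    by (intro continuous_intros continuous_on_compose2[OF cf0 cf]) auto
  ultimately have "\<exists>m::int. \<forall>x. f0 (f x) - x = 2 * pi * of_int m"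
    by (intro multiple_2pi_constant) blast+
  then obtain m :: int where m': "\<forall>x. f0 (f x) - x = 2 * pi * of_int m" ..
  note m = m'[rule_format]
  define f' where "f' x = f0 x - 2 * pi * of_int m" for x
  have f'f: "f' (f x) = x" for x using m[of x] by (simp add: f'_def)
  have surj: "\<exists>x. f x = y" for y
  proof -
    define k where "k = \<lfloor>(y - f 0) / (2 * pi)\<rfloor>"
    have "of_int k \<le> (y - f 0) / (2 * pi)" "(y - f 0) / (2 * pi) < of_int k + 1" unfolding k_def by linarith+
    then have "f 0 + 2 * pi * of_int k \<le> y" "y \<le> f 0 + 2 * pi * of_int (k + 1)" by (simp_all add: field_simps)
    then have "f (2 * pi * of_int k) \<le> y" "y \<le> f (2 * pi * of_int (k + 1))"
      using real_periodic_int[of f 0 k, OF per] real_periodic_int[of f 0 "k + 1", OF per] by simp_all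
    moreover have "2 * pi * of_int k \<le> 2 * pi * real_of_int (k + 1)" by simp
    ultimately show ?thesis using IVT'[of f _ y] continuous_on_subset[OF cf] by (metis subset_UNIV)
  qed
  have ff': "f (f' y) = y" for y using surj[of y] f'f by metis
  have per': "f' (y + 2 * pi) = f' y + 2 * pi" for y
    using per[of "f' y"] f'f[of "f' y + 2 * pi"] ff'[of y] by simp
  have sm: "strict_mono f'"
  proof (rule strict_monoI)
    fix x y :: real assume "x < y"
    then show "f' x < f' y" using ff' f(3) by (metis strict_mono_less)
  qed
  have lift': "circle_lift (inv_into UNIV \<phi>) f'"
    unfolding circle_lift_def lf0[symmetric] circ_eq_iff f'_def by (auto intro!: exI[of _ m])
  have an': "real_analytic f'"
    unfolding real_analytic_iff
  proof
    fix x
    obtain r h where rh: "r > 0" "h holomorphic_on ball (complex_of_real x) r" "\<forall>y. \<bar>y - x\<bar> < r \<longrightarrow> h (of_real y) = of_real (f0 y)"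
      using f0(2)[unfolded real_analytic_iff] by blast
    then show "\<exists>r>0. \<exists>h. h holomorphic_on ball (of_real x) r \<and> (\<forall>y. \<bar>y - x\<bar> < r \<longrightarrow> h (of_real y) = of_real (f' y))"
      by (intro exI[of _ r] conjI exI[of _ "\<lambda>z. h z - of_real (2 * pi * of_int m)"]) (auto intro!: holomorphic_intros simp: f'_def)
  qed
  show thesis by (rule that[OF f _ lift' an' _ _ _ sm]) (use per f'f ff' per' in auto)
qed

lemma ext_pair_exists:
  assumes "\<phi> \<in> diff_an"
  obtains \<Phi> \<Psi> \<rho> where "ext_pair \<phi> \<Phi> \<Psi> \<rho>"
proof -
  obtain f f' where F: "circle_lift \<phi> f" "real_analytic f" "strict_mono f" "\<forall>x. f (x + 2 * pi) = f x + 2 * pi"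
    and F': "circle_lift (inv_into UNIV \<phi>) f'" "real_analytic f'" "\<forall>x. f' (f x) = x" "\<forall>x. f (f' x) = x"
      "\<forall>x. f' (x + 2 * pi) = f' x + 2 * pi" "strict_mono f'"
    by (rule diff_an_lifts[OF assms]) (rule that; assumption)
  note f = F(1-3) F(4)[rule_format]
  note f' = F'(1,2) F'(3)[rule_format] F'(4)[rule_format] F'(5)[rule_format] F'(6)
  obtain \<rho>1 \<Phi> where P: "\<rho>1 > 0" "\<Phi> holomorphic_on band \<rho>1" "\<And>x. \<Phi> (of_real x) = of_real (f x)"
    "\<And>z. z \<in> band \<rho>1 \<Longrightarrow> \<Phi> (z + of_real (2 * pi)) = \<Phi> z + of_real (2 * pi)"
    using holomorphic_extension_band[OF f(2,4)] by metis
  obtain \<rho>2 \<Psi> where Q: "\<rho>2 > 0" "\<Psi> holomorphic_on band \<rho>2" "\<And>x. \<Psi> (of_real x) = of_real (f' x)"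
    "\<And>z. z \<in> band \<rho>2 \<Longrightarrow> \<Psi> (z + of_real (2 * pi)) = \<Psi> z + of_real (2 * pi)"
    using holomorphic_extension_band[OF f'(2,5)] by metis
  have Pr: "Im (\<Phi> (of_real x)) = 0" and Qr: "Im (\<Psi> (of_real x)) = 0" for x :: real by (simp_all add: P(3) Q(3))
  \<comment> \<open>Stated for arbitrary pairs, to be used once in each order of the two
    extensions.\<close>
  have idl: "\<exists>\<sigma>>0. \<sigma> \<le> \<rho>1 \<and> \<Phi> ` band \<sigma> \<subseteq> band \<rho>2 \<and> (\<forall>z\<in>band \<sigma>. \<Psi> (\<Phi> z) = z)"
    if P: "\<rho>1 > 0" "\<Phi> holomorphic_on band \<rho>1" "\<And>x. \<Phi> (of_real x) = of_real (f x)"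
      "\<And>z. z \<in> band \<rho>1 \<Longrightarrow> \<Phi> (z + of_real (2 * pi)) = \<Phi> z + of_real (2 * pi)"
      and Q: "\<rho>2 > 0" "\<Psi> holomorphic_on band \<rho>2" "\<And>x. \<Psi> (of_real x) = of_real (f' x)" and ff: "\<And>x::real. f' (f x) = x"
    for \<rho>1 \<rho>2 \<Phi> \<Psi> f f'
  proof -
    obtain \<sigma> where s: "\<sigma> > 0" "\<sigma> \<le> \<rho>1" "\<Phi> ` band \<sigma> \<subseteq> band \<rho>2"
      using small_image_band[OF P(1,2,4) _ Q(1)] P(3) by auto
    have sub: "band \<sigma> \<subseteq> band \<rho>1" using s by auto
    have "\<Psi> (\<Phi> z) = z" if z: "z \<in> band \<sigma>" for z
    proof (rule analytic_continuation_real[OF open_band convex_connected[OF convex_band] _ _ s(1), where x=0 and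
        f="\<lambda>z. \<Psi> (\<Phi> z)" and g="\<lambda>z. z"])
      show "(\<lambda>z. \<Psi> (\<Phi> z)) holomorphic_on band \<sigma>"
        by (rule holomorphic_on_compose_gen[OF holomorphic_on_subset[OF P(2) sub] Q(2) s(3), unfolded o_def])
      show "ball (of_real 0) \<sigma> \<subseteq> band \<sigma>" by (rule ball_subset_band)
    qed (use z P(3) Q(3) ff in \<open>auto intro!: holomorphic_intros\<close>)
    then show ?thesis using s by blast
  qed
  obtain \<sigma>1 where s1: "\<sigma>1 > 0" "\<sigma>1 \<le> \<rho>1" "\<Phi> ` band \<sigma>1 \<subseteq> band \<rho>2" "\<And>z. z \<in> band \<sigma>1 \<Longrightarrow> \<Psi> (\<Phi> z) = z"
    using idl[OF P Q(1-3) f'(3)] by blast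
  obtain \<sigma>2 where s2: "\<sigma>2 > 0" "\<sigma>2 \<le> \<rho>2" "\<Psi> ` band \<sigma>2 \<subseteq> band \<rho>1" "\<And>z. z \<in> band \<sigma>2 \<Longrightarrow> \<Phi> (\<Psi> z) = z"
    using idl[OF Q P(1-3) f'(4)] by blast
  \<comment> \<open>The chain rule for the inverse lifts makes the derivative nonzero; strict
    monotonicity alone would allow a zero.\<close>
  have pos: "0 < Re (deriv \<Phi> (of_real x))"
    if P: "\<rho>1 > 0" "\<Phi> holomorphic_on band \<rho>1" "\<And>x. \<Phi> (of_real x) = of_real (f x)" and f: "strict_mono f"
      and Q: "\<rho>2 > 0" "\<Psi> holomorphic_on band \<rho>2" "\<And>x. \<Psi> (of_real x) = of_real (f' x)" "\<And>x::real. f' (f x) = x"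
    for \<rho>1 \<rho>2 \<Phi> \<Psi> f f' and x :: real
  proof -
    have d1: "(\<Phi> has_field_derivative deriv \<Phi> (of_real x)) (at (of_real x))"
      by (rule holomorphic_derivI[OF P(2) open_band]) (use P(1) in simp)
    have d2: "(\<Psi> has_field_derivative deriv \<Psi> (of_real (f x))) (at (of_real (f x)))"
      by (rule holomorphic_derivI[OF Q(2) open_band]) (use Q(1) in simp)
    have fd: "(f has_real_derivative Re (deriv \<Phi> (of_real x))) (at x)"
      using real_line_derivative[OF d1] by (simp add: P(3))
    have fd': "(f' has_real_derivative Re (deriv \<Psi> (of_real (f x)))) (at (f x))"
      using real_line_derivative[OF d2] by (simp add: Q(3))
    have "((\<lambda>x. f' (f x)) has_real_derivative Re (deriv \<Psi> (of_real (f x))) * Re (deriv \<Phi> (of_real x))) (at x)"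
      by (rule DERIV_chain2[OF fd' fd])
    then have "((\<lambda>x. x) has_real_derivative Re (deriv \<Psi> (of_real (f x))) * Re (deriv \<Phi> (of_real x))) (at x)"
      by (simp add: Q(4))
    then have "Re (deriv \<Psi> (of_real (f x))) * Re (deriv \<Phi> (of_real x)) = 1" using DERIV_unique[OF _ DERIV_ident] by blast
    then have "Re (deriv \<Phi> (of_real x)) \<noteq> 0" by auto
    moreover have "\<not> Re (deriv \<Phi> (of_real x)) < 0"
    proof
      assume "Re (deriv \<Phi> (of_real x)) < 0"
      then obtain d where d: "d > 0" "\<And>h. 0 < h \<Longrightarrow> h < d \<Longrightarrow> f (x + h) < f x" using DERIV_neg_dec_right[OF fd] by blast
      have "f (x + d/2) < f x" using d by simp
      moreover have "f x < f (x + d/2)" using f d(1) by (simp add: strict_mono_less)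
      ultimately show False by simp
    qed
    ultimately show ?thesis by linarith
  qed
  obtain \<sigma>3 where s3: "\<sigma>3 > 0" "\<sigma>3 \<le> \<rho>1" "\<And>z. z \<in> band \<sigma>3 \<Longrightarrow> 0 \<le> Im z \<Longrightarrow> 0 \<le> Im (\<Phi> z)"
    using upper_preserving[OF P(1,2,4) Pr pos[OF P(1-3) f(3) Q(1-3) f'(3)]] by blast
  obtain \<sigma>4 where s4: "\<sigma>4 > 0" "\<sigma>4 \<le> \<rho>2" "\<And>z. z \<in> band \<sigma>4 \<Longrightarrow> 0 \<le> Im z \<Longrightarrow> 0 \<le> Im (\<Psi> z)"
    using upper_preserving[OF Q(1,2,4) Qr pos[OF Q(1-3) f'(6) P(1-3) f'(4)]] by blast
  define \<rho> where "\<rho> = min (min \<sigma>1 \<sigma>2) (min \<sigma>3 \<sigma>4)"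
  have r: "\<rho> > 0" "\<rho> \<le> \<sigma>1" "\<rho> \<le> \<sigma>2" "\<rho> \<le> \<sigma>3" "\<rho> \<le> \<sigma>4" using s1 s2 s3 s4 by (auto simp: \<rho>_def)
  have "ext_pair \<phi> \<Phi> \<Psi> \<rho>"
    unfolding ext_pair_def
  proof (intro conjI ballI allI impI)
    show "\<Phi> holomorphic_on band \<rho>" "\<Psi> holomorphic_on band \<rho>"
      by (rule holomorphic_on_subset[OF P(2)] holomorphic_on_subset[OF Q(2)], use r s1 s2 in auto)+
    show "\<phi> (circ x) = circ (Re (\<Phi> (of_real x)))" for x using f(1) by (simp add: circle_lift_def P(3))
  qed (use r s1 s2 s3 s4 P(4) Q(4) Pr Qr in auto)
  then show thesis by (rule that)
qed

lemma ext_pairD: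
  assumes "ext_pair \<phi> \<Phi> \<Psi> \<rho>"
  shows "0 < \<rho>" "\<Phi> holomorphic_on band \<rho>" "\<Psi> holomorphic_on band \<rho>"
    "\<bar>Im z\<bar> < \<rho> \<Longrightarrow> \<Phi> (z + of_real (2 * pi)) = \<Phi> z + of_real (2 * pi)"
    "\<bar>Im z\<bar> < \<rho> \<Longrightarrow> \<Psi> (z + of_real (2 * pi)) = \<Psi> z + of_real (2 * pi)"
    "Im (\<Phi> (of_real x)) = 0" "Im (\<Psi> (of_real x)) = 0"
    "\<bar>Im z\<bar> < \<rho> \<Longrightarrow> 0 \<le> Im z \<Longrightarrow> 0 \<le> Im (\<Phi> z)" "\<bar>Im z\<bar> < \<rho> \<Longrightarrow> 0 \<le> Im z \<Longrightarrow> 0 \<le> Im (\<Psi> z)"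
    "\<bar>Im z\<bar> < \<rho> \<Longrightarrow> \<bar>Im (\<Phi> z)\<bar> < \<rho> \<Longrightarrow> \<Psi> (\<Phi> z) = z" "\<bar>Im z\<bar> < \<rho> \<Longrightarrow> \<bar>Im (\<Psi> z)\<bar> < \<rho> \<Longrightarrow> \<Phi> (\<Psi> z) = z"
    "\<phi> (circ x) = circ (Re (\<Phi> (of_real x)))"
  using assms unfolding ext_pair_def by auto

lemma ext_pair_small:
  assumes E: "ext_pair \<phi> \<Phi> \<Psi> \<rho>" and e: "0 < \<eta>"
  obtains \<sigma> where "0 < \<sigma>" "\<sigma> \<le> \<rho>" "\<And>z. \<bar>Im z\<bar> < \<sigma> \<Longrightarrow> \<bar>Im (\<Phi> z)\<bar> < \<eta>" "\<And>z. \<bar>Im z\<bar> < \<sigma> \<Longrightarrow> \<bar>Im (\<Psi> z)\<bar> < \<eta>"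
proof -
  note d = ext_pairD[OF E]
  obtain s1 where 1: "s1 > 0" "s1 \<le> \<rho>" "\<Phi> ` band s1 \<subseteq> band \<eta>"
    using small_image_band[OF d(1,2) _ d(6) e] d(4) by auto
  obtain s2 where 2: "s2 > 0" "s2 \<le> \<rho>" "\<Psi> ` band s2 \<subseteq> band \<eta>"
    using small_image_band[OF d(1,3) _ d(7) e] d(5) by auto
  show thesis
    by (rule that[of "min s1 s2"]) (use 1 2 in auto)
qed

text \<open>Only the band shrinks: it is chosen so that the first map applied, in either order,
  lands in both original bands.\<close>

lemma ext_pair_compose:
  assumes E: "ext_pair \<phi> \<Phi> \<Psi> \<rho>" and E2: "ext_pair \<psi> \<Phi>2 \<Psi>2 \<rho>2"
  obtains \<rho>3 where "ext_pair (\<phi> \<circ> \<psi>) (\<lambda>z. \<Phi> (\<Phi>2 z)) (\<lambda>z. \<Psi>2 (\<Psi> z)) \<rho>3"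
proof -
  note d = ext_pairD[OF E] and d2 = ext_pairD[OF E2]
  define \<eta> where "\<eta> = min \<rho> \<rho>2"
  have e: "0 < \<eta>" "\<eta> \<le> \<rho>" "\<eta> \<le> \<rho>2" using d(1) d2(1) by (auto simp: \<eta>_def)
  obtain s1 where 1: "0 < s1" "s1 \<le> \<rho>" "\<And>z. \<bar>Im z\<bar> < s1 \<Longrightarrow> \<bar>Im (\<Phi> z)\<bar> < \<eta>" "\<And>z. \<bar>Im z\<bar> < s1 \<Longrightarrow> \<bar>Im (\<Psi> z)\<bar> < \<eta>"
    by (rule ext_pair_small[OF E e(1)]) (rule that; blast)
  obtain s2 where 2: "0 < s2" "s2 \<le> \<rho>2" "\<And>z. \<bar>Im z\<bar> < s2 \<Longrightarrow> \<bar>Im (\<Phi>2 z)\<bar> < \<eta>" "\<And>z. \<bar>Im z\<bar> < s2 \<Longrightarrow> \<bar>Im (\<Psi>2 z)\<bar> < \<eta>"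
    by (rule ext_pair_small[OF E2 e(1)]) (rule that; blast)
  define r where "r = min \<eta> (min s1 s2)"
  have r: "0 < r" "r \<le> \<eta>" "r \<le> s1" "r \<le> s2" using e 1 2 by (auto simp: r_def)
  have imP: "\<bar>Im (\<Phi>2 z)\<bar> < \<rho>" "\<bar>Im (\<Phi>2 z)\<bar> < \<rho>2" if "\<bar>Im z\<bar> < r" for z using 2(3)[of z] that r e by linarith+
  have imQ: "\<bar>Im (\<Psi> z)\<bar> < \<rho>" "\<bar>Im (\<Psi> z)\<bar> < \<rho>2" if "\<bar>Im z\<bar> < r" for z using 1(4)[of z] that r e by linarith+
  have rr: "\<bar>Im z\<bar> < \<rho>" "\<bar>Im z\<bar> < \<rho>2" if "\<bar>Im z\<bar> < r" for z using that r e by linarith+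
  have of_re: "of_real (Re w) = w" if "Im w = 0" for w using that by (simp add: complex_eq_iff)
  have "ext_pair (\<phi> \<circ> \<psi>) (\<lambda>z. \<Phi> (\<Phi>2 z)) (\<lambda>z. \<Psi>2 (\<Psi> z)) r"
    unfolding ext_pair_def
  proof (intro conjI ballI allI impI)
    show "(\<lambda>z. \<Phi> (\<Phi>2 z)) holomorphic_on band r"
      by (rule holomorphic_on_compose_gen[OF holomorphic_on_subset[OF d2(2)] d(2), unfolded o_def]) (use rr imP in auto)
    show "(\<lambda>z. \<Psi>2 (\<Psi> z)) holomorphic_on band r"
      by (rule holomorphic_on_compose_gen[OF holomorphic_on_subset[OF d(3)] d2(3), unfolded o_def]) (use rr imQ in auto)
    show "Im (\<Phi> (\<Phi>2 (of_real x))) = 0" for x using d(6)[of "Re (\<Phi>2 (of_real x))"] of_re[OF d2(6)[of x]] by simp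
    show "Im (\<Psi>2 (\<Psi> (of_real x))) = 0" for x using d2(7)[of "Re (\<Psi> (of_real x))"] of_re[OF d(7)[of x]] by simp
    show "(\<phi> \<circ> \<psi>) (circ x) = circ (Re (\<Phi> (\<Phi>2 (of_real x))))" for x
      using of_re[OF d2(6)[of x]] by (simp add: d(12) d2(12))
    fix z assume "z \<in> band r"
    then have z: "\<bar>Im z\<bar> < r" by simp
    show "\<Phi> (\<Phi>2 (z + of_real (2 * pi))) = \<Phi> (\<Phi>2 z) + of_real (2 * pi)"
      by (simp only: d2(4)[OF rr(2)[OF z]] d(4)[OF imP(1)[OF z]])
    show "\<Psi>2 (\<Psi> (z + of_real (2 * pi))) = \<Psi>2 (\<Psi> z) + of_real (2 * pi)"
      by (simp only: d(5)[OF rr(1)[OF z]] d2(5)[OF imQ(2)[OF z]])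
    show "0 \<le> Im (\<Phi> (\<Phi>2 z))" if "0 \<le> Im z"
      by (rule d(8)[OF imP(1)[OF z] d2(8)[OF rr(2)[OF z] that]])
    show "0 \<le> Im (\<Psi>2 (\<Psi> z))" if "0 \<le> Im z"
      by (rule d2(9)[OF imQ(2)[OF z] d(9)[OF rr(1)[OF z] that]])
    show "\<Psi>2 (\<Psi> (\<Phi> (\<Phi>2 z))) = z" if "\<Phi> (\<Phi>2 z) \<in> band r"
      using that d(10)[OF imP(1)[OF z]] d2(10)[OF rr(2)[OF z] imP(2)[OF z]] rr(1) by simp
    show "\<Phi> (\<Phi>2 (\<Psi>2 (\<Psi> z))) = z" if "\<Psi>2 (\<Psi> z) \<in> band r"
      using that d2(11)[OF imQ(2)[OF z]] d(11)[OF rr(1)[OF z] imQ(1)[OF z]] rr(2) by simp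
  qed (rule r(1))
  then show thesis by (rule that)
qed

lemma diff_an_compose:
  assumes "\<phi> \<in> diff_an" "\<psi> \<in> diff_an" shows "\<phi> \<circ> \<psi> \<in> diff_an"
proof -
  obtain f f0 where b: "bij \<phi>" and f: "circle_lift \<phi> f" "real_analytic f" "strict_mono f"
    and f0: "circle_lift (inv_into UNIV \<phi>) f0" "real_analytic f0"
    using assms(1) by (auto simp: diff_an_def)
  obtain g g0 where c: "bij \<psi>" and g: "circle_lift \<psi> g" "real_analytic g" "strict_mono g"
    and g0: "circle_lift (inv_into UNIV \<psi>) g0" "real_analytic g0"
    using assms(2) by (auto simp: diff_an_def)
  have "inv_into UNIV (\<phi> \<circ> \<psi>) = inv_into UNIV \<psi> \<circ> inv_into UNIV \<phi>"
    using o_inv_distrib[OF b c] .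
  then have "circle_lift (inv_into UNIV (\<phi> \<circ> \<psi>)) (\<lambda>x. g0 (f0 x))"
    using f0(1) g0(1) by (simp add: circle_lift_def)
  moreover have "circle_lift (\<phi> \<circ> \<psi>) (\<lambda>x. f (g x))" using f(1) g(1) by (simp add: circle_lift_def)
  moreover have "strict_mono (\<lambda>x. f (g x))" using f(3) g(3) by (simp add: strict_mono_def)
  ultimately show ?thesis
    using b c real_analytic_compose f(2) g(2) f0(2) g0(2) by (auto simp: diff_an_def intro: bij_comp)
qed

section \<open>Collars\<close>

definition cyl_map :: "(complex \<Rightarrow> complex) \<Rightarrow> circle \<times> real \<Rightarrow> circle \<times> real" where
  "cyl_map \<Phi> p = cyl_pt (\<Phi> (SOME z. cyl_pt z = p))"

lemma band_periodic_int:
  fixes \<Phi> :: "complex \<Rightarrow> complex"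
  assumes "\<And>z. \<bar>Im z\<bar> < \<rho> \<Longrightarrow> \<Phi> (z + of_real (2 * pi)) = \<Phi> z + of_real (2 * pi)" "\<bar>Im z\<bar> < \<rho>"
  shows "\<Phi> (z + of_real (2 * pi * of_int k)) = \<Phi> z + of_real (2 * pi * of_int k)"
proof -
  let ?K = "complex_of_real (2 * pi * of_int k)"
  have "\<Phi> (z + ?K) - (z + ?K) = \<Phi> z - z"
    by (rule periodic_int[where v="\<lambda>z. \<Phi> z - z" and I="{y. \<bar>y\<bar> < \<rho>}"]) (use assms in simp_all)
  moreover have e: "y = u + K" if "y - (z + K) = u - z" for y u K :: complex using that by (simp add: algebra_simps)
  ultimately show ?thesis by (intro e)
qed

lemma cyl_map:
  fixes \<Phi> :: "complex \<Rightarrow> complex"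
  assumes per: "\<And>z. \<bar>Im z\<bar> < \<rho> \<Longrightarrow> \<Phi> (z + of_real (2 * pi)) = \<Phi> z + of_real (2 * pi)" and z: "\<bar>Im z\<bar> < \<rho>"
  shows "cyl_map \<Phi> (cyl_pt z) = cyl_pt (\<Phi> z)"
proof -
  have "cyl_pt (SOME z'. cyl_pt z' = cyl_pt z) = cyl_pt z" by (rule someI) simp
  then have "cyl_pt z = cyl_pt (SOME z'. cyl_pt z' = cyl_pt z)" ..
  then obtain k :: int where k: "(SOME z'. cyl_pt z' = cyl_pt z) = z + of_real (2 * pi * of_int k)"
    unfolding cyl_pt_eq_iff by blast
  have "\<Phi> (z + of_real (2 * pi * of_int k)) = \<Phi> z + of_real (2 * pi * of_int k)"
    by (rule band_periodic_int[of \<rho>]) (use per z in blast)+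
  then show ?thesis unfolding cyl_map_def k by (simp only: cyl_pt_add_period)
qed

lemma ext_pair_cyl_map:
  assumes E: "ext_pair \<phi> \<Phi> \<Psi> \<rho>" and z: "\<bar>Im z\<bar> < \<rho>"
  shows "cyl_map \<Phi> (cyl_pt z) = cyl_pt (\<Phi> z)" "cyl_map \<Psi> (cyl_pt z) = cyl_pt (\<Psi> z)"
  by (rule cyl_map[of \<rho>], rule ext_pairD(4)[OF E] ext_pairD(5)[OF E], assumption, rule z)+

lemma ext_pair_periodic:
  assumes E: "ext_pair \<phi> \<Phi> \<Psi> \<rho>" and z: "\<bar>Im z\<bar> < \<rho>"
  shows "\<Psi> (z + of_real (2 * pi * of_int k)) = \<Psi> z + of_real (2 * pi * of_int k)"
  by (rule band_periodic_int[of \<rho>], rule ext_pairD(5)[OF E], assumption, rule z)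

lemma biholo_of_loc_lift:
  assumes I: "cyl_ivl I a b" and J: "cyl_ivl J c d" and V: "openin (topo (flat_cyl J)) V"
    and F: "loc_lift I UNIV J V F" and G: "loc_lift J V I UNIV G"
    and GF: "\<And>z. Im z \<in> I \<Longrightarrow> G (F (cyl_pt z)) = cyl_pt z" and FG: "\<And>z. cyl_pt z \<in> V \<Longrightarrow> F (G (cyl_pt z)) = cyl_pt z"
  shows "biholo (flat_cyl I) (open_sub (flat_cyl J) V) F"
proof -
  have VJ: "V \<inter> UNIV \<times> J = V" using openin_subset[OF V] by auto
  have "openin (topo (flat_cyl I)) (UNIV \<inter> UNIV \<times> I)"
    using openin_topspace[of "topo (flat_cyl I)"] by simp
  from loc_lift_imp_holo_map[OF I J this F] have hF: "holo_map (flat_cyl I) (open_sub (flat_cyl J) V) F" by simp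
  from loc_lift_imp_holo_map[OF J I _ G] V VJ have hG: "holo_map (open_sub (flat_cyl J) V) (flat_cyl I) G" by simp
  have "G (F p) = p" if "p \<in> UNIV \<times> I" for p
  proof -
    obtain z where z: "p = cyl_pt z" by (rule cyl_pt_surj)
    show ?thesis using GF[of z] that unfolding z by (simp only: cyl_pt_in)
  qed
  moreover have "F (G q) = q" if "q \<in> V" for q
  proof -
    obtain z where z: "q = cyl_pt z" by (rule cyl_pt_surj)
    show ?thesis using FG[of z] that unfolding z by simp
  qed
  ultimately have "homeomorphic_maps (topo (flat_cyl I)) (topo (open_sub (flat_cyl J) V)) F G"
    using hF hG by (auto simp: homeomorphic_maps_def holo_map_def open_sub_sel)
  then show ?thesis using hF hG unfolding biholo_def by blast
qed

lemma ext_pair_collar: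
  assumes E: "ext_pair \<phi> \<Phi> \<Psi> \<rho>"
  obtains \<sigma> where "0 < \<sigma>" "\<And>\<epsilon>. 0 < \<epsilon> \<Longrightarrow> \<epsilon> < \<sigma> \<Longrightarrow> collar {0..<\<epsilon>} (flat_cyl {0..1}) (\<lambda>p. (\<phi> p, 0)) (cyl_map \<Phi>)"
proof -
  note d = ext_pairD[OF E]
  note mP = ext_pair_cyl_map(1)[OF E] and mQ = ext_pair_cyl_map(2)[OF E]
  define s where "s = min \<rho> 1"
  have s: "0 < s" "s \<le> \<rho>" "s \<le> 1" using d(1) by (auto simp: s_def)
  obtain \<sigma> where \<sigma>: "0 < \<sigma>" "\<sigma> \<le> \<rho>" "\<And>z. \<bar>Im z\<bar> < \<sigma> \<Longrightarrow> \<bar>Im (\<Phi> z)\<bar> < s" "\<And>z. \<bar>Im z\<bar> < \<sigma> \<Longrightarrow> \<bar>Im (\<Psi> z)\<bar> < s"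
    by (rule ext_pair_small[OF E s(1)]) (rule that; blast)
  have "collar {0..<\<epsilon>} (flat_cyl {0..1}) (\<lambda>p. (\<phi> p, 0)) (cyl_map \<Phi>)" if e: "0 < \<epsilon>" "\<epsilon> < \<sigma>" for \<epsilon>
  proof -
    have I: "cyl_ivl {0..<\<epsilon>} 0 \<epsilon>" and J: "cyl_ivl {0..1} 0 1" using e by (auto simp: cyl_ivl_def)
    \<comment> \<open>The image of the collar, described through the inverse \<Psi>, so that
      openness follows from continuity of \<Psi>.\<close>
    define V where "V = {cyl_pt w | w. \<bar>Im w\<bar> < s \<and> 0 \<le> Im w \<and> Im (\<Psi> w) < \<epsilon>}"
    have Viff: "cyl_pt u \<in> V \<longleftrightarrow> \<bar>Im u\<bar> < s \<and> 0 \<le> Im u \<and> Im (\<Psi> u) < \<epsilon>" for u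
    proof
      assume "cyl_pt u \<in> V"
      then obtain w where w: "cyl_pt u = cyl_pt w" "\<bar>Im w\<bar> < s" "0 \<le> Im w" "Im (\<Psi> w) < \<epsilon>" by (auto simp: V_def)
      then obtain k :: int where k: "w = u + of_real (2 * pi * of_int k)" unfolding cyl_pt_eq_iff by blast
      have "\<bar>Im u\<bar> < \<rho>" using w(2) s k by simp
      from ext_pair_periodic[OF E this, of k] have "Im (\<Psi> w) = Im (\<Psi> u)" by (simp add: k)
      then show "\<bar>Im u\<bar> < s \<and> 0 \<le> Im u \<and> Im (\<Psi> u) < \<epsilon>" using w k by simp
    qed (auto simp: V_def)
    have V: "openin (topo (flat_cyl {0..1})) V"
    proof (rule openin_flatI)
      show "V \<subseteq> UNIV \<times> {0..1}" using s by (auto simp: V_def cyl_pt_def)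
      fix z assume "cyl_pt z \<in> V"
      then have z: "\<bar>Im z\<bar> < s" "Im (\<Psi> z) < \<epsilon>" by (auto simp: Viff)
      let ?N = "band s \<inter> \<Psi> -` {w. Im w < \<epsilon>}"
      have "\<Psi> holomorphic_on band s" by (rule holomorphic_on_subset[OF d(3)]) (use s in auto)
      then have "open ?N"
        by (intro continuous_open_preimage[OF holomorphic_on_imp_continuous_on] open_band open_Collect_less continuous_intros)
      then show "\<exists>N. open N \<and> z \<in> N \<and> (\<forall>u\<in>N. Im u \<in> {0..1} \<longrightarrow> cyl_pt u \<in> V)"
        using z by (intro exI[of _ ?N]) (auto simp: Viff)
    qed
    have PV: "cyl_pt (\<Phi> u) \<in> V" "Im (\<Phi> u) \<in> {0..1}" "\<Psi> (\<Phi> u) = u" if u: "Im u \<in> {0..<\<epsilon>}" for u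
    proof -
      have us: "\<bar>Im u\<bar> < \<sigma>" "\<bar>Im u\<bar> < \<rho>" using u e \<sigma>(2) by auto
      have P: "\<bar>Im (\<Phi> u)\<bar> < s" "0 \<le> Im (\<Phi> u)" using \<sigma>(3)[OF us(1)] d(8)[OF us(2)] u by auto
      show "\<Psi> (\<Phi> u) = u" using d(10)[OF us(2)] P s by simp
      then show "cyl_pt (\<Phi> u) \<in> V" using P u by (simp add: Viff)
      show "Im (\<Phi> u) \<in> {0..1}" using P s by simp
    qed
    have QV: "Im (\<Psi> u) \<in> {0..<\<epsilon>}" "\<Phi> (\<Psi> u) = u" if u: "cyl_pt u \<in> V" for u
    proof -
      have us: "\<bar>Im u\<bar> < \<rho>" "0 \<le> Im u" "Im (\<Psi> u) < \<epsilon>" using u s by (auto simp: Viff)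
      then show *: "Im (\<Psi> u) \<in> {0..<\<epsilon>}" using d(9)[of u] by auto
      then have "\<bar>Im (\<Psi> u)\<bar> < \<rho>" using e \<sigma>(2) by auto
      then show "\<Phi> (\<Psi> u) = u" using d(11)[OF us(1)] by simp
    qed
    have "biholo (flat_cyl {0..<\<epsilon>}) (open_sub (flat_cyl {0..1}) V) (cyl_map \<Phi>)"
    proof (rule biholo_of_loc_lift[OF I J V])
      show "loc_lift {0..<\<epsilon>} UNIV {0..1} V (cyl_map \<Phi>)"
        unfolding loc_lift_def
      proof (intro allI impI exI[of _ "band \<rho>"] exI[of _ \<Phi>] conjI ballI)
        fix z assume "Im z \<in> {0..<\<epsilon>} \<and> cyl_pt z \<in> UNIV"
        then show "z \<in> band \<rho>" using e \<sigma>(2) by auto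
      next
        fix z u assume "u \<in> band \<rho>" and u: "Im u \<in> {0..<\<epsilon>} \<and> cyl_pt u \<in> UNIV"
        then show "Im (\<Phi> u) \<in> {0..1}" "cyl_pt (\<Phi> u) \<in> V" "cyl_pt (\<Phi> u) = cyl_map \<Phi> (cyl_pt u)"
          using PV[of u] mP[of u] by auto
      qed (rule open_band d(2))+
      show "loc_lift {0..1} V {0..<\<epsilon>} UNIV (cyl_map \<Psi>)"
        unfolding loc_lift_def
      proof (intro allI impI exI[of _ "band \<rho>"] exI[of _ \<Psi>] conjI ballI)
        fix z assume "Im z \<in> {0..1} \<and> cyl_pt z \<in> V"
        then show "z \<in> band \<rho>" using s by (auto simp: Viff)
      next
        fix z u assume "u \<in> band \<rho>" and u: "Im u \<in> {0..1} \<and> cyl_pt u \<in> V"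
        then show "Im (\<Psi> u) \<in> {0..<\<epsilon>}" "cyl_pt (\<Psi> u) = cyl_map \<Psi> (cyl_pt u)"
          using QV[of u] mQ[of u] by auto
      qed (rule open_band d(3) UNIV_I)+
      show "cyl_map \<Psi> (cyl_map \<Phi> (cyl_pt z)) = cyl_pt z" if z: "Im z \<in> {0..<\<epsilon>}" for z
      proof -
        have 1: "\<bar>Im z\<bar> < \<rho>" using z e \<sigma>(2) by auto
        have 2: "\<bar>Im (\<Phi> z)\<bar> < \<rho>" using PV(1)[OF z] s by (auto simp: Viff)
        show ?thesis unfolding mP[OF 1] mQ[OF 2] PV(3)[OF z] ..
      qed
      show "cyl_map \<Phi> (cyl_map \<Psi> (cyl_pt z)) = cyl_pt z" if z: "cyl_pt z \<in> V" for z
      proof -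
        have 1: "\<bar>Im z\<bar> < \<rho>" using z s by (auto simp: Viff)
        have 2: "\<bar>Im (\<Psi> z)\<bar> < \<rho>" using QV(1)[OF z] e \<sigma>(2) by auto
        show ?thesis unfolding mQ[OF 1] mP[OF 2] QV(2)[OF z] ..
      qed
    qed
    moreover have bd: "cyl_pt (\<Phi> (of_real x)) = (\<phi> (circ x), 0)" for x
      by (simp add: cyl_pt_def d(6,12))
    moreover have "range (\<lambda>p. (\<phi> p, 0)) \<subseteq> V"
    proof clarify
      fix p obtain x where x: "p = circ x" by (rule circ_surj)
      have "cyl_pt (\<Phi> (of_real x)) \<in> V" using PV(1)[of "of_real x"] e by simp
      then show "(\<phi> p, 0) \<in> V" unfolding bd x .
    qed
    moreover have "cyl_map \<Phi> (p, 0) = (\<phi> p, 0)" for p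
    proof -
      obtain x where x: "p = circ x" by (rule circ_surj)
      show ?thesis using mP[of "of_real x"] d(1) bd[of x] lower_strip_point[OF x] by (simp add: x)
    qed
    ultimately show ?thesis using V unfolding collar_def by blast
  qed
  then show thesis using \<sigma>(1) that by blast
qed

lemma top_collar:
  assumes e: "0 < \<epsilon>" "\<epsilon> < 1"
  shows "collar {-\<epsilon><..0} (flat_cyl {0..1}) (\<lambda>p. (p, 1)) (\<lambda>(p, x). (p, 1 + x))"
proof -
  have I: "cyl_ivl {-\<epsilon><..0} (-\<epsilon>) 0" and J: "cyl_ivl {0..1} 0 1" using e by (auto simp: cyl_ivl_def)
  let ?V = "UNIV \<times> {1 - \<epsilon><..1} :: (circle \<times> real) set"
  have V: "openin (topo (flat_cyl {0..1})) ?V"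
  proof (rule openin_flatI)
    fix z assume "cyl_pt z \<in> ?V"
    then have "1 - \<epsilon> < Im z" by simp
    moreover have "open {w. 1 - \<epsilon> < Im w}" by (intro open_Collect_less continuous_intros)
    ultimately show "\<exists>N. open N \<and> z \<in> N \<and> (\<forall>u\<in>N. Im u \<in> {0..1} \<longrightarrow> cyl_pt u \<in> ?V)"
      by (intro exI[of _ "{w. 1 - \<epsilon> < Im w}"]) auto
  qed (use e in auto)
  have i1: "(\<lambda>z. z + \<i> * of_real t) holomorphic_on UNIV" for t by (intro holomorphic_intros)
  have up: "(case cyl_pt u of (p, x) \<Rightarrow> (p, c + x)) = cyl_pt (u + \<i> * of_real c)" for u c
    by (simp add: cyl_pt_def add.commute)
  have "biholo (flat_cyl {-\<epsilon><..0}) (open_sub (flat_cyl {0..1}) ?V) (\<lambda>(p, x). (p, 1 + x))"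
  proof (rule biholo_of_loc_lift[OF I J V, where G="\<lambda>(p, x). (p, (-1) + x)"])
    show "loc_lift {-\<epsilon><..0} UNIV {0..1} ?V (\<lambda>(p, x). (p, 1 + x))"
      unfolding loc_lift_def
    proof (intro allI impI exI[of _ UNIV] exI[of _ "\<lambda>z. z + \<i> * of_real 1"] conjI ballI)
      fix u assume "Im u \<in> {-\<epsilon><..0} \<and> cyl_pt u \<in> UNIV"
      then show "Im (u + \<i> * of_real 1) \<in> {0..1}" "cyl_pt (u + \<i> * of_real 1) \<in> ?V"
        "cyl_pt (u + \<i> * of_real 1) = (case cyl_pt u of (p, x) \<Rightarrow> (p, 1 + x))"
        unfolding cyl_pt_in up using e by auto
    qed (rule open_UNIV UNIV_I i1)+
    show "loc_lift {0..1} ?V {-\<epsilon><..0} UNIV (\<lambda>(p, x). (p, (-1) + x))"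
      unfolding loc_lift_def
    proof (intro allI impI exI[of _ UNIV] exI[of _ "\<lambda>z. z + \<i> * of_real (-1)"] conjI ballI)
      fix u assume "Im u \<in> {0..1} \<and> cyl_pt u \<in> ?V"
      then show "Im (u + \<i> * of_real (-1)) \<in> {-\<epsilon><..0}"
        "cyl_pt (u + \<i> * of_real (-1)) = (case cyl_pt u of (p, x) \<Rightarrow> (p, (-1) + x))"
        unfolding cyl_pt_in up by auto
    qed (rule open_UNIV UNIV_I i1)+
  qed (auto split: prod.splits)
  moreover have "range (\<lambda>p. (p, 1)) \<subseteq> ?V" using e by auto
  ultimately show ?thesis using V unfolding collar_def by auto
qed

section \<open>The standard cylinders\<close>

lemma holo_map_flat_id:
  assumes I: "cyl_ivl I a b" shows "holo_map (flat_cyl I) (flat_cyl I) id"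
proof -
  have "loc_lift I UNIV I UNIV id"
    unfolding loc_lift_def by (intro allI impI exI[of _ UNIV] exI[of _ "\<lambda>z. z"]) auto
  moreover have "openin (topo (flat_cyl I)) (UNIV \<inter> UNIV \<times> I)"
    using openin_topspace[of "topo (flat_cyl I)"] by simp
  ultimately show ?thesis using loc_lift_imp_holo_map[OF I I, of UNIV UNIV id] by simp
qed

lemma flat_chart_open_image:
  assumes c: "flat_chart I a b D s \<beta> \<sigma>" and U: "open U"
  shows "openin (topo (flat_cyl I)) (s ` (U \<inter> D))"
proof (rule openin_flatI)
  note cd = flat_chartD[OF c]
  show "s ` (U \<inter> D) \<subseteq> UNIV \<times> I"
  proof (rule image_subsetI)
    fix w assume "w \<in> U \<inter> D"
    then have "w \<in> D" by blast
    then have "Im (\<beta> + \<sigma> * w) \<in> I" unfolding cd(2) by blast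
    then show "s w \<in> UNIV \<times> I" by (simp only: cd(1) cyl_pt_in)
  qed
  fix z assume "cyl_pt z \<in> s ` (U \<inter> D)"
  then obtain w where w: "w \<in> U" "w \<in> D" "cyl_pt z = cyl_pt (\<beta> + \<sigma> * w)" using cd(1) by auto
  obtain k :: int where k: "\<beta> + \<sigma> * w = z + of_real (2 * pi * of_int k)" using w(3) unfolding cyl_pt_eq_iff by blast
  let ?h = "\<lambda>u. \<sigma> * (u + of_real (2 * pi * of_int k) - \<beta>)"
  let ?N = "?h -` (U \<inter> chart_box a b)"
  have "open ?N" by (rule open_vimage) (auto intro!: continuous_intros U)
  moreover have "?h z = w" unfolding k[symmetric] by (rule cd(6))
  then have "z \<in> ?N" using w(1,2) cd(2) by simp
  moreover have "cyl_pt u \<in> s ` (U \<inter> D)" if u: "u \<in> ?N" "Im u \<in> I" for u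
  proof -
    have e: "\<beta> + \<sigma> * ?h u = u + of_real (2 * pi * of_int k)" by (rule cd(5))
    have "?h u \<in> D" unfolding cd(2) e using u by simp
    moreover have "s (?h u) = cyl_pt u" unfolding cd(1) e by (rule cyl_pt_add_period)
    ultimately show ?thesis using u by (metis IntI Int_iff image_eqI vimageE)
  qed
  ultimately show "\<exists>N. open N \<and> z \<in> N \<and> (\<forall>u\<in>N. Im u \<in> I \<longrightarrow> cyl_pt u \<in> s ` (U \<inter> D))" by blast
qed

lemma continuous_cyl_pt: "continuous_map (top_of_set (strip I)) (topo (flat_cyl I)) cyl_pt"
  unfolding continuous_map_def
proof (intro conjI allI impI)
  fix U assume "openin (topo (flat_cyl I)) U"
  then have "openin (top_of_set (strip I)) (cyl_pt -` U)" unfolding openin_flat by blast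
  moreover from this have "cyl_pt -` U \<subseteq> strip I" by (rule openin_imp_subset)
  moreover have "{x \<in> topspace (top_of_set (strip I)). cyl_pt x \<in> U} = cyl_pt -` U" using calculation(2) by auto
  ultimately show "openin (top_of_set (strip I)) {x \<in> topspace (top_of_set (strip I)). cyl_pt x \<in> U}" by simp
qed auto

text \<open>The property is pulled back from the plane along the continuous injection
  \<open>Ecyl\<close>.\<close>

lemma Hausdorff_flat: "Hausdorff_space (topo (flat_cyl I))"
proof (rule Hausdorff_space_injective_preimage[OF Hausdorff_space_euclidean, of _ Ecyl])
  show "continuous_map (topo (flat_cyl I)) euclidean Ecyl"
    unfolding continuous_map_def
  proof (intro conjI allI impI)
    fix U :: "complex set" assume U: "openin euclidean U"
    show "openin (topo (flat_cyl I)) {x \<in> topspace (topo (flat_cyl I)). Ecyl x \<in> U}"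
    proof (rule openin_flatI)
      fix z assume "cyl_pt z \<in> {x \<in> topspace (topo (flat_cyl I)). Ecyl x \<in> U}"
      then have "exp (\<i> * z) \<in> U" by (simp add: Ecyl_cyl_pt)
      moreover have "open ((\<lambda>z. exp (\<i> * z)) -` U)" by (rule open_vimage) (use U in \<open>auto intro!: continuous_intros\<close>)
      ultimately show "\<exists>N. open N \<and> z \<in> N \<and> (\<forall>u\<in>N. Im u \<in> I \<longrightarrow> cyl_pt u \<in> {x \<in> topspace (topo (flat_cyl I)). Ecyl x \<in> U})"
        by (intro exI[of _ "(\<lambda>z. exp (\<i> * z)) -` U"]) (auto simp: Ecyl_cyl_pt)
    qed auto
  qed auto
  show "inj_on Ecyl (topspace (topo (flat_cyl I)))" using inj_Ecyl by (rule inj_on_subset) simp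
qed

lemma riemann_surface_flat:
  assumes I: "cyl_ivl I a b" shows "riemann_surface (flat_cyl I)"
  unfolding riemann_surface_def
proof (intro conjI)
  show "Hausdorff_space (topo (flat_cyl I))" by (rule Hausdorff_flat)
  show "holo_map (flat_cyl I) (flat_cyl I) id" by (rule holo_map_flat_id[OF I])
  show "\<forall>(D, s) \<in> atlas (flat_cyl I). openin (top_of_set upper_half) D \<and>
        embedding_map (top_of_set D) (topo (flat_cyl I)) s \<and> openin (topo (flat_cyl I)) (s ` D)"
  proof (clarify, intro conjI)
    fix D s assume c: "(D, s) \<in> atlas (flat_cyl I)"
    obtain \<beta> \<sigma> where ch: "flat_chart I a b D s \<beta> \<sigma>" by (rule flat_cyl_atlasD[OF I c])
    note cd = flat_chartD[OF ch]
    show "openin (topo (flat_cyl I)) (s ` D)" using flat_chart_open_image[OF ch open_UNIV] by simp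
    have "openin (top_of_set (chart_box a b \<inter> upper_half)) D"
    proof -
      \<comment> \<open>Membership in I is decided only at the end where the chart starts, so D is
        the half-box with its bottom line either kept or removed.\<close>
      have inI: "a + y \<in> I \<longleftrightarrow> a \<in> I \<or> 0 < y" "b - y \<in> I \<longleftrightarrow> b \<in> I \<or> 0 < y" if "0 \<le> y" "y < b - a" for y
        using I that by (auto simp: cyl_ivl_def)
      consider "D = {w. \<bar>Re w\<bar> < pi \<and> 0 \<le> Im w \<and> Im w < b - a \<and> a + Im w \<in> I}"
        | "D = {w. \<bar>Re w\<bar> < pi \<and> 0 \<le> Im w \<and> Im w < b - a \<and> b - Im w \<in> I}"
        using c by (auto simp: flat_cyl_def Let_def cyl_ivlD[OF I])
      then have "\<exists>P. D = (chart_box a b \<inter> upper_half) \<inter> {w. P \<or> 0 < Im w}"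
      proof cases
        case 1
        have "w \<in> D \<longleftrightarrow> w \<in> (chart_box a b \<inter> upper_half) \<inter> {w. a \<in> I \<or> 0 < Im w}" for w
          using inI(1)[of "Im w"] unfolding 1 by (auto simp: chart_box_def upper_half_def)
        then show ?thesis by blast
      next
        case 2
        have "w \<in> D \<longleftrightarrow> w \<in> (chart_box a b \<inter> upper_half) \<inter> {w. b \<in> I \<or> 0 < Im w}" for w
          using inI(2)[of "Im w"] unfolding 2 by (auto simp: chart_box_def upper_half_def)
        then show ?thesis by blast
      qed
      moreover have "open {w. P \<or> 0 < Im w}" for P
        by (cases P) (simp_all add: open_Collect_less continuous_on_const continuous_on_Im)
      ultimately show ?thesis by (metis openin_open_Int)
    qed
    moreover have "openin (top_of_set upper_half) (chart_box a b \<inter> upper_half)"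
      by (subst Int_commute) (rule openin_open_Int[OF open_chart_box])
    ultimately show "openin (top_of_set upper_half) D" by (rule openin_trans)
    show "embedding_map (top_of_set D) (topo (flat_cyl I)) s"
    proof (rule injective_open_imp_embedding_map)
      have "continuous_map (top_of_set D) (top_of_set (strip I)) (\<lambda>w. \<beta> + \<sigma> * w)"
        using cd(2) by (auto intro!: continuous_intros simp: continuous_map_in_subtopology)
      from continuous_map_compose[OF this continuous_cyl_pt] show "continuous_map (top_of_set D) (topo (flat_cyl I)) s"
        by (rule continuous_map_eq) (simp only: cd(1) o_apply)
      show "open_map (top_of_set D) (topo (flat_cyl I)) s"
        unfolding open_map_def
      proof (intro allI impI)
        fix U assume "openin (top_of_set D) U"
        then obtain O' where "open O'" "U = D \<inter> O'" by (auto simp: openin_open)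
        then show "openin (topo (flat_cyl I)) (s ` U)" using flat_chart_open_image[OF ch, of O'] by (simp add: Int_commute)
      qed
      show "inj_on s (topspace (top_of_set D))" using flat_chart_inj[OF ch] by simp
    qed
  qed
  show "topspace (topo (flat_cyl I)) = (\<Union>(D, s)\<in>atlas (flat_cyl I). s ` D)"
  proof (intro equalityI subsetI)
    fix p assume p: "p \<in> topspace (topo (flat_cyl I))"
    obtain z where z: "p = cyl_pt z" by (rule cyl_pt_surj)
    have "Im z \<in> I" using p unfolding z by simp
    then obtain D s \<beta> \<sigma> where c: "(D, s) \<in> atlas (flat_cyl I)" "flat_chart I a b D s \<beta> \<sigma>" "\<sigma> * (z - \<beta>) \<in> D"
      using flat_cyl_atlas_cover[OF I] by metis
    have "s (\<sigma> * (z - \<beta>)) = p" unfolding flat_chartD(1,5)[OF c(2)] z ..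
    then show "p \<in> (\<Union>(D, s)\<in>atlas (flat_cyl I). s ` D)" using c(1,3) by blast
  next
    fix p assume "p \<in> (\<Union>(D, s)\<in>atlas (flat_cyl I). s ` D)"
    then obtain D s w where c: "(D, s) \<in> atlas (flat_cyl I)" "w \<in> D" "p = s w" by blast
    obtain \<beta> \<sigma> where ch: "flat_chart I a b D s \<beta> \<sigma>" by (rule flat_cyl_atlasD[OF I c(1)])
    show "p \<in> topspace (topo (flat_cyl I))" using c(2) unfolding c(3) flat_chartD(1,2)[OF ch] by simp
  qed
qed

lemma reparam_std: "surf (reparam std_cyl \<phi>) = flat_cyl {0..1}" "bd1 (reparam std_cyl \<phi>) = (\<lambda>p. (\<phi> p, 0))"
  "bd2 (reparam std_cyl \<phi>) = (\<lambda>p. (p, 1))" "reparam std_cyl id = std_cyl" "surf std_cyl = flat_cyl {0..1}"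
  "reparam (reparam std_cyl \<phi>) \<psi> = reparam std_cyl (\<phi> \<circ> \<psi>)"
  "bd1 std_cyl = (\<lambda>p. (p, 0))" "bd2 std_cyl = (\<lambda>p. (p, 1))"
  by (simp_all add: reparam_def std_cyl_def o_def)

lemma ext_pair_surj: assumes E: "ext_pair \<phi> \<Phi> \<Psi> \<rho>" shows "surj \<phi>"
proof -
  have "\<exists>x. p = \<phi> x" for p
  proof -
    obtain t where t: "p = circ t" by (rule circ_surj)
    note d = ext_pairD[OF E]
    let ?y = "Re (\<Psi> (of_real t))"
    have y: "of_real ?y = \<Psi> (of_real t)" using d(7)[of t] by (simp add: complex_eq_iff)
    have "\<Phi> (\<Psi> (of_real t)) = of_real t" using d(11)[of "of_real t"] d(1,7) by simp
    then have "\<phi> (circ ?y) = circ t" unfolding d(12) y by simp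
    then show ?thesis using t by metis
  qed
  then show ?thesis by (metis surj_def)
qed

lemma flat_model_reparam:
  assumes E: "ext_pair \<phi> \<Phi> \<Psi> \<rho>" shows "flat_model 1 (reparam std_cyl \<phi>)"
proof -
  have "range (\<lambda>p. (\<phi> p, 0::real)) = UNIV \<times> {0}"
    using ext_pair_surj[OF E] by (auto simp: image_iff surj_def)
  moreover have "range (\<lambda>p::circle. (p, 1::real)) = UNIV \<times> {1}" by auto
  ultimately show ?thesis unfolding flat_model_def reparam_std by auto
qed

lemma cylinder_reparam:
  assumes E: "ext_pair \<phi> \<Phi> \<Psi> \<rho>" shows "cylinder (reparam std_cyl \<phi>)"
  unfolding cylinder_def reparam_std
proof (intro conjI)
  have J: "cyl_ivl {0..1} 0 (1::real)" by (simp add: cyl_ivl_def)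
  show "riemann_surface (flat_cyl {0..1})" by (rule riemann_surface_flat[OF J])
  show "topo (flat_cyl {0..1}) homeomorphic_space topo (flat_cyl {0..1})" by (rule homeomorphic_space_refl)
  show "surface_boundary (flat_cyl {0..1}) = range (\<lambda>p. (\<phi> p, 0)) \<union> range (\<lambda>p. (p, 1))"
    using flat_model_reparam[OF E] surface_boundary_flat[of 1] by (simp add: flat_model_def reparam_std)
  show "range (\<lambda>p. (\<phi> p, 0::real)) \<inter> range (\<lambda>p. (p, 1)) = {}" by auto
  obtain \<sigma> where s: "0 < \<sigma>" "\<And>\<epsilon>. 0 < \<epsilon> \<Longrightarrow> \<epsilon> < \<sigma> \<Longrightarrow> collar {0..<\<epsilon>} (flat_cyl {0..1}) (\<lambda>p. (\<phi> p, 0)) (cyl_map \<Phi>)"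
    by (rule ext_pair_collar[OF E]) (rule that; blast)
  show "\<exists>\<epsilon>>0. \<exists>Z. collar {0..<\<epsilon>} (flat_cyl {0..1}) (\<lambda>p. (\<phi> p, 0)) Z"
    using s(1) s(2)[of "\<sigma>/2"] by (intro exI[of _ "\<sigma>/2"]) auto
  show "\<exists>\<epsilon>>0. \<exists>Z. collar {- \<epsilon><..0} (flat_cyl {0..1}) (\<lambda>p. (p, 1)) Z"
    using top_collar[of "1/2"] by (intro exI[of _ "1/2"]) auto
qed

lemma ext_pair_id: "ext_pair id (\<lambda>z. z) (\<lambda>z. z) 1"
  by (simp add: ext_pair_def)

section \<open>Smooth cutoff functions\<close>

text \<open>A family closed under differentiation: in the variable X = 1/t the polynomial p turns
  into X^2 (p - p'). Iterating from p = 1 gives all derivatives of exp (-1/t).\<close>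

definition exp_poly :: "real poly \<Rightarrow> real \<Rightarrow> real" where
  "exp_poly p t = (if 0 < t then poly p (1 / t) * exp (- 1 / t) else 0)"

lemma poly_exp_tendsto_0: "((\<lambda>x. poly p x * exp (- x)) \<longlongrightarrow> 0) at_top" for p :: "real poly"
proof -
  have "((\<lambda>x. \<Sum>i\<le>degree p. coeff p i * (x ^ i / exp x)) \<longlongrightarrow> (\<Sum>i\<le>degree p. coeff p i * 0)) at_top"
    by (intro tendsto_intros tendsto_power_div_exp_0)
  then show ?thesis
    by (simp add: poly_altdef sum_divide_distrib exp_minus field_simps)
qed

lemma exp_poly_tendsto_0: "((\<lambda>t. poly p (1 / t) * exp (- 1 / t)) \<longlongrightarrow> 0) (at_right 0)" for p :: "real poly"
proof -
  have "filterlim (\<lambda>t::real. inverse t) at_top (at_right 0)" by (rule filterlim_inverse_at_top_right)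
  from filterlim_compose[OF poly_exp_tendsto_0[of p] this] show ?thesis by (simp add: inverse_eq_divide)
qed

lemma exp_poly_derivative:
  "(exp_poly p has_real_derivative exp_poly (monom 1 2 * (p - pderiv p)) t) (at t)"
proof -
  consider "t > 0" | "t < 0" | "t = 0" by linarith
  then show ?thesis
  proof cases
    case 1
    have "((\<lambda>t. poly p (1 / t) * exp (- 1 / t)) has_real_derivative exp_poly (monom 1 2 * (p - pderiv p)) t) (at t)"
      using 1 by (auto intro!: derivative_eq_intros DERIV_chain2[OF poly_DERIV]
          simp: exp_poly_def poly_monom power2_eq_square field_simps)
    then show ?thesis
      by (rule has_field_derivative_transform_within_open[of _ _ _ "{0<..}"]) (use 1 in \<open>auto simp: exp_poly_def\<close>)
  next
    case 2
    have "((\<lambda>t. 0) has_real_derivative exp_poly (monom 1 2 * (p - pderiv p)) t) (at t)"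
      using 2 by (simp add: exp_poly_def)
    then show ?thesis
      by (rule has_field_derivative_transform_within_open[of _ _ _ "{..<0}"]) (use 2 in \<open>auto simp: exp_poly_def\<close>)
  next
    case 3
    have "((\<lambda>y. (exp_poly p y - exp_poly p 0) / (y - 0)) \<longlongrightarrow> 0) (at 0)"
      unfolding filterlim_at_split
    proof
      show "((\<lambda>y. (exp_poly p y - exp_poly p 0) / (y - 0)) \<longlongrightarrow> 0) (at_left 0)"
        by (rule tendsto_eventually) (auto simp: exp_poly_def eventually_at_filter)
      \<comment> \<open>Dividing by t multiplies the polynomial in 1/t by its variable, so the
        difference quotient at 0 is of the same form.\<close>
      have "((\<lambda>t. poly (pCons 0 p) (1 / t) * exp (- 1 / t)) \<longlongrightarrow> 0) (at_right 0)" by (rule exp_poly_tendsto_0)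
      then show "((\<lambda>y. (exp_poly p y - exp_poly p 0) / (y - 0)) \<longlongrightarrow> 0) (at_right 0)"
        by (rule Lim_transform_eventually) (auto simp: exp_poly_def eventually_at_filter)
    qed
    then show ?thesis using 3 by (simp add: has_field_derivative_iff exp_poly_def)
  qed
qed

lemma smooth_cutoff_exists:
  assumes "p < q"
  obtains \<kappa> :: "real \<Rightarrow> real" where "\<forall>N k. open N \<longrightarrow> Ck_on k N (\<lambda>z. \<kappa> (Im z))" "\<forall>x\<le>p. \<kappa> x = 1" "\<forall>x\<ge>q. \<kappa> x = 0"
proof -
  define d where "d n = exp_poly (((\<lambda>p. monom 1 2 * (p - pderiv p)) ^^ n) 1)" for n
  have d: "(d n has_real_derivative d (Suc n) t) (at t)" for n t
    using exp_poly_derivative by (simp add: d_def)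
  have d0: "d 0 t = (if 0 < t then exp (- 1 / t) else 0)" for t by (simp add: d_def exp_poly_def)
  \<comment> \<open>The quotient A / (A + B) with A positive exactly below q and B exactly above p;
    since p < q they never vanish together. The arguments are spelled out as affine functions to fit
    \<open>Ck_on_Im_tower\<close>.\<close>
  define \<kappa> where "\<kappa> x = d 0 (-1 * x + q) * inverse (d 0 (-1 * x + q) + d 0 (1 * x + (- p)))" for x
  have nz: "d 0 (-1 * x + q) + d 0 (1 * x + (- p)) \<noteq> 0" for x
  proof -
    have "0 < d 0 (-1 * x + q) \<or> 0 < d 0 (1 * x + (- p))" using assms by (auto simp: d0)
    moreover have "0 \<le> d 0 y" for y by (simp add: d0)
    ultimately show ?thesis by (metis add_nonneg_eq_0_iff less_irrefl)
  qed
  have "Ck_on k N (\<lambda>z. \<kappa> (Im z))" if N: "open N" for N k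
    unfolding \<kappa>_def
    by (intro Ck_on_mult Ck_on_inverse Ck_on_add N Ck_on_Im_tower[OF N, of d] d nz)
  moreover have "\<kappa> x = 1" if "x \<le> p" for x
    using nz[of x] that by (simp add: \<kappa>_def d0)
  moreover have "\<kappa> x = 0" if "x \<ge> q" for x using that by (simp add: \<kappa>_def d0)
  ultimately show thesis by (intro that[of \<kappa>]) auto
qed

section \<open>Admissible metrics\<close>

text \<open>The point z is produced before F, H and the density are quantified, so that two
  pulled-back metrics can be evaluated at the same z.\<close>

lemma pull_metric_of:
  assumes I: "cyl_ivl I a b" "I \<subseteq> {x. \<bar>x\<bar> < \<rho>}"
    and c: "(D, s) \<in> atlas (flat_cyl I)" "w \<in> D"
  obtains z where "Im z \<in> I" "s w = cyl_pt z"
    "\<forall>F H \<gamma>. H holomorphic_on band \<rho> \<longrightarrow> (\<forall>u. Im u \<in> I \<longrightarrow> Im (H u) \<in> {0..1} \<and> cyl_pt (H u) = F (cyl_pt u)) \<longrightarrow>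
       smooth_on (strip {0..1}) (\<lambda>z. \<gamma> (cyl_pt z)) \<longrightarrow>
       pull_metric (flat_cyl {0..1}) F (metric_of \<gamma>) (D, s) w = \<gamma> (cyl_pt (H z)) + 2 * ln (cmod (deriv H z))"
proof -
  have J: "cyl_ivl {0..1} 0 (1::real)" by (simp add: cyl_ivl_def)
  obtain \<beta> \<sigma> where ch: "flat_chart I a b D s \<beta> \<sigma>" by (rule flat_cyl_atlasD[OF I(1) c(1)])
  note cd = flat_chartD[OF ch]
  let ?z = "\<beta> + \<sigma> * w"
  have zI: "Im ?z \<in> I" using c(2) cd(2) by blast
  have "pull_metric (flat_cyl {0..1}) F (metric_of \<gamma>) (D, s) w = \<gamma> (cyl_pt (H ?z)) + 2 * ln (cmod (deriv H ?z))"
    if H: "H holomorphic_on band \<rho>" and F: "\<forall>u. Im u \<in> I \<longrightarrow> Im (H u) \<in> {0..1} \<and> cyl_pt (H u) = F (cyl_pt u)"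
      and \<gamma>: "smooth_on (strip {0..1}) (\<lambda>z. \<gamma> (cyl_pt z))" for F H \<gamma>
  proof -
    have "pull_metric (flat_cyl {0..1}) F (metric_of \<gamma>) (D, s) w
        = gam (flat_cyl {0..1}) (metric_of \<gamma>) (F (cyl_pt ?z)) + 2 * ln (cmod (deriv H ?z))"
      by (rule pull_metric_lift[OF I(1) J c(1) ch open_band _ H _ c(2)]) (use zI I(2) F in auto)
    moreover have "F (cyl_pt ?z) = cyl_pt (H ?z)" "Im (H ?z) \<in> {0..1}" using F zI by auto
    moreover have "gam (flat_cyl {0..1}) (metric_of \<gamma>) (cyl_pt (H ?z)) = \<gamma> (cyl_pt (H ?z))"
      by (rule metric_of(2)[OF J \<gamma>]) (use calculation(3) in \<open>simp only: cyl_pt_in\<close>)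
    ultimately show ?thesis by simp
  qed
  then show thesis by (intro that[of ?z] zI cd(1)) blast
qed

lemma metric_eq_flatI:
  assumes I: "cyl_ivl I a b" "I \<subseteq> {x. \<bar>x\<bar> < \<rho>}" and H: "H holomorphic_on band \<rho>"
    and F: "\<And>u. Im u \<in> I \<Longrightarrow> Im (H u) \<in> {0..1} \<and> cyl_pt (H u) = F (cyl_pt u)"
    and \<gamma>: "smooth_on (strip {0..1}) (\<lambda>z. \<gamma> (cyl_pt z))"
    and z: "\<And>z. Im z \<in> I \<Longrightarrow> cyl_pt z \<in> E \<Longrightarrow> \<gamma> (cyl_pt (H z)) + 2 * ln (cmod (deriv H z)) = 0"
  shows "metric_eq_on (flat_cyl I) E (pull_metric (flat_cyl {0..1}) F (metric_of \<gamma>)) flat_metric"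
  unfolding metric_eq_on_def
proof (clarify)
  fix D s w assume c: "(D, s) \<in> atlas (flat_cyl I)" "w \<in> D" "s w \<in> E"
  obtain z where z': "Im z \<in> I" "s w = cyl_pt z"
    "\<forall>F H \<gamma>. H holomorphic_on band \<rho> \<longrightarrow> (\<forall>u. Im u \<in> I \<longrightarrow> Im (H u) \<in> {0..1} \<and> cyl_pt (H u) = F (cyl_pt u)) \<longrightarrow>
       smooth_on (strip {0..1}) (\<lambda>z. \<gamma> (cyl_pt z)) \<longrightarrow>
       pull_metric (flat_cyl {0..1}) F (metric_of \<gamma>) (D, s) w = \<gamma> (cyl_pt (H z)) + 2 * ln (cmod (deriv H z))"
    by (rule pull_metric_of[OF I c(1,2)]) (rule that; assumption)
  have "pull_metric (flat_cyl {0..1}) F (metric_of \<gamma>) (D, s) w = \<gamma> (cyl_pt (H z)) + 2 * ln (cmod (deriv H z))"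
    using z'(3)[rule_format, OF H F \<gamma>] .
  also have "\<dots> = 0" using z[OF z'(1)] c(3) z'(2) by simp
  finally show "pull_metric (flat_cyl {0..1}) F (metric_of \<gamma>) (D, s) w = flat_metric (D, s) w" by (simp add: flat_metric_def)
qed

lemma metric_eq_pullI:
  assumes I: "cyl_ivl I a b" "I \<subseteq> {x. \<bar>x\<bar> < \<rho>}"
    and H: "H holomorphic_on band \<rho>" "\<And>u. Im u \<in> I \<Longrightarrow> Im (H u) \<in> {0..1} \<and> cyl_pt (H u) = F (cyl_pt u)"
    and \<gamma>: "smooth_on (strip {0..1}) (\<lambda>z. \<gamma> (cyl_pt z))"
    and H': "H' holomorphic_on band \<rho>" "\<And>u. Im u \<in> I \<Longrightarrow> Im (H' u) \<in> {0..1} \<and> cyl_pt (H' u) = F' (cyl_pt u)"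
    and \<gamma>': "smooth_on (strip {0..1}) (\<lambda>z. \<gamma>' (cyl_pt z))"
    and z: "\<And>z. Im z \<in> I \<Longrightarrow> cyl_pt z \<in> E \<Longrightarrow>
      \<gamma> (cyl_pt (H z)) + 2 * ln (cmod (deriv H z)) = \<gamma>' (cyl_pt (H' z)) + 2 * ln (cmod (deriv H' z))"
  shows "metric_eq_on (flat_cyl I) E (pull_metric (flat_cyl {0..1}) F (metric_of \<gamma>)) (pull_metric (flat_cyl {0..1}) F' (metric_of \<gamma>'))"
  unfolding metric_eq_on_def
proof (clarify)
  fix D s w assume c: "(D, s) \<in> atlas (flat_cyl I)" "w \<in> D" "s w \<in> E"
  obtain z where z': "Im z \<in> I" "s w = cyl_pt z"
    "\<forall>F H \<gamma>. H holomorphic_on band \<rho> \<longrightarrow> (\<forall>u. Im u \<in> I \<longrightarrow> Im (H u) \<in> {0..1} \<and> cyl_pt (H u) = F (cyl_pt u)) \<longrightarrow>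
       smooth_on (strip {0..1}) (\<lambda>z. \<gamma> (cyl_pt z)) \<longrightarrow>
       pull_metric (flat_cyl {0..1}) F (metric_of \<gamma>) (D, s) w = \<gamma> (cyl_pt (H z)) + 2 * ln (cmod (deriv H z))"
    by (rule pull_metric_of[OF I c(1,2)]) (rule that; assumption)
  have "pull_metric (flat_cyl {0..1}) F (metric_of \<gamma>) (D, s) w = \<gamma> (cyl_pt (H z)) + 2 * ln (cmod (deriv H z))"
    using z'(3)[rule_format, OF H \<gamma>] .
  moreover have "pull_metric (flat_cyl {0..1}) F' (metric_of \<gamma>') (D, s) w = \<gamma>' (cyl_pt (H' z)) + 2 * ln (cmod (deriv H' z))"
    using z'(3)[rule_format, OF H' \<gamma>'] .
  ultimately show "pull_metric (flat_cyl {0..1}) F (metric_of \<gamma>) (D, s) w = pull_metric (flat_cyl {0..1}) F' (metric_of \<gamma>') (D, s) w"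
    using z[OF z'(1)] c(3) z'(2) by simp
qed

lemma ext_pair_deriv:
  assumes E: "ext_pair \<phi> \<Phi> \<Psi> \<rho>" and z: "\<bar>Im z\<bar> < \<rho>" "\<bar>Im (\<Phi> z)\<bar> < \<rho>"
  shows "deriv \<Psi> (\<Phi> z) * deriv \<Phi> z = 1"
proof -
  note d = ext_pairD[OF E]
  let ?N = "band \<rho> \<inter> \<Phi> -` band \<rho>"
  have o: "open ?N"
    by (rule continuous_open_preimage[OF holomorphic_on_imp_continuous_on[OF d(2)] open_band open_band])
  have "((\<lambda>u. \<Psi> (\<Phi> u)) has_field_derivative deriv \<Psi> (\<Phi> z) * deriv \<Phi> z) (at z)"
    by (rule DERIV_chain2[OF holomorphic_derivI[OF d(3) open_band] holomorphic_derivI[OF d(2) open_band]]) (use z in auto)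
  then have "((\<lambda>u. u) has_field_derivative deriv \<Psi> (\<Phi> z) * deriv \<Phi> z) (at z)"
    by (rule has_field_derivative_transform_within_open[OF _ o]) (use z d(10) in auto)
  then show ?thesis using DERIV_unique[OF _ DERIV_ident] by blast
qed

lemma ln_inverse_product: "a * b = 1 \<Longrightarrow> 2 * ln (cmod a) + 2 * ln (cmod b) = 0"
proof -
  assume e: "a * b = 1"
  then have "a \<noteq> 0" "b \<noteq> 0" by auto
  then have "ln (cmod a) + ln (cmod b) = ln (cmod (a * b))" by (simp add: norm_mult ln_mult)
  then show ?thesis by (simp add: e)
qed

text \<open>At the bottom the condition says that the metric is flat in the coordinate given by
  \<Phi>; the top parametrization is a translation, for which flat means density zero.\<close>

lemma Adm_metric_of:
  assumes A: "surf A = flat_cyl {0..1}" "bd1 A = (\<lambda>p. (\<phi> p, 0))" "bd2 A = (\<lambda>p. (p, 1))"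
    and E: "ext_pair \<phi> \<Phi> \<Psi> \<rho>" and \<gamma>: "smooth_on (strip {0..1}) (\<lambda>z. \<gamma> (cyl_pt z))"
    and bot: "0 < \<eta>" "\<And>z. 0 \<le> Im z \<Longrightarrow> Im z < \<eta> \<Longrightarrow> \<gamma> (cyl_pt (\<Phi> z)) + 2 * ln (cmod (deriv \<Phi> z)) = 0"
    and top: "t < 1" "\<And>z. t \<le> Im z \<Longrightarrow> \<gamma> (cyl_pt z) = 0"
  shows "metric_of \<gamma> \<in> Adm A"
  unfolding Adm_def A
proof (intro CollectI conjI)
  note d = ext_pairD[OF E]
  have J: "cyl_ivl {0..1} 0 (1::real)" by (simp add: cyl_ivl_def)
  show "conf_metric (flat_cyl {0..1}) (metric_of \<gamma>)" by (rule metric_of(1)[OF J \<gamma>])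
  obtain \<sigma> where s: "0 < \<sigma>" "\<And>\<epsilon>. 0 < \<epsilon> \<Longrightarrow> \<epsilon> < \<sigma> \<Longrightarrow> collar {0..<\<epsilon>} (flat_cyl {0..1}) (\<lambda>p. (\<phi> p, 0)) (cyl_map \<Phi>)"
    by (rule ext_pair_collar[OF E]) (rule that; blast)
  obtain \<sigma>' where s': "0 < \<sigma>'" "\<sigma>' \<le> \<rho>" "\<And>z. \<bar>Im z\<bar> < \<sigma>' \<Longrightarrow> \<bar>Im (\<Phi> z)\<bar> < 1" "\<And>z. \<bar>Im z\<bar> < \<sigma>' \<Longrightarrow> \<bar>Im (\<Psi> z)\<bar> < 1"
    by (rule ext_pair_small[OF E zero_less_one]) (rule that; blast)
  define \<epsilon> where "\<epsilon> = min (\<sigma> / 2) (min \<sigma>' \<eta>)"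
  have e: "0 < \<epsilon>" "\<epsilon> < \<sigma>" "\<epsilon> \<le> \<sigma>'" "\<epsilon> \<le> \<eta>" using s(1) s'(1) bot(1) by (auto simp: \<epsilon>_def)
  have "metric_eq_on (flat_cyl {0..<\<epsilon>}) UNIV (pull_metric (flat_cyl {0..1}) (cyl_map \<Phi>) (metric_of \<gamma>)) flat_metric"
  proof (rule metric_eq_flatI[OF _ _ d(2) _ \<gamma>])
    show "cyl_ivl {0..<\<epsilon>} 0 \<epsilon>" using e by (simp add: cyl_ivl_def)
    show "{0..<\<epsilon>} \<subseteq> {x. \<bar>x\<bar> < \<rho>}" using e s'(2) by auto
    show "Im (\<Phi> u) \<in> {0..1} \<and> cyl_pt (\<Phi> u) = cyl_map \<Phi> (cyl_pt u)" if u: "Im u \<in> {0..<\<epsilon>}" for u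
    proof -
      have 1: "\<bar>Im u\<bar> < \<sigma>'" "\<bar>Im u\<bar> < \<rho>" "0 \<le> Im u" using u e s'(2) by auto
      show ?thesis using s'(3)[OF 1(1)] d(8)[OF 1(2,3)] ext_pair_cyl_map(1)[OF E 1(2)] by simp
    qed
    show "\<gamma> (cyl_pt (\<Phi> z)) + 2 * ln (cmod (deriv \<Phi> z)) = 0" if "Im z \<in> {0..<\<epsilon>}" for z
      using bot(2)[of z] that e by auto
  qed
  then show "\<exists>\<epsilon>>0. \<exists>Z. collar {0..<\<epsilon>} (flat_cyl {0..1}) (\<lambda>p. (\<phi> p, 0)) Z \<and>
    metric_eq_on (flat_cyl {0..<\<epsilon>}) UNIV (pull_metric (flat_cyl {0..1}) Z (metric_of \<gamma>)) flat_metric"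
    using e(1) s(2)[OF e(1,2)] by blast
  define \<delta> where "\<delta> = min (1/2) (1 - t)"
  have dl: "0 < \<delta>" "\<delta> < 1" "\<delta> \<le> 1 - t" using top(1) by (auto simp: \<delta>_def)
  have i: "(\<lambda>z. z + \<i>) holomorphic_on band 1" by (intro holomorphic_intros)
  have "metric_eq_on (flat_cyl {-\<delta><..0}) UNIV (pull_metric (flat_cyl {0..1}) (\<lambda>(p, x). (p, 1 + x)) (metric_of \<gamma>)) flat_metric"
  proof (rule metric_eq_flatI[OF _ _ i _ \<gamma>])
    show "cyl_ivl {-\<delta><..0} (-\<delta>) 0" using dl by (simp add: cyl_ivl_def)
    show "{-\<delta><..0} \<subseteq> {x. \<bar>x\<bar> < 1}" using dl by auto
    show "Im (u + \<i>) \<in> {0..1} \<and> cyl_pt (u + \<i>) = (case cyl_pt u of (p, x) \<Rightarrow> (p, 1 + x))" if "Im u \<in> {-\<delta><..0}" for u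
      using that dl by (auto simp: cyl_pt_def)
    have "deriv (\<lambda>z. z + \<i>) z = 1" for z by (rule DERIV_imp_deriv) (auto intro!: derivative_eq_intros)
    then show "\<gamma> (cyl_pt (z + \<i>)) + 2 * ln (cmod (deriv (\<lambda>z. z + \<i>) z)) = 0" if "Im z \<in> {-\<delta><..0}" for z
      using top(2)[of "z + \<i>"] that dl by simp
  qed
  then show "\<exists>\<epsilon>>0. \<exists>Z. collar {-\<epsilon><..0} (flat_cyl {0..1}) (\<lambda>p. (p, 1)) Z \<and>
    metric_eq_on (flat_cyl {-\<epsilon><..0}) UNIV (pull_metric (flat_cyl {0..1}) Z (metric_of \<gamma>)) flat_metric"
    using dl(1) top_collar[OF dl(1,2)] by blast
qed

text \<open>The log-density of the push-forward of the flat metric, cut off away from the boundary.\<close>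

definition cut_factor :: "(real \<Rightarrow> real) \<Rightarrow> (complex \<Rightarrow> complex) \<Rightarrow> real \<Rightarrow> complex \<Rightarrow> real" where
  "cut_factor \<kappa> \<Psi> \<rho> z = (if \<bar>Im z\<bar> < \<rho> then \<kappa> (Im z) * (2 * ln (cmod (deriv \<Psi> z))) else 0)"

lemma ext_pair_deriv':
  assumes E: "ext_pair \<phi> \<Phi> \<Psi> \<rho>" and z: "\<bar>Im z\<bar> < \<rho>" "\<bar>Im (\<Psi> z)\<bar> < \<rho>"
  shows "deriv \<Phi> (\<Psi> z) * deriv \<Psi> z = 1"
proof -
  note d = ext_pairD[OF E]
  let ?N = "band \<rho> \<inter> \<Psi> -` band \<rho>"
  have o: "open ?N"
    by (rule continuous_open_preimage[OF holomorphic_on_imp_continuous_on[OF d(3)] open_band open_band])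
  have "((\<lambda>u. \<Phi> (\<Psi> u)) has_field_derivative deriv \<Phi> (\<Psi> z) * deriv \<Psi> z) (at z)"
    by (rule DERIV_chain2[OF holomorphic_derivI[OF d(2) open_band] holomorphic_derivI[OF d(3) open_band]]) (use z in auto)
  then have "((\<lambda>u. u) has_field_derivative deriv \<Phi> (\<Psi> z) * deriv \<Psi> z) (at z)"
    by (rule has_field_derivative_transform_within_open[OF _ o]) (use z d(11) in auto)
  then show ?thesis using DERIV_unique[OF _ DERIV_ident] by blast
qed

text \<open>The formula governs Im z < q, zero governs Im z > q', and q' < q makes these regions
  overlap. The bound on Im (\<Psi> z) gives access to the chain rule with \<Phi>, which keeps
  \<Psi>' from vanishing under the logarithm.\<close>

lemma cut_factor:
  assumes E: "ext_pair \<phi> \<Phi> \<Psi> \<rho>" and q: "0 < q" "\<And>z. \<bar>Im z\<bar> \<le> q \<Longrightarrow> \<bar>Im z\<bar> < \<rho> \<and> \<bar>Im (\<Psi> z)\<bar> < \<rho>"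
    and \<kappa>: "\<forall>N k. open N \<longrightarrow> Ck_on k N (\<lambda>z. \<kappa> (Im z))" "\<forall>x\<ge>q'. \<kappa> x = 0" "q' < q"
  shows "smooth_on (strip {0..1}) (cut_factor \<kappa> \<Psi> \<rho>)"
    and "cut_factor \<kappa> \<Psi> \<rho> (z + of_real (2 * pi)) = cut_factor \<kappa> \<Psi> \<rho> z"
    and "q' \<le> Im z \<Longrightarrow> cut_factor \<kappa> \<Psi> \<rho> z = 0"
proof -
  note d = ext_pairD[OF E]
  show z0: "q' \<le> Im z \<Longrightarrow> cut_factor \<kappa> \<Psi> \<rho> z = 0" for z using \<kappa>(2) by (simp add: cut_factor_def)
  have dper: "deriv \<Psi> (z + of_real (2 * pi)) = deriv \<Psi> z" if z: "\<bar>Im z\<bar> < \<rho>" for z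
  proof -
    let ?p = "complex_of_real (2 * pi)"
    have "z + ?p \<in> band \<rho>" using z by simp
    from holomorphic_derivI[OF d(3) open_band this]
    have "((\<lambda>w. \<Psi> (w + ?p)) has_field_derivative deriv \<Psi> (z + ?p) * 1) (at z)"
      by (rule DERIV_chain2[where f=\<Psi> and g="\<lambda>w. w + ?p"]) (auto intro!: derivative_eq_intros)
    then have "((\<lambda>w. \<Psi> (w + ?p) - ?p) has_field_derivative deriv \<Psi> (z + ?p)) (at z)"
      by (auto intro!: derivative_eq_intros)
    then have "(\<Psi> has_field_derivative deriv \<Psi> (z + ?p)) (at z)"
      by (rule has_field_derivative_transform_within_open[OF _ open_band, of _ _ _ \<rho>]) (use z d(5) in auto)
    then show ?thesis by (simp add: DERIV_imp_deriv)
  qed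
  show "cut_factor \<kappa> \<Psi> \<rho> (z + of_real (2 * pi)) = cut_factor \<kappa> \<Psi> \<rho> z"
    using dper[of z] by (simp add: cut_factor_def)
  show "smooth_on (strip {0..1}) (cut_factor \<kappa> \<Psi> \<rho>)"
  proof (rule smooth_onI)
    fix w assume w: "w \<in> strip {0..1}"
    show "\<exists>N F. open N \<and> w \<in> N \<and> (\<forall>k. Ck_on k N F) \<and> (\<forall>u\<in>N \<inter> strip {0..1}. F u = cut_factor \<kappa> \<Psi> \<rho> u)"
    proof (cases "Im w < q")
      case True
      have sub: "band q \<subseteq> band \<rho>" using q(2) by force
      have nz: "deriv \<Psi> u \<noteq> 0" if "u \<in> band q" for u
        using ext_pair_deriv'[OF E, of u] q(2)[of u] that by auto
      have "Ck_on k (band q) (\<lambda>z. \<kappa> (Im z) * (2 * ln (cmod (deriv \<Psi> z))))" for k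
      proof (rule Ck_on_mult[OF open_band])
        show "Ck_on k (band q) (\<lambda>z. \<kappa> (Im z))" using \<kappa>(1) open_band by blast
        show "Ck_on k (band q) (\<lambda>z. 2 * ln (cmod (deriv \<Psi> z)))"
          by (rule Ck_on_ln_holomorphic(1)[OF open_band holomorphic_on_subset[OF holomorphic_deriv[OF d(3) open_band] sub] nz])
      qed
      moreover have "w \<in> band q" using True w by simp
      moreover have "\<forall>u\<in>band q \<inter> strip {0..1}. \<kappa> (Im u) * (2 * ln (cmod (deriv \<Psi> u))) = cut_factor \<kappa> \<Psi> \<rho> u"
        using sub by (auto simp: cut_factor_def subset_iff)
      ultimately show ?thesis using open_band by blast
    next
      case False
      have "open {u. q' < Im u}" by (intro open_Collect_less continuous_intros)
      moreover have "\<forall>u\<in>{u. q' < Im u} \<inter> strip {0..1}. 0 = cut_factor \<kappa> \<Psi> \<rho> u" using z0 by auto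
      ultimately show ?thesis
        using False \<kappa>(3) by (intro exI[of _ "{u. q' < Im u}"] exI[of _ "\<lambda>_. 0"]) (auto intro: Ck_on_const)
    qed
  qed
qed

section \<open>The canonical isomorphism preserves the coordinate\<close>

lemma density_eq_of_metric_eq:
  assumes I: "cyl_ivl I a b" and v: "density I g v" and v': "density I g' v'"
    and e: "metric_eq_on (flat_cyl I) E g g'" and z: "Im z \<in> I" "cyl_pt z \<in> E"
  shows "v z = v' z"
proof -
  obtain D s \<beta> \<sigma> where c: "(D, s) \<in> atlas (flat_cyl I)" "flat_chart I a b D s \<beta> \<sigma>" "\<sigma> * (z - \<beta>) \<in> D"
    using flat_cyl_atlas_cover[OF I z(1)] by metis
  have s: "s (\<sigma> * (z - \<beta>)) = cyl_pt z" unfolding flat_chartD(1,5)[OF c(2)] ..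
  have "g (D, s) (\<sigma> * (z - \<beta>)) = g' (D, s) (\<sigma> * (z - \<beta>))"
    using e c(1,3) z(2) unfolding metric_eq_on_def s[symmetric] by blast
  then show ?thesis unfolding densityD(3)[OF v c(1,3) s z(1)] densityD(3)[OF v' c(1,3) s z(1)] .
qed

text \<open>In coordinates the tensor has coefficient t times the quotient of the weights of
  \<open>g\<phi>\<close> and \<open>g\<close>, so only the difference of their energies enters. By
  locality that is a difference of collar integrals, which coincide for A and B because the
  pull-backs by Z and \<open>Z'\<close> do.\<close>

lemma can_rel_unique:
  assumes A: "flat_model 1 A" "flat_model 1 (reparam A \<phi>)" and B: "flat_model 1 B" "flat_model 1 (reparam B \<phi>)"
    and R: "can_rel c \<phi> A B (line_map c A (reparam A \<phi>) k) Y"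
  shows "Y = line_map c B (reparam B \<phi>) k"
proof -
  obtain \<epsilon> r \<delta> t Z Z' g\<phi> g g\<phi>' g' where
    par: "0 < \<delta>" "\<delta> < r" "r + \<delta> < \<epsilon>"
    and Z: "collar {0..<\<epsilon>} (surf A) (bd1 A) Z" and Z': "collar {0..<\<epsilon>} (surf B) (bd1 B) Z'"
    and sm: "seamed (reparam A \<phi>) \<epsilon> Z r \<delta> g\<phi>" "seamed A \<epsilon> Z r \<delta> g"
      "seamed (reparam B \<phi>) \<epsilon> Z' r \<delta> g\<phi>'" "seamed B \<epsilon> Z' r \<delta> g'"
    and out: "metric_eq_on (surf A)
         (topo (surf A) closure_of (topspace (topo (surf A)) - Z ` (UNIV \<times> {0..r}))) g\<phi> g"
      "metric_eq_on (surf B)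
         (topo (surf B) closure_of (topspace (topo (surf B)) - Z' ` (UNIV \<times> {0..r}))) g\<phi>' g'"
    and ins: "metric_eq_on (flat_cyl {0..<\<epsilon>}) (UNIV \<times> {0..r}) (pull_metric (surf A) Z g\<phi>) (pull_metric (surf B) Z' g\<phi>')"
      "metric_eq_on (flat_cyl {0..<\<epsilon>}) (UNIV \<times> {0..r}) (pull_metric (surf A) Z g) (pull_metric (surf B) Z' g')"
    and XY: "line_map c A (reparam A \<phi>) k = tensor c A (fmult c (reparam A \<phi>) t g\<phi>) (dual_elem c A (fmult c A 1 g))"
      "Y = tensor c B (fmult c (reparam B \<phi>) t g\<phi>') (dual_elem c B (fmult c B 1 g'))"
    using R unfolding can_rel_def by (elim exE conjE) (rule that; assumption)
  let ?I = "{0..<\<epsilon>}"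
  have I: "cyl_ivl ?I 0 \<epsilon>" "0 \<in> ?I" and rI: "0 < r" "{0..r} \<subseteq> ?I" using par by (auto simp: cyl_ivl_def)
  note J = cyl_ivl_closed[OF zero_less_one]
  have sf: "surf A = flat_cyl {0..1}" "surf B = flat_cyl {0..1}" using A B by (auto simp: flat_model_def)
  have sr: "surf (reparam C \<phi>) = surf C" for C :: "(circle \<times> real) cylinder" by (simp add: reparam_def)
  have adm: "g\<phi> \<in> Adm (reparam A \<phi>)" "g \<in> Adm A" "g\<phi>' \<in> Adm (reparam B \<phi>)" "g' \<in> Adm B"
    using sm by (auto simp: seamed_def)
  let ?K = "\<lambda>h. c * energy 1 (dens 1 h) / (96 * pi)"
  let ?N = "{z. r - \<delta> < Im z} \<inter> {z. Im z < r + \<delta>}"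
  have N: "open ?N" "Complex x r \<in> ?N" for x
    using par by (auto intro!: open_Int open_Collect_less continuous_intros)
  have diff: "energy 1 (dens 1 h1) - energy 1 (dens 1 h2)
      = integral (period_box 0 r) (\<lambda>z. pull_density ?I {0..1} W (dens 1 h1) z * lap ?I (pull_density ?I {0..1} W (dens 1 h1)) z)
      - integral (period_box 0 r) (\<lambda>z. pull_density ?I {0..1} W (dens 1 h2) z * lap ?I (pull_density ?I {0..1} W (dens 1 h2)) z)"
    (is "_ = ?d")
    and flat: "density ?I (pull_metric (flat_cyl {0..1}) W h1) (pull_density ?I {0..1} W (dens 1 h1))"
      "density ?I (pull_metric (flat_cyl {0..1}) W h2) (pull_density ?I {0..1} W (dens 1 h2))"
      "\<forall>z. Im z = r \<longrightarrow> pull_density ?I {0..1} W (dens 1 h1) z = 0"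
      "\<forall>z. Im z = r \<longrightarrow> pull_density ?I {0..1} W (dens 1 h2) z = 0"
    if C: "flat_model 1 C" "flat_model 1 (reparam C \<phi>)" and W: "collar ?I (surf C) (bd1 C) W"
      and sm: "seamed (reparam C \<phi>) \<epsilon> W r \<delta> h1" "seamed C \<epsilon> W r \<delta> h2"
      and out: "metric_eq_on (surf C)
         (topo (surf C) closure_of (topspace (topo (surf C)) - W ` (UNIV \<times> {0..r}))) h1 h2"
    for C W h1 h2
  proof -
    have sC: "surf C = flat_cyl {0..1}" using C by (simp add: flat_model_def)
    have a: "h1 \<in> Adm (reparam C \<phi>)" "h2 \<in> Adm C" using sm by (auto simp: seamed_def)
    note n1 = Adm_neumann[OF C(2) a(1)] and n2 = Adm_neumann[OF C(1) a(2)]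
    have W': "collar ?I (flat_cyl {0..1}) (bd1 C) W" using W sC by simp
    note F = collar_conf_embedding[OF I(1) zero_less_one W']
    note d1 = pull_metric_density[OF I(1) zero_less_one F(1) n1(1)]
      and d2 = pull_metric_density[OF I(1) zero_less_one F(1) n2(1)]
    show "density ?I (pull_metric (flat_cyl {0..1}) W h1) (pull_density ?I {0..1} W (dens 1 h1))"
      "density ?I (pull_metric (flat_cyl {0..1}) W h2) (pull_density ?I {0..1} W (dens 1 h2))" by (rule d1 d2)+
    have fl: "metric_eq_on (flat_cyl ?I) (UNIV \<times> {r - \<delta><..<r + \<delta>}) (pull_metric (flat_cyl {0..1}) W h1) flat_metric"
      "metric_eq_on (flat_cyl ?I) (UNIV \<times> {r - \<delta><..<r + \<delta>}) (pull_metric (flat_cyl {0..1}) W h2) flat_metric"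
      using sm unfolding seamed_def sr sC by blast+
    have w1: "pull_density ?I {0..1} W (dens 1 h1) z = 0" if "z \<in> ?N" "Im z \<in> ?I" for z
      by (rule density_eq_of_metric_eq[OF I(1) d1 density_flat_metric(1) fl(1) that(2)]) (use that(1) in \<open>simp add: cyl_pt_def\<close>)
    have w2: "pull_density ?I {0..1} W (dens 1 h2) z = 0" if "z \<in> ?N" "Im z \<in> ?I" for z
      by (rule density_eq_of_metric_eq[OF I(1) d2 density_flat_metric(1) fl(2) that(2)]) (use that(1) in \<open>simp add: cyl_pt_def\<close>)
    show "\<forall>z. Im z = r \<longrightarrow> pull_density ?I {0..1} W (dens 1 h1) z = 0" "\<forall>z. Im z = r \<longrightarrow> pull_density ?I {0..1} W (dens 1 h2) z = 0"
      using w1 w2 par by simp_all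
    have bl: "boundary_level 1 W 0"
      unfolding boundary_level_def F(2)
    proof
      fix x
      have "bd1 C (circ x) \<in> UNIV \<times> {0, 1}" using C(1) unfolding flat_model_def by blast
      then show "snd (bd1 C (circ x)) = 0 \<or> snd (bd1 C (circ x)) = 1" by (cases "bd1 C (circ x)") auto
    qed
    have gh: "dens 1 h1 z = dens 1 h2 z" if z: "Im z \<in> {0..1}" "cyl_pt z \<notin> W ` (UNIV \<times> {0..r})" for z
    proof (rule density_eq_of_metric_eq[OF J n1(2) n2(2) out[unfolded sC] z(1)])
      have "cyl_pt z \<in> topspace (topo (flat_cyl {0..1})) - W ` (UNIV \<times> {0..r})"
        using z by (simp only: topspace_flat cyl_pt_in Diff_iff not_False_eq_True simp_thms)
      then show "cyl_pt z \<in> topo (flat_cyl {0..1}) closure_of (topspace (topo (flat_cyl {0..1})) - W ` (UNIV \<times> {0..r}))"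
        using closure_of_subset[of "topspace (topo (flat_cyl {0..1})) - W ` (UNIV \<times> {0..r})" "topo (flat_cyl {0..1})"] by blast
    qed
    show "energy 1 (dens 1 h1) - energy 1 (dens 1 h2) = ?d"
      by (rule energy_difference[OF I F(1) bl rI n1(1,3) n2(1,3) N w1 w2 gh])
  qed
  note D = diff[OF A Z sm(1,2) out(1)] and D' = diff[OF B Z' sm(3,4) out(2)]
  note f = flat[OF A Z sm(1,2) out(1)] and f' = flat[OF B Z' sm(3,4) out(2)]
  have same: "integral (period_box 0 r) (\<lambda>z. a z * lap ?I a z) = integral (period_box 0 r) (\<lambda>z. a' z * lap ?I a' z)"
    if a: "density ?I h a" "density ?I h' a'" "metric_eq_on (flat_cyl ?I) (UNIV \<times> {0..r}) h h'"
      "\<forall>z. Im z = r \<longrightarrow> a z = 0" "\<forall>z. Im z = r \<longrightarrow> a' z = 0" for a a' h h'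
  proof (rule integral_cong)
    fix z assume "z \<in> period_box 0 r"
    then have z: "0 \<le> Im z" "Im z \<le> r" by (auto simp: period_box_def cbox_complex)
    have e: "a u = a' u" if "0 \<le> Im u" "Im u \<le> r" for u
      by (rule density_eq_of_metric_eq[OF I(1) a(1-3)]) (use that rI in \<open>auto simp: cyl_pt_def\<close>)
    \<comment> \<open>On the seam the densities are only known to agree from one side, so their
      Laplacians are not compared there; the densities themselves are zero.\<close>
    show "a z * lap ?I a z = a' z * lap ?I a' z"
    proof (cases "Im z = r")
      case True then show ?thesis using a(4,5) by simp
    next
      case False
      have "lap ?I a' z = lap ?I a z"
        by (rule lap_local[OF I(1) densityD(1)[OF a(1)], of "{u. Im u < r}"])
          (use False z rI par e in \<open>auto intro!: open_Collect_less continuous_intros\<close>)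
      then show ?thesis using e[OF z] by simp
    qed
  qed
  have "energy 1 (dens 1 g\<phi>) - energy 1 (dens 1 g) = energy 1 (dens 1 g\<phi>') - energy 1 (dens 1 g')"
    unfolding D D' same[OF f(1) f'(1) ins(1)[unfolded sf] f(3) f'(3)] same[OF f(2) f'(2) ins(2)[unfolded sf] f(4) f'(4)] ..
  then have "c * energy 1 (dens 1 g\<phi>) / (96 * pi) - c * energy 1 (dens 1 g) / (96 * pi)
      = c * energy 1 (dens 1 g\<phi>') / (96 * pi) - c * energy 1 (dens 1 g') / (96 * pi)"
    by (metis diff_divide_distrib right_diff_distrib)
  then have K: "exp (?K g\<phi>) / exp (?K g) = exp (?K g\<phi>') / exp (?K g')" by (simp only: exp_diff[symmetric])
  have "line_map c A (reparam A \<phi>) k = line_map c A (reparam A \<phi>) (t * exp (?K g\<phi>) / (1 * exp (?K g)))"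
    unfolding XY(1) fmult_Adm[OF A(2) adm(1)] fmult_Adm[OF A(1) adm(2)]
    by (rule tensor_line_map[OF A(1) adm(2)]) simp
  then have k: "k = t * exp (?K g\<phi>) / (1 * exp (?K g))" by (rule line_map_inj[OF A(1) adm(2) adm(1)])
  have "Y = line_map c B (reparam B \<phi>) (t * exp (?K g\<phi>') / (1 * exp (?K g')))"
    unfolding XY(2) fmult_Adm[OF B(2) adm(3)] fmult_Adm[OF B(1) adm(4)]
    by (rule tensor_line_map[OF B(1) adm(4)]) simp
  also have "t * exp (?K g\<phi>') / (1 * exp (?K g')) = k"
    unfolding k mult_1 by (metis K times_divide_eq_right)
  finally show ?thesis .
qed

lemma tscale_one_tensor: "tscale c B 1 (tensor c B l \<alpha>) = tensor c B l \<alpha>"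
  by (auto simp: tscale_def tensor_def scale_def restrict_def fun_eq_iff)

section \<open>The cochain vanishes\<close>

text \<open>Supplies the witness that gives meaning to the \<open>SOME\<close> in
  \<open>F_fun\<close>.\<close>

lemma hol_ext_inverse:
  assumes b: "bij \<phi>" and E: "ext_pair \<phi> \<Phi> \<Psi> \<rho>"
  shows "hol_ext (inv_into UNIV \<phi>) \<Psi>"
proof -
  note d = ext_pairD[OF E]
  have re: "\<Psi> (of_real x) = of_real (Re (\<Psi> (of_real x)))" for x using d(7)[of x] by (simp add: complex_eq_iff)
  have "\<Psi> analytic_on \<real>"
    using d(1,3) by (auto simp: analytic_on_def Reals_def intro!: exI[of _ \<rho>] elim!: holomorphic_on_subset)
      (metis abs_Im_le_cmod dist_commute dist_norm le_less_trans minus_complex.sel(2) Im_complex_of_real diff_zero)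
  moreover have "circle_lift (inv_into UNIV \<phi>) (\<lambda>x. Re (\<Psi> (of_real x)))"
    unfolding circle_lift_def
  proof
    fix x
    have "\<Phi> (\<Psi> (of_real x)) = of_real x" using d(11)[of "of_real x"] d(1,7) by simp
    then have "\<phi> (circ (Re (\<Psi> (of_real x)))) = circ x" unfolding d(12) re[symmetric] by simp
    then show "circ (Re (\<Psi> (of_real x))) = inv_into UNIV \<phi> (circ x)" using b by (metis bij_inv_eq_iff)
  qed
  ultimately show ?thesis unfolding hol_ext_def using re by blast
qed

text \<open>The extension G chosen by \<open>SOME\<close> is arbitrary, so the argument rests on
  what all extensions share: they are real on the axis and, as lifts of an inverse diffeomorphism,
  have nonzero derivative there.\<close>

lemma N_fun_zero:
  assumes "\<phi> \<in> diff_an" shows "N_fun \<phi> = 0"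
proof -
  obtain \<Phi> \<Psi> \<rho> where E: "ext_pair \<phi> \<Phi> \<Psi> \<rho>" by (rule ext_pair_exists[OF assms])
  note d = ext_pairD[OF E]
  have b: "bij \<phi>" using assms by (simp add: diff_an_def)
  define G where "G = (SOME G. hol_ext (inv_into UNIV \<phi>) G)"
  have "hol_ext (inv_into UNIV \<phi>) G" unfolding G_def by (rule someI[of "hol_ext (inv_into UNIV \<phi>)"]) (rule hol_ext_inverse[OF b E])
  then obtain f where an: "G analytic_on \<real>" and f: "circle_lift (inv_into UNIV \<phi>) f" "\<And>x. G (of_real x) = of_real (f x)"
    by (auto simp: hol_ext_def)
  obtain S where S: "open S" "\<real> \<subseteq> S" "G holomorphic_on S" using an by (auto simp: analytic_on_holomorphic)
  have xS: "complex_of_real x \<in> S" for x using S(2) Reals_of_real by blast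
  have dG: "(G has_field_derivative deriv G z) (at z)" if "z \<in> S" for z
    using holomorphic_derivI[OF S(3,1) that] .
  have dG2: "(deriv G has_field_derivative deriv (deriv G) z) (at z)" if "z \<in> S" for z
    using holomorphic_derivI[OF holomorphic_deriv[OF S(3,1)] S(1) that] .
  have im1: "Im (deriv G (of_real x)) = 0" for x
    by (rule deriv_along_real_line[OF dG[OF xS] zero_less_one, of _ 0]) (simp add: f(2) flip: of_real_add)
  have im2: "Im (deriv (deriv G) (of_real x)) = 0" for x
    by (rule deriv_along_real_line[OF dG2[OF xS] zero_less_one, of _ 0]) (simp add: im1 flip: of_real_add)
  have dPG: "((\<lambda>x::real. Re (\<Phi> (G (of_real x)))) has_real_derivative Re (deriv \<Phi> (G (of_real x)) * deriv G (of_real x))) (at x)" for x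
  proof (rule real_line_derivative)
    show "((\<lambda>z. \<Phi> (G z)) has_field_derivative deriv \<Phi> (G (of_real x)) * deriv G (of_real x)) (at (of_real x))"
      by (rule DERIV_chain2[OF holomorphic_derivI[OF d(2) open_band] dG[OF xS]]) (use d(1) f(2) in simp)
  qed
  have "\<exists>k::int. Re (\<Phi> (G (of_real x))) - x = 2 * pi * of_int k" for x
  proof -
    have "circ (Re (\<Phi> (of_real (f x)))) = \<phi> (inv_into UNIV \<phi> (circ x))"
      using d(12)[of "f x"] f(1) by (simp add: circle_lift_def)
    also have "\<dots> = circ x" using b by (simp add: bij_is_surj surj_f_inv_f)
    finally have "circ x = circ (Re (\<Phi> (of_real (f x))))" ..
    then obtain k :: int where "Re (\<Phi> (of_real (f x))) = x + 2 * pi * of_int k" unfolding circ_eq_iff by blast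
    then show ?thesis unfolding f(2) by (intro exI[of _ k]) simp
  qed
  moreover have "continuous_on UNIV (\<lambda>x. Re (\<Phi> (G (of_real x))) - x)"
    using dPG by (intro continuous_on_diff continuous_on_id continuous_at_imp_continuous_on) (blast intro: DERIV_isCont)
  ultimately obtain k :: int where k: "\<And>x. Re (\<Phi> (G (of_real x))) - x = 2 * pi * of_int k"
    using multiple_2pi_constant by blast
  \<comment> \<open>On the axis \<Phi> after G is a translation, so the chain rule excludes a zero
    of G'.\<close>
  have nz: "deriv G (of_real x) \<noteq> 0" for x
  proof -
    have "(\<lambda>x::real. Re (\<Phi> (G (of_real x)))) = (\<lambda>x. x + 2 * pi * of_int k)" using k by (auto simp: fun_eq_iff algebra_simps)
    moreover have "((\<lambda>x. x + 2 * pi * of_int k) has_real_derivative 1) (at x)" by (auto intro!: derivative_eq_intros)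
    ultimately have "Re (deriv \<Phi> (G (of_real x)) * deriv G (of_real x)) = 1" using DERIV_unique[OF dPG] by metis
    then show ?thesis by auto
  qed
  have "deriv (\<lambda>x. ln (F_fun \<phi> (Complex \<theta> x))) 0 = 0" for \<theta>
  proof (rule DERIV_imp_deriv)
    let ?N = "S \<inter> deriv G -` (- {0})"
    have hG: "deriv G holomorphic_on S" by (rule holomorphic_deriv[OF S(3,1)])
    have oN: "open ?N"
      by (rule continuous_open_preimage[OF holomorphic_on_imp_continuous_on[OF hG] S(1) open_Compl[OF closed_singleton]])
    \<comment> \<open>If G' vanishes at z, both sides are 0 by the default value ln 0 = 0.\<close>
    have F: "ln (F_fun \<phi> z) = 2 * ln (cmod (deriv G z))" for z
      by (cases "deriv G z = 0") (simp_all add: F_fun_def G_def[symmetric] ln_realpow)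
    have L: "((\<lambda>w. 2 * ln (cmod (deriv G w))) has_derivative
       (\<lambda>v. Re v * Re (2 * (deriv (deriv G) (of_real \<theta>) / deriv G (of_real \<theta>))) +
            Im v * Re (\<i> * (2 * (deriv (deriv G) (of_real \<theta>) / deriv G (of_real \<theta>)))))) (at (of_real \<theta>))"
      by (rule Ck_on_ln_holomorphic(2)[OF oN]) (use hG holomorphic_on_subset xS nz in auto)
    have C: "((\<lambda>x. Complex \<theta> x) has_derivative (\<lambda>x. Complex 0 x)) (at 0)"
      unfolding Complex_eq by (auto intro!: derivative_eq_intros)
    have L': "((\<lambda>w. 2 * ln (cmod (deriv G w))) has_derivative
       (\<lambda>v. Re v * Re (2 * (deriv (deriv G) (of_real \<theta>) / deriv G (of_real \<theta>))) +
            Im v * Re (\<i> * (2 * (deriv (deriv G) (of_real \<theta>) / deriv G (of_real \<theta>)))))) (at (Complex \<theta> 0))"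
      using L by (simp only: complex_of_real_def)
    have "Re (\<i> * (2 * (deriv (deriv G) (of_real \<theta>) / deriv G (of_real \<theta>)))) = 0"
    proof -
      have "deriv (deriv G) (of_real \<theta>) / deriv G (of_real \<theta>) \<in> \<real>"
        using im1 im2 by (intro Reals_divide) (simp_all add: complex_is_Real_iff)
      then show ?thesis by (elim Reals_cases) simp
    qed
    with diff_chain_at[OF C L'] show "((\<lambda>x. ln (F_fun \<phi> (Complex \<theta> x))) has_real_derivative 0) (at 0)"
      unfolding F has_field_derivative_def o_def by (rule_tac has_derivative_eq_rhs2) auto
  qed
  then show ?thesis unfolding N_fun_def by simp
qed

section \<open>Cohomology\<close>

text \<open>The coset of the zero cochain is the subgroup of coboundaries itself, which is the unit
  of the quotient.\<close>

lemma zero_H2: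
  fixes G (structure)
  assumes "\<And>g h. g \<in> carrier G \<Longrightarrow> h \<in> carrier G \<Longrightarrow> g \<otimes> h \<in> carrier G"
  defines "f \<equiv> \<lambda>p \<in> carrier G \<times> carrier G. 0::real"
  shows "f \<in> coboundaries2 G" "f \<in> carrier (cocycles2 G)" "H2_class G f = \<one>\<^bsub>H2 G\<^esub>"
proof -
  have "f = coboundary2 G (\<lambda>_. 0)" by (auto simp: f_def coboundary2_def restrict_def fun_eq_iff)
  then show "f \<in> coboundaries2 G" by (simp add: coboundaries2_def)
  show "f \<in> carrier (cocycles2 G)" using assms(1) by (simp add: f_def cocycles2_def)
  have "x \<otimes>\<^bsub>cocycles2 G\<^esub> f = x" if "x \<in> coboundaries2 G" for x
    using that by (auto simp: cocycles2_def coboundaries2_def coboundary2_def f_def restrict_def fun_eq_iff)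
  then show "H2_class G f = \<one>\<^bsub>H2 G\<^esub>"
    unfolding H2_class_def H2_def FactGroup_def r_coset_def by auto
qed

section \<open>Existence of transported representatives\<close>

lemma cut_factor_push:
  assumes E: "ext_pair \<phi> \<Phi> \<Psi> \<rho>" and z: "\<bar>Im z\<bar> < \<rho>" "\<bar>Im (\<Phi> z)\<bar> < \<rho>" and k: "\<kappa> (Im (\<Phi> z)) = 1"
  shows "cut_factor \<kappa> \<Psi> \<rho> (\<Phi> z) + 2 * ln (cmod (deriv \<Phi> z)) = 0"
  using ln_inverse_product[OF ext_pair_deriv[OF E z]] z k by (simp add: cut_factor_def)

lemma descend_global: "(\<And>z. v (z + of_real (2 * pi)) = v z) \<Longrightarrow> descend v (cyl_pt z) = v z"
  by (rule descend[where I=UNIV]) auto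

text \<open>\<open>can_rel\<close> compares metrics on the closure of the complement of the collar.
  A point strictly below the seam has a neighbourhood inside the collar and therefore escapes that
  closure.\<close>

lemma not_in_closure_outside:
  assumes E: "ext_pair \<phi> \<Phi> \<Psi> \<rho>" and s: "\<sigma> \<le> \<rho>" "\<And>z. \<bar>Im z\<bar> < \<sigma> \<Longrightarrow> \<bar>Im (\<Psi> z)\<bar> < \<rho>"
    and z: "Im z \<in> {0..1}" "\<bar>Im z\<bar> < \<sigma>" "Im (\<Psi> z) < r"
  shows "cyl_pt z \<notin> topo (flat_cyl {0..1}) closure_of (topspace (topo (flat_cyl {0..1})) - cyl_map \<Phi> ` (UNIV \<times> {0..r}))"
proof
  note d = ext_pairD[OF E]
  let ?P = "\<lambda>u. Im u \<in> {0..1::real} \<and> \<bar>Im u\<bar> < \<sigma> \<and> Im (\<Psi> u) < r"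
  let ?T = "cyl_pt ` {u. ?P u}"
  let ?N = "band \<sigma> \<inter> \<Psi> -` {w. Im w < r}"
  have Piff: "?P u" if c: "cyl_pt u \<in> ?T" for u
  proof -
    obtain u' where u': "cyl_pt u = cyl_pt u'" "?P u'" using c by auto
    then obtain k :: int where k: "u' = u + of_real (2 * pi * of_int k)" unfolding cyl_pt_eq_iff by blast
    have im: "Im u' = Im u" unfolding k by simp
    have "\<bar>Im u\<bar> < \<rho>" using u'(2) s(1) im by auto
    from ext_pair_periodic[OF E this, of k] have "Im (\<Psi> u') = Im (\<Psi> u)" unfolding k by simp
    then show ?thesis using u'(2) im by auto
  qed
  have oN: "open ?N"
    by (rule continuous_open_preimage[OF holomorphic_on_imp_continuous_on[OF holomorphic_on_subset[OF d(3)]] open_band])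
      (use s(1) in \<open>auto intro!: open_Collect_less continuous_intros\<close>)
  have oT: "openin (topo (flat_cyl {0..1})) ?T"
  proof (rule openin_flatI)
    show "?T \<subseteq> UNIV \<times> {0..1}"
    proof (rule image_subsetI)
      fix u assume "u \<in> {u. ?P u}"
      then show "cyl_pt u \<in> UNIV \<times> {0..1}" by (simp only: cyl_pt_in mem_Collect_eq)
    qed
    fix u assume "cyl_pt u \<in> ?T"
    then have "?P u" by (rule Piff)
    then have "u \<in> ?N" by auto
    moreover have "cyl_pt w \<in> ?T" if "w \<in> ?N" "Im w \<in> {0..1}" for w using that by (intro imageI) simp
    ultimately show "\<exists>N. open N \<and> u \<in> N \<and> (\<forall>w\<in>N. Im w \<in> {0..1} \<longrightarrow> cyl_pt w \<in> ?T)" using oN by blast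
  qed
  have sub: "?T \<subseteq> cyl_map \<Phi> ` (UNIV \<times> {0..r})"
  proof (rule image_subsetI)
    fix u assume "u \<in> {u. ?P u}"
    then have u: "0 \<le> Im u" "\<bar>Im u\<bar> < \<sigma>" "Im (\<Psi> u) < r" by auto
    have 1: "\<bar>Im u\<bar> < \<rho>" "\<bar>Im (\<Psi> u)\<bar> < \<rho>" using u s by auto
    have "Im (\<Psi> u) \<in> {0..r}" using d(9)[OF 1(1) u(1)] u(3) by simp
    then have "cyl_pt (\<Psi> u) \<in> UNIV \<times> {0..r}" by (simp only: cyl_pt_in)
    moreover have "cyl_pt u = cyl_map \<Phi> (cyl_pt (\<Psi> u))"
      unfolding ext_pair_cyl_map(1)[OF E 1(2)] d(11)[OF 1] ..
    ultimately show "cyl_pt u \<in> cyl_map \<Phi> ` (UNIV \<times> {0..r})" by (rule rev_image_eqI)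
  qed
  have zT: "cyl_pt z \<in> ?T" using z by (intro imageI) simp
  assume "cyl_pt z \<in> topo (flat_cyl {0..1}) closure_of (topspace (topo (flat_cyl {0..1})) - cyl_map \<Phi> ` (UNIV \<times> {0..r}))"
  then have "\<forall>T. cyl_pt z \<in> T \<and> openin (topo (flat_cyl {0..1})) T \<longrightarrow>
      (\<exists>y. y \<in> topspace (topo (flat_cyl {0..1})) - cyl_map \<Phi> ` (UNIV \<times> {0..r}) \<and> y \<in> T)"
    unfolding in_closure_of by (rule conjunct2)
  then have "\<exists>y. y \<in> topspace (topo (flat_cyl {0..1})) - cyl_map \<Phi> ` (UNIV \<times> {0..r}) \<and> y \<in> ?T"
    using zT oT by (elim allE[of _ ?T] impE) (rule conjI)
  then obtain y where "y \<in> topspace (topo (flat_cyl {0..1})) - cyl_map \<Phi> ` (UNIV \<times> {0..r})" "y \<in> ?T"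
    by (elim exE conjE)
  then show False using sub by blast
qed

lemma metric_of_eq_on:
  assumes "\<And>z. Im z \<in> {0..1} \<Longrightarrow> cyl_pt z \<in> E \<Longrightarrow> \<gamma> (cyl_pt z) = \<gamma>' (cyl_pt z)"
  shows "metric_eq_on (flat_cyl {0..1}) E (metric_of \<gamma>) (metric_of \<gamma>')"
  unfolding metric_eq_on_def
proof (clarify)
  fix D s w assume c: "(D, s) \<in> atlas (flat_cyl {0..1})" "w \<in> D" "s w \<in> E"
  obtain \<beta> \<sigma> where ch: "flat_chart {0..1} 0 1 D s \<beta> \<sigma>" by (rule flat_cyl_atlasD[OF cyl_ivl_closed[OF zero_less_one] c(1)])
  note cd = flat_chartD[OF ch]
  have "Im (\<beta> + \<sigma> * w) \<in> {0..1}" using c(2) unfolding cd(2) by blast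
  then have "\<gamma> (s w) = \<gamma>' (s w)" using assms c(3) unfolding cd(1) by blast
  then show "metric_of \<gamma> (D, s) w = metric_of \<gamma>' (D, s) w" by (simp add: metric_of_def)
qed

text \<open>On the standard cylinder the log-densities are 0 and b, on the reparametrized one a and
  a + \<theta>: a makes \<Phi> isometric near the boundary, and \<theta> is b transported by \<Phi>.
  Two scales are nested: b lives below height \<epsilon>/4, under the seam at \<epsilon>/2, and
  \<Phi> sends heights in [0, \<epsilon>) below \<sigma>/2, where the cutoff in a is still
  1.\<close>

lemma can_rel_exists:
  assumes E: "ext_pair \<phi> \<Phi> \<Psi> \<rho>" and E2: "ext_pair \<psi> \<Phi>2 \<Psi>2 \<rho>2"
  shows "\<exists>Y. can_rel c \<psi> std_cyl (reparam std_cyl \<phi>) (line_map c std_cyl (reparam std_cyl \<psi>) 1) Y"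
proof -
  note d = ext_pairD[OF E] and d2 = ext_pairD[OF E2]
  define m where "m = min \<rho> 1"
  have m: "0 < m" "m \<le> \<rho>" "m \<le> 1" using d(1) by (auto simp: m_def)
  obtain \<sigma>1 where s1: "0 < \<sigma>1" "\<sigma>1 \<le> \<rho>" "\<forall>z. \<bar>Im z\<bar> < \<sigma>1 \<longrightarrow> \<bar>Im (\<Psi> z)\<bar> < m"
    by (rule ext_pair_small[OF E m(1)]) (rule that; blast)
  define \<sigma> where "\<sigma> = min \<sigma>1 1"
  have s: "0 < \<sigma>" "\<sigma> \<le> \<rho>" "\<sigma> \<le> 1" "\<And>z. \<bar>Im z\<bar> < \<sigma> \<Longrightarrow> \<bar>Im (\<Psi> z)\<bar> < m" using s1 by (auto simp: \<sigma>_def)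
  have s2: "0 < \<sigma> / 2" using s by simp
  obtain \<epsilon>1 where e1: "0 < \<epsilon>1" "\<epsilon>1 \<le> \<rho>" "\<forall>z. \<bar>Im z\<bar> < \<epsilon>1 \<longrightarrow> \<bar>Im (\<Phi> z)\<bar> < \<sigma> / 2"
    by (rule ext_pair_small[OF E s2]) (rule that; blast)
  obtain \<epsilon>2 where e2: "0 < \<epsilon>2" "\<epsilon>2 \<le> \<rho>2" "\<forall>z. \<bar>Im z\<bar> < \<epsilon>2 \<longrightarrow> \<bar>Im (\<Psi>2 z)\<bar> < \<rho>2"
    by (rule ext_pair_small[OF E2 d2(1)]) (rule that; blast)
  obtain \<epsilon>3 where e3: "0 < \<epsilon>3" "\<forall>\<epsilon>>0. \<epsilon> < \<epsilon>3 \<longrightarrow> collar {0..<\<epsilon>} (flat_cyl {0..1}) (\<lambda>p. (\<phi> p, 0)) (cyl_map \<Phi>)"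
    by (rule ext_pair_collar[OF E]) (rule that; blast)
  obtain \<epsilon>4 where e4: "0 < \<epsilon>4" "\<forall>\<epsilon>>0. \<epsilon> < \<epsilon>4 \<longrightarrow> collar {0..<\<epsilon>} (flat_cyl {0..1}) (\<lambda>p. (id p, 0)) (cyl_map (\<lambda>z. z))"
    by (rule ext_pair_collar[OF ext_pair_id]) (rule that; blast)
  define \<epsilon> where "\<epsilon> = min (min \<epsilon>1 \<epsilon>2) (min (min \<epsilon>3 \<epsilon>4) m) / 2"
  have e: "0 < \<epsilon>" "\<epsilon> < \<epsilon>1" "\<epsilon> < \<epsilon>2" "\<epsilon> < \<epsilon>3" "\<epsilon> < \<epsilon>4" "\<epsilon> < m"
    using e1(1) e2(1) e3(1) e4(1) m(1) by (auto simp: \<epsilon>_def min_def)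
  \<comment> \<open>The window of half-width \<epsilon>/8 around \<epsilon>/2 stays inside the
    collar and above \<epsilon>/4, where b has already vanished.\<close>
  define r \<delta> where "r = \<epsilon> / 2" and "\<delta> = \<epsilon> / 8"
  have par: "0 < \<delta>" "\<delta> < r" "r + \<delta> < \<epsilon>" "r < \<epsilon>" "\<epsilon> / 4 < r - \<delta>" using e(1) by (auto simp: r_def \<delta>_def)
  have "\<epsilon> / 8 < \<epsilon> / 4" using e(1) by simp
  then obtain \<kappa>2 where k2: "\<forall>N k. open N \<longrightarrow> Ck_on k N (\<lambda>z. \<kappa>2 (Im z))" "\<forall>x\<le>\<epsilon> / 8. \<kappa>2 x = 1" "\<forall>x\<ge>\<epsilon> / 4. \<kappa>2 x = 0"
    by (rule smooth_cutoff_exists)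
  have "\<sigma> / 2 < 3 * \<sigma> / 4" using s(1) by simp
  then obtain \<kappa> where k: "\<forall>N k. open N \<longrightarrow> Ck_on k N (\<lambda>z. \<kappa> (Im z))" "\<forall>x\<le>\<sigma> / 2. \<kappa> x = 1" "\<forall>x\<ge>3 * \<sigma> / 4. \<kappa> x = 0"
    by (rule smooth_cutoff_exists)
  define a where "a = cut_factor \<kappa> \<Psi> \<rho>"
  define b where "b = cut_factor \<kappa>2 \<Psi>2 \<rho>2"
  \<comment> \<open>Zero beyond the band where \<Psi> is controlled; \<open>t0\<close> shows that
    the transported b has vanished before its edge.\<close>
  define \<theta> where "\<theta> w = (if \<bar>Im w\<bar> < \<sigma> then b (\<Psi> w) else 0)" for w
  have "0 < 7 * \<sigma> / 8" "3 * \<sigma> / 4 < 7 * \<sigma> / 8" using s(1) by auto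
  moreover have "\<bar>Im z\<bar> < \<rho> \<and> \<bar>Im (\<Psi> z)\<bar> < \<rho>" if "\<bar>Im z\<bar> \<le> 7 * \<sigma> / 8" for z
    using s(1,2) m(2) s(4)[of z] that by auto
  ultimately have a: "smooth_on (strip {0..1}) a" "\<And>z. a (z + of_real (2 * pi)) = a z" "\<And>z. 3 * \<sigma> / 4 \<le> Im z \<Longrightarrow> a z = 0"
    using cut_factor[OF E _ _ k(1,3), of "7 * \<sigma> / 8"] unfolding a_def by blast+
  have "0 < \<epsilon> / 2" "\<epsilon> / 4 < \<epsilon> / 2" using e(1) by auto
  moreover have "\<bar>Im z\<bar> < \<rho>2 \<and> \<bar>Im (\<Psi>2 z)\<bar> < \<rho>2" if "\<bar>Im z\<bar> \<le> \<epsilon> / 2" for z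
  proof -
    have "\<bar>Im z\<bar> < \<epsilon>2" using that e by linarith
    then show ?thesis using e2(2,3) by auto
  qed
  ultimately have b: "smooth_on (strip {0..1}) b" "\<And>z. b (z + of_real (2 * pi)) = b z" "\<And>z. \<epsilon> / 4 \<le> Im z \<Longrightarrow> b z = 0"
    using cut_factor[OF E2 _ _ k2(1,3), of "\<epsilon> / 2"] unfolding b_def by blast+
  have small: "\<bar>Im u\<bar> < \<rho>" "\<bar>Im u\<bar> < 1" "0 \<le> Im (\<Phi> u)" "Im (\<Phi> u) < \<sigma> / 2" "\<bar>Im (\<Phi> u)\<bar> < \<sigma>" "\<bar>Im (\<Phi> u)\<bar> < \<rho>" "Im (\<Phi> u) \<in> {0..1}"
    if u: "0 \<le> Im u" "Im u < \<epsilon>" for u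
  proof -
    show 1: "\<bar>Im u\<bar> < \<rho>" and "\<bar>Im u\<bar> < 1" using u e m by auto
    have "\<bar>Im u\<bar> < \<epsilon>1" using u e by auto
    then have "\<bar>Im (\<Phi> u)\<bar> < \<sigma> / 2" using e1(3) by blast
    moreover show "0 \<le> Im (\<Phi> u)" using d(8)[OF 1 u(1)] .
    ultimately show "Im (\<Phi> u) < \<sigma> / 2" "\<bar>Im (\<Phi> u)\<bar> < \<sigma>" "\<bar>Im (\<Phi> u)\<bar> < \<rho>" "Im (\<Phi> u) \<in> {0..1}" using s(1-3) by auto
  qed
  have f1: "a (\<Phi> u) + 2 * ln (cmod (deriv \<Phi> u)) = 0" if u: "0 \<le> Im u" "Im u < \<epsilon>" for u
    unfolding a_def by (rule cut_factor_push[OF E]) (use small[OF u] k(2) in auto)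
  have f2: "\<theta> (\<Phi> u) = b u" if u: "0 \<le> Im u" "Im u < \<epsilon>" for u
    using small[OF u] d(10)[OF small(1)[OF u] small(6)[OF u]] by (simp add: \<theta>_def)
  \<comment> \<open>If \<Psi> w were lower than \<open>\<epsilon>1\<close>, then \<Phi> would bring
    it back below \<sigma>/2; so \<Psi> w lies above the support of b.\<close>
  have t0: "\<theta> w = 0" if w: "\<sigma> / 2 \<le> Im w" for w
  proof (cases "\<bar>Im w\<bar> < \<sigma>")
    case True
    have 1: "\<bar>Im w\<bar> < \<rho>" "\<bar>Im (\<Psi> w)\<bar> < \<rho>" "0 \<le> Im w" using True s(1,2) m(2) w s(4)[OF True] by auto
    have "\<not> \<bar>Im (\<Psi> w)\<bar> < \<epsilon>1"
    proof
      assume "\<bar>Im (\<Psi> w)\<bar> < \<epsilon>1"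
      then have "\<bar>Im (\<Phi> (\<Psi> w))\<bar> < \<sigma> / 2" using e1(3) by blast
      then show False using w unfolding d(11)[OF 1(1,2)] by simp
    qed
    then have "\<epsilon> / 4 \<le> Im (\<Psi> w)" using d(9)[OF 1(1,3)] e by auto
    then show ?thesis using b(3) by (simp add: \<theta>_def)
  qed (simp add: \<theta>_def)
  have tp: "\<theta> (z + of_real (2 * pi)) = \<theta> z" for z
    using d(5)[of z] b(2) s(2) by (simp add: \<theta>_def)
  have ts: "smooth_on (strip {0..1}) \<theta>"
  proof (rule smooth_on_comp[OF b(1)])
    fix w assume w: "w \<in> strip {0..1::real}"
    show "\<exists>N h. open N \<and> w \<in> N \<and> h holomorphic_on N \<and> (\<forall>u\<in>N \<inter> strip {0..1}. h u \<in> strip {0..1} \<and> \<theta> u = b (h u))"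
    proof (cases "Im w < \<sigma>")
      case True
      have h: "\<Psi> holomorphic_on band \<sigma>" by (rule holomorphic_on_subset[OF d(3)]) (use s(2) in auto)
      have "\<Psi> u \<in> strip {0..1} \<and> \<theta> u = b (\<Psi> u)" if u: "u \<in> band \<sigma> \<inter> strip {0..1}" for u
        using u s(2) s(4)[of u] d(9)[of u] m(3) by (auto simp: \<theta>_def)
      then show ?thesis using True w h open_band by (intro exI[of _ "band \<sigma>"] exI[of _ \<Psi>]) auto
    next
      case False
      have "open {u. \<sigma> / 2 < Im u}" by (intro open_Collect_less continuous_intros)
      \<comment> \<open>Where \<theta> vanishes a constant map serves as inner function; the point i
        has height 1, above the support of b.\<close>
      moreover have "b \<i> = 0" using b(3)[of \<i>] e m by simp
      ultimately show ?thesis using False s(1) t0 by (intro exI[of _ "{u. \<sigma> / 2 < Im u}"] exI[of _ "\<lambda>_. \<i>"]) auto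
    qed
  qed
  define \<gamma>a where "\<gamma>a = descend a"
  define \<gamma>b where "\<gamma>b = descend b"
  define \<gamma>c where "\<gamma>c = descend (\<lambda>z. a z + \<theta> z)"
  have ev: "\<gamma>a (cyl_pt z) = a z" "\<gamma>b (cyl_pt z) = b z" "\<gamma>c (cyl_pt z) = a z + \<theta> z" for z
    unfolding \<gamma>a_def \<gamma>b_def \<gamma>c_def by (rule descend_global, simp only: a(2) b(2) tp)+
  have sm: "smooth_on (strip {0..1}) (\<lambda>z. \<gamma>a (cyl_pt z))" "smooth_on (strip {0..1}) (\<lambda>z. \<gamma>b (cyl_pt z))"
    "smooth_on (strip {0..1}) (\<lambda>z. \<gamma>c (cyl_pt z))"
    unfolding ev by (intro a b ts smooth_on_add)+
  have sm0: "smooth_on (strip {0..1}) (\<lambda>z. (\<lambda>p::circle \<times> real. 0) (cyl_pt z))" by (rule smooth_on_const)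
  let ?g0 = "metric_of (\<lambda>_. 0)" and ?gb = "metric_of \<gamma>b" and ?ga = "metric_of \<gamma>a" and ?gc = "metric_of \<gamma>c"
  note R = reparam_std
  have adm0: "?g0 \<in> Adm std_cyl"
    by (rule Adm_metric_of[where \<phi>=id and \<eta>=1 and t=0, OF _ _ _ ext_pair_id sm0]) (simp_all add: R)
  have e8: "0 < \<epsilon> / 8" using e(1) by simp
  obtain \<eta>2 where n2: "0 < \<eta>2" "\<eta>2 \<le> \<rho>2" "\<forall>z. \<bar>Im z\<bar> < \<eta>2 \<longrightarrow> \<bar>Im (\<Phi>2 z)\<bar> < \<epsilon> / 8"
    by (rule ext_pair_small[OF E2 e8]) (rule that; blast)
  have f3: "b (\<Phi>2 z) + 2 * ln (cmod (deriv \<Phi>2 z)) = 0" "0 \<le> Im (\<Phi>2 z)" "Im (\<Phi>2 z) < \<epsilon>" if z: "0 \<le> Im z" "Im z < \<eta>2" for z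
  proof -
    have 1: "\<bar>Im z\<bar> < \<eta>2" "\<bar>Im z\<bar> < \<rho>2" using z n2(2) by auto
    have 2: "\<bar>Im (\<Phi>2 z)\<bar> < \<epsilon> / 8" using n2(3) 1(1) by blast
    show "0 \<le> Im (\<Phi>2 z)" using d2(8)[OF 1(2) z(1)] .
    show "Im (\<Phi>2 z) < \<epsilon>" using 2 e(1) by auto
    show "b (\<Phi>2 z) + 2 * ln (cmod (deriv \<Phi>2 z)) = 0"
      unfolding b_def by (rule cut_factor_push[OF E2 1(2)]) (use 2 e e2(2) k2(2) in auto)
  qed
  have admb: "?gb \<in> Adm (reparam std_cyl \<psi>)"
    by (rule Adm_metric_of[where t="\<epsilon> / 4", OF R(1-3) E2 sm(2) n2(1)]) (use f3 e m b(3) in \<open>auto simp: ev\<close>)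
  have adma: "?ga \<in> Adm (reparam std_cyl \<phi>)"
    by (rule Adm_metric_of[where t="3 * \<sigma> / 4", OF R(1-3) E sm(1) e(1)]) (use f1 s a(3) in \<open>auto simp: ev\<close>)
  have admc: "?gc \<in> Adm (reparam (reparam std_cyl \<phi>) \<psi>)"
  proof -
    obtain \<rho>3 where E3: "ext_pair (\<phi> \<circ> \<psi>) (\<lambda>z. \<Phi> (\<Phi>2 z)) (\<lambda>z. \<Psi>2 (\<Psi> z)) \<rho>3" by (rule ext_pair_compose[OF E E2])
    have bot: "\<gamma>c (cyl_pt (\<Phi> (\<Phi>2 z))) + 2 * ln (cmod (deriv (\<lambda>z. \<Phi> (\<Phi>2 z)) z)) = 0" if z: "0 \<le> Im z" "Im z < \<eta>2" for z
    proof -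
      note f = f3[OF z]
      have "\<bar>Im z\<bar> < \<rho>2" using z n2(2) by auto
      then have D: "((\<lambda>z. \<Phi> (\<Phi>2 z)) has_field_derivative deriv \<Phi> (\<Phi>2 z) * deriv \<Phi>2 z) (at z)"
        by (intro DERIV_chain2[OF holomorphic_derivI[OF d(2) open_band] holomorphic_derivI[OF d2(2) open_band]])
          (use small(1)[OF f(2,3)] in auto)
      have "deriv \<Psi> (\<Phi> (\<Phi>2 z)) * deriv \<Phi> (\<Phi>2 z) = 1" using ext_pair_deriv[OF E small(1)[OF f(2,3)] small(6)[OF f(2,3)]] .
      then have nz: "deriv \<Phi> (\<Phi>2 z) \<noteq> 0" by auto
      have "\<bar>Im (\<Phi>2 z)\<bar> < \<epsilon> / 8" using n2(3) z by auto
      then have "\<bar>Im (\<Phi>2 z)\<bar> < \<rho>2" using e e2(2) by auto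
      then have "deriv \<Psi>2 (\<Phi>2 z) * deriv \<Phi>2 z = 1" by (rule ext_pair_deriv[OF E2 \<open>\<bar>Im z\<bar> < \<rho>2\<close>])
      then have nz2: "deriv \<Phi>2 z \<noteq> 0" by auto
      have "ln (cmod (deriv (\<lambda>z. \<Phi> (\<Phi>2 z)) z)) = ln (cmod (deriv \<Phi> (\<Phi>2 z))) + ln (cmod (deriv \<Phi>2 z))"
        unfolding DERIV_imp_deriv[OF D] norm_mult using nz nz2 by (simp add: ln_mult)
      then show ?thesis using f1[OF f(2,3)] f2[OF f(2,3)] f(1) unfolding ev by simp
    qed
    have top: "\<gamma>c (cyl_pt z) = 0" if "3 * \<sigma> / 4 \<le> Im z" for z
      using a(3)[OF that] t0[of z] that s(1) by (simp add: ev)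
    show ?thesis unfolding R(6)
      by (rule Adm_metric_of[where t="3 * \<sigma> / 4", OF R(1-3) E3 sm(3) n2(1) bot _ top]) (use s in auto)
  qed
  have I: "cyl_ivl {0..<\<epsilon>} 0 \<epsilon>" "{0..<\<epsilon>} \<subseteq> {x. \<bar>x\<bar> < m}" using e by (auto simp: cyl_ivl_def)
  have H1: "(\<lambda>z. z) holomorphic_on band m" by (intro holomorphic_intros)
  have H2: "\<Phi> holomorphic_on band m" by (rule holomorphic_on_subset[OF d(2)]) (use m in auto)
  have F1: "Im u \<in> {0..1} \<and> cyl_pt u = cyl_map (\<lambda>z. z) (cyl_pt u)" if "Im u \<in> {0..<\<epsilon>}" for u
    using ext_pair_cyl_map(1)[OF ext_pair_id, of u] small(2)[of u] that by auto
  have F2: "Im (\<Phi> u) \<in> {0..1} \<and> cyl_pt (\<Phi> u) = cyl_map \<Phi> (cyl_pt u)" if u: "Im u \<in> {0..<\<epsilon>}" for u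
  proof -
    have u': "0 \<le> Im u" "Im u < \<epsilon>" using u by auto
    show ?thesis using ext_pair_cyl_map(1)[OF E small(1)[OF u']] small(7)[OF u'] by metis
  qed
  have b0: "b z = 0" if "Im z \<in> {0..<\<epsilon>}" "cyl_pt z \<in> UNIV \<times> {r - \<delta><..<r + \<delta>}" for z
  proof -
    have "Im z \<in> {r - \<delta><..<r + \<delta>}" using that(2) by (simp only: cyl_pt_in)
    then show ?thesis using b(3)[of z] par by auto
  qed
  have e1': "metric_eq_on (flat_cyl {0..<\<epsilon>}) (UNIV \<times> {r - \<delta><..<r + \<delta>}) (pull_metric (flat_cyl {0..1}) (cyl_map (\<lambda>z. z)) ?gb) flat_metric"
  proof (rule metric_eq_flatI[OF I H1 F1 sm(2)])
    fix z assume z: "Im z \<in> {0..<\<epsilon>}" "cyl_pt z \<in> UNIV \<times> {r - \<delta><..<r + \<delta>}"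
    show "\<gamma>b (cyl_pt z) + 2 * ln (cmod (deriv (\<lambda>z. z) z)) = 0" unfolding ev b0[OF z] by simp
  qed
  have e2': "metric_eq_on (flat_cyl {0..<\<epsilon>}) (UNIV \<times> {r - \<delta><..<r + \<delta>}) (pull_metric (flat_cyl {0..1}) (cyl_map (\<lambda>z. z)) ?g0) flat_metric"
    by (rule metric_eq_flatI[OF I H1 F1 sm0]) simp_all
  have e3': "metric_eq_on (flat_cyl {0..<\<epsilon>}) (UNIV \<times> {r - \<delta><..<r + \<delta>}) (pull_metric (flat_cyl {0..1}) (cyl_map \<Phi>) ?gc) flat_metric"
  proof (rule metric_eq_flatI[OF I H2 F2 sm(3)])
    fix z assume z: "Im z \<in> {0..<\<epsilon>}" "cyl_pt z \<in> UNIV \<times> {r - \<delta><..<r + \<delta>}"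
    then show "\<gamma>c (cyl_pt (\<Phi> z)) + 2 * ln (cmod (deriv \<Phi> z)) = 0"
      using f1[of z] f2[of z] b0[OF z] by (simp add: ev)
  qed
  have e4': "metric_eq_on (flat_cyl {0..<\<epsilon>}) (UNIV \<times> {r - \<delta><..<r + \<delta>}) (pull_metric (flat_cyl {0..1}) (cyl_map \<Phi>) ?ga) flat_metric"
    by (rule metric_eq_flatI[OF I H2 F2 sm(1)]) (use f1 in \<open>simp_all add: ev\<close>)
  have sub: "cyl_pt z \<notin> topo (flat_cyl {0..1}) closure_of (topspace (topo (flat_cyl {0..1})) - cyl_map (\<lambda>z. z) ` (UNIV \<times> {0..r}))"
    if "Im z \<in> {0..1}" "Im z < r" for z
    by (rule not_in_closure_outside[OF ext_pair_id, of 1]) (use that par e m in auto)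
  have o1: "metric_eq_on (flat_cyl {0..1}) (topo (flat_cyl {0..1}) closure_of
      (topspace (topo (flat_cyl {0..1})) - cyl_map (\<lambda>z. z) ` (UNIV \<times> {0..r}))) ?gb ?g0"
  proof (rule metric_of_eq_on)
    fix z assume z: "Im z \<in> {0..1::real}" "cyl_pt z \<in> topo (flat_cyl {0..1}) closure_of
      (topspace (topo (flat_cyl {0..1})) - cyl_map (\<lambda>z. z) ` (UNIV \<times> {0..r}))"
    then have "\<not> Im z < r" using sub by blast
    then show "\<gamma>b (cyl_pt z) = 0" using b(3)[of z] par by (simp add: ev)
  qed
  have o2: "metric_eq_on (flat_cyl {0..1}) (topo (flat_cyl {0..1}) closure_of
      (topspace (topo (flat_cyl {0..1})) - cyl_map \<Phi> ` (UNIV \<times> {0..r}))) ?gc ?ga"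
  proof (rule metric_of_eq_on)
    fix z assume z: "Im z \<in> {0..1::real}" "cyl_pt z \<in> topo (flat_cyl {0..1}) closure_of
      (topspace (topo (flat_cyl {0..1})) - cyl_map \<Phi> ` (UNIV \<times> {0..r}))"
    have "\<theta> z = 0"
    proof (cases "\<bar>Im z\<bar> < \<sigma>")
      case True
      have "\<bar>Im (\<Psi> w)\<bar> < \<rho>" if "\<bar>Im w\<bar> < \<sigma>" for w using s(4)[OF that] m(2) by linarith
      then have "\<not> Im (\<Psi> z) < r" using not_in_closure_outside[OF E s(2) _ z(1) True] z(2) by blast
      then show ?thesis using b(3)[of "\<Psi> z"] par by (simp add: \<theta>_def)
    qed (simp add: \<theta>_def)
    then show "\<gamma>c (cyl_pt z) = \<gamma>a (cyl_pt z)" by (simp add: ev)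
  qed
  have i1: "metric_eq_on (flat_cyl {0..<\<epsilon>}) (UNIV \<times> {0..r})
      (pull_metric (flat_cyl {0..1}) (cyl_map (\<lambda>z. z)) ?gb) (pull_metric (flat_cyl {0..1}) (cyl_map \<Phi>) ?gc)"
  proof (rule metric_eq_pullI[OF I H1 F1 sm(2) H2 F2 sm(3)])
    fix z assume "Im z \<in> {0..<\<epsilon>}"
    then show "\<gamma>b (cyl_pt z) + 2 * ln (cmod (deriv (\<lambda>z. z) z)) = \<gamma>c (cyl_pt (\<Phi> z)) + 2 * ln (cmod (deriv \<Phi> z))"
      using f1[of z] f2[of z] by (simp add: ev)
  qed
  have i2: "metric_eq_on (flat_cyl {0..<\<epsilon>}) (UNIV \<times> {0..r})
      (pull_metric (flat_cyl {0..1}) (cyl_map (\<lambda>z. z)) ?g0) (pull_metric (flat_cyl {0..1}) (cyl_map \<Phi>) ?ga)"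
  proof (rule metric_eq_pullI[OF I H1 F1 sm0 H2 F2 sm(1)])
    fix z assume "Im z \<in> {0..<\<epsilon>}"
    then show "0 + 2 * ln (cmod (deriv (\<lambda>z. z) z)) = \<gamma>a (cyl_pt (\<Phi> z)) + 2 * ln (cmod (deriv \<Phi> z))"
      using f1[of z] by (simp add: ev)
  qed
  \<comment> \<open>The weight of a metric in the coordinate. The scalar of the tensor is chosen as
    \<open>K ?g0 / K ?gb\<close> so that the coefficient becomes exactly 1.\<close>
  define K where "K h = exp (c * energy 1 (dens 1 h) / (96 * pi))" for h
  have fl: "flat_model 1 std_cyl" "flat_model 1 (reparam std_cyl \<psi>)"
    using flat_model_reparam[OF ext_pair_id] flat_model_reparam[OF E2] unfolding R(4) by blast+
  have X: "line_map c std_cyl (reparam std_cyl \<psi>) 1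
      = tensor c std_cyl (fmult c (reparam std_cyl \<psi>) (K ?g0 / K ?gb) ?gb) (dual_elem c std_cyl (fmult c std_cyl 1 ?g0))"
  proof -
    have "K h \<noteq> 0" for h by (simp add: K_def)
    then have "1 = K ?g0 / K ?gb * K ?gb / (1 * K ?g0)" by simp
    moreover have "1 * K ?g0 \<noteq> 0" by (simp add: K_def)
    ultimately show ?thesis
      unfolding fmult_Adm[OF fl(2) admb] fmult_Adm[OF fl(1) adm0] K_def[symmetric]
      using tensor_line_map[OF fl(1) adm0, of "1 * K ?g0" c "reparam std_cyl \<psi>" "K ?g0 / K ?gb * K ?gb"] by metis
  qed
  have c1: "collar {0..<\<epsilon>} (surf std_cyl) (bd1 std_cyl) (cyl_map (\<lambda>z. z))"
    using e4(2) e(1,5) by (simp add: R)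
  have c2: "collar {0..<\<epsilon>} (surf (reparam std_cyl \<phi>)) (bd1 (reparam std_cyl \<phi>)) (cyl_map \<Phi>)"
    using e3(2) e(1,4) by (simp add: R)
  have s': "seamed (reparam std_cyl \<psi>) \<epsilon> (cyl_map (\<lambda>z. z)) r \<delta> ?gb" "seamed std_cyl \<epsilon> (cyl_map (\<lambda>z. z)) r \<delta> ?g0"
    "seamed (reparam (reparam std_cyl \<phi>) \<psi>) \<epsilon> (cyl_map \<Phi>) r \<delta> ?gc" "seamed (reparam std_cyl \<phi>) \<epsilon> (cyl_map \<Phi>) r \<delta> ?ga"
    using adm0 admb adma admc e1' e2' e3' e4' unfolding seamed_def R(1,5,6) by blast+
  show ?thesis
    unfolding can_rel_def
    by (rule exI, rule exI[of _ \<epsilon>], rule exI[of _ r], rule exI[of _ \<delta>], rule exI[of _ "K ?g0 / K ?gb"],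
        rule exI[of _ "cyl_map (\<lambda>z. z)"], rule exI[of _ "cyl_map \<Phi>"],
        rule exI[of _ ?gb], rule exI[of _ ?g0], rule exI[of _ ?gc], rule exI[of _ ?ga],
        intro conjI, (rule par(1-3) c1 c2 s')+, unfold R(1,5), rule o1, rule o2, rule i1, rule i2, rule X[unfolded R], rule refl)
qed

section \<open>The cocycle is trivial\<close>

lemma diff_an_reparam:
  assumes "\<phi> \<in> diff_an"
  shows "flat_model 1 (reparam std_cyl \<phi>)" "cylinder (reparam std_cyl \<phi>)"
    "\<exists>g. g \<in> Adm (reparam std_cyl \<phi>)"
proof -
  obtain \<Phi> \<Psi> \<rho> where E: "ext_pair \<phi> \<Phi> \<Psi> \<rho>" by (rule ext_pair_exists[OF assms])
  show "flat_model 1 (reparam std_cyl \<phi>)" by (rule flat_model_reparam[OF E])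
  show "cylinder (reparam std_cyl \<phi>)" by (rule cylinder_reparam[OF E])
  \<comment> \<open>The metrics constructed for \<open>can_rel\<close> include an admissible one on
    this cylinder.\<close>
  show "\<exists>g. g \<in> Adm (reparam std_cyl \<phi>)"
    using can_rel_exists[OF E E] unfolding can_rel_def seamed_def by blast
qed

lemma diff_an_id: "id \<in> diff_an"
proof -
  have "(\<lambda>n. (if n = 0 then x else if n = 1 then 1 else 0) * (y - x) ^ n) sums y" for x y :: real
  proof -
    have "(\<lambda>n. (if n = 0 then x else if n = 1 then 1 else 0) * (y - x) ^ n) sums
        (\<Sum>n\<in>{0, 1}. (if n = 0 then x else if n = 1 then 1 else 0) * (y - x) ^ n)"
      by (rule sums_finite) auto
    then show ?thesis by simp
  qed
  then have "real_analytic (\<lambda>x. x)"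
    unfolding real_analytic_def by (intro allI exI[of _ 1] conjI exI[of _ "\<lambda>n. if n = 0 then _ else if n = 1 then 1 else 0"]) auto
  moreover have "circle_lift id (\<lambda>x. x)" by (simp add: circle_lift_def)
  moreover have "strict_mono (\<lambda>x::real. x)" by (simp add: strict_mono_def)
  ultimately show ?thesis unfolding diff_an_def by (auto simp: inv_id)
qed

lemma mu_hat_line_map:
  assumes p: "\<phi> \<in> diff_an"
  shows "mu_hat c \<phi> = line_class c \<phi> std_cyl (line_map c std_cyl (reparam std_cyl \<phi>) 1)"
proof -
  have mu: "mu c (reparam std_cyl \<psi>) = line_vec c (reparam std_cyl \<psi>) 1" if q: "\<psi> \<in> diff_an" for \<psi>
  proof -
    obtain g where "g \<in> Adm (reparam std_cyl \<psi>)" using diff_an_reparam(3)[OF q] by blast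
    then show ?thesis by (rule mu_line_vec[OF diff_an_reparam(1,2)[OF q]]) (simp add: reparam_std)
  qed
  note I = diff_an_reparam[OF diff_an_id, unfolded reparam_std(4)]
  obtain g where "g \<in> Adm std_cyl" using I(3) by blast
  then show ?thesis
    unfolding mu_hat_def mu[OF p] mu[OF diff_an_id, unfolded reparam_std(4)]
    using tensor_line_map[OF I(1), of g 1 c] by simp
qed

text \<open>The canonical isomorphism keeps the coefficient 1. Existence and uniqueness together are
  what makes \<open>line_rep\<close> return a definite element.\<close>

lemma can_rel_line_map:
  assumes "\<phi> \<in> diff_an" "\<psi> \<in> diff_an"
  shows "can_rel c \<psi> std_cyl (reparam std_cyl \<phi>) (line_map c std_cyl (reparam std_cyl \<psi>) 1) Y \<longleftrightarrow>
    Y = line_map c (reparam std_cyl \<phi>) (reparam std_cyl (\<phi> \<circ> \<psi>)) 1"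
proof -
  have uniq: "Y = line_map c (reparam std_cyl \<phi>) (reparam std_cyl (\<phi> \<circ> \<psi>)) 1"
    if R: "can_rel c \<psi> std_cyl (reparam std_cyl \<phi>) (line_map c std_cyl (reparam std_cyl \<psi>) 1) Y" for Y
    using can_rel_unique[OF diff_an_reparam(1)[OF diff_an_id, unfolded reparam_std(4)] diff_an_reparam(1)[OF assms(2)]
        diff_an_reparam(1)[OF assms(1)] _ R] diff_an_reparam(1)[OF diff_an_compose[OF assms]]
    unfolding reparam_std(6) by blast
  obtain \<Phi> \<Psi> \<rho> where E: "ext_pair \<phi> \<Phi> \<Psi> \<rho>" by (rule ext_pair_exists[OF assms(1)])
  obtain \<Phi>2 \<Psi>2 \<rho>2 where E2: "ext_pair \<psi> \<Phi>2 \<Psi>2 \<rho>2" by (rule ext_pair_exists[OF assms(2)])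
  show ?thesis using uniq can_rel_exists[OF E E2, of c] by metis
qed

lemma line_rep_mu_hat:
  assumes "\<phi> \<in> diff_an" "\<psi> \<in> diff_an"
  shows "line_rep (mu_hat c \<psi>) (reparam std_cyl \<phi>) = line_map c (reparam std_cyl \<phi>) (reparam std_cyl (\<phi> \<circ> \<psi>)) 1"
  unfolding line_rep_def mu_hat_line_map[OF assms(2)] line_class_def
  using diff_an_reparam(2)[OF assms(1)] can_rel_line_map[OF assms] by simp

lemma line_mult_mu_hat:
  assumes p: "\<phi> \<in> diff_an" and q: "\<psi> \<in> diff_an"
  shows "line_mult c std_cyl \<phi> \<psi> (mu_hat c \<phi>) (mu_hat c \<psi>) = mu_hat c (\<phi> \<circ> \<psi>)"
proof -
  note I = diff_an_reparam[OF diff_an_id, unfolded reparam_std(4)] and P = diff_an_reparam[OF p]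
  obtain g g' where g: "g \<in> Adm std_cyl" "g' \<in> Adm (reparam std_cyl \<phi>)" using I(3) P(3) by blast
  have "line_rep (mu_hat c \<phi>) std_cyl = line_map c std_cyl (reparam std_cyl \<phi>) 1"
    using line_rep_mu_hat[OF diff_an_id p] by (simp add: reparam_std(4))
  then show ?thesis
    unfolding line_mult_def line_rep_mu_hat[OF p q] mu_hat_line_map[OF diff_an_compose[OF p q]]
    by (simp add: compose_line_map[OF I(1) g(1) P(1) g(2)])
qed

text \<open>Members of a class are tensors, hence already restricted to the line, and so unaffected
  by the restriction built into \<open>tscale\<close>.\<close>

lemma line_scale_one: "line_scale c 1 (line_class c \<phi> A X) = line_class c \<phi> A X"
proof -
  have e: "tscale c B 1 Y = Y" if "can_rel c \<phi> A B X Y" for B Y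
    using that tscale_one_tensor unfolding can_rel_def by metis
  have "(\<lambda>(B, Y). (B, tscale c B 1 Y)) ` line_class c \<phi> A X = (\<lambda>p. p) ` line_class c \<phi> A X"
    by (rule image_cong) (auto simp: line_class_def e)
  then show ?thesis by (simp add: line_scale_def)
qed

text \<open>All coefficients are 1, so the product of the sections is again the section. The scalar
  is unique because the class has exactly one representative over the standard cylinder, and its
  coefficient reads the scalar off.\<close>

lemma Gamma_cocycle_one:
  assumes p: "\<phi> \<in> diff_an" and q: "\<psi> \<in> diff_an"
  shows "Gamma_cocycle c \<phi> \<psi> = 1"
proof -
  let ?\<chi> = "\<phi> \<circ> \<psi>"
  note r = diff_an_compose[OF p q]
  let ?L = "line_map c std_cyl (reparam std_cyl ?\<chi>)"
  note I = diff_an_reparam[OF diff_an_id, unfolded reparam_std(4)]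
  have mem: "(std_cyl, Y) \<in> mu_hat c ?\<chi> \<longleftrightarrow> Y = ?L 1" for Y
    using can_rel_line_map[OF diff_an_id r, of c Y] I(2)
    by (simp add: mu_hat_line_map[OF r] line_class_def reparam_std(4))
  have "\<gamma> = 1" if "mu_hat c ?\<chi> = line_scale c \<gamma> (mu_hat c ?\<chi>)" for \<gamma>
  proof -
    have "(std_cyl, ?L 1) \<in> line_scale c \<gamma> (mu_hat c ?\<chi>)" using mem that by blast
    then obtain Y where Y: "(std_cyl, Y) \<in> mu_hat c ?\<chi>" "?L 1 = tscale c std_cyl \<gamma> Y"
      by (auto simp: line_scale_def)
    have e: "?L 1 = ?L \<gamma>" using Y(2) Y(1)[unfolded mem] by (simp add: tscale_line_map)
    obtain g g' where "g \<in> Adm std_cyl" "g' \<in> Adm (reparam std_cyl ?\<chi>)"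
      using I(3) diff_an_reparam(3)[OF r] by blast
    from line_map_inj[OF I(1) this e] show ?thesis by simp
  qed
  moreover have "mu_hat c ?\<chi> = line_scale c 1 (mu_hat c ?\<chi>)"
    by (simp add: mu_hat_line_map[OF r] line_scale_one)
  ultimately show ?thesis
    unfolding Gamma_cocycle_def line_mult_mu_hat[OF p q] by (intro the_equality) auto
qed

theorem propositionB1:
  fixes c :: real
  shows "(\<forall>\<phi> \<in> carrier Diff_an. \<forall>\<psi> \<in> carrier Diff_an.
            ln (Gamma_cocycle c \<phi> \<psi>) = N_fun (\<phi> \<circ> \<psi>) - N_fun \<phi> - N_fun \<psi>)
       \<and> log_Gamma c \<in> coboundaries2 Diff_an
       \<and> log_Gamma c \<in> carrier (cocycles2 Diff_an)
       \<and> H2_class Diff_an (log_Gamma c) = \<one>\<^bsub>H2 Diff_an\<^esub>"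
proof (intro conjI ballI)
  fix \<phi> \<psi> assume "\<phi> \<in> carrier Diff_an" "\<psi> \<in> carrier Diff_an"
  then have "\<phi> \<in> diff_an" "\<psi> \<in> diff_an" by (simp_all add: Diff_an_def)
  then show "ln (Gamma_cocycle c \<phi> \<psi>) = N_fun (\<phi> \<circ> \<psi>) - N_fun \<phi> - N_fun \<psi>"
    using diff_an_compose[of \<phi> \<psi>] by (simp add: Gamma_cocycle_one N_fun_zero)
next
  \<comment> \<open>Since ln 1 = 0, the cocycle is literally the zero cochain, to which the
    cohomological claims then refer.\<close>
  have f: "log_Gamma c = (\<lambda>p \<in> carrier Diff_an \<times> carrier Diff_an. 0)"
    by (auto simp: log_Gamma_def Diff_an_def restrict_def fun_eq_iff Gamma_cocycle_one)
  have "g \<otimes>\<^bsub>Diff_an\<^esub> h \<in> carrier Diff_an" if "g \<in> carrier Diff_an" "h \<in> carrier Diff_an" for g h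
    using that diff_an_compose by (simp add: Diff_an_def)
  note z = zero_H2[of Diff_an, OF this]
  show "log_Gamma c \<in> coboundaries2 Diff_an" "log_Gamma c \<in> carrier (cocycles2 Diff_an)"
    "H2_class Diff_an (log_Gamma c) = \<one>\<^bsub>H2 Diff_an\<^esub>"
    unfolding f by (rule z; assumption)+
qed

end
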